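(* Let $M$ and $N$ be gapped filtered $A_\infty$-bimodules over a gapped filtered $A_\infty$-algebra $A=(C,m)$, and let $\widetilde A$ be the $L_\infty$-algebra induced from $A$. Let $\phi:M\to N$ be a filtered or weakly filtered gapped $A_\infty$-bimodule homomorphism (over the identity of $A$) which is a homotopy equivalence. (In the weakly filtered case all objects are taken over $\Lambda_{nov}$.) Then $\phi$ induces isomorphisms of Hochschild homology and of Chevalley-Eilenberg homology: $$H_\bullet(A,M)\cong H_\bullet(A,N),\qquad H^{CE}_\bullet(\widetilde A,M)\cong H^{CE}_\bullet(\widetilde A,N).$$
   Context: **Rings.** $R=\mathbb R$; $\Lambda_{nov}=\{\sum_{i\ge0}a_iT^{\lambda_i}e^{q_i}:a_i\in R,\lambda_i\in\mathbb R,q_i\in\mathbb Z,\lambda_i\to\infty\}$ ($\deg T=0,\deg e=2$), $\Lambda_{0,nov}$ the part with $\lambda_i\ge0$; $F^\lambda$ is the filtration by minimal exponent of $T$. **Filtered $A_\infty$-algebra** $A=(C,\{m_k\}_{k\ge0})$: $C$ is the energy completion of $\overline C\otimes_R\Lambda_{0,nov}$, $|x|'=|x|-1$ the degree in $C[1]$, $B_kC=C[1]^{\otimes k}$, $\widehat BC=\widehat\bigoplus_{k\ge0}B_kC$ (energy completion); degree one filtration-preserving maps $m_k:B_kC\to C[1]$, $m_0(1)$ of positive energy, such that the coderivation $\widehat d=\sum_k\widehat m_k$, $\widehat m_k(x_1\otimes\cdots\otimes x_n)=\sum_i(-1)^{|x_1|'+\cdots+|x_{i-1}|'}x_1\otimes\cdots\otimes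 m_k(x_i,\dots)\otimes\cdots\otimes x_n$, squares to zero. Filtered $A_\infty$-homomorphisms $f=\{f_k\}_{k\ge0}$ are degree $0$, energy-preserving, $f_0(1)$ of positive energy, with $\widehat f\widehat d=\widehat d\widehat f$. **Bimodules.** $M$ is a completed free graded filtered module with degree one filtered maps $n_{i,j}:B_iC_1\otimes M[1]\otimes B_jC_0\to M[1]$ such that the induced $\widehat d$ on $\widehat BC_1\widehat\otimes M[1]\widehat\otimes\widehat BC_0$ squares to zero. A filtered bimodule homomorphism $M\to M'$ over $(f^1,f^0)$, $f^i:C_i\to C_i'$, is a family of degree $0$ filtered maps $\phi_{i,j}:B_iC_1\otimes M[1]\otimes B_jC_0\to M'[1]$ whose induced map $\widehat\phi=\sum\widehat f^1\otimes\phi_{i,j}\otimes\widehat f^0$ commutes with $\widehat d$. Weakly filtered: over $\Lambda_{nov}$ (tensor and complete), with $\phi_{i,j}(F^{\lambda_1}\otimes F^\lambda\otimes F^{\lambda_0})\subset F^{\lambda_1+\lambda+\lambda_0-c}$ for some $c\ge0$ independent of $i,j$. Bimodules "over $A$" have $C_1=C_0=C$. **Gapped.** All structure maps are of the form $\sum_{\beta=(\lambda,\mu)}T^\lambda e^{\mu/2}(\cdot)_\beta$ with $(\cdot)_\beta$ defined over $R$, $\beta$ running over a submonoid $G\subset\mathbb R_{\ge0}\times2\mathbb Z$ with discrete projection to $\mathbb R$, finite fibres and only $(0,0)$ at $\lambda=0$; for weakly filtered homomorphisms $\beta$ runs over a $G$-set $G'\subset\mathbb R\times2\mathbb Z$ ($G+G'\subset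 G'$) with projection discrete and bounded below and finite fibres. **Homotopies.** A model of $[0,1]\times C$ is a filtered $A_\infty$-algebra $\mathfrak C$ with filtered $A_\infty$-homomorphisms $Incl:C\to\mathfrak C$, $Eval_{s=0},Eval_{s=1}:\mathfrak C\to C$ having only $k=1$ components, $Eval_{s}\circ Incl=\mathrm{id}$, inducing cochain homotopy equivalences of $\overline m_1$-complexes, and $(Eval_{s=0})_1\oplus(Eval_{s=1})_1$ surjective. A model of $[0,1]\times M$ is an $A_\infty$-bimodule $\mathfrak M$ over $(\mathfrak C_1,\mathfrak C_0)$ with bimodule homomorphisms $Incl:M\to\mathfrak M$ over $Incl$ and $Eval_{s}:\mathfrak M\to M$ over $Eval_s$ ($s=0,1$), having only $(0,0)$-components, $Eval_s\circ Incl=\mathrm{id}$, $(Eval_{s=0})_{0,0}\oplus(Eval_{s=1})_{0,0}$ split surjective, and $Incl_{0,0}$ inducing a cochain homotopy equivalence of $\overline n_{0,0}$-complexes. $f,g:C_1\to C_2$ are homotopic if there is $\mathfrak F:C_1\to\mathfrak C_2$ with $Eval_{s=0}\circ\mathfrak F=f$, $Eval_{s=1}\circ\mathfrak F=g$. (Weakly) filtered bimodule homomorphisms $\phi,\psi:M\to M'$ over $(f^1,f^0)$, $(g^1,g^0)$ are homotopic if there are homotopies $\mathfrak F^{i}:C_i\to\mathfrak C_i'$ between $f^i$ and $g^i$ and a (weakly) filtered bimodule homomorphism $\Phi:M\to\mathfrak M'$ over $(\mathfrak F^1,\mathfrak F^0)$ with $Eval_{s=0}\circ\Phi=\phi$,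 $Eval_{s=1}\circ\Phi=\psi$. $\phi$ is a homotopy equivalence if there is a (weakly) filtered $\psi:M'\to M$ over homotopy inverses of $f^1,f^0$ with $\phi\circ\psi$ and $\psi\circ\phi$ homotopic to the identity. **Hochschild homology.** $C_\bullet(A,M)=\widehat\bigoplus_{k\ge0}M[1]\otimes C[1]^{\otimes k}$ with $d^{Hoch}(\underline v\otimes x_1\otimes\cdots\otimes x_k)=\sum_{j\ge0,i\ge1}\pm\underline v\otimes\cdots\otimes m_j(x_i,\dots,x_{i+j-1})\otimes\cdots\otimes x_k+\sum_{i+j\le k}\pm\underline{n_{i,j}(x_{k-i+1},\dots,x_k,v,x_1,\dots,x_j)}\otimes x_{j+1}\otimes\cdots\otimes x_{k-i}$ (Koszul signs; $m_0(1)$ inserted in all positions to the right of $v$). The map induced by $\phi$ is $\phi_*(v\otimes x_1\otimes\cdots\otimes x_k)=\sum_{i+j\le k}\pm\phi_{i,j}(x_{k-i+1},\dots,x_k,v,x_1,\dots,x_j)\otimes x_{j+1}\otimes\cdots\otimes x_{k-i}$. **Chevalley-Eilenberg homology.** $E_kC\subset B_kC$ is the submodule fixed by the signed $S_k$-action, generated by $[x_1,\dots,x_k]=\sum_{\tau}\pm x_{\tau(1)}\otimes\cdots\otimes x_{\tau(k)}$; $\widetilde A=(C,l)$, $l_k=m_k|_{E_kC}$; $M$ becomes an $L_\infty$-module by symmetrization: $\eta_k(v\otimes[x_1,\dots,x_k])$ is the sum, over all $\tau\in S_k$ and all positions of $v$ in the word $x_{\tau(1)}\cdots x_{\tau(k)}$,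 of $\pm n_{i,k-i}$ applied to the resulting word. $CE_\bullet(\widetilde A,M)=\widehat\bigoplus_{k\ge0}M[1]\otimes E_kC$ with $d^{CE}(v\otimes[x_1,\dots,x_k])=\sum\pm\eta_{k_1}(v\otimes[x_{\sigma(1)},\dots,x_{\sigma(k_1)}])\otimes[x_{\sigma(k_1+1)},\dots,x_{\sigma(k)}]+\sum\pm v\otimes[l_{k_1}([x_{\sigma(1)},\dots,x_{\sigma(k_1)}]),x_{\sigma(k_1+1)},\dots,x_{\sigma(k)}]$ over $0\le k_1\le k$ and $(k_1,k-k_1)$-shuffles $\sigma$. $\phi$ induces a chain map by the same symmetrization. *)

theory Defs
  imports
    Complex_Main
    "HOL-Library.Groups_Big_Fun"
    "HOL-Library.Product_Plus"
    "HOL-Combinatorics.Permutations"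
    "HOL-Algebra.Coset"
begin

section \<open>The universal Novikov ring over the reals\<close>

text \<open>
  The element \<open>\<Sum> a\<^sub>i T^\<lambda>\<^sub>i e^q\<^sub>i\<close> with \<open>\<lambda>\<^sub>i \<rightarrow> \<infinity>\<close> is stored as its coefficient function
  \<open>(\<lambda>, q) \<mapsto> a\<close>.
\<close>

typedef nov = "{f :: real \<times> int \<Rightarrow> real. \<forall>E. finite {p. fst p \<le> E \<and> f p \<noteq> 0}}"
  morphisms coeff Abs_nov
  by (rule exI[of _ "\<lambda>_. 0"]) simp

setup_lifting type_definition_nov

lemma nov_eqI: "(\<And>p. coeff x p = coeff y p) \<Longrightarrow> x = y"
  by (simp add: coeff_inject[symmetric] fun_eq_iff)

definition nov_conv :: "(real \<times> int \<Rightarrow> real) \<Rightarrow> (real \<times> int \<Rightarrow> real) \<Rightarrow> real \<times> int \<Rightarrow> real" where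
  "nov_conv f g p = Sum_any (\<lambda>a. f a * g (p - a))"

definition nov_fin :: "(real \<times> int \<Rightarrow> real) \<Rightarrow> bool" where
  "nov_fin f \<longleftrightarrow> (\<forall>E. finite {p. fst p \<le> E \<and> f p \<noteq> 0})"

definition nov_lowb :: "real \<Rightarrow> (real \<times> int \<Rightarrow> real) \<Rightarrow> bool" where
  "nov_lowb c f \<longleftrightarrow> (\<forall>p. f p \<noteq> 0 \<longrightarrow> c \<le> fst p)"

lemma nov_lowb_ex:
  assumes "nov_fin f" shows "\<exists>c. nov_lowb c f"
proof -
  let ?S = "fst ` {p. fst p \<le> 0 \<and> f p \<noteq> 0}"
  have fin: "finite ?S" using assms unfolding nov_fin_def by (intro finite_imageI) blast
  have "nov_lowb (Min (insert 0 ?S)) f"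
    unfolding nov_lowb_def
  proof (intro allI impI)
    fix p assume p: "f p \<noteq> 0"
    show "Min (insert 0 ?S) \<le> fst p"
    proof (cases "fst p \<le> 0")
      case True
      then have "fst p \<in> insert 0 ?S" using p by blast
      then show ?thesis using fin by (intro Min_le) auto
    next
      case False
      have "Min (insert 0 ?S) \<le> 0" using fin by (intro Min_le) auto
      then show ?thesis using False by linarith
    qed
  qed
  then show ?thesis ..
qed

lemma nov_conv_sum:
  assumes "nov_fin f" "nov_lowb c g" "fst p - c \<le> K"
  shows "nov_conv f g p = (\<Sum>a\<in>{a. fst a \<le> K \<and> f a \<noteq> 0}. f a * g (p - a))"
  unfolding nov_conv_def
proof (rule Sum_any.expand_superset)
  show "finite {a. fst a \<le> K \<and> f a \<noteq> 0}" using assms(1) by (simp add: nov_fin_def)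
  show "{a. f a * g (p - a) \<noteq> 0} \<subseteq> {a. fst a \<le> K \<and> f a \<noteq> 0}"
  proof
    fix a assume "a \<in> {a. f a * g (p - a) \<noteq> 0}"
    then have "f a \<noteq> 0" "g (p - a) \<noteq> 0" by auto
    moreover from this have "c \<le> fst (p - a)" using assms(2) unfolding nov_lowb_def by blast
    ultimately show "a \<in> {a. fst a \<le> K \<and> f a \<noteq> 0}" using assms(3) by (auto simp: fst_diff)
  qed
qed

lemma nov_conv_nz:
  assumes "nov_conv f g p \<noteq> 0" shows "\<exists>a. f a \<noteq> 0 \<and> g (p - a) \<noteq> 0"
proof -
  from assms obtain a where "f a * g (p - a) \<noteq> 0"
    unfolding nov_conv_def by (rule Sum_any.not_neutral_obtains_not_neutral)
  then have "f a \<noteq> 0 \<and> g (p - a) \<noteq> 0" by simp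
  then show ?thesis by (rule exI)
qed

lemma nov_conv_lowb: "nov_lowb c f \<Longrightarrow> nov_lowb d g \<Longrightarrow> nov_lowb (c + d) (nov_conv f g)"
proof (unfold nov_lowb_def, intro allI impI)
  fix p assume H: "\<forall>p. f p \<noteq> 0 \<longrightarrow> c \<le> fst p" "\<forall>p. g p \<noteq> 0 \<longrightarrow> d \<le> fst p"
    and "nov_conv f g p \<noteq> 0"
  then obtain a where "f a \<noteq> 0" "g (p - a) \<noteq> 0" using nov_conv_nz by blast
  then have "c \<le> fst a" "d \<le> fst (p - a)" using H by blast+
  then show "c + d \<le> fst p" by (simp add: fst_diff)
qed

lemma nov_conv_nfin:
  assumes f: "nov_fin f" and g: "nov_fin g" shows "nov_fin (nov_conv f g)"
  unfolding nov_fin_def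
proof
  fix E
  obtain c d where c: "nov_lowb c f" and d: "nov_lowb d g" using nov_lowb_ex f g by blast
  let ?F = "{a. fst a \<le> E - d \<and> f a \<noteq> 0}" and ?G = "{b. fst b \<le> E - c \<and> g b \<noteq> 0}"
  have "{p. fst p \<le> E \<and> nov_conv f g p \<noteq> 0} \<subseteq> (\<lambda>(a, b). a + b) ` (?F \<times> ?G)"
  proof
    fix p assume "p \<in> {p. fst p \<le> E \<and> nov_conv f g p \<noteq> 0}"
    then obtain a where p: "fst p \<le> E" and a: "f a \<noteq> 0" "g (p - a) \<noteq> 0" using nov_conv_nz by blast
    have "c \<le> fst a" "d \<le> fst (p - a)" using a c d unfolding nov_lowb_def by blast+
    then have "(a, p - a) \<in> ?F \<times> ?G" using a p by (auto simp: fst_diff)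
    moreover have "p = (\<lambda>(a, b). a + b) (a, p - a)" by simp
    ultimately show "p \<in> (\<lambda>(a, b). a + b) ` (?F \<times> ?G)" by blast
  qed
  moreover have "finite (?F \<times> ?G)" using f g by (auto simp: nov_fin_def)
  ultimately show "finite {p. fst p \<le> E \<and> nov_conv f g p \<noteq> 0}"
    by (meson finite_imageI finite_subset)
qed

lemma nov_conv_comm: "nov_conv f g p = nov_conv g f p"
proof -
  have "bij (\<lambda>a. p - a)" by (rule bij_betwI[where g = "\<lambda>a. p - a"]) auto
  then show ?thesis unfolding nov_conv_def
    by (rule Sum_any.reindex_cong) (auto simp: fun_eq_iff mult.commute)
qed

lemma nov_conv_assoc:
  assumes f: "nov_fin f" and g: "nov_fin g" and h: "nov_fin h"
  shows "nov_conv (nov_conv f g) h p = nov_conv f (nov_conv g h) p"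
proof -
  obtain c where c: "nov_lowb c f" using nov_lowb_ex[OF f] ..
  obtain d where d: "nov_lowb d g" using nov_lowb_ex[OF g] ..
  obtain e where e: "nov_lowb e h" using nov_lowb_ex[OF h] ..
  define F where "F = {a. fst a \<le> fst p - (d + e) \<and> f a \<noteq> 0}"
  define H where "H = {a. fst a \<le> fst p - (c + d) \<and> h a \<noteq> 0}"
  have "nov_conv (nov_conv f g) h p = nov_conv h (nov_conv f g) p" by (rule nov_conv_comm)
  also have "\<dots> = (\<Sum>b\<in>H. h b * nov_conv f g (p - b))"
    unfolding H_def by (rule nov_conv_sum[OF h nov_conv_lowb[OF c d]]) simp
  also have "\<dots> = (\<Sum>b\<in>H. h b * (\<Sum>a\<in>F. f a * g (p - b - a)))"
  proof (rule sum.cong[OF refl])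
    fix b assume "b \<in> H"
    then have "e \<le> fst b" using e unfolding H_def nov_lowb_def by blast
    then have "nov_conv f g (p - b) = (\<Sum>a\<in>F. f a * g (p - b - a))"
      unfolding F_def by (intro nov_conv_sum[OF f d]) (simp add: fst_diff)
    then show "h b * nov_conv f g (p - b) = h b * (\<Sum>a\<in>F. f a * g (p - b - a))" by simp
  qed
  also have "\<dots> = (\<Sum>b\<in>H. \<Sum>a\<in>F. f a * (h b * g (p - b - a)))"
    unfolding sum_distrib_left by (intro sum.cong refl mult.left_commute)
  also have "\<dots> = (\<Sum>a\<in>F. \<Sum>b\<in>H. f a * (h b * g (p - b - a)))" by (rule sum.swap)
  also have "\<dots> = (\<Sum>a\<in>F. f a * (\<Sum>b\<in>H. h b * g (p - a - b)))"
  proof -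
    have "f a * (h b * g (p - b - a)) = f a * (h b * g (p - a - b))" for a b
      by (simp add: diff_diff_eq add.commute)
    then show ?thesis unfolding sum_distrib_left by (intro sum.cong refl)
  qed
  also have "\<dots> = (\<Sum>a\<in>F. f a * nov_conv g h (p - a))"
  proof (rule sum.cong[OF refl])
    fix a assume "a \<in> F"
    then have "c \<le> fst a" using c unfolding F_def nov_lowb_def by blast
    then have "nov_conv h g (p - a) = (\<Sum>b\<in>H. h b * g (p - a - b))"
      unfolding H_def by (intro nov_conv_sum[OF h d]) (simp add: fst_diff)
    then show "f a * (\<Sum>b\<in>H. h b * g (p - a - b)) = f a * nov_conv g h (p - a)"
      by (simp only: nov_conv_comm[of g h])
  qed
  also have "\<dots> = nov_conv f (nov_conv g h) p"
    unfolding F_def by (rule nov_conv_sum[OF f nov_conv_lowb[OF d e], symmetric]) simp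
  finally show ?thesis .
qed

lemma nov_conv_distrib:
  assumes f: "nov_fin f" and g: "nov_fin g" and h: "nov_fin h"
  shows "nov_conv (\<lambda>p. f p + g p) h p = nov_conv f h p + nov_conv g h p"
proof -
  obtain c where c: "nov_lowb c h" using nov_lowb_ex h by blast
  obtain d where "nov_lowb d f" using nov_lowb_ex f by blast
  obtain d' where "nov_lowb d' g" using nov_lowb_ex g by blast
  define K where "K = fst p - min d d'"
  define H where "H = {a. fst a \<le> K \<and> h a \<noteq> 0}"
  have l: "nov_lowb (min d d') f" "nov_lowb (min d d') g" "nov_lowb (min d d') (\<lambda>p. f p + g p)"
  proof -
    show "nov_lowb (min d d') f" "nov_lowb (min d d') g"
      using \<open>nov_lowb d f\<close> \<open>nov_lowb d' g\<close> unfolding nov_lowb_def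
      by (meson min.coboundedI1 min.coboundedI2)+
    then show "nov_lowb (min d d') (\<lambda>p. f p + g p)"
      unfolding nov_lowb_def by (metis add_0)
  qed
  have "nov_conv h (\<lambda>p. f p + g p) p = (\<Sum>a\<in>H. h a * (f (p - a) + g (p - a)))"
    "nov_conv h f p = (\<Sum>a\<in>H. h a * f (p - a))" "nov_conv h g p = (\<Sum>a\<in>H. h a * g (p - a))"
    unfolding H_def by (rule nov_conv_sum[OF h l(3)] nov_conv_sum[OF h l(1)] nov_conv_sum[OF h l(2)], simp add: K_def)+
  then show ?thesis by (simp add: nov_conv_comm[of _ h] ring_distribs sum.distrib)
qed

lemma nov_conv_one: "nov_conv (\<lambda>p. if p = 0 then 1 else 0) f p = f p"
proof -
  have "nov_conv (\<lambda>p. if p = 0 then 1 else 0) f p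
      = (\<Sum>a\<in>{0}. (if a = 0 then 1 else 0) * f (p - a))"
    unfolding nov_conv_def by (rule Sum_any.expand_superset) auto
  then show ?thesis by simp
qed

lemma nov_fin_coeff: "nov_fin (coeff x)"
  using coeff[of x] by (simp add: nov_fin_def)

instantiation nov :: comm_ring_1
begin

lift_definition zero_nov :: nov is "\<lambda>_. 0" by simp

lift_definition one_nov :: nov is "\<lambda>p. if p = 0 then 1 else 0"
  by (auto intro!: finite_subset[of _ "{0}"])

lift_definition plus_nov :: "nov \<Rightarrow> nov \<Rightarrow> nov" is "\<lambda>f g p. f p + g p"
proof -
  fix f g :: "real \<times> int \<Rightarrow> real" and E
  assume "\<And>E. finite {p. fst p \<le> E \<and> f p \<noteq> 0}" "\<And>E. finite {p. fst p \<le> E \<and> g p \<noteq> 0}"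
  then have "finite ({p. fst p \<le> E \<and> f p \<noteq> 0} \<union> {p. fst p \<le> E \<and> g p \<noteq> 0})" by blast
  then show "finite {p. fst p \<le> E \<and> f p + g p \<noteq> 0}"
    by (rule rev_finite_subset) auto
qed

lift_definition uminus_nov :: "nov \<Rightarrow> nov" is "\<lambda>f p. - f p" by simp

definition minus_nov :: "nov \<Rightarrow> nov \<Rightarrow> nov" where "minus_nov x y = x + - y"

lift_definition times_nov :: "nov \<Rightarrow> nov \<Rightarrow> nov" is nov_conv
  using nov_conv_nfin unfolding nov_fin_def by blast

instance
proof
  fix x y z :: nov
  show "x * y * z = x * (y * z)"
    by (rule nov_eqI) (simp add: times_nov.rep_eq nov_conv_assoc nov_fin_coeff)
  show "x * y = y * x"
    by (rule nov_eqI) (simp add: times_nov.rep_eq nov_conv_comm)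
  show "1 * x = x"
    by (rule nov_eqI) (simp add: times_nov.rep_eq one_nov.rep_eq nov_conv_one)
  show "(x + y) * z = x * z + y * z"
    by (rule nov_eqI) (simp add: times_nov.rep_eq plus_nov.rep_eq nov_conv_distrib nov_fin_coeff)
  show "x + y + z = x + (y + z)" "x + y = y + x" "0 + x = x" "- x + x = 0" "x - y = x + - y"
    by (auto intro!: nov_eqI simp: plus_nov.rep_eq zero_nov.rep_eq uminus_nov.rep_eq minus_nov_def)
  show "(0::nov) \<noteq> 1"
  proof
    assume "(0::nov) = 1"
    then have "coeff 0 0 = coeff 1 0" by simp
    then show False by (simp add: zero_nov.rep_eq one_nov.rep_eq)
  qed
qed

end

lift_definition nov_const :: "real \<Rightarrow> nov" is "\<lambda>r p. if p = 0 then r else 0"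
  by (auto intro!: finite_subset[of _ "{0}"])

definition energy_ge :: "real \<Rightarrow> nov set" where
  "energy_ge E = {c. \<forall>p. coeff c p \<noteq> 0 \<longrightarrow> E \<le> fst p}"

text \<open>
  The sum of a family converging in the \<open>T\<close>-adic topology, i.e. such that for every \<open>E\<close> all but
  finitely many members lie in \<open>energy_ge E\<close>; the value is meaningful for such families only.
\<close>

definition nov_sum :: "('i \<Rightarrow> nov) \<Rightarrow> nov" where
  "nov_sum f = Abs_nov (\<lambda>p. Sum_any (\<lambda>i. coeff (f i) p))"

definition ksign :: "int \<Rightarrow> nov" where
  "ksign k = (if even k then 1 else - 1)"

definition kron :: "'i \<Rightarrow> 'i \<Rightarrow> nov" where
  "kron i j = (if i = j then 1 else 0)"

text \<open>\<open>Filtered\<close>: coefficients in \<open>\<Lambda>\<^sub>0\<^sub>,\<^sub>n\<^sub>o\<^sub>v\<close>; \<open>Weakly_filtered\<close>: coefficients in \<open>\<Lambda>\<^sub>n\<^sub>o\<^sub>v\<close>.\<close>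

datatype setting = Filtered | Weakly_filtered

fun scalars :: "setting \<Rightarrow> nov set" where
  "scalars Filtered = energy_ge 0"
| "scalars Weakly_filtered = UNIV"


section \<open>Completed free modules and their maps\<close>

text \<open>
  A graded free module over the reals is given by a set of homogeneous basis elements and their
  degrees. The energy completion of its tensor product with the Novikov ring consists of the formal
  sums \<open>\<Sum> x\<^sub>i b\<^sub>i\<close> over the basis such that for every \<open>E\<close> all but finitely many coefficients \<open>x\<^sub>i\<close>
  have energy at least \<open>E\<close>. Completed tensor products and completed direct sums are again of this
  form: the completed tensor coalgebra has the words in the basis of \<open>C\<close> as its basis, and
  the module \<open>M[1]\<close> tensored with it has the pairs (basis element of \<open>M\<close>, word).

  A Novikov-linear map raising energy by at least a fixed (possibly negative) amount is the same as
  the family of its values on the basis, so it is represented by the matrix \<open>D\<close> for which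
  \<open>D i\<close> is the image of the basis element \<open>i\<close>; \<open>lin D\<close> is the map itself.
\<close>

record 'b gmod =
  basis :: "'b set"
  gdeg :: "'b \<Rightarrow> int"

definition completed :: "setting \<Rightarrow> 'i set \<Rightarrow> ('i \<Rightarrow> nov) set" where
  "completed \<kappa> X = {x. (\<forall>i. i \<notin> X \<longrightarrow> x i = 0) \<and> (\<forall>i. x i \<in> scalars \<kappa>) \<and>
     (\<forall>E. finite {i. x i \<notin> energy_ge E})}"

definition lin :: "('i \<Rightarrow> 'j \<Rightarrow> nov) \<Rightarrow> ('i \<Rightarrow> nov) \<Rightarrow> 'j \<Rightarrow> nov" where
  "lin D x = (\<lambda>j. nov_sum (\<lambda>i. x i * D i j))"

text \<open>\<open>T\<close> has degree 0 and \<open>e\<close> has degree 2.\<close>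

definition homogeneous :: "('i \<Rightarrow> int) \<Rightarrow> int \<Rightarrow> ('i \<Rightarrow> nov) \<Rightarrow> bool" where
  "homogeneous dg k x \<longleftrightarrow> (\<forall>i p. coeff (x i) p \<noteq> 0 \<longrightarrow> dg i + 2 * snd p = k)"

definition sdeg :: "('b, 'z) gmod_scheme \<Rightarrow> 'b \<Rightarrow> int" where
  "sdeg C b = gdeg C b - 1"

definition wdeg :: "('b, 'z) gmod_scheme \<Rightarrow> 'b list \<Rightarrow> int" where
  "wdeg C w = (\<Sum>b\<leftarrow>w. sdeg C b)"

text \<open>The tensor product of two elements of the completed tensor coalgebra.\<close>

definition tens :: "('b list \<Rightarrow> nov) \<Rightarrow> ('b list \<Rightarrow> nov) \<Rightarrow> 'b list \<Rightarrow> nov" where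
  "tens x y w = (\<Sum>i\<le>length w. x (take i w) * y (drop i w))"

definition letter :: "('b \<Rightarrow> nov) \<Rightarrow> 'b list \<Rightarrow> nov" where
  "letter c w = (case w of [b] \<Rightarrow> c b | _ \<Rightarrow> 0)"


section \<open>Gapped families\<close>

text \<open>
  Discreteness of the projection to the energies is local finiteness: finitely many energies
  below any bound.
\<close>

definition gap_monoid :: "(real \<times> int) set \<Rightarrow> bool" where
  "gap_monoid G \<longleftrightarrow>
     G \<subseteq> {(r, \<mu>). 0 \<le> r \<and> even \<mu>} \<and> (0, 0) \<in> G \<and> (\<forall>\<beta>\<in>G. \<forall>\<gamma>\<in>G. \<beta> + \<gamma> \<in> G) \<and>
     (\<forall>E. finite {r \<in> fst ` G. r \<le> E}) \<and> (\<forall>r. finite {\<mu>. (r, \<mu>) \<in> G}) \<and>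
     (\<forall>\<mu>. (0, \<mu>) \<in> G \<longrightarrow> \<mu> = 0)"

definition gap_set :: "(real \<times> int) set \<Rightarrow> (real \<times> int) set \<Rightarrow> bool" where
  "gap_set G G' \<longleftrightarrow>
     G' \<subseteq> {(r, \<mu>). even \<mu>} \<and> (\<forall>\<beta>\<in>G. \<forall>\<gamma>\<in>G'. \<beta> + \<gamma> \<in> G') \<and>
     (\<forall>E. finite {r \<in> fst ` G'. r \<le> E}) \<and> (\<forall>r. finite {\<mu>. (r, \<mu>) \<in> G'})"

text \<open>An element of the form \<open>\<Sum> T^\<lambda> e^(\<mu>/2) x\<^sub>\<beta>\<close>, \<open>\<beta> = (\<lambda>, \<mu>) \<in> G\<close>, with each \<open>x\<^sub>\<beta>\<close> real.\<close>

definition supported :: "(real \<times> int) set \<Rightarrow> ('i \<Rightarrow> nov) \<Rightarrow> bool" where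
  "supported G x \<longleftrightarrow> (\<forall>i p. coeff (x i) p \<noteq> 0 \<longrightarrow> (fst p, 2 * snd p) \<in> G)"


section \<open>Filtered A-infinity algebras and homomorphisms\<close>

text \<open>\<open>mop A w\<close> is \<open>m\<^sub>k(w)\<close> for a word \<open>w\<close> of length \<open>k\<close>.\<close>

record 'b ainf = "'b gmod" +
  mop :: "'b list \<Rightarrow> 'b \<Rightarrow> nov"

definition bar_d :: "'b ainf \<Rightarrow> 'b list \<Rightarrow> 'b list \<Rightarrow> nov" where
  "bar_d A w y = (\<Sum>i\<le>length w. \<Sum>k\<le>length w - i. ksign (wdeg A (take i w)) *
     tens (kron (take i w)) (tens (letter (mop A (take k (drop i w)))) (kron (drop (i + k) w))) y)"

definition filtered_ainf :: "'b ainf \<Rightarrow> bool" where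
  "filtered_ainf A \<longleftrightarrow>
     (\<forall>w\<in>lists (basis A). mop A w \<in> completed Filtered (basis A) \<and>
        homogeneous (sdeg A) (wdeg A w + 1) (mop A w)) \<and>
     (\<exists>\<epsilon>>0. \<forall>b. mop A [] b \<in> energy_ge \<epsilon>) \<and>
     (\<forall>x\<in>completed Filtered (lists (basis A)). lin (bar_d A) (lin (bar_d A) x) = (\<lambda>_. 0))"

definition gapped_ainf :: "'b ainf \<Rightarrow> bool" where
  "gapped_ainf A \<longleftrightarrow> filtered_ainf A \<and>
     (\<exists>G. gap_monoid G \<and> (\<forall>w\<in>lists (basis A). supported G (mop A w)))"

type_synonym ('a, 'b) hom_family = "'a list \<Rightarrow> 'b \<Rightarrow> nov"

text \<open>
  Coefficient at the word \<open>y\<close> of \<open>\<Sum> f\<^sub>k\<^sub>1(\<dots>) \<otimes> \<cdots> \<otimes> f\<^sub>k\<^sub>n(\<dots>)\<close>, the sum being over all \<open>n\<close> and all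
  decompositions of \<open>w\<close> into \<open>n\<close> consecutive, possibly empty, pieces; only \<open>n = length y\<close>
  contributes.
\<close>

fun hat :: "('a, 'b) hom_family \<Rightarrow> 'a list \<Rightarrow> 'b list \<Rightarrow> nov" where
  "hat f w [] = (if w = [] then 1 else 0)"
| "hat f w (b # y) = (\<Sum>k\<le>length w. f (take k w) b * hat f (drop k w) y)"

definition filtered_hom :: "'a ainf \<Rightarrow> 'b ainf \<Rightarrow> ('a, 'b) hom_family \<Rightarrow> bool" where
  "filtered_hom A B f \<longleftrightarrow>
     (\<forall>w\<in>lists (basis A). f w \<in> completed Filtered (basis B) \<and>
        homogeneous (sdeg B) (wdeg A w) (f w)) \<and>
     (\<exists>\<epsilon>>0. \<forall>b. f [] b \<in> energy_ge \<epsilon>) \<and>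
     (\<forall>x\<in>completed Filtered (lists (basis A)).
        lin (hat f) (lin (bar_d A) x) = lin (bar_d B) (lin (hat f) x))"

definition gapped_hom :: "'a ainf \<Rightarrow> 'b ainf \<Rightarrow> ('a, 'b) hom_family \<Rightarrow> bool" where
  "gapped_hom A B f \<longleftrightarrow> filtered_hom A B f \<and>
     (\<exists>G. gap_monoid G \<and> (\<forall>w\<in>lists (basis A). supported G (f w)))"

definition id_hom :: "('a, 'a) hom_family" where
  "id_hom w b = kron w [b]"

definition comp_hom :: "('b, 'c) hom_family \<Rightarrow> ('a, 'b) hom_family \<Rightarrow> ('a, 'c) hom_family" where
  "comp_hom g f w = lin g (hat f w)"

definition hom_eq :: "'a ainf \<Rightarrow> ('a, 'b) hom_family \<Rightarrow> ('a, 'b) hom_family \<Rightarrow> bool" where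
  "hom_eq A f g \<longleftrightarrow> (\<forall>w\<in>lists (basis A). f w = g w)"

definition linear_hom :: "'a ainf \<Rightarrow> ('a, 'b) hom_family \<Rightarrow> bool" where
  "linear_hom A f \<longleftrightarrow> (\<forall>w\<in>lists (basis A). length w \<noteq> 1 \<longrightarrow> f w = (\<lambda>_. 0))"


section \<open>Filtered bimodules and (weakly) filtered homomorphisms\<close>

text \<open>A family \<open>\<phi> u v w\<close> is \<open>\<phi>\<^sub>i\<^sub>,\<^sub>j(u \<otimes> v \<otimes> w)\<close> for words \<open>u\<close>, \<open>w\<close> of lengths \<open>i\<close>, \<open>j\<close>.\<close>

type_synonym ('a, 'v, 'b, 'u) bi_family = "'a list \<Rightarrow> 'v \<Rightarrow> 'b list \<Rightarrow> 'u \<Rightarrow> nov"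

record ('a, 'v, 'b) bimod = "'v gmod" +
  nop :: "('a, 'v, 'b, 'v) bi_family"

definition bi_basis :: "'a ainf \<Rightarrow> 'b ainf \<Rightarrow> ('v, 'z) gmod_scheme \<Rightarrow> ('a list \<times> 'v \<times> 'b list) set" where
  "bi_basis A1 A0 M = lists (basis A1) \<times> basis M \<times> lists (basis A0)"

fun bimod_d :: "'a ainf \<Rightarrow> 'b ainf \<Rightarrow> ('a, 'v, 'b) bimod \<Rightarrow>
    'a list \<times> 'v \<times> 'b list \<Rightarrow> 'a list \<times> 'v \<times> 'b list \<Rightarrow> nov" where
  "bimod_d A1 A0 M (u, v, w) (u', v', w') =
     bar_d A1 u u' * kron v v' * kron w w' +
     (\<Sum>i\<le>length u. \<Sum>j\<le>length w. ksign (wdeg A1 (take i u)) *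
        kron (take i u) u' * nop M (drop i u) v (take j w) v' * kron (drop j w) w') +
     ksign (wdeg A1 u + sdeg M v) * kron u u' * kron v v' * bar_d A0 w w'"

definition filtered_bimod :: "'a ainf \<Rightarrow> 'b ainf \<Rightarrow> ('a, 'v, 'b) bimod \<Rightarrow> bool" where
  "filtered_bimod A1 A0 M \<longleftrightarrow>
     (\<forall>(u, v, w)\<in>bi_basis A1 A0 M. nop M u v w \<in> completed Filtered (basis M) \<and>
        homogeneous (sdeg M) (wdeg A1 u + sdeg M v + wdeg A0 w + 1) (nop M u v w)) \<and>
     (\<forall>x\<in>completed Filtered (bi_basis A1 A0 M).
        lin (bimod_d A1 A0 M) (lin (bimod_d A1 A0 M) x) = (\<lambda>_. 0))"

definition gapped_bimod :: "'a ainf \<Rightarrow> 'b ainf \<Rightarrow> ('a, 'v, 'b) bimod \<Rightarrow> bool" where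
  "gapped_bimod A1 A0 M \<longleftrightarrow> filtered_bimod A1 A0 M \<and>
     (\<exists>G. gap_monoid G \<and> (\<forall>(u, v, w)\<in>bi_basis A1 A0 M. supported G (nop M u v w)))"

fun bi_hat :: "('a, 'c) hom_family \<Rightarrow> ('b, 'd) hom_family \<Rightarrow> ('a, 'v, 'b, 'u) bi_family \<Rightarrow>
    'a list \<times> 'v \<times> 'b list \<Rightarrow> 'c list \<times> 'u \<times> 'd list \<Rightarrow> nov" where
  "bi_hat f1 f0 \<phi> (u, v, w) (u', v', w') =
     (\<Sum>i\<le>length u. \<Sum>j\<le>length w.
        hat f1 (take i u) u' * \<phi> (drop i u) v (take j w) v' * hat f0 (drop j w) w')"

text \<open>
  Homomorphisms from \<open>M\<close> over \<open>(A1, A0)\<close> to \<open>N\<close> over \<open>(B1, B0)\<close>, over \<open>(f1, f0)\<close>. The energy loss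
  \<open>c\<close> is 0 in the filtered setting; in the weakly filtered setting it is uniform in all words.
\<close>

definition bimod_hom :: "setting \<Rightarrow> 'a ainf \<Rightarrow> 'b ainf \<Rightarrow> ('a, 'v, 'b) bimod \<Rightarrow>
    'c ainf \<Rightarrow> 'd ainf \<Rightarrow> ('c, 'u, 'd) bimod \<Rightarrow>
    ('a, 'c) hom_family \<Rightarrow> ('b, 'd) hom_family \<Rightarrow> ('a, 'v, 'b, 'u) bi_family \<Rightarrow> bool" where
  "bimod_hom \<kappa> A1 A0 M B1 B0 N f1 f0 \<phi> \<longleftrightarrow>
     (\<exists>c\<ge>0. (\<kappa> = Filtered \<longrightarrow> c = 0) \<and>
        (\<forall>(u, v, w)\<in>bi_basis A1 A0 M.
           \<phi> u v w \<in> completed Weakly_filtered (basis N) \<and> (\<forall>b. \<phi> u v w b \<in> energy_ge (- c)) \<and>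
           homogeneous (sdeg N) (wdeg A1 u + sdeg M v + wdeg A0 w) (\<phi> u v w))) \<and>
     (\<forall>x\<in>completed \<kappa> (bi_basis A1 A0 M).
        lin (bi_hat f1 f0 \<phi>) (lin (bimod_d A1 A0 M) x) =
        lin (bimod_d B1 B0 N) (lin (bi_hat f1 f0 \<phi>) x))"

definition gapped_bimod_hom :: "setting \<Rightarrow> 'a ainf \<Rightarrow> 'b ainf \<Rightarrow> ('a, 'v, 'b) bimod \<Rightarrow>
    'c ainf \<Rightarrow> 'd ainf \<Rightarrow> ('c, 'u, 'd) bimod \<Rightarrow>
    ('a, 'c) hom_family \<Rightarrow> ('b, 'd) hom_family \<Rightarrow> ('a, 'v, 'b, 'u) bi_family \<Rightarrow> bool" where
  "gapped_bimod_hom \<kappa> A1 A0 M B1 B0 N f1 f0 \<phi> \<longleftrightarrow>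
     bimod_hom \<kappa> A1 A0 M B1 B0 N f1 f0 \<phi> \<and>
     (\<exists>G G'. gap_monoid G \<and> (if \<kappa> = Filtered then G' = G else gap_set G G') \<and>
        (\<forall>(u, v, w)\<in>bi_basis A1 A0 M. supported G' (\<phi> u v w)))"

definition id_bi :: "('a, 'v, 'b, 'v) bi_family" where
  "id_bi u v w v' = kron u [] * kron v v' * kron w []"

definition comp_bi :: "('c, 'u, 'd, 't) bi_family \<Rightarrow> ('a, 'c) hom_family \<Rightarrow> ('b, 'd) hom_family \<Rightarrow>
    ('a, 'v, 'b, 'u) bi_family \<Rightarrow> ('a, 'v, 'b, 't) bi_family" where
  "comp_bi \<psi> f1 f0 \<phi> u v w = lin (\<lambda>(u', v', w'). \<psi> u' v' w') (bi_hat f1 f0 \<phi> (u, v, w))"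

definition bi_eq :: "'a ainf \<Rightarrow> 'b ainf \<Rightarrow> ('a, 'v, 'b) bimod \<Rightarrow>
    ('a, 'v, 'b, 'u) bi_family \<Rightarrow> ('a, 'v, 'b, 'u) bi_family \<Rightarrow> bool" where
  "bi_eq A1 A0 M \<phi> \<psi> \<longleftrightarrow> (\<forall>(u, v, w)\<in>bi_basis A1 A0 M. \<phi> u v w = \<psi> u v w)"

definition linear_bi :: "'a ainf \<Rightarrow> 'b ainf \<Rightarrow> ('a, 'v, 'b) bimod \<Rightarrow>
    ('a, 'v, 'b, 'u) bi_family \<Rightarrow> bool" where
  "linear_bi A1 A0 M \<phi> \<longleftrightarrow>
     (\<forall>(u, v, w)\<in>bi_basis A1 A0 M. u \<noteq> [] \<or> w \<noteq> [] \<longrightarrow> \<phi> u v w = (\<lambda>_. 0))"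


section \<open>Reduction to the reals and cochain homotopy equivalences\<close>

text \<open>
  Real matrices again have the image of the basis element \<open>a\<close> as their row \<open>a\<close>; here all rows are
  finite, the modules being uncompleted.
\<close>

definition real_map :: "int \<Rightarrow> ('a, 'y) gmod_scheme \<Rightarrow> ('b, 'z) gmod_scheme \<Rightarrow>
    ('a \<Rightarrow> 'b \<Rightarrow> real) \<Rightarrow> bool" where
  "real_map k X Y S \<longleftrightarrow> (\<forall>a\<in>basis X. finite {b. S a b \<noteq> 0} \<and>
     (\<forall>b. S a b \<noteq> 0 \<longrightarrow> b \<in> basis Y \<and> gdeg Y b = gdeg X a + k))"

definition real_comp :: "('b \<Rightarrow> 'c \<Rightarrow> real) \<Rightarrow> ('a \<Rightarrow> 'b \<Rightarrow> real) \<Rightarrow> 'a \<Rightarrow> 'c \<Rightarrow> real" where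
  "real_comp S' S a c = Sum_any (\<lambda>b. S a b * S' b c)"

definition cochain_map :: "('a, 'y) gmod_scheme \<Rightarrow> ('a \<Rightarrow> 'a \<Rightarrow> real) \<Rightarrow>
    ('b, 'z) gmod_scheme \<Rightarrow> ('b \<Rightarrow> 'b \<Rightarrow> real) \<Rightarrow> ('a \<Rightarrow> 'b \<Rightarrow> real) \<Rightarrow> bool" where
  "cochain_map X dX Y dY S \<longleftrightarrow> real_map 0 X Y S \<and>
     (\<forall>a\<in>basis X. real_comp S dX a = real_comp dY S a)"

definition cochain_homotopic_id :: "('a, 'y) gmod_scheme \<Rightarrow> ('a \<Rightarrow> 'a \<Rightarrow> real) \<Rightarrow>
    ('a \<Rightarrow> 'a \<Rightarrow> real) \<Rightarrow> bool" where
  "cochain_homotopic_id X dX S \<longleftrightarrow> (\<exists>h. real_map (- 1) X X h \<and>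
     (\<forall>a\<in>basis X. \<forall>c. S a c - (if a = c then 1 else 0) = real_comp dX h a c + real_comp h dX a c))"

definition cochain_homotopy_equiv :: "('a, 'y) gmod_scheme \<Rightarrow> ('a \<Rightarrow> 'a \<Rightarrow> real) \<Rightarrow>
    ('b, 'z) gmod_scheme \<Rightarrow> ('b \<Rightarrow> 'b \<Rightarrow> real) \<Rightarrow> ('a \<Rightarrow> 'b \<Rightarrow> real) \<Rightarrow> bool" where
  "cochain_homotopy_equiv X dX Y dY S \<longleftrightarrow> cochain_map X dX Y dY S \<and>
     (\<exists>S'. cochain_map Y dY X dX S' \<and>
        cochain_homotopic_id X dX (real_comp S' S) \<and> cochain_homotopic_id Y dY (real_comp S S'))"

text \<open>
  By gappedness the reduction modulo positive energy of a filtered map is given by its coefficients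
  at \<open>\<beta> = (0, 0)\<close>.
\<close>

definition red_hom :: "('a, 'b) hom_family \<Rightarrow> 'a \<Rightarrow> 'b \<Rightarrow> real" where
  "red_hom f a b = coeff (f [a] b) (0, 0)"

definition red_bi :: "('a, 'v, 'b, 'u) bi_family \<Rightarrow> 'v \<Rightarrow> 'u \<Rightarrow> real" where
  "red_bi \<phi> v v' = coeff (\<phi> [] v [] v') (0, 0)"


section \<open>Models of the product with an interval, and homotopies\<close>

text \<open>
  Everything is taken in the gapped category. Models, together with their inclusion and evaluation
  maps, are filtered also in the weakly filtered setting (where they are used after extending
  scalars), since their definition refers to the reduction modulo positive energy.
\<close>

record ('c, 'a) alg_model =
  mod_alg :: "'c ainf"
  alg_incl :: "('a, 'c) hom_family"
  alg_eval0 :: "('c, 'a) hom_family"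
  alg_eval1 :: "('c, 'a) hom_family"

definition is_alg_model :: "'a ainf \<Rightarrow> ('c, 'a) alg_model \<Rightarrow> bool" where
  "is_alg_model A X \<longleftrightarrow>
     gapped_ainf (mod_alg X) \<and> gapped_hom A (mod_alg X) (alg_incl X) \<and> linear_hom A (alg_incl X) \<and>
     cochain_homotopy_equiv A (red_hom (mop A)) (mod_alg X) (red_hom (mop (mod_alg X)))
       (red_hom (alg_incl X)) \<and>
     (\<forall>ev\<in>{alg_eval0 X, alg_eval1 X}.
        gapped_hom (mod_alg X) A ev \<and> linear_hom (mod_alg X) ev \<and>
        hom_eq A (comp_hom ev (alg_incl X)) id_hom \<and>
        cochain_homotopy_equiv (mod_alg X) (red_hom (mop (mod_alg X))) A (red_hom (mop A))
          (red_hom ev)) \<and>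
     (\<forall>x\<in>completed Filtered (basis A). \<forall>y\<in>completed Filtered (basis A).
        \<exists>z\<in>completed Filtered (basis (mod_alg X)).
          lin (\<lambda>b. alg_eval0 X [b]) z = x \<and> lin (\<lambda>b. alg_eval1 X [b]) z = y)"

record ('c, 'k, 'd, 'a, 'v, 'b) bi_model =
  mod_bi :: "('c, 'k, 'd) bimod"
  bi_incl :: "('a, 'v, 'b, 'k) bi_family"
  bi_eval0 :: "('c, 'k, 'd, 'v) bi_family"
  bi_eval1 :: "('c, 'k, 'd, 'v) bi_family"

text \<open>
  The last clause is the splitting of \<open>v \<mapsto> (Eval\<^sub>0 v, Eval\<^sub>1 v)\<close>: \<open>s0\<close>, \<open>s1\<close> are the restrictions of
  the right inverse to the two summands.
\<close>

definition is_bi_model :: "'a ainf \<Rightarrow> 'b ainf \<Rightarrow> ('a, 'v, 'b) bimod \<Rightarrow>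
    ('c, 'a) alg_model \<Rightarrow> ('d, 'b) alg_model \<Rightarrow> ('c, 'k, 'd, 'a, 'v, 'b) bi_model \<Rightarrow> bool" where
  "is_bi_model A1 A0 M X1 X0 Y \<longleftrightarrow>
     gapped_bimod (mod_alg X1) (mod_alg X0) (mod_bi Y) \<and>
     gapped_bimod_hom Filtered A1 A0 M (mod_alg X1) (mod_alg X0) (mod_bi Y)
       (alg_incl X1) (alg_incl X0) (bi_incl Y) \<and>
     linear_bi A1 A0 M (bi_incl Y) \<and>
     cochain_homotopy_equiv M (red_bi (nop M)) (mod_bi Y) (red_bi (nop (mod_bi Y)))
       (red_bi (bi_incl Y)) \<and>
     (\<forall>(ev1, ev0, ev)\<in>{(alg_eval0 X1, alg_eval0 X0, bi_eval0 Y),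
                        (alg_eval1 X1, alg_eval1 X0, bi_eval1 Y)}.
        gapped_bimod_hom Filtered (mod_alg X1) (mod_alg X0) (mod_bi Y) A1 A0 M ev1 ev0 ev \<and>
        linear_bi (mod_alg X1) (mod_alg X0) (mod_bi Y) ev \<and>
        bi_eq A1 A0 M (comp_bi ev (alg_incl X1) (alg_incl X0) (bi_incl Y)) id_bi) \<and>
     (\<exists>s0 s1.
        (\<forall>s\<in>{s0, s1}. \<forall>v\<in>basis M. s v \<in> completed Filtered (basis (mod_bi Y)) \<and>
           homogeneous (sdeg (mod_bi Y)) (sdeg M v) (s v)) \<and>
        (\<forall>x\<in>completed Filtered (basis M).
           lin (\<lambda>k. bi_eval0 Y [] k []) (lin s0 x) = x \<and>
           lin (\<lambda>k. bi_eval1 Y [] k []) (lin s0 x) = (\<lambda>_. 0) \<and>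
           lin (\<lambda>k. bi_eval0 Y [] k []) (lin s1 x) = (\<lambda>_. 0) \<and>
           lin (\<lambda>k. bi_eval1 Y [] k []) (lin s1 x) = x))"

definition is_homotopy :: "'a ainf \<Rightarrow> 'b ainf \<Rightarrow> ('a, 'b) hom_family \<Rightarrow> ('a, 'b) hom_family \<Rightarrow>
    ('c, 'b) alg_model \<Rightarrow> ('a, 'c) hom_family \<Rightarrow> bool" where
  "is_homotopy A B f g X F \<longleftrightarrow>
     is_alg_model B X \<and> gapped_hom A (mod_alg X) F \<and>
     hom_eq A (comp_hom (alg_eval0 X) F) f \<and> hom_eq A (comp_hom (alg_eval1 X) F) g"

text \<open>
  HOL cannot quantify existentially over the type in which a model lives, so that type is a
  parameter: \<open>'c\<close> for models of algebras and \<open>'k\<close> for models of bimodules. Bases are arbitrary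
  subsets of these types, so one sufficiently large type accommodates all models at once. In a
  hypothesis of a theorem a free type parameter amounts to the existential quantification.
\<close>

definition homotopic_homs :: "'c itself \<Rightarrow> 'a ainf \<Rightarrow> 'b ainf \<Rightarrow>
    ('a, 'b) hom_family \<Rightarrow> ('a, 'b) hom_family \<Rightarrow> bool" where
  "homotopic_homs _ A B f g \<longleftrightarrow> (\<exists>(X :: ('c, 'b) alg_model) F. is_homotopy A B f g X F)"

definition homotopy_inverse :: "'c itself \<Rightarrow> 'a ainf \<Rightarrow> 'b ainf \<Rightarrow>
    ('a, 'b) hom_family \<Rightarrow> ('b, 'a) hom_family \<Rightarrow> bool" where
  "homotopy_inverse tc A B f g \<longleftrightarrow> gapped_hom B A g \<and>
     homotopic_homs tc B B (comp_hom f g) id_hom \<and> homotopic_homs tc A A (comp_hom g f) id_hom"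

definition homotopic_bi :: "'c itself \<Rightarrow> 'k itself \<Rightarrow> setting \<Rightarrow>
    'a ainf \<Rightarrow> 'b ainf \<Rightarrow> ('a, 'v, 'b) bimod \<Rightarrow> 'a2 ainf \<Rightarrow> 'b2 ainf \<Rightarrow> ('a2, 'u, 'b2) bimod \<Rightarrow>
    ('a, 'a2) hom_family \<Rightarrow> ('b, 'b2) hom_family \<Rightarrow> ('a, 'v, 'b, 'u) bi_family \<Rightarrow>
    ('a, 'a2) hom_family \<Rightarrow> ('b, 'b2) hom_family \<Rightarrow> ('a, 'v, 'b, 'u) bi_family \<Rightarrow> bool" where
  "homotopic_bi _ _ \<kappa> A1 A0 M B1 B0 N f1 f0 \<phi> g1 g0 \<psi> \<longleftrightarrow>
     (\<exists>(X1 :: ('c, 'a2) alg_model) F1 (X0 :: ('c, 'b2) alg_model) F0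
       (Y :: ('c, 'k, 'c, 'a2, 'u, 'b2) bi_model) \<Phi>.
        is_homotopy A1 B1 f1 g1 X1 F1 \<and> is_homotopy A0 B0 f0 g0 X0 F0 \<and>
        is_bi_model B1 B0 N X1 X0 Y \<and>
        gapped_bimod_hom \<kappa> A1 A0 M (mod_alg X1) (mod_alg X0) (mod_bi Y) F1 F0 \<Phi> \<and>
        bi_eq A1 A0 M (comp_bi (bi_eval0 Y) F1 F0 \<Phi>) \<phi> \<and>
        bi_eq A1 A0 M (comp_bi (bi_eval1 Y) F1 F0 \<Phi>) \<psi>)"

definition homotopy_equivalence_bi :: "'c itself \<Rightarrow> 'k itself \<Rightarrow> setting \<Rightarrow>
    'a ainf \<Rightarrow> 'b ainf \<Rightarrow> ('a, 'v, 'b) bimod \<Rightarrow> 'a2 ainf \<Rightarrow> 'b2 ainf \<Rightarrow> ('a2, 'u, 'b2) bimod \<Rightarrow>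
    ('a, 'a2) hom_family \<Rightarrow> ('b, 'b2) hom_family \<Rightarrow> ('a, 'v, 'b, 'u) bi_family \<Rightarrow> bool" where
  "homotopy_equivalence_bi tc tk \<kappa> A1 A0 M B1 B0 N f1 f0 \<phi> \<longleftrightarrow>
     (\<exists>g1 g0 \<psi>.
        homotopy_inverse tc A1 B1 f1 g1 \<and> homotopy_inverse tc A0 B0 f0 g0 \<and>
        gapped_bimod_hom \<kappa> B1 B0 N A1 A0 M g1 g0 \<psi> \<and>
        homotopic_bi tc tk \<kappa> B1 B0 N B1 B0 N
          (comp_hom f1 g1) (comp_hom f0 g0) (comp_bi \<phi> g1 g0 \<psi>) id_hom id_hom id_bi \<and>
        homotopic_bi tc tk \<kappa> A1 A0 M A1 A0 M
          (comp_hom g1 f1) (comp_hom g0 f0) (comp_bi \<psi> f1 f0 \<phi>) id_hom id_hom id_bi)"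


section \<open>Homology and isomorphisms induced on it\<close>

record 'i cplx =
  chains :: "('i \<Rightarrow> nov) set"
  diff :: "('i \<Rightarrow> nov) \<Rightarrow> 'i \<Rightarrow> nov"
  cdeg :: "'i \<Rightarrow> int"

definition add_monoid_on :: "('i \<Rightarrow> nov) set \<Rightarrow> ('i \<Rightarrow> nov) monoid" where
  "add_monoid_on Z = \<lparr>carrier = Z, monoid.mult = (\<lambda>x y i. x i + y i), one = (\<lambda>_. 0)\<rparr>"

definition cycles :: "'i cplx \<Rightarrow> ('i \<Rightarrow> nov) set" where
  "cycles X = {x \<in> chains X. diff X x = (\<lambda>_. 0)}"

definition boundaries :: "'i cplx \<Rightarrow> ('i \<Rightarrow> nov) set" where
  "boundaries X = diff X ` chains X"

definition homology :: "'i cplx \<Rightarrow> ('i \<Rightarrow> nov) set monoid" where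
  "homology X = add_monoid_on (cycles X) Mod boundaries X"

definition hclass :: "'i cplx \<Rightarrow> ('i \<Rightarrow> nov) \<Rightarrow> ('i \<Rightarrow> nov) set" where
  "hclass X z = boundaries X #>\<^bsub>add_monoid_on (cycles X)\<^esub> z"

definition hscale :: "'i cplx \<Rightarrow> nov \<Rightarrow> ('i \<Rightarrow> nov) set \<Rightarrow> ('i \<Rightarrow> nov) set" where
  "hscale X a c = (\<Union>z\<in>c. hclass X (\<lambda>i. a * z i))"

definition homology_deg :: "'i cplx \<Rightarrow> int \<Rightarrow> ('i \<Rightarrow> nov) set set" where
  "homology_deg X k = {hclass X z | z. z \<in> cycles X \<and> homogeneous (cdeg X) k z}"

definition induced :: "'j cplx \<Rightarrow> (('i \<Rightarrow> nov) \<Rightarrow> 'j \<Rightarrow> nov) \<Rightarrow>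
    ('i \<Rightarrow> nov) set \<Rightarrow> ('j \<Rightarrow> nov) set" where
  "induced Y f c = (\<Union>z\<in>c. hclass Y (f z))"

definition is_complex :: "'i cplx \<Rightarrow> bool" where
  "is_complex X \<longleftrightarrow> (\<forall>x\<in>chains X. diff X x \<in> chains X \<and> diff X (diff X x) = (\<lambda>_. 0) \<and>
     (\<forall>k. homogeneous (cdeg X) k x \<longrightarrow> homogeneous (cdeg X) (k + 1) (diff X x)))"

definition is_chain_map :: "'i cplx \<Rightarrow> 'j cplx \<Rightarrow> (('i \<Rightarrow> nov) \<Rightarrow> 'j \<Rightarrow> nov) \<Rightarrow> bool" where
  "is_chain_map X Y f \<longleftrightarrow> (\<forall>x\<in>chains X. f x \<in> chains Y \<and> f (diff X x) = diff Y (f x) \<and>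
     (\<forall>k. homogeneous (cdeg X) k x \<longrightarrow> homogeneous (cdeg Y) k (f x)))"

text \<open>The induced map is an isomorphism of graded modules over the Novikov ring.\<close>

definition induces_homology_iso :: "setting \<Rightarrow> 'i cplx \<Rightarrow> 'j cplx \<Rightarrow>
    (('i \<Rightarrow> nov) \<Rightarrow> 'j \<Rightarrow> nov) \<Rightarrow> bool" where
  "induces_homology_iso \<kappa> X Y f \<longleftrightarrow>
     is_complex X \<and> is_complex Y \<and> is_chain_map X Y f \<and>
     induced Y f \<in> iso (homology X) (homology Y) \<and>
     (\<forall>a\<in>scalars \<kappa>. \<forall>c\<in>carrier (homology X).
        induced Y f (hscale X a c) = hscale Y a (induced Y f c)) \<and>
     (\<forall>k. induced Y f ` homology_deg X k = homology_deg Y k)"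


section \<open>Hochschild homology\<close>

text \<open>
  The image under a family \<open>\<phi>\<close> of all cyclic words around \<open>v\<close>; the sign is the Koszul sign of
  moving the last \<open>i\<close> letters to the front.
\<close>

fun hoch_wrap :: "'a ainf \<Rightarrow> ('v, 'z) gmod_scheme \<Rightarrow> ('a, 'v, 'a, 'u) bi_family \<Rightarrow>
    'v \<times> 'a list \<Rightarrow> 'u \<times> 'a list \<Rightarrow> nov" where
  "hoch_wrap A M \<phi> (v, w) (v', w') =
     (\<Sum>i\<le>length w. \<Sum>j\<le>length w - i.
        let k = length w; l = drop (k - i) w; r = take (k - i) w in
        ksign (wdeg A l * (sdeg M v + wdeg A r)) * \<phi> l v (take j r) v' * kron (drop j r) w')"

fun hoch_d :: "'a ainf \<Rightarrow> ('a, 'v, 'a) bimod \<Rightarrow> 'v \<times> 'a list \<Rightarrow> 'v \<times> 'a list \<Rightarrow> nov" where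
  "hoch_d A M (v, w) (v', w') =
     ksign (sdeg M v) * kron v v' * bar_d A w w' + hoch_wrap A M (nop M) (v, w) (v', w')"

definition hochschild :: "setting \<Rightarrow> 'a ainf \<Rightarrow> ('a, 'v, 'a) bimod \<Rightarrow> ('v \<times> 'a list) cplx" where
  "hochschild \<kappa> A M =
     \<lparr>chains = completed \<kappa> (basis M \<times> lists (basis A)), diff = lin (hoch_d A M),
      cdeg = (\<lambda>(v, w). sdeg M v + wdeg A w)\<rparr>"

definition hoch_map :: "'a ainf \<Rightarrow> ('a, 'v, 'a) bimod \<Rightarrow> ('a, 'v, 'a, 'u) bi_family \<Rightarrow>
    ('v \<times> 'a list \<Rightarrow> nov) \<Rightarrow> 'u \<times> 'a list \<Rightarrow> nov" where
  "hoch_map A M \<phi> = lin (hoch_wrap A M \<phi>)"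


section \<open>Chevalley-Eilenberg homology\<close>

text \<open>\<open>permute_list \<tau> w\<close> is the word \<open>x\<^sub>\<tau>\<^sub>(\<^sub>1\<^sub>) \<dots> x\<^sub>\<tau>\<^sub>(\<^sub>k\<^sub>)\<close>; \<open>koszul A \<tau> w\<close> is its sign relative to \<open>w\<close>.\<close>

definition koszul :: "('a, 'z) gmod_scheme \<Rightarrow> (nat \<Rightarrow> nat) \<Rightarrow> 'a list \<Rightarrow> nov" where
  "koszul A \<tau> w = (\<Prod>(i, j)\<in>{(i, j). i < j \<and> j < length w \<and> \<tau> j < \<tau> i}.
     ksign (sdeg A (w ! \<tau> i) * sdeg A (w ! \<tau> j)))"

definition perms :: "nat \<Rightarrow> (nat \<Rightarrow> nat) set" where
  "perms k = {\<tau>. \<tau> permutes {..<k}}"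

definition shuffles_at :: "nat \<Rightarrow> nat \<Rightarrow> (nat \<Rightarrow> nat) set" where
  "shuffles_at k1 k = {\<sigma> \<in> perms k. strict_mono_on {..<k1} \<sigma> \<and> strict_mono_on {k1..<k} \<sigma>}"

text \<open>The element \<open>[x\<^sub>1, \<dots>, x\<^sub>k]\<close>.\<close>

definition sym_word :: "('a, 'z) gmod_scheme \<Rightarrow> 'a list \<Rightarrow> 'a list \<Rightarrow> nov" where
  "sym_word A w y = (\<Sum>\<tau>\<in>perms (length w). koszul A \<tau> w * kron (permute_list \<tau> w) y)"

text \<open>\<open>l\<^sub>k([x\<^sub>1, \<dots>, x\<^sub>k])\<close>: the restriction of \<open>m\<^sub>k\<close> evaluated on \<open>[x\<^sub>1, \<dots>, x\<^sub>k]\<close>.\<close>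

definition bracket :: "'a ainf \<Rightarrow> 'a list \<Rightarrow> 'a \<Rightarrow> nov" where
  "bracket A w b = (\<Sum>\<tau>\<in>perms (length w). koszul A \<tau> w * mop A (permute_list \<tau> w) b)"

text \<open>
  Symmetrization \<open>v \<otimes> [x\<^sub>1, \<dots>, x\<^sub>k] \<mapsto> \<dots>\<close> of a family, over all orders of the letters and all
  positions of \<open>v\<close>. For \<open>\<phi> = nop M\<close> these are the operations \<open>\<eta>\<^sub>k\<close>.
\<close>

definition symmetrize :: "'a ainf \<Rightarrow> ('v, 'z) gmod_scheme \<Rightarrow> ('a, 'v, 'a, 'u) bi_family \<Rightarrow>
    'v \<Rightarrow> 'a list \<Rightarrow> 'u \<Rightarrow> nov" where
  "symmetrize A M \<phi> v w v' = (\<Sum>\<tau>\<in>perms (length w). \<Sum>i\<le>length w.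
     let y = permute_list \<tau> w in
     koszul A \<tau> w * ksign (sdeg M v * wdeg A (take i y)) * \<phi> (take i y) v (drop i y) v')"

definition ce_wrap :: "'a ainf \<Rightarrow> ('v \<Rightarrow> 'a list \<Rightarrow> 'u \<Rightarrow> nov) \<Rightarrow>
    'v \<times> 'a list \<Rightarrow> 'u \<times> 'a list \<Rightarrow> nov" where
  "ce_wrap A \<eta> = (\<lambda>(v, w) (v', w').
     (\<Sum>k1\<le>length w. \<Sum>\<sigma>\<in>shuffles_at k1 (length w).
        let y = permute_list \<sigma> w in
        koszul A \<sigma> w * \<eta> v (take k1 y) v' * sym_word A (drop k1 y) w'))"

text \<open>\<open>d\<^sup>C\<^sup>E(v \<otimes> [x\<^sub>1, \<dots>, x\<^sub>k])\<close> for \<open>w = x\<^sub>1 \<dots> x\<^sub>k\<close>.\<close>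

definition ce_d :: "'a ainf \<Rightarrow> ('a, 'v, 'a) bimod \<Rightarrow> 'v \<times> 'a list \<Rightarrow> 'v \<times> 'a list \<Rightarrow> nov" where
  "ce_d A M = (\<lambda>(v, w) (v', w').
     ce_wrap A (symmetrize A M (nop M)) (v, w) (v', w') +
     (\<Sum>k1\<le>length w. \<Sum>\<sigma>\<in>shuffles_at k1 (length w).
        let y = permute_list \<sigma> w in
        ksign (sdeg M v) * koszul A \<sigma> w * kron v v' *
        nov_sum (\<lambda>b. bracket A (take k1 y) b * sym_word A (b # drop k1 y) w')))"

text \<open>
  Chains are the elements fixed by the signed symmetric group action on the letters. Such an
  element is \<open>\<Sum> x(v, w) v \<otimes> w = \<Sum> (1/k!) x(v, w) v \<otimes> [w]\<close> with \<open>k\<close> the length of \<open>w\<close>, so a map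
  given by its values \<open>D (v, w)\<close> on the generators \<open>v \<otimes> [w]\<close> acts as follows.
\<close>

definition ce_lin :: "('v \<times> 'a list \<Rightarrow> 'u \<times> 'a list \<Rightarrow> nov) \<Rightarrow>
    ('v \<times> 'a list \<Rightarrow> nov) \<Rightarrow> 'u \<times> 'a list \<Rightarrow> nov" where
  "ce_lin D x = lin D (\<lambda>(v, w). nov_const (1 / fact (length w)) * x (v, w))"

definition ce_chains :: "setting \<Rightarrow> 'a ainf \<Rightarrow> ('v, 'z) gmod_scheme \<Rightarrow> ('v \<times> 'a list \<Rightarrow> nov) set" where
  "ce_chains \<kappa> A M = {x \<in> completed \<kappa> (basis M \<times> lists (basis A)).
     \<forall>v w. \<forall>\<tau>\<in>perms (length w). x (v, permute_list \<tau> w) = koszul A \<tau> w * x (v, w)}"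

definition chevalley_eilenberg :: "setting \<Rightarrow> 'a ainf \<Rightarrow> ('a, 'v, 'a) bimod \<Rightarrow>
    ('v \<times> 'a list) cplx" where
  "chevalley_eilenberg \<kappa> A M =
     \<lparr>chains = ce_chains \<kappa> A M, diff = ce_lin (ce_d A M),
      cdeg = (\<lambda>(v, w). sdeg M v + wdeg A w)\<rparr>"

definition ce_map :: "'a ainf \<Rightarrow> ('a, 'v, 'a) bimod \<Rightarrow> ('a, 'v, 'a, 'u) bi_family \<Rightarrow>
    ('v \<times> 'a list \<Rightarrow> nov) \<Rightarrow> 'u \<times> 'a list \<Rightarrow> nov" where
  "ce_map A M \<phi> = ce_lin (ce_wrap A (symmetrize A M \<phi>))"

end

(*
  A homotopy between bimodule homomorphisms is a lift Phi : N -> Y of both of them through the two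
  evaluations of a model Y of the product with an interval, after pulling everything back to
  bimodules over A along A-infinity homomorphisms. An evaluation e : Y -> N induces an isomorphism
  on the homology of the Hochschild and Chevalley-Eilenberg complexes: e is split by the inclusion
  j, and modulo positive energy and shorter words 1 - j e is null-homotopic. The error is an
  operator that strictly raises a filtration combining energy and word length, so it is removed by a
  Neumann series and the kernel of e is acyclic. As one of the two homotopic homomorphisms
  is the identity, the other one induces an isomorphism too. This applies to psi phi and to
  phi^g psi, where psi is a homotopy inverse over g and phi^g is the pull-back of phi along g, and
  so phi induces an isomorphism as well.

  Hochschild chains embed into the bar construction of the bimodule by cyclic rotation, which turns
  the Hochschild identities into those of the bar differential. Chevalley-Eilenberg chains are the
  image of the symmetrization idempotent on Hochschild chains, and the differential and the maps
  induced by homomorphisms on them are the restrictions of the Hochschild ones.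
*)

theory Submission
  imports Defs "HOL-Library.Multiset"
begin

section \<open>Convergent sums in the Novikov ring\<close>

text \<open>The inclusion of a model is a homomorphism over the inclusions of the model algebras,
  whereas the model bimodule is pulled back along the homotopies \<open>F1\<close>,
  \<open>F0\<close>, which in general do not factor through those inclusions. After the pull-back
  only the linear part \<open>j\<close> of the inclusion is kept, and it is a chain map only up to
  terms that raise the filtration. So there is no strict deformation retraction, and this second
  defect has to be absorbed by the perturbation as well. The evaluations are strict, and their
  pull-backs are again given by one linear map \<open>e\<close>.

  The curvature m_0(1) lengthens words, which works against a filtration by word length. It enters
  the Hochschild differential in the summand \<open>Wb\<close>, where it acts on the word alone;
  there it commutes up to sign with every map f \<otimes> 1 and drops out of the homotopy formulas
  without an estimate. The terms g_0(1) of homomorphisms enter pull-backs, where they change n_{0,0}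
  by positive energy only. The constant \<epsilon> is a common lower bound for the energies by which
  the maps involved differ from their reductions; it comes from gappedness and from the energy of
  g_0(1).\<close>

lemma energy_geD: "x \<in> energy_ge E \<Longrightarrow> coeff x p \<noteq> 0 \<Longrightarrow> E \<le> fst p"
  by (cases p) (auto simp: energy_ge_def)

lemma energy_ge_0 [simp]: "0 \<in> energy_ge E"
  by (simp add: energy_ge_def zero_nov.rep_eq)

lemma energy_ge_mono: "x \<in> energy_ge E \<Longrightarrow> E' \<le> E \<Longrightarrow> x \<in> energy_ge E'"
  by (fastforce simp: energy_ge_def)

lemma energy_ge_add: "x \<in> energy_ge E \<Longrightarrow> y \<in> energy_ge E \<Longrightarrow> x + y \<in> energy_ge E"
  by (auto simp: energy_ge_def plus_nov.rep_eq) (metis add_0)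

lemma energy_ge_uminus [simp]: "- x \<in> energy_ge E \<longleftrightarrow> x \<in> energy_ge E"
  by (simp add: energy_ge_def uminus_nov.rep_eq)

lemma energy_ge_diff: "x \<in> energy_ge E \<Longrightarrow> y \<in> energy_ge E \<Longrightarrow> x - y \<in> energy_ge E"
  using energy_ge_add[of x E "- y"] by simp

lemma energy_ge_sum: "(\<And>i. i \<in> F \<Longrightarrow> f i \<in> energy_ge E) \<Longrightarrow> sum f F \<in> energy_ge E"
  by (induction F rule: infinite_finite_induct) (auto intro: energy_ge_add)

lemma energy_ge_lowb: "x \<in> energy_ge E \<longleftrightarrow> nov_lowb E (coeff x)"
  by (simp add: energy_ge_def nov_lowb_def)

lemma energy_ge_mult: "x \<in> energy_ge E \<Longrightarrow> y \<in> energy_ge E' \<Longrightarrow> x * y \<in> energy_ge (E + E')"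
  by (simp add: energy_ge_lowb times_nov.rep_eq nov_conv_lowb)

lemma energy_ge_mult': "x \<in> energy_ge E \<Longrightarrow> y \<in> energy_ge E' \<Longrightarrow> K \<le> E + E' \<Longrightarrow> x * y \<in> energy_ge K"
  using energy_ge_mult energy_ge_mono by blast

lemma energy_ge_ex: "\<exists>c. x \<in> energy_ge c"
  using nov_lowb_ex[OF nov_fin_coeff] by (simp add: energy_ge_lowb)

lemma energy_ge_1 [simp]: "1 \<in> energy_ge 0"
  by (auto simp: energy_ge_def one_nov.rep_eq zero_prod_def)

lemma energy_ge_ksign [simp]: "ksign k \<in> energy_ge 0"
  by (simp add: ksign_def)

lemma energy_ge_const [simp]: "nov_const r \<in> energy_ge 0"
  by (auto simp: energy_ge_def nov_const.rep_eq zero_prod_def split: if_splits)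

lemma energy_ge_kron [simp]: "kron i j \<in> energy_ge 0"
  by (simp add: kron_def)

lemma energy_ge_all_0: "(\<And>E. x \<in> energy_ge E) \<Longrightarrow> x = 0"
proof (rule nov_eqI)
  fix p :: "real \<times> int" assume "\<And>E. x \<in> energy_ge E"
  then have "x \<in> energy_ge (fst p + 1)" .
  from energy_geD[OF this, of p] have "coeff x p = 0" by linarith
  then show "coeff x p = coeff 0 p" by (simp add: zero_nov.rep_eq)
qed

text \<open>The energy filtration is separated, so an identity between infinite sums may be checked
  modulo energy E for every E, where the sums can be truncated.\<close>

lemma nov_eq_approx: "(\<And>E. x - y \<in> energy_ge E) \<Longrightarrow> x = y"
  using energy_ge_all_0[of "x - y"] by simp

section \<open>Signs and real constants in the Novikov ring\<close>

lemma ksign_add: "ksign (a + b) = ksign a * ksign b"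
  by (simp add: ksign_def)

lemma ksign_0 [simp]: "ksign 0 = 1"
  by (simp add: ksign_def)

lemma ksign_cong: "even (a - b) \<Longrightarrow> ksign a = ksign b"
  by (auto simp: ksign_def)

lemma ksign_sq [simp]: "ksign a * ksign a = 1"
  by (simp add: ksign_def)

lemma kron_same [simp]: "kron i i = 1"
  by (simp add: kron_def)

lemma nov_const_0 [simp]: "nov_const 0 = 0"
  by (rule nov_eqI) (simp add: nov_const.rep_eq zero_nov.rep_eq)

lemma nov_const_1 [simp]: "nov_const 1 = 1"
  by (rule nov_eqI) (simp add: nov_const.rep_eq one_nov.rep_eq)

lemma nov_const_add: "nov_const (a + b) = nov_const a + nov_const b"
  by (rule nov_eqI) (simp add: nov_const.rep_eq plus_nov.rep_eq)

lemma nov_const_minus: "nov_const (- a) = - nov_const a"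
  by (rule nov_eqI) (simp add: nov_const.rep_eq uminus_nov.rep_eq)

lemma nov_const_mult: "nov_const (a * b) = nov_const a * nov_const b"
proof (rule nov_eqI)
  fix p
  have "coeff (nov_const a * nov_const b) p =
    (\<Sum>q\<in>{q. fst q \<le> fst p \<and> coeff (nov_const a) q \<noteq> 0}. coeff (nov_const a) q * coeff (nov_const b) (p - q))"
    unfolding times_nov.rep_eq
    by (rule nov_conv_sum[OF nov_fin_coeff, where c = 0])
      (auto simp: nov_lowb_def nov_const.rep_eq zero_prod_def split: if_splits)
  also have "\<dots> = (\<Sum>q\<in>{q. q = 0 \<and> fst q \<le> fst p}. coeff (nov_const a) q * coeff (nov_const b) (p - q))"
    by (rule sum.mono_neutral_cong_left) (auto simp: nov_const.rep_eq split: if_splits)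
  also have "\<dots> = coeff (nov_const (a * b)) p"
  proof (cases "0 \<le> fst p")
    case True
    then have "{q. q = 0 \<and> fst q \<le> fst p} = {0}" by auto
    then show ?thesis by (subst \<open>_ = {0}\<close>) (simp add: nov_const.rep_eq)
  next
    case False
    then have "{q. q = 0 \<and> fst q \<le> fst p} = {}" "p \<noteq> 0" by auto
    then show ?thesis by (simp add: nov_const.rep_eq)
  qed
  finally show "coeff (nov_const (a * b)) p = coeff (nov_const a * nov_const b) p" by simp
qed

lemma nov_const_sum: "nov_const (sum f F) = (\<Sum>i\<in>F. nov_const (f i))"
  by (induction F rule: infinite_finite_induct) (auto simp: nov_const_add)

lemma nov_const_of_nat: "nov_const (of_nat n) = of_nat n"
  by (induction n) (simp_all add: nov_const_add)

lemma nov_const_inverse_of_nat: "n \<noteq> 0 \<Longrightarrow> nov_const (1 / of_nat n) * of_nat n = 1"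
  by (simp add: nov_const_of_nat[symmetric] nov_const_mult[symmetric])

text \<open>Summability in the T-adic topology. The same condition cuts out the elements of an
  energy completion, so that summable families and vectors of coefficients coincide.\<close>

definition cvg :: "('i \<Rightarrow> nov) \<Rightarrow> bool" where
  "cvg x \<longleftrightarrow> (\<forall>E. finite {i. x i \<notin> energy_ge E})"

lemma cvgD: "cvg x \<Longrightarrow> finite {i. x i \<notin> energy_ge E}"
  by (simp add: cvg_def)

lemma cvg_mono:
  assumes "cvg x" "\<And>i E. x i \<in> energy_ge E \<Longrightarrow> y i \<in> energy_ge (E + c)"
  shows "cvg y"
  unfolding cvg_def
proof
  fix E
  have "y i \<notin> energy_ge E \<Longrightarrow> x i \<notin> energy_ge (E - c)" for i
    using assms(2)[of i "E - c"] by auto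
  then have "{i. y i \<notin> energy_ge E} \<subseteq> {i. x i \<notin> energy_ge (E - c)}" by auto
  then show "finite {i. y i \<notin> energy_ge E}" using cvgD[OF assms(1)] finite_subset by blast
qed

lemma cvg_add: "cvg x \<Longrightarrow> cvg y \<Longrightarrow> cvg (\<lambda>i. x i + y i)"
  unfolding cvg_def
proof
  fix E assume *: "\<forall>E. finite {i. x i \<notin> energy_ge E}" "\<forall>E. finite {i. y i \<notin> energy_ge E}"
  have "{i. x i + y i \<notin> energy_ge E} \<subseteq> {i. x i \<notin> energy_ge E} \<union> {i. y i \<notin> energy_ge E}"
    using energy_ge_add by auto
  then show "finite {i. x i + y i \<notin> energy_ge E}" using * finite_subset by blast
qed

lemma cvg_uminus: "cvg x \<Longrightarrow> cvg (\<lambda>i. - x i)"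
  by (simp add: cvg_def)

lemma cvg_mult: "cvg x \<Longrightarrow> (\<And>i. a i \<in> energy_ge c) \<Longrightarrow> cvg (\<lambda>i. a i * x i)"
  by (rule cvg_mono[where c = c]) (auto intro!: energy_ge_mult'[of _ c])

lemma cvg_multc: "cvg x \<Longrightarrow> cvg (\<lambda>i. a * x i)"
  using energy_ge_ex[of a] cvg_mult[of x "\<lambda>_. a"] by blast

lemma cvg_finite: "finite {i. x i \<noteq> 0} \<Longrightarrow> cvg x"
  unfolding cvg_def by (auto elim!: finite_subset[rotated])

text \<open>Only finitely many members leave \<open>energy_ge 0\<close>, and each of them has its
  own lower bound.\<close>

lemma cvg_bound:
  assumes "cvg x" obtains c where "\<And>i. x i \<in> energy_ge c"
proof -
  let ?F = "{i. x i \<notin> energy_ge 0}"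
  have fin: "finite ?F" using cvgD[OF assms] .
  have "\<forall>i. \<exists>c. x i \<in> energy_ge c" using energy_ge_ex by blast
  then obtain b where b: "\<And>i. x i \<in> energy_ge (b i)" by metis
  have "x i \<in> energy_ge (Min (insert 0 (b ` ?F)))" for i
  proof (cases "i \<in> ?F")
    case True
    then have "Min (insert 0 (b ` ?F)) \<le> b i" using fin by (intro Min_le) auto
    then show ?thesis using b energy_ge_mono by blast
  next
    case False
    moreover have "Min (insert 0 (b ` ?F)) \<le> 0" using fin by (intro Min_le) auto
    ultimately show ?thesis using energy_ge_mono by blast
  qed
  then show ?thesis using that by blast
qed

lemma cvg_coeff_finite: "cvg f \<Longrightarrow> finite {i. coeff (f i) p \<noteq> 0}"
  by (rule finite_subset[OF _ cvgD[of f "fst p + 1"]]) (auto dest!: energy_geD)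

text \<open>\<open>nov_sum\<close> is a value of \<open>Abs_nov\<close>, which is controlled on
  locally finite functions only. Up to an energy E only the finitely many members outside
  \<open>energy_ge (E + 1)\<close> contribute, each with finitely many exponents.\<close>

lemma coeff_nov_sum:
  assumes "cvg f" shows "coeff (nov_sum f) p = Sum_any (\<lambda>i. coeff (f i) p)"
proof -
  have "finite {p. fst p \<le> E \<and> Sum_any (\<lambda>i. coeff (f i) p) \<noteq> 0}" for E
  proof (rule finite_subset)
    show "{p. fst p \<le> E \<and> Sum_any (\<lambda>i. coeff (f i) p) \<noteq> 0}
      \<subseteq> (\<Union>i\<in>{i. f i \<notin> energy_ge (E + 1)}. {p. fst p \<le> E \<and> coeff (f i) p \<noteq> 0})"
    proof
      fix p assume p: "p \<in> {p. fst p \<le> E \<and> Sum_any (\<lambda>i. coeff (f i) p) \<noteq> 0}"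
      then obtain i where i: "coeff (f i) p \<noteq> 0"
        using Sum_any.not_neutral_obtains_not_neutral by blast
      with p have "f i \<notin> energy_ge (E + 1)" by (auto dest: energy_geD)
      with p i show "p \<in> (\<Union>i\<in>{i. f i \<notin> energy_ge (E + 1)}. {p. fst p \<le> E \<and> coeff (f i) p \<noteq> 0})"
        by blast
    qed
    show "finite (\<Union>i\<in>{i. f i \<notin> energy_ge (E + 1)}. {p. fst p \<le> E \<and> coeff (f i) p \<noteq> 0})"
      using cvgD[OF assms] coeff by auto
  qed
  then show ?thesis unfolding nov_sum_def by (subst Abs_nov_inverse) auto
qed

lemma coeff_sum: "coeff (sum f F) p = (\<Sum>i\<in>F. coeff (f i) p)"
  by (induction F rule: infinite_finite_induct) (auto simp: zero_nov.rep_eq plus_nov.rep_eq)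

lemma coeff_diff: "coeff (x - y) p = coeff x p - coeff y p"
  by (simp only: minus_nov_def plus_nov.rep_eq uminus_nov.rep_eq diff_conv_add_uminus)

lemma nov_sum_approx:
  assumes "cvg f" "finite F" "\<And>i. i \<notin> F \<Longrightarrow> f i \<in> energy_ge E"
  shows "nov_sum f - sum f F \<in> energy_ge E"
  unfolding energy_ge_def
proof (intro CollectI allI impI, rule ccontr)
  fix p assume p: "coeff (nov_sum f - sum f F) p \<noteq> 0" "\<not> E \<le> fst p"
  have "{i. coeff (f i) p \<noteq> 0} \<subseteq> F" using assms(3) p(2) by (auto dest: energy_geD)
  then have "Sum_any (\<lambda>i. coeff (f i) p) = (\<Sum>i\<in>F. coeff (f i) p)"
    by (intro Sum_any.expand_superset) (use assms(2) in auto)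
  then show False using p(1) by (simp add: coeff_diff coeff_nov_sum[OF assms(1)] coeff_sum)
qed

lemma nov_sum_finite: "finite F \<Longrightarrow> (\<And>i. i \<notin> F \<Longrightarrow> f i = 0) \<Longrightarrow> nov_sum f = sum f F"
  by (rule nov_eq_approx, rule nov_sum_approx, rule cvg_finite)
    (auto elim!: finite_subset[rotated])

lemma nov_sum_single: "(\<And>i. i \<noteq> k \<Longrightarrow> f i = 0) \<Longrightarrow> nov_sum f = f k"
  using nov_sum_finite[of "{k}" f] by auto

lemma nov_sum_0 [simp]: "nov_sum (\<lambda>_. 0) = 0"
  using nov_sum_finite[of "{}" "\<lambda>_. 0"] by simp

lemma nov_sum_ge:
  assumes "cvg f" "\<And>i. f i \<in> energy_ge E" shows "nov_sum f \<in> energy_ge E"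
  using nov_sum_approx[OF assms(1), of "{}" E] assms(2) by simp

lemma nov_sum_add:
  assumes "cvg f" "cvg g" shows "nov_sum (\<lambda>i. f i + g i) = nov_sum f + nov_sum g"
proof (rule nov_eqI)
  fix p
  show "coeff (nov_sum (\<lambda>i. f i + g i)) p = coeff (nov_sum f + nov_sum g) p"
    by (simp add: coeff_nov_sum assms cvg_add plus_nov.rep_eq Sum_any.distrib cvg_coeff_finite)
qed

lemma nov_sum_mult:
  assumes "cvg f" shows "nov_sum (\<lambda>i. a * f i) = a * nov_sum f"
proof (rule nov_eq_approx)
  fix E
  obtain c where c: "a \<in> energy_ge c" using energy_ge_ex by blast
  define F where "F = {i. f i \<notin> energy_ge (E - c)}"
  have F: "finite F" unfolding F_def using cvgD[OF assms] .
  have "nov_sum f - sum f F \<in> energy_ge (E - c)"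
    by (rule nov_sum_approx) (auto simp: F assms, simp add: F_def)
  then have 1: "a * (nov_sum f - sum f F) \<in> energy_ge E" using c energy_ge_mult' by fastforce
  have 2: "nov_sum (\<lambda>i. a * f i) - (\<Sum>i\<in>F. a * f i) \<in> energy_ge E"
    by (rule nov_sum_approx) (auto simp: F cvg_multc assms, auto simp: F_def intro: energy_ge_mult'[OF c])
  from energy_ge_diff[OF 2 1] show "nov_sum (\<lambda>i. a * f i) - a * nov_sum f \<in> energy_ge E"
    by (simp add: algebra_simps sum_distrib_left)
qed

text \<open>Summability is assumed over the pairs. At one exponent the iterated sum then runs over a
  finite rectangle of indices.\<close>

lemma nov_sum_Fubini:
  assumes "cvg f" shows "nov_sum (\<lambda>i. nov_sum (\<lambda>j. f (i, j))) = nov_sum f"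
proof (rule nov_eqI)
  fix p
  have row: "cvg (\<lambda>j. f (i, j))" for i
    unfolding cvg_def
  proof
    fix E
    have "{j. f (i, j) \<notin> energy_ge E} \<subseteq> snd ` {q. f q \<notin> energy_ge E}" by force
    then show "finite {j. f (i, j) \<notin> energy_ge E}" using cvgD[OF assms] finite_surj by blast
  qed
  have col: "cvg (\<lambda>i. nov_sum (\<lambda>j. f (i, j)))"
    unfolding cvg_def
  proof
    fix E
    have "{i. nov_sum (\<lambda>j. f (i, j)) \<notin> energy_ge E} \<subseteq> fst ` {q. f q \<notin> energy_ge E}"
      using nov_sum_ge[OF row] by force
    then show "finite {i. nov_sum (\<lambda>j. f (i, j)) \<notin> energy_ge E}"
      using cvgD[OF assms] finite_surj by blast
  qed
  let ?Q = "{q. coeff (f q) p \<noteq> 0}"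
  have "Sum_any (\<lambda>i. Sum_any (\<lambda>j. coeff (f (i, j)) p)) = Sum_any (\<lambda>(i, j). coeff (f (i, j)) p)"
  proof (rule Sum_any.cartesian_product[of "fst ` ?Q \<times> snd ` ?Q"])
    show "finite (fst ` ?Q \<times> snd ` ?Q)" using cvg_coeff_finite[OF assms] by blast
    show "{a. \<exists>b. coeff (f (a, b)) p \<noteq> 0} \<times> {b. \<exists>a. coeff (f (a, b)) p \<noteq> 0} \<subseteq> fst ` ?Q \<times> snd ` ?Q"
      by force
  qed
  moreover have "(\<lambda>(i, j). coeff (f (i, j)) p) = (\<lambda>q. coeff (f q) p)" by auto
  ultimately have "Sum_any (\<lambda>i. Sum_any (\<lambda>j. coeff (f (i, j)) p)) = Sum_any (\<lambda>q. coeff (f q) p)"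
    by (rule subst[rotated])
  then show "coeff (nov_sum (\<lambda>i. nov_sum (\<lambda>j. f (i, j)))) p = coeff (nov_sum f) p"
    by (simp only: coeff_nov_sum[OF assms] coeff_nov_sum[OF col] coeff_nov_sum[OF row])
qed

lemma nov_sum_reindex:
  assumes "bij h" shows "nov_sum (\<lambda>i. f (h i)) = nov_sum f"
proof -
  have *: "Sum_any (\<lambda>i. coeff (f (h i)) p) = Sum_any (\<lambda>i. coeff (f i) p)" for p
    using Sum_any.reindex_cong[OF assms, of "\<lambda>i. coeff (f i) p" "\<lambda>i. coeff (f (h i)) p"]
    by (simp add: o_def)
  show ?thesis unfolding nov_sum_def by (simp only: *)
qed

text \<open>The second hypothesis is uniform in j: almost every row lies in
  \<open>energy_ge E\<close> as a whole. It holds for products x_i D_ij as soon as the rows of D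
  share an energy bound.\<close>

lemma cvg_pairI:
  assumes "\<And>i. cvg (\<lambda>j. f (i, j))" "\<And>E. finite {i. \<exists>j. f (i, j) \<notin> energy_ge E}"
  shows "cvg f"
  unfolding cvg_def
proof
  fix E
  have "{q. f q \<notin> energy_ge E} \<subseteq> Sigma {i. \<exists>j. f (i, j) \<notin> energy_ge E} (\<lambda>i. {j. f (i, j) \<notin> energy_ge E})"
  proof
    fix q assume "q \<in> {q. f q \<notin> energy_ge E}"
    then show "q \<in> Sigma {i. \<exists>j. f (i, j) \<notin> energy_ge E} (\<lambda>i. {j. f (i, j) \<notin> energy_ge E})"
      by (cases q) blast
  qed
  moreover have "finite \<dots>" using assms(2) cvgD[OF assms(1)] by (rule finite_SigmaI)
  ultimately show "finite {q. f q \<notin> energy_ge E}" by (rule finite_subset)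
qed

section \<open>Convergent vectors and bounded linear maps\<close>

text \<open>The basis and the sign of the energies are left out of the type. Supports
  (\<open>supv\<close>) and non-negativity (\<open>vge 0\<close>) are separate predicates, so the
  filtered and the weakly filtered setting share one calculus with total maps.\<close>

typedef 'i vec = "{x :: 'i \<Rightarrow> nov. cvg x}" morphisms vnth Vec
  by (rule exI[of _ "\<lambda>_. 0"]) (simp add: cvg_def)

notation vnth (infixl "$" 95)

lemma cvg_vnth [simp]: "cvg (vnth x)"
  using vnth[of x] by simp

lemma vec_eqI: "(\<And>i. x $ i = y $ i) \<Longrightarrow> x = y"
  by (simp add: vnth_inject[symmetric] fun_eq_iff)

instantiation vec :: (type) ab_group_add
begin
definition zero_vec :: "'a vec" where "zero_vec = Vec (\<lambda>_. 0)"
definition plus_vec :: "'a vec \<Rightarrow> 'a vec \<Rightarrow> 'a vec" where "plus_vec x y = Vec (\<lambda>i. x $ i + y $ i)"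
definition uminus_vec :: "'a vec \<Rightarrow> 'a vec" where "uminus_vec x = Vec (\<lambda>i. - (x $ i))"
definition minus_vec :: "'a vec \<Rightarrow> 'a vec \<Rightarrow> 'a vec" where "minus_vec x y = x + - y"

lemma vec_rep_eq:
  "vnth 0 = (\<lambda>_. 0)" "vnth (x + y) = (\<lambda>i. x $ i + y $ i)" "vnth (- x) = (\<lambda>i. - (x $ i))"
  by (simp_all add: zero_vec_def plus_vec_def uminus_vec_def Vec_inverse cvg_add cvg_uminus cvg_finite)

instance
  by standard (auto intro!: vec_eqI simp: vec_rep_eq minus_vec_def)
end

definition vscale :: "nov \<Rightarrow> 'a vec \<Rightarrow> 'a vec" (infixr "*v" 75) where
  "a *v x = Vec (\<lambda>i. a * x $ i)"

definition unitv :: "'a \<Rightarrow> 'a vec" where "unitv i = Vec (kron i)"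

lemma cvg_kron: "cvg (kron i)" by (rule cvg_finite) (auto simp: kron_def)

lemma vnth_0 [simp]: "0 $ i = 0" by (simp add: vec_rep_eq)
lemma vnth_add [simp]: "(x + y) $ i = x $ i + y $ i" by (simp add: vec_rep_eq)
lemma vnth_uminus [simp]: "(- x) $ i = - (x $ i)" by (simp add: vec_rep_eq)
lemma vnth_diff [simp]: "(x - y) $ i = x $ i - y $ i"
  by (simp only: minus_vec_def vec_rep_eq) simp
lemma vnth_scale [simp]: "(a *v x) $ i = a * x $ i" by (simp add: vscale_def Vec_inverse cvg_multc)
lemma vnth_unitv: "unitv i $ j = kron i j" by (simp add: unitv_def Vec_inverse cvg_kron)

lemma vnth_sum: "sum f F $ i = (\<Sum>k\<in>F. f k $ i)"
  by (induction F rule: infinite_finite_induct) auto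

lemma vscale_simps [simp]:
  "0 *v x = 0" "1 *v x = x" "a *v 0 = 0" "a *v b *v x = (a * b) *v x" "(- a) *v x = - (a *v x)"
  "a *v (- x) = - (a *v x)"
  by (auto intro!: vec_eqI simp: mult.assoc)

lemma vscale_add: "a *v (x + y) = a *v x + a *v y" "(a + b) *v x = a *v x + b *v x"
  by (auto intro!: vec_eqI simp: algebra_simps)

definition vge :: "real \<Rightarrow> 'i vec \<Rightarrow> bool" where
  "vge c x \<longleftrightarrow> (\<forall>i. x $ i \<in> energy_ge c)"

lemma vge_0 [simp]: "vge c 0" by (simp add: vge_def)
lemma vge_add: "vge c x \<Longrightarrow> vge c y \<Longrightarrow> vge c (x + y)" by (simp add: vge_def energy_ge_add)
lemma vge_uminus [simp]: "vge c (- x) \<longleftrightarrow> vge c x" by (simp add: vge_def)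
lemma vge_diff: "vge c x \<Longrightarrow> vge c y \<Longrightarrow> vge c (x - y)" by (simp add: vge_def energy_ge_diff)
lemma vge_mono: "vge c x \<Longrightarrow> c' \<le> c \<Longrightarrow> vge c' x" by (auto simp: vge_def intro: energy_ge_mono)
lemma vge_scale: "vge c x \<Longrightarrow> a \<in> energy_ge 0 \<Longrightarrow> vge c (a *v x)"
  by (auto simp: vge_def intro: energy_ge_mult')
lemma vge_unitv [simp]: "vge 0 (unitv i)" by (simp add: vge_def vnth_unitv)
lemma vge_sum: "(\<And>k. k \<in> F \<Longrightarrow> vge c (f k)) \<Longrightarrow> vge c (sum f F)"
  by (auto simp: vge_def vnth_sum intro: energy_ge_sum)
lemma vge_ex: "\<exists>c. vge c x"
  using cvg_bound[OF cvg_vnth[of x]] by (auto simp: vge_def)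
lemma vge_all_0: "(\<And>E. vge E x) \<Longrightarrow> x = 0"
  by (rule vec_eqI, simp, rule energy_ge_all_0) (simp add: vge_def)

text \<open>The energy loss must be uniform over the basis for the image of a summable vector to be
  summable. Structure maps have bound 0, weakly filtered homomorphisms a possibly negative
  one.\<close>

definition bdd :: "('i \<Rightarrow> 'j vec) \<Rightarrow> bool" where
  "bdd D \<longleftrightarrow> (\<exists>c. \<forall>i. vge c (D i))"

lemma bddI: "(\<And>i. vge c (D i)) \<Longrightarrow> bdd D" by (auto simp: bdd_def)

lemma bdd_const [simp]: "bdd (\<lambda>_. x)" using vge_ex by (auto simp: bdd_def)
lemma bdd_unitv [simp]: "bdd (\<lambda>i. unitv (f i))" by (rule bddI[of 0]) simp
lemma bdd_unitv' [simp]: "bdd unitv" by (rule bddI[of 0]) simp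
lemma bdd_comp: "bdd D \<Longrightarrow> bdd (\<lambda>i. D (f i))" by (auto simp: bdd_def)
lemma bdd_scale: "bdd D \<Longrightarrow> (\<And>i. a i \<in> energy_ge 0) \<Longrightarrow> bdd (\<lambda>i. a i *v D i)"
  by (auto simp: bdd_def intro: vge_scale)
lemma bdd_scalec: "bdd D \<Longrightarrow> bdd (\<lambda>i. a *v D i)"
proof -
  assume "bdd D"
  then obtain c where c: "\<And>i. vge c (D i)" by (auto simp: bdd_def)
  obtain d where "a \<in> energy_ge d" using energy_ge_ex by blast
  then have "vge (d + c) (a *v D i)" for i using c by (auto simp: vge_def intro: energy_ge_mult)
  then show ?thesis by (rule bddI)
qed
lemma bdd_add: "bdd D \<Longrightarrow> bdd D' \<Longrightarrow> bdd (\<lambda>i. D i + D' i)"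
proof -
  assume "bdd D" "bdd D'"
  then obtain c c' where "\<And>i. vge c (D i)" "\<And>i. vge c' (D' i)" by (auto simp: bdd_def)
  then have "vge (min c c') (D i + D' i)" for i
    by (intro vge_add) (meson vge_mono min.cobounded1 min.cobounded2)+
  then show ?thesis by (rule bddI)
qed
lemma bdd_uminus: "bdd D \<Longrightarrow> bdd (\<lambda>i. - D i)" by (simp add: bdd_def)
lemma bdd_diff: "bdd D \<Longrightarrow> bdd D' \<Longrightarrow> bdd (\<lambda>i. D i - D' i)"
  using bdd_add[of D "\<lambda>i. - D' i"] bdd_uminus[of D'] by simp
lemma bdd_if: "bdd D \<Longrightarrow> bdd D' \<Longrightarrow> bdd (\<lambda>i. if P i then D i else D' i)"
proof -
  assume "bdd D" "bdd D'"
  then obtain c c' where "\<And>i. vge c (D i)" "\<And>i. vge c' (D' i)" by (auto simp: bdd_def)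
  then have "vge (min c c') (if P i then D i else D' i)" for i
    by (cases "P i") (simp_all, (meson vge_mono min.cobounded1 min.cobounded2)+)
  then show ?thesis by (rule bddI)
qed

definition app :: "('i \<Rightarrow> 'j vec) \<Rightarrow> 'i vec \<Rightarrow> 'j vec" where
  "app D x = Vec (lin (\<lambda>i j. D i $ j) (vnth x))"

lemma vge_cvg_pair:
  assumes "\<And>i. vge c (D i)"
  shows "cvg (\<lambda>(i, j). x $ i * D i $ j)"
proof (rule cvg_pairI)
  show "cvg (\<lambda>j. case (i, j) of (i, j) \<Rightarrow> x $ i * D i $ j)" for i by (simp add: cvg_multc)
  fix E
  have "{i. \<exists>j. (case (i, j) of (i, j) \<Rightarrow> x $ i * D i $ j) \<notin> energy_ge E} \<subseteq> {i. x $ i \<notin> energy_ge (E - c)}"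
    using assms by (auto simp: vge_def intro!: energy_ge_mult'[of _ "E - c" _ c])
  then show "finite {i. \<exists>j. (case (i, j) of (i, j) \<Rightarrow> x $ i * D i $ j) \<notin> energy_ge E}"
    using cvgD[OF cvg_vnth] finite_subset by blast
qed

lemma cvg_app1: "bdd D \<Longrightarrow> cvg (\<lambda>i. x $ i * D i $ j)"
  by (auto simp: bdd_def vge_def mult.commute[of "x $ _"] intro!: cvg_mult)

lemma cvg_lin:
  assumes "bdd D" shows "cvg (lin (\<lambda>i j. D i $ j) (vnth x))"
  unfolding cvg_def
proof
  fix E
  from assms obtain c where c: "\<And>i. vge c (D i)" by (auto simp: bdd_def)
  have "{j. lin (\<lambda>i j. D i $ j) (vnth x) j \<notin> energy_ge E} \<subseteq>
    snd ` {q. (case q of (i, j) \<Rightarrow> x $ i * D i $ j) \<notin> energy_ge E}" (is "_ \<subseteq> ?R")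
  proof
    fix j assume "j \<in> {j. lin (\<lambda>i j. D i $ j) (vnth x) j \<notin> energy_ge E}"
    then have "\<not> (\<forall>i. x $ i * D i $ j \<in> energy_ge E)"
      using nov_sum_ge[OF cvg_app1[OF assms], of x j E] by (auto simp: lin_def)
    then obtain i where "x $ i * D i $ j \<notin> energy_ge E" by blast
    then have "(i, j) \<in> {q. (case q of (i, j) \<Rightarrow> x $ i * D i $ j) \<notin> energy_ge E}" by simp
    then show "j \<in> ?R" by (rule image_eqI[rotated]) (simp only: snd_conv)
  qed
  then show "finite {j. lin (\<lambda>i j. D i $ j) (vnth x) j \<notin> energy_ge E}"
    by (rule finite_surj[OF cvgD[OF vge_cvg_pair[OF c]]])
qed

lemma vnth_app: "bdd D \<Longrightarrow> app D x $ j = nov_sum (\<lambda>i. x $ i * D i $ j)"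
  unfolding app_def by (subst Vec_inverse) (simp_all add: cvg_lin, simp add: lin_def)

lemma vge_app: "vge c x \<Longrightarrow> (\<And>i. vge c' (D i)) \<Longrightarrow> vge (c + c') (app D x)"
proof -
  assume *: "vge c x" "\<And>i. vge c' (D i)"
  then have b: "bdd D" by (auto intro: bddI)
  have "x $ i * D i $ j \<in> energy_ge (c + c')" for i j
    using * energy_ge_mult by (simp add: vge_def)
  then have "nov_sum (\<lambda>i. x $ i * D i $ j) \<in> energy_ge (c + c')" for j
    by (rule nov_sum_ge[OF cvg_app1[OF b]])
  then show ?thesis by (simp add: vge_def vnth_app[OF b])
qed

lemma vge_app': "vge c x \<Longrightarrow> (\<And>i. vge c' (D i)) \<Longrightarrow> K \<le> c + c' \<Longrightarrow> vge K (app D x)"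
  using vge_app vge_mono by blast

lemma app_cong_nz: "(\<And>i. x $ i \<noteq> 0 \<Longrightarrow> D i = D' i) \<Longrightarrow> app D x = app D' x"
  unfolding app_def lin_def
  by (rule arg_cong[of _ _ Vec], rule ext, rule arg_cong[of _ _ nov_sum], rule ext) (metis mult_zero_left)

lemma app_add: "bdd D \<Longrightarrow> app D (x + y) = app D x + app D y"
  by (rule vec_eqI) (simp add: vnth_app ring_distribs nov_sum_add cvg_app1)

lemma app_scale: "bdd D \<Longrightarrow> app D (a *v x) = a *v app D x"
  by (rule vec_eqI) (simp add: vnth_app mult.assoc nov_sum_mult cvg_app1)

lemma app_uminus: "bdd D \<Longrightarrow> app D (- x) = - app D x"
  using app_scale[of D "- 1" x] by simp

lemma app_diff: "bdd D \<Longrightarrow> app D (x - y) = app D x - app D y"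
  using app_add[of D x "- y"] by (simp add: app_uminus)

lemma app_0 [simp]: "app D 0 = 0"
  by (simp add: app_def lin_def zero_vec_def[symmetric])

lemma app_sum: "bdd D \<Longrightarrow> app D (sum f F) = (\<Sum>k\<in>F. app D (f k))"
  by (induction F rule: infinite_finite_induct) (auto simp: app_add)

lemma app_unitv [simp]:
  "bdd D \<Longrightarrow> app D (unitv i) = D i"
  by (rule vec_eqI) (simp add: vnth_app vnth_unitv, subst nov_sum_single[of i], auto simp: kron_def)

lemma app_unitv_row: "app unitv x = x"
  by (rule vec_eqI) (simp add: vnth_app vnth_unitv, subst nov_sum_single, auto simp: kron_def)

lemma app_row_add: "bdd D \<Longrightarrow> bdd D' \<Longrightarrow> app (\<lambda>i. D i + D' i) x = app D x + app D' x"
  by (rule vec_eqI) (simp add: vnth_app bdd_add ring_distribs nov_sum_add cvg_app1)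

lemma app_row_0 [simp]: "app (\<lambda>_. 0) x = 0"
  by (rule vec_eqI) (simp add: vnth_app)

lemma app_row_scale: "bdd D \<Longrightarrow> app (\<lambda>i. a *v D i) x = a *v app D x"
proof (rule vec_eqI)
  fix j assume b: "bdd D"
  have "nov_sum (\<lambda>i. x $ i * (a * D i $ j)) = nov_sum (\<lambda>i. a * (x $ i * D i $ j))"
    by (simp add: mult.left_commute)
  then show "app (\<lambda>i. a *v D i) x $ j = (a *v app D x) $ j"
    using b by (simp add: vnth_app bdd_scalec nov_sum_mult cvg_app1)
qed

lemma app_row_uminus: "bdd D \<Longrightarrow> app (\<lambda>i. - D i) x = - app D x"
  using app_row_scale[of D "- 1" x] by simp

lemma app_row_diff: "bdd D \<Longrightarrow> bdd D' \<Longrightarrow> app (\<lambda>i. D i - D' i) x = app D x - app D' x"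
  using app_row_add[of D "\<lambda>i. - D' i" x] by (simp add: app_row_uminus bdd_uminus)

lemma bdd_app: "bdd D \<Longrightarrow> bdd D' \<Longrightarrow> bdd (\<lambda>i. app D' (D i))"
  unfolding bdd_def using vge_app by blast

text \<open>Composition of matrices is Fubini for the triple products x_i D_ij D'_jk; the uniform
  bounds make them summable over the pairs (i, j) for each k.\<close>

lemma app_app:
  assumes "bdd D" "bdd D'" shows "app D' (app D x) = app (\<lambda>i. app D' (D i)) x"
proof (rule vec_eqI)
  fix k
  from assms obtain c c' where c: "\<And>i. vge c (D i)" and c': "\<And>i. vge c' (D' i)" by (auto simp: bdd_def)
  define f where "f = (\<lambda>(i, j). x $ i * D i $ j * D' j $ k)"
  have f: "cvg f"
    using cvg_mult[OF vge_cvg_pair[OF c, of x], of "\<lambda>(i, j). D' j $ k" c'] c'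
    by (simp add: f_def vge_def case_prod_unfold mult.commute)
  have f': "cvg (\<lambda>(j, i). f (i, j))"
    unfolding cvg_def
  proof
    fix E
    have "{q. (case q of (j, i) \<Rightarrow> f (i, j)) \<notin> energy_ge E} = prod.swap ` {q. f q \<notin> energy_ge E}" by force
    then show "finite {q. (case q of (j, i) \<Rightarrow> f (i, j)) \<notin> energy_ge E}" using cvgD[OF f] by simp
  qed
  have "app D' (app D x) $ k = nov_sum (\<lambda>j. nov_sum (\<lambda>i. D' j $ k * (x $ i * D i $ j)))"
    by (simp add: vnth_app assms nov_sum_mult cvg_app1 mult.commute)
  also have "\<dots> = nov_sum (\<lambda>j. nov_sum (\<lambda>i. (\<lambda>(j, i). f (i, j)) (j, i)))"
    by (simp add: f_def mult_ac)
  also have "\<dots> = nov_sum (\<lambda>(j, i). f (i, j))" using f' by (rule nov_sum_Fubini)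
  also have "\<dots> = nov_sum f"
  proof -
    have "nov_sum (\<lambda>q. f (prod.swap q)) = nov_sum f" by (rule nov_sum_reindex) simp
    then show ?thesis by (simp add: case_prod_unfold prod.swap_def)
  qed
  also have "\<dots> = nov_sum (\<lambda>i. nov_sum (\<lambda>j. f (i, j)))" using f by (rule nov_sum_Fubini[symmetric])
  also have "\<dots> = app (\<lambda>i. app D' (D i)) x $ k"
    by (simp add: vnth_app assms bdd_app f_def mult.assoc nov_sum_mult cvg_app1)
  finally show "app D' (app D x) $ k = app (\<lambda>i. app D' (D i)) x $ k" .
qed

section \<open>Completed tensor products and the exchange of two sums\<close>

definition tensv :: "'i vec \<Rightarrow> 'j vec \<Rightarrow> ('i \<times> 'j) vec" where
  "tensv x y = app (\<lambda>i. app (\<lambda>j. unitv (i, j)) y) x"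

lemma bdd_app_row: "(\<And>i j. vge c (F i j)) \<Longrightarrow> bdd (\<lambda>i. app (F i) y)"
proof -
  assume F: "\<And>i j. vge c (F i j)"
  obtain d where "vge d y" using vge_ex by blast
  then have "vge (d + c) (app (F i) y)" for i using F by (intro vge_app) auto
  then show ?thesis by (rule bddI)
qed

lemma bdd_tens_row [simp]: "bdd (\<lambda>i. app (\<lambda>j. unitv (f i j)) y)"
  by (rule bdd_app_row[of 0]) simp

lemma vnth_tensv: "tensv x y $ (i, j) = x $ i * y $ j"
proof -
  have 1: "app (\<lambda>j. unitv (i', j)) y $ (i, j) = kron i' i * y $ j" for i'
    by (simp add: vnth_app vnth_unitv, subst nov_sum_single[of j], auto simp: kron_def)
  show ?thesis
    unfolding tensv_def
    by (simp add: vnth_app 1, subst nov_sum_single[of i], auto simp: kron_def)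
qed

lemma app_tensv:
  assumes "bdd F" shows "app F (tensv x y) = app (\<lambda>i. app (\<lambda>j. F (i, j)) y) x"
  unfolding tensv_def using assms
  by (simp add: app_app)

text \<open>Both sides are the value on x \<otimes> y of one map on the completed tensor product,
  read with either factor first.\<close>

lemma app_swap:
  assumes F: "\<And>i j. vge c (F i j)"
  shows "app (\<lambda>i. app (\<lambda>j. F i j) y) x = app (\<lambda>j. app (\<lambda>i. F i j) x) y"
proof -
  define G where "G = (\<lambda>(i, j). F i j)"
  have b: "bdd G" "bdd (\<lambda>q. G (prod.swap q))" using F by (auto simp: G_def case_prod_unfold intro!: bddI)
  have "tensv x y = app (\<lambda>q. unitv (prod.swap q)) (tensv y x)"
  proof (rule vec_eqI)
    fix q
    show "tensv x y $ q = app (\<lambda>q. unitv (prod.swap q)) (tensv y x) $ q"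
      by (cases q) (simp add: vnth_app vnth_unitv, subst nov_sum_single[of "prod.swap q"],
        auto simp: kron_def vnth_tensv mult.commute)
  qed
  then have "app G (tensv x y) = app (\<lambda>q. G (prod.swap q)) (tensv y x)"
    using b by (simp add: app_app)
  then show ?thesis using b by (simp add: app_tensv) (simp add: G_def)
qed

section \<open>Sums over splittings of words\<close>

text \<open>Sum over all cuts of a word into two pieces. The recursion on the word, instead of a sum
  over positions, lets the coalgebra identities of deconcatenation go by structural
  induction.\<close>

primrec ssum :: "'a list \<Rightarrow> ('a list \<Rightarrow> 'a list \<Rightarrow> 'b::comm_monoid_add) \<Rightarrow> 'b" where
  "ssum [] f = f [] []"
| "ssum (x # u) f = f [] (x # u) + ssum u (\<lambda>a b. f (x # a) b)"

lemma ssum_conv: "ssum u f = (\<Sum>i\<le>length u. f (take i u) (drop i u))"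
  by (induction u arbitrary: f) (simp_all add: sum.atMost_Suc_shift del: sum.atMost_Suc)

lemma ssum_cong: "(\<And>a b. a @ b = u \<Longrightarrow> f a b = g a b) \<Longrightarrow> ssum u f = ssum u g"
proof (induction u arbitrary: f g)
  case (Cons x u)
  have "ssum u (\<lambda>a b. f (x # a) b) = ssum u (\<lambda>a b. g (x # a) b)"
    by (rule Cons.IH) (simp add: Cons.prems)
  moreover have "f [] (x # u) = g [] (x # u)" by (rule Cons.prems) simp
  ultimately show ?case by simp
qed simp

lemma ssum_add: "ssum u (\<lambda>a b. f a b + g a b) = ssum u f + ssum u g"
  by (induction u arbitrary: f g) (simp_all add: ac_simps)

lemma ssum_0 [simp]: "ssum u (\<lambda>a b. 0) = 0"
  by (induction u) simp_all

lemma ssum_hom: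
  assumes "h 0 = 0" "\<And>x y. h (x + y) = h x + h y"
  shows "h (ssum u f) = ssum u (\<lambda>a b. h (f a b))"
  by (induction u arbitrary: f) (simp_all add: assms)

lemma ssum_swap: "ssum u (\<lambda>a b. ssum w (\<lambda>c d. f a b c d)) = ssum w (\<lambda>c d. ssum u (\<lambda>a b. f a b c d))"
  by (induction u arbitrary: f) (simp_all add: ssum_add)

text \<open>Coassociativity of deconcatenation: both sides run over the cuts into three
  pieces.\<close>

lemma ssum_assoc: "ssum u (\<lambda>a b. ssum a (\<lambda>a1 a2. f a1 a2 b)) = ssum u (\<lambda>a1 x. ssum x (\<lambda>a2 b. f a1 a2 b))"
  by (induction u arbitrary: f) (simp_all add: ssum_add ac_simps)

text \<open>A cut of a word with a marked letter y lies on one side of y. This separates the terms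
  in which the letter produced by an operation goes to the right piece from those in which it goes
  to the left one.\<close>

lemma ssum_insert:
  "ssum (a @ y # c) f = ssum a (\<lambda>a1 a2. f a1 (a2 @ y # c)) + ssum c (\<lambda>c1 c2. f (a @ y # c1) c2)"
  by (induction a arbitrary: f) (simp_all add: ac_simps)

lemma ssum_Nil1: "ssum u (\<lambda>a b. if a = [] then f a b else 0) = f [] u"
  by (cases u) simp_all

lemma ssum_Nil2: "ssum u (\<lambda>a b. if b = [] then f a b else 0) = f u []"
  by (induction u arbitrary: f) simp_all

lemma vscale_ssum: "k *v ssum u f = ssum u (\<lambda>a b. k *v f a b)"
  by (rule ssum_hom) (simp_all add: vscale_add)

lemma mult_ssum: "(k :: nov) * ssum u f = ssum u (\<lambda>a b. k * f a b)"
  by (rule ssum_hom) (simp_all add: algebra_simps)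

lemma vnth_ssum: "ssum u f $ i = ssum u (\<lambda>a b. f a b $ i)"
  by (rule ssum_hom) simp_all

lemma vge_ssum: "(\<And>a b. a @ b = u \<Longrightarrow> vge c (f a b)) \<Longrightarrow> vge c (ssum u f)"
  by (induction u arbitrary: f) (simp_all add: vge_add)

lemma vge_ssum' [simp]: "(\<And>a b. vge c (f a b)) \<Longrightarrow> vge c (ssum u f)"
  by (rule vge_ssum)

lemma vge_ksign [simp]: "vge c (ksign k *v x) \<longleftrightarrow> vge c x"
  by (simp add: ksign_def)

lemma vge_push [simp]: "vge c x \<Longrightarrow> vge c (app (\<lambda>y. unitv (f y)) x)"
  by (rule vge_app'[of c _ 0]) simp_all

lemma vge_app_left: "vge 0 x \<Longrightarrow> (\<And>i. vge c (D i)) \<Longrightarrow> vge c (app D x)"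
  by (rule vge_app'[of 0 _ c]) simp_all

lemma vge_app_right: "vge c x \<Longrightarrow> (\<And>i. vge 0 (D i)) \<Longrightarrow> vge c (app D x)"
  by (rule vge_app'[of c _ 0]) simp_all

lemma app_push: "bdd D \<Longrightarrow> app D (app (\<lambda>i. unitv (f i)) x) = app (\<lambda>i. D (f i)) x"
  by (simp add: app_app)

lemma app_ssum: "bdd D \<Longrightarrow> app D (ssum u f) = ssum u (\<lambda>a b. app D (f a b))"
  by (rule ssum_hom) (simp_all add: app_add)

lemma app_row_ssum:
  assumes "\<And>a b x. vge c (F a b x)"
  shows "app (\<lambda>x. ssum u (\<lambda>a b. F a b x)) z = ssum u (\<lambda>a b. app (F a b) z)"
  using assms
proof (induction u arbitrary: F)
  case (Cons y u)
  have "app (\<lambda>x. F [] (y # u) x + ssum u (\<lambda>a b. F (y # a) b x)) z =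
    app (F [] (y # u)) z + app (\<lambda>x. ssum u (\<lambda>a b. F (y # a) b x)) z"
    by (rule app_row_add) (auto intro!: bddI[of c] simp: Cons.prems)
  then show ?case using Cons.IH[of "\<lambda>a b. F (y # a) b"] Cons.prems by simp
qed simp

text \<open>Signs only see degrees modulo 2, and the Novikov variable e has even degree. Parity
  therefore suffices for all sign computations, with no reference to the exponents of the
  coefficients.\<close>

definition par :: "('i \<Rightarrow> int) \<Rightarrow> int \<Rightarrow> 'i vec \<Rightarrow> bool" where
  "par d k x \<longleftrightarrow> (\<forall>i. x $ i \<noteq> 0 \<longrightarrow> even (d i - k))"

text \<open>On the support of x the parity of d is constant, so a sign determined by that parity
  leaves the sum.\<close>

lemma app_par:
  assumes "par d k x" "bdd F" "\<And>i. even (d i - k) \<Longrightarrow> even (q i - r)"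
  shows "app (\<lambda>i. ksign (q i) *v F i) x = ksign r *v app F x"
proof -
  have "app (\<lambda>i. ksign (q i) *v F i) x = app (\<lambda>i. ksign r *v F i) x"
    using assms(1,3) by (intro app_cong_nz) (auto simp: par_def intro: arg_cong[OF ksign_cong])
  then show ?thesis using assms(2) by (simp add: app_row_scale)
qed

lemma par_0 [simp]: "par d k 0" by (simp add: par_def)
lemma par_add: "par d k x \<Longrightarrow> par d k y \<Longrightarrow> par d k (x + y)"
  unfolding par_def by (metis add_0 vnth_add)
lemma par_scale: "par d k x \<Longrightarrow> par d k (a *v x)"
  unfolding par_def by (metis mult_zero_right vnth_scale)
lemma par_ssum: "(\<And>a b. a @ b = u \<Longrightarrow> par d k (f a b)) \<Longrightarrow> par d k (ssum u f)"
  by (induction u arbitrary: f) (simp_all add: par_add)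

lemma par_push:
  assumes "par d k x" "\<And>i. even (d i - k) \<Longrightarrow> even (d' (f i) - k')"
  shows "par d' k' (app (\<lambda>i. unitv (f i)) x)"
  unfolding par_def
proof (intro allI impI)
  fix j assume "app (\<lambda>i. unitv (f i)) x $ j \<noteq> 0"
  then have *: "nov_sum (\<lambda>i. x $ i * kron (f i) j) \<noteq> 0" by (simp add: vnth_app vnth_unitv)
  have "\<not> (\<forall>i. x $ i * kron (f i) j = 0)"
  proof
    assume "\<forall>i. x $ i * kron (f i) j = 0"
    then have "(\<lambda>i. x $ i * kron (f i) j) = (\<lambda>_. 0)" by (simp only: fun_eq_iff simp_thms)
    then have "nov_sum (\<lambda>i. x $ i * kron (f i) j) = 0" by (simp only: nov_sum_0)
    with * show False ..
  qed
  then obtain i where "x $ i * kron (f i) j \<noteq> 0" by blast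
  then show "even (d' j - k')" using assms by (auto simp: par_def kron_def split: if_splits)
qed

definition wd :: "('a \<Rightarrow> int) \<Rightarrow> 'a list \<Rightarrow> int" where
  "wd d w = sum_list (map d w)"

lemma wd_simps [simp]: "wd d [] = 0" "wd d (x # w) = d x + wd d w" "wd d (u @ w) = wd d u + wd d w"
  by (simp_all add: wd_def)

section \<open>The bar differential and comodule maps\<close>

definition bar :: "('a \<Rightarrow> int) \<Rightarrow> ('a list \<Rightarrow> 'a vec) \<Rightarrow> 'a list \<Rightarrow> 'a list vec" where
  "bar d m u = ssum u (\<lambda>a x. ssum x (\<lambda>b c. ksign (wd d a) *v app (\<lambda>y. unitv (a @ y # c)) (m b)))"

lemma vge_bar: "(\<And>w. vge 0 (m w)) \<Longrightarrow> vge 0 (bar d m u)"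
  by (simp add: bar_def)

lemma par_bar:
  assumes "\<And>w. par d (wd d w + 1) (m w)" shows "par (wd d) (wd d u + 1) (bar d m u)"
  unfolding bar_def
proof (intro par_ssum par_scale)
  fix a x b c assume *: "a @ x = u" "b @ c = x"
  show "par (wd d) (wd d u + 1) (app (\<lambda>y. unitv (a @ y # c)) (m b))"
    by (rule par_push[OF assms[of b]]) (use * in auto)
qed

text \<open>The bar differential is a coderivation: in a cut of an output word the new letter lies
  in one of the two pieces, and m has acted inside that piece. The identity is paired with an
  arbitrary F instead of taking values in a tensor product, the form in which it is used under
  \<open>app\<close>.\<close>

lemma bar_coleibniz:
  assumes m: "\<And>w. vge 0 (m w)" and F: "\<And>a b. vge c (F a b)"
  shows "app (\<lambda>x. ssum x F) (bar d m u) =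
    ssum u (\<lambda>a b. app (\<lambda>x. F x b) (bar d m a) + ksign (wd d a) *v app (\<lambda>x. F a x) (bar d m b))"
proof -
  have b: "bdd (\<lambda>x. ssum (f x) (\<lambda>a b. F (g x a b) (h x a b)))" for f :: "'z \<Rightarrow> 'y list" and g h
    by (rule bddI[of c]) (simp add: F)
  have b1: "bdd (\<lambda>x. F (g x) (h x))" for g h :: "'z \<Rightarrow> _"
    by (rule bddI[of c]) (simp add: F)
  have b0: "bdd (\<lambda>x. ssum x F)" using b[of "\<lambda>x. x" "\<lambda>x a b. a" "\<lambda>x a b. b"] by simp
  have "app (\<lambda>x. ssum x F) (bar d m u) =
    ssum u (\<lambda>a x. ssum x (\<lambda>b c. ksign (wd d a) *v app (\<lambda>y. ssum (a @ y # c) F) (m b)))"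
    by (simp only: bar_def app_ssum[OF b0] app_scale[OF b0] app_push[OF b0])
  also have "\<dots> = ssum u (\<lambda>a x. ssum x (\<lambda>b c. ksign (wd d a) *v
      (ssum a (\<lambda>a1 a2. app (\<lambda>y. F a1 (a2 @ y # c)) (m b)) +
       ssum c (\<lambda>c1 c2. app (\<lambda>y. F (a @ y # c1) c2) (m b)))))"
    by (simp only: ssum_insert app_row_add[OF b b] app_row_ssum[of c, OF F])
  also have "\<dots> = ssum u (\<lambda>a x. ssum x (\<lambda>b c.
      ssum a (\<lambda>a1 a2. ksign (wd d a) *v app (\<lambda>y. F a1 (a2 @ y # c)) (m b)))) +
      ssum u (\<lambda>a x. ssum x (\<lambda>b c. ssum c (\<lambda>c1 c2. ksign (wd d a) *v app (\<lambda>y. F (a @ y # c1) c2) (m b))))"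
    (is "_ = ?S1 + ?S2")
    by (simp only: ssum_add vscale_ssum vscale_add)
  also have "?S1 = ssum u (\<lambda>a x. ssum a (\<lambda>a1 a2. ssum x (\<lambda>b c.
      ksign (wd d a1) *v ksign (wd d a2) *v app (\<lambda>y. F a1 (a2 @ y # c)) (m b))))"
    by (subst ssum_swap) (auto intro!: ssum_cong simp: ksign_add)
  also have "\<dots> = ssum u (\<lambda>a b. ksign (wd d a) *v app (\<lambda>x. F a x) (bar d m b))"
    by (subst ssum_assoc) (simp only: bar_def app_ssum[OF b1] app_scale[OF b1] app_push[OF b1] vscale_ssum)
  also have "?S2 = ssum u (\<lambda>a b. app (\<lambda>x. F x b) (bar d m a))"
    by (simp only: bar_def app_ssum[OF b1] app_scale[OF b1] app_push[OF b1] ssum_assoc)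
  finally show ?thesis by (simp add: ssum_add add.commute)
qed

text \<open>Extension of \<alpha> to the cofree bicomodule. The parity s of \<alpha> gives the sign
  for passing the left word: s = 1 for the operations of a bimodule, s = 0 for a
  homomorphism.\<close>

fun bhat :: "int \<Rightarrow> ('a \<Rightarrow> int) \<Rightarrow> ('a list \<times> 'v \<times> 'b list \<Rightarrow> 'u vec) \<Rightarrow>
    'a list \<times> 'v \<times> 'b list \<Rightarrow> ('a list \<times> 'u \<times> 'b list) vec" where
  "bhat s da \<alpha> (u, v, w) = ssum u (\<lambda>a b. ssum w (\<lambda>c e.
     ksign (s * wd da a) *v app (\<lambda>y. unitv (a, y, e)) (\<alpha> (b, v, c))))"

text \<open>The summand of the bar differential of a bimodule that comes from the two algebras; the
  bimodule operations are added separately as \<open>bhat 1\<close>.\<close>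

fun Bd :: "('a \<Rightarrow> int) \<Rightarrow> ('v \<Rightarrow> int) \<Rightarrow> ('b \<Rightarrow> int) \<Rightarrow> ('a list \<Rightarrow> 'a vec) \<Rightarrow> ('b list \<Rightarrow> 'b vec) \<Rightarrow>
    'a list \<times> 'v \<times> 'b list \<Rightarrow> ('a list \<times> 'v \<times> 'b list) vec" where
  "Bd da dv db ma mb (u, v, w) = app (\<lambda>x. unitv (x, v, w)) (bar da ma u) +
     ksign (wd da u + dv v) *v app (\<lambda>x. unitv (u, v, x)) (bar db mb w)"

lemma vge_bhat: "(\<And>t. vge c (\<alpha> t)) \<Longrightarrow> vge c (bhat s da \<alpha> t)"
  by (cases t) simp

lemma vge_Bd: "(\<And>w. vge 0 (ma w)) \<Longrightarrow> (\<And>w. vge 0 (mb w)) \<Longrightarrow> vge 0 (Bd da dv db ma mb t)"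
  by (cases t) (simp add: vge_add vge_bar)

definition bpar :: "('a \<Rightarrow> int) \<Rightarrow> ('v \<Rightarrow> int) \<Rightarrow> ('b \<Rightarrow> int) \<Rightarrow> ('u \<Rightarrow> int) \<Rightarrow> int \<Rightarrow>
    ('a list \<times> 'v \<times> 'b list \<Rightarrow> 'u vec) \<Rightarrow> bool" where
  "bpar da dv db du s \<alpha> \<longleftrightarrow> (\<forall>u v w. par du (wd da u + dv v + wd db w + s) (\<alpha> (u, v, w)))"

text \<open>A map between cofree comodules is determined by its corestriction. Concretely, the two
  cuts of each outer word are regrouped by coassociativity into the part consumed by the composite
  and the part left over.\<close>

lemma bhat_bhat:
  assumes A: "\<And>t. vge c (\<alpha> t)" and B: "\<And>t. vge c' (\<beta> t)"
  shows "app (bhat t da \<beta>) (bhat s da \<alpha> q) = bhat (s + t) da (\<lambda>q. app \<beta> (bhat s da \<alpha> q)) q"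
proof -
  obtain u v w where q: "q = (u, v, w)" by (cases q)
  have bB: "bdd (bhat t da \<beta>)" using vge_bhat[OF B] by (rule bddI)
  have b: "bdd \<beta>" using B by (rule bddI)
  have b1: "bdd (\<lambda>y. app (\<lambda>z. unitv (a1, z, e2)) (\<beta> (a2, y, e1)))" for a1 e2 a2 e1
    by (rule bddI[of c']) (simp add: B)
  have b2: "bdd (\<lambda>y. \<beta> (f y))" for f :: "'z \<Rightarrow> _" by (rule bddI[of c']) (rule B)
  have r: "app (\<lambda>y. ssum a (\<lambda>a1 a2. ssum e (\<lambda>c1 c2. ksign (t * wd da a1) *v
      app (\<lambda>z. unitv (a1, z, c2)) (\<beta> (a2, y, c1))))) x =
      ssum a (\<lambda>a1 a2. ssum e (\<lambda>c1 c2. ksign (t * wd da a1) *v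
      app (\<lambda>y. app (\<lambda>z. unitv (a1, z, c2)) (\<beta> (a2, y, c1))) x))" for a e x
    by (subst app_row_ssum[of c'], simp add: B, subst app_row_ssum[of c'], simp add: B,
      simp add: app_row_scale b1)
  have "app (bhat t da \<beta>) (bhat s da \<alpha> q) = ssum u (\<lambda>a b. ssum w (\<lambda>c e.
     ksign (s * wd da a) *v app (\<lambda>y. bhat t da \<beta> (a, y, e)) (\<alpha> (b, v, c))))"
    by (simp only: q bhat.simps app_ssum[OF bB] app_scale[OF bB] app_push[OF bB])
  also have "\<dots> = ssum u (\<lambda>a b. ssum w (\<lambda>c e. ssum a (\<lambda>a1 a2. ssum e (\<lambda>c1 c2.
     ksign (s * wd da a) *v ksign (t * wd da a1) *v
     app (\<lambda>y. app (\<lambda>z. unitv (a1, z, c2)) (\<beta> (a2, y, c1))) (\<alpha> (b, v, c))))))"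
    by (simp only: bhat.simps r vscale_ssum)
  also have "\<dots> = ssum u (\<lambda>a b. ssum a (\<lambda>a1 a2. ssum w (\<lambda>c e. ssum e (\<lambda>c1 c2.
     ksign ((s + t) * wd da a1) *v ksign (s * wd da a2) *v
     app (\<lambda>y. app (\<lambda>z. unitv (a1, z, c2)) (\<beta> (a2, y, c1))) (\<alpha> (b, v, c))))))"
    by (subst ssum_swap) (auto intro!: ssum_cong simp: ksign_add[symmetric] algebra_simps)
  also have "\<dots> = ssum u (\<lambda>a1 x. ssum x (\<lambda>a2 b. ssum w (\<lambda>z c2. ssum z (\<lambda>c c1.
     ksign ((s + t) * wd da a1) *v ksign (s * wd da a2) *v
     app (\<lambda>y. app (\<lambda>z. unitv (a1, z, c2)) (\<beta> (a2, y, c1))) (\<alpha> (b, v, c))))))"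
    by (simp only: ssum_assoc)
  also have "\<dots> = ssum u (\<lambda>a1 x. ssum w (\<lambda>z c2. ssum x (\<lambda>a2 b. ssum z (\<lambda>c c1.
     ksign ((s + t) * wd da a1) *v ksign (s * wd da a2) *v
     app (\<lambda>y. app (\<lambda>z. unitv (a1, z, c2)) (\<beta> (a2, y, c1))) (\<alpha> (b, v, c))))))"
    by (subst (2) ssum_swap) (rule refl)
  also have "\<dots> = bhat (s + t) da (\<lambda>q. app \<beta> (bhat s da \<alpha> q)) q"
    by (simp only: q bhat.simps app_ssum[OF b] app_scale[OF b] app_push[OF b]
      app_ssum[OF bdd_unitv] app_scale[OF bdd_unitv] app_app[OF b2 bdd_unitv] vscale_ssum)
  finally show ?thesis .
qed

text \<open>Operations on letters that \<alpha> leaves untouched occur on both sides and cancel up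
  to the sign of s; those on letters that \<alpha> consumes form the extension of a composite. Hence
  the graded commutator of a comodule map with \<open>Bd\<close> is again a comodule map, of parity
  s + 1.\<close>

lemma bhat_Bd:
  fixes \<alpha> :: "'a list \<times> 'v \<times> 'b list \<Rightarrow> 'u vec"
  assumes ma: "\<And>w. vge 0 (ma w)" "\<And>w. par da (wd da w + 1) (ma w)"
    and mb: "\<And>w. vge 0 (mb w)"
    and A: "\<And>t. vge c (\<alpha> t)" and P: "bpar da dv db du s \<alpha>"
  shows "app (bhat s da \<alpha>) (Bd da dv db ma mb q) =
    ksign s *v app (Bd da du db ma mb) (bhat s da \<alpha> q) +
    bhat (s + 1) da (\<lambda>q. app \<alpha> (Bd da dv db ma mb q)) q"
proof -
  obtain u v w where q: "q = (u, v, w)" by (cases q)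
  have bH: "bdd (bhat s da \<alpha>)" using vge_bhat[OF A] by (rule bddI)
  have bA: "bdd \<alpha>" using A by (rule bddI)
  have bB: "bdd (Bd da du db ma mb)" using vge_Bd[OF ma(1) mb] by (rule bddI)
  have bU: "bdd (\<lambda>x. app (\<lambda>y. unitv (f x y)) (\<alpha> (g x)))" for f :: "'z \<Rightarrow> 'u \<Rightarrow> 'y" and g
    by (rule bddI[of c]) (simp add: A)
  \<comment> \<open>The cut of the right word is hidden in \<open>\<Phi>\<close>, so that the
    coderivation rule can first be applied to the left word alone.\<close>
  define \<Phi> where "\<Phi> a b = ssum w (\<lambda>x e. app (\<lambda>y. unitv (a, y, e)) (\<alpha> (b, v, x)))"
    for a b :: "'a list"
  have \<Phi>: "vge c (\<Phi> a b)" for a b by (simp add: \<Phi>_def A)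
  have b\<Phi>: "bdd (\<lambda>x. \<Phi> (f x) (g x))" for f g :: "'z \<Rightarrow> 'a list" by (rule bddI[of c]) (simp add: \<Phi>)
  have hs: "bhat s da \<alpha> (x, v, w) = ssum x (\<lambda>a b. ksign (s * wd da a) *v \<Phi> a b)" for x
    by (simp add: \<Phi>_def vscale_ssum)
  have L: "app (\<lambda>x. bhat s da \<alpha> (x, v, w)) (bar da ma u) =
    ssum u (\<lambda>a b. ksign (s * wd da a + s) *v app (\<lambda>x. \<Phi> x b) (bar da ma a) +
      ksign (s * wd da a + wd da a) *v app (\<lambda>x. \<Phi> a x) (bar da ma b))"
    unfolding hs
  proof (subst bar_coleibniz[of _ c, OF ma(1)], simp add: \<Phi>, rule ssum_cong)
    fix a b
    have "app (\<lambda>x. ksign (s * wd da x) *v \<Phi> x b) (bar da ma a) =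
      ksign (s * wd da a + s) *v app (\<lambda>x. \<Phi> x b) (bar da ma a)"
      by (rule app_par[OF par_bar[OF ma(2)] b\<Phi>]) auto
    moreover have "app (\<lambda>x. ksign (s * wd da a) *v \<Phi> a x) (bar da ma b) =
      ksign (s * wd da a) *v app (\<lambda>x. \<Phi> a x) (bar da ma b)"
      by (rule app_row_scale[OF b\<Phi>])
    ultimately show "app (\<lambda>x. ksign (s * wd da x) *v \<Phi> x b) (bar da ma a) +
        ksign (wd da a) *v app (\<lambda>x. ksign (s * wd da a) *v \<Phi> a x) (bar da ma b) =
      ksign (s * wd da a + s) *v app (\<lambda>x. \<Phi> x b) (bar da ma a) +
      ksign (s * wd da a + wd da a) *v app (\<lambda>x. \<Phi> a x) (bar da ma b)"
      by (simp add: ksign_add mult.commute)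
  qed
  have L1: "app (\<lambda>x. \<Phi> x b) (bar da ma a) =
      ssum w (\<lambda>z e. app (\<lambda>y. app (\<lambda>x. unitv (x, y, e)) (bar da ma a)) (\<alpha> (b, v, z)))" for a b
    unfolding \<Phi>_def by (subst app_row_ssum[of c], simp add: A) (rule ssum_cong, rule app_swap[of 0], simp)
  have L2: "app (\<lambda>x. \<Phi> a x) (bar da ma b) =
      ssum w (\<lambda>z e. app (\<lambda>y. unitv (a, y, e)) (app (\<lambda>x. \<alpha> (x, v, z)) (bar da ma b)))" for a b
    unfolding \<Phi>_def by (subst app_row_ssum[of c], simp add: A) (simp add: app_app bdd_comp[OF bA])
  have R: "app (\<lambda>x. bhat s da \<alpha> (u, v, x)) (bar db mb w) =
    ssum u (\<lambda>a b. ssum w (\<lambda>z e. ksign (s * wd da a) *v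
      (app (\<lambda>y. unitv (a, y, e)) (app (\<lambda>x. \<alpha> (b, v, x)) (bar db mb z)) +
      ksign (wd db z) *v app (\<lambda>y. app (\<lambda>x. unitv (a, y, x)) (bar db mb e)) (\<alpha> (b, v, z)))))"
    unfolding bhat.simps
  proof (subst app_row_ssum[of c], simp add: A, rule ssum_cong, subst bar_coleibniz[of _ c, OF mb],
      simp add: A, rule ssum_cong)
    fix a b :: "'a list" and z e :: "'b list"
    have 1: "app (\<lambda>x. app (\<lambda>y. unitv (a, y, e)) (\<alpha> (b, v, x))) (bar db mb z) =
      app (\<lambda>y. unitv (a, y, e)) (app (\<lambda>x. \<alpha> (b, v, x)) (bar db mb z))"
      by (simp add: app_app bdd_comp[OF bA])
    have 2: "app (\<lambda>x. app (\<lambda>y. unitv (a, y, x)) (\<alpha> (b, v, z))) (bar db mb e) =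
      app (\<lambda>y. app (\<lambda>x. unitv (a, y, x)) (bar db mb e)) (\<alpha> (b, v, z))"
      by (rule app_swap[of 0]) simp
    show "app (\<lambda>x. ksign (s * wd da a) *v app (\<lambda>y. unitv (a, y, e)) (\<alpha> (b, v, x))) (bar db mb z) +
       ksign (wd db z) *v
       app (\<lambda>x. ksign (s * wd da a) *v app (\<lambda>y. unitv (a, y, x)) (\<alpha> (b, v, z))) (bar db mb e) =
       ksign (s * wd da a) *v
       (app (\<lambda>y. unitv (a, y, e)) (app (\<lambda>x. \<alpha> (b, v, x)) (bar db mb z)) +
        ksign (wd db z) *v app (\<lambda>y. app (\<lambda>x. unitv (a, y, x)) (bar db mb e)) (\<alpha> (b, v, z)))"
      by (subst app_row_scale, rule bU, subst app_row_scale, rule bU)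
        (simp add: 1 2 vscale_add mult.commute)
  qed
  have S: "app (Bd da du db ma mb) (bhat s da \<alpha> q) = ssum u (\<lambda>a b. ssum w (\<lambda>z e.
     ksign (s * wd da a) *v (app (\<lambda>y. app (\<lambda>x. unitv (x, y, e)) (bar da ma a)) (\<alpha> (b, v, z)) +
       ksign (wd da a + wd da b + dv v + wd db z + s) *v
         app (\<lambda>y. app (\<lambda>x. unitv (a, y, x)) (bar db mb e)) (\<alpha> (b, v, z)))))"
    unfolding q bhat.simps app_ssum[OF bB] app_scale[OF bB] app_push[OF bB]
  proof (intro ssum_cong arg_cong[of _ _ "vscale _"])
    fix a b :: "'a list" and z e :: "'b list"
    have b2: "bdd (\<lambda>y. app (\<lambda>x. unitv (f x y)) (bar da ma a))"
      "bdd (\<lambda>y. app (\<lambda>x. unitv (f' x y)) (bar db mb e))"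
      for f :: "'a list \<Rightarrow> 'u \<Rightarrow> 'a list \<times> 'u \<times> 'b list"
      and f' :: "'b list \<Rightarrow> 'u \<Rightarrow> 'a list \<times> 'u \<times> 'b list"
      by (auto intro!: bddI[of 0] simp: vge_bar ma(1) mb)
    have "app (\<lambda>y. ksign (wd da a + du y) *v app (\<lambda>x. unitv (a, y, x)) (bar db mb e)) (\<alpha> (b, v, z)) =
      ksign (wd da a + wd da b + dv v + wd db z + s) *v
         app (\<lambda>y. app (\<lambda>x. unitv (a, y, x)) (bar db mb e)) (\<alpha> (b, v, z))"
      by (rule app_par[OF _ b2(2)]) (use P in \<open>auto simp: bpar_def\<close>)
    then show "app (\<lambda>i. Bd da du db ma mb (a, i, e)) (\<alpha> (b, v, z)) =
       app (\<lambda>y. app (\<lambda>x. unitv (x, y, e)) (bar da ma a)) (\<alpha> (b, v, z)) +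
       ksign (wd da a + wd da b + dv v + wd db z + s) *v
       app (\<lambda>y. app (\<lambda>x. unitv (a, y, x)) (bar db mb e)) (\<alpha> (b, v, z))"
      unfolding Bd.simps by (subst app_row_add) (auto intro: b2 bdd_scale)
  qed
  have T: "bhat (s + 1) da (\<lambda>q. app \<alpha> (Bd da dv db ma mb q)) q = ssum u (\<lambda>a b. ssum w (\<lambda>z e.
     ksign (s * wd da a + wd da a) *v
       (app (\<lambda>y. unitv (a, y, e)) (app (\<lambda>x. \<alpha> (x, v, z)) (bar da ma b)) +
       ksign (wd da b + dv v) *v app (\<lambda>y. unitv (a, y, e)) (app (\<lambda>x. \<alpha> (b, v, x)) (bar db mb z)))))"
    by (simp only: q bhat.simps Bd.simps app_add[OF bA] app_scale[OF bA] app_push[OF bA]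
        app_add[OF bdd_unitv] app_scale[OF bdd_unitv] distrib_right mult_1)
  have "app (bhat s da \<alpha>) (Bd da dv db ma mb q) =
    app (\<lambda>x. bhat s da \<alpha> (x, v, w)) (bar da ma u) +
    ksign (wd da u + dv v) *v app (\<lambda>x. bhat s da \<alpha> (u, v, x)) (bar db mb w)"
    by (simp only: q Bd.simps app_add[OF bH] app_scale[OF bH] app_push[OF bH])
  also have "\<dots> = ssum u (\<lambda>a b. ssum w (\<lambda>z e.
      ksign (s * wd da a + s) *v app (\<lambda>y. app (\<lambda>x. unitv (x, y, e)) (bar da ma a)) (\<alpha> (b, v, z)) +
      ksign (s * wd da a + wd da a) *v app (\<lambda>y. unitv (a, y, e)) (app (\<lambda>x. \<alpha> (x, v, z)) (bar da ma b)) +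
      ksign (wd da u + dv v) *v ksign (s * wd da a) *v
      (app (\<lambda>y. unitv (a, y, e)) (app (\<lambda>x. \<alpha> (b, v, x)) (bar db mb z)) +
      ksign (wd db z) *v app (\<lambda>y. app (\<lambda>x. unitv (a, y, x)) (bar db mb e)) (\<alpha> (b, v, z)))))"
    by (simp only: L L1 L2 R vscale_ssum ssum_add[symmetric])
  also have "\<dots> = ssum u (\<lambda>a b. ssum w (\<lambda>z e.
     ksign s *v ksign (s * wd da a) *v (app (\<lambda>y. app (\<lambda>x. unitv (x, y, e)) (bar da ma a)) (\<alpha> (b, v, z)) +
       ksign (wd da a + wd da b + dv v + wd db z + s) *v
         app (\<lambda>y. app (\<lambda>x. unitv (a, y, x)) (bar db mb e)) (\<alpha> (b, v, z))) +
     ksign (s * wd da a + wd da a) *v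
       (app (\<lambda>y. unitv (a, y, e)) (app (\<lambda>x. \<alpha> (x, v, z)) (bar da ma b)) +
       ksign (wd da b + dv v) *v app (\<lambda>y. unitv (a, y, e)) (app (\<lambda>x. \<alpha> (b, v, x)) (bar db mb z)))))"
    (is "ssum u ?X = ssum u ?Y")
  proof (intro ssum_cong)
    fix a b :: "'a list" and z e :: "'b list" assume "a @ b = u"
    then have u: "u = a @ b" by simp
    \<comment> \<open>The extra s appears when the right differential passes the output of \<alpha>,
      whose parity is that of its inputs plus s.\<close>
    have s1: "ksign (s * wd da a + wd da a) * ksign (wd da b + dv v) * ksign (wd db z) =
      ksign s * ksign (s * wd da a) * ksign (wd da a + wd da b + dv v + wd db z + s)"
      unfolding ksign_add[symmetric] by (rule ksign_cong) (simp add: u)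
    have s2: "ksign (wd da u + dv v) * ksign (s * wd da a) =
      ksign (s * wd da a + wd da a) * ksign (wd da b + dv v)"
      unfolding ksign_add[symmetric] by (rule ksign_cong) (simp add: u)
    have s3: "ksign (s * wd da a + s) = ksign s * ksign (s * wd da a)" by (simp add: ksign_add)
    show "ksign (s * wd da a + s) *v app (\<lambda>y. app (\<lambda>x. unitv (x, y, e)) (bar da ma a)) (\<alpha> (b, v, z)) +
      ksign (s * wd da a + wd da a) *v app (\<lambda>y. unitv (a, y, e)) (app (\<lambda>x. \<alpha> (x, v, z)) (bar da ma b)) +
      ksign (wd da u + dv v) *v ksign (s * wd da a) *v
      (app (\<lambda>y. unitv (a, y, e)) (app (\<lambda>x. \<alpha> (b, v, x)) (bar db mb z)) +
      ksign (wd db z) *v app (\<lambda>y. app (\<lambda>x. unitv (a, y, x)) (bar db mb e)) (\<alpha> (b, v, z))) =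
     ksign s *v ksign (s * wd da a) *v (app (\<lambda>y. app (\<lambda>x. unitv (x, y, e)) (bar da ma a)) (\<alpha> (b, v, z)) +
       ksign (wd da a + wd da b + dv v + wd db z + s) *v
         app (\<lambda>y. app (\<lambda>x. unitv (a, y, x)) (bar db mb e)) (\<alpha> (b, v, z))) +
     ksign (s * wd da a + wd da a) *v
       (app (\<lambda>y. unitv (a, y, e)) (app (\<lambda>x. \<alpha> (x, v, z)) (bar da ma b)) +
       ksign (wd da b + dv v) *v app (\<lambda>y. unitv (a, y, e)) (app (\<lambda>x. \<alpha> (b, v, x)) (bar db mb z)))"
      unfolding vscale_add vscale_simps s3 mult.assoc[symmetric] s2 s1 by (simp only: ac_simps)
  qed
  also have "\<dots> = ksign s *v app (Bd da du db ma mb) (bhat s da \<alpha> q) +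
    bhat (s + 1) da (\<lambda>q. app \<alpha> (Bd da dv db ma mb q)) q"
    by (simp only: S T vscale_ssum ssum_add)
  finally show ?thesis .
qed

fun pr :: "'a list \<times> 'v \<times> 'b list \<Rightarrow> 'v vec" where
  "pr (u, v, w) = (if u = [] \<and> w = [] then unitv v else 0)"

lemma vge_pr [simp]: "vge 0 (pr t)" by (cases t) simp

lemma bdd_pr [simp]: "bdd (\<lambda>x. pr (f x))" by (rule bddI[of 0]) simp

lemma bdd_pr' [simp]: "bdd pr" by (rule bddI[of 0]) simp

text \<open>Only the cuts with empty left-over words survive the projection to the cogenerators.
  Identities between comodule maps are turned into identities between families this way.\<close>

lemma pr_bhat: "app pr (bhat s da \<alpha> q) = \<alpha> q"
proof -
  obtain u v w where q: "q = (u, v, w)" by (cases q)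
  have *: "app (\<lambda>y. pr (a, y, e)) x = (if a = [] then if e = [] then x else 0 else 0)" for a e x
    by (simp add: app_unitv_row)
  have "app pr (bhat s da \<alpha> q) = ssum u (\<lambda>a b. ssum w (\<lambda>c e.
      ksign (s * wd da a) *v (if a = [] then if e = [] then \<alpha> (b, v, c) else 0 else 0)))"
    unfolding q bhat.simps
    by (simp only: app_ssum[OF bdd_pr'] app_scale[OF bdd_pr'] app_push[OF bdd_pr'] *)
  also have "\<dots> = ssum u (\<lambda>a b. if a = [] then \<alpha> (b, v, w) else 0)"
    by (rule ssum_cong) (simp add: ssum_Nil2)
  finally show ?thesis by (simp add: ssum_Nil1 q)
qed

section \<open>Coalgebra maps\<close>

lemma hat_ssum: "hat f w (b # y) = ssum w (\<lambda>p q. f p b * hat f q y)"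
  by (simp add: ssum_conv)

lemma energy_ge_ssum: "(\<And>a b. a @ b = u \<Longrightarrow> f a b \<in> energy_ge E) \<Longrightarrow> ssum u f \<in> energy_ge E"
  unfolding ssum_conv by (intro energy_ge_sum) simp

lemma hat_ge0:
  assumes "\<And>w b. f w b \<in> energy_ge 0" shows "hat f w y \<in> energy_ge 0"
proof (induction y arbitrary: w)
  case (Cons b y)
  show ?case unfolding hat_ssum
    by (rule energy_ge_ssum) (use energy_ge_mult[OF assms Cons.IH] in simp)
qed simp

text \<open>An output longer than the input by n letters needs at least n empty pieces, and each of
  them costs the energy \<epsilon> of f_0(1). This is what makes the infinitely many output words
  summable.\<close>

lemma hat_ge:
  assumes f: "\<And>w b. f w b \<in> energy_ge 0" "\<And>b. f [] b \<in> energy_ge \<epsilon>" and "\<epsilon> > 0"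
  shows "hat f w y \<in> energy_ge (\<epsilon> * (real (length y) - real (length w)))"
proof (induction y arbitrary: w)
  case Nil
  then show ?case using \<open>\<epsilon> > 0\<close> by (auto intro: energy_ge_mono[OF energy_ge_1])
next
  case (Cons b y)
  show ?case unfolding hat_ssum
  proof (rule energy_ge_ssum)
    fix p q assume pq: "p @ q = w"
    show "f p b * hat f q y \<in> energy_ge (\<epsilon> * (real (length (b # y)) - real (length w)))"
    proof (cases "p = []")
      case True
      then show ?thesis using pq energy_ge_mult[OF f(2) Cons.IH[of q]]
        by (auto simp: algebra_simps)
    next
      case False
      then have "real (length q) + 1 \<le> real (length w)" using pq by (cases p) auto
      then have "\<epsilon> * (real (length (b # y)) - real (length w)) \<le> \<epsilon> * (real (length y) - real (length q))"
        using \<open>\<epsilon> > 0\<close> by simp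
      then show ?thesis using energy_ge_mult'[OF f(1) Cons.IH] by simp
    qed
  qed
qed

text \<open>Outputs of a fixed length are handled one letter at a time: the first letter comes from
  one of finitely many initial pieces, and f has only finitely many coefficients of low energy on
  each of these.\<close>

lemma finite_hat:
  assumes f: "\<And>w b. f w b \<in> energy_ge 0" "\<And>w. cvg (f w)"
  shows "finite {y. length y = n \<and> hat f w y \<notin> energy_ge E}"
proof (induction n arbitrary: w)
  case 0
  then show ?case by (rule finite_subset[of _ "{[]}"]) auto
next
  case (Suc n)
  let ?R = "\<Union>i\<in>{..length w}. (\<lambda>(b, y). b # y) ` ({b. f (take i w) b \<notin> energy_ge E} \<times>
    {y. length y = n \<and> hat f (drop i w) y \<notin> energy_ge E})"
  have "{y. length y = Suc n \<and> hat f w y \<notin> energy_ge E} \<subseteq> ?R"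
  proof
    fix y' assume y': "y' \<in> {y. length y = Suc n \<and> hat f w y \<notin> energy_ge E}"
    then obtain b y where y: "y' = b # y" "length y = n" by (cases y') auto
    have "\<exists>i\<le>length w. f (take i w) b * hat f (drop i w) y \<notin> energy_ge E"
    proof (rule ccontr)
      assume "\<not> ?thesis"
      then have "hat f w (b # y) \<in> energy_ge E" unfolding hat.simps by (intro energy_ge_sum) auto
      with y' y(1) show False by simp
    qed
    then obtain i where i: "i \<le> length w" "f (take i w) b * hat f (drop i w) y \<notin> energy_ge E" by blast
    have "f (take i w) b \<notin> energy_ge E"
      using i(2) energy_ge_mult'[OF _ hat_ge0[where f = f, OF f(1)], of _ E E] by auto
    moreover have "hat f (drop i w) y \<notin> energy_ge E"
      using i(2) energy_ge_mult'[OF f(1), of _ E E] by auto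
    ultimately have "(b, y) \<in> {b. f (take i w) b \<notin> energy_ge E} \<times>
      {y. length y = n \<and> hat f (drop i w) y \<notin> energy_ge E}" using y(2) by simp
    then have "y' \<in> (\<lambda>(b, y). b # y) ` ({b. f (take i w) b \<notin> energy_ge E} \<times>
      {y. length y = n \<and> hat f (drop i w) y \<notin> energy_ge E})" unfolding y(1) by (rule image_eqI[rotated]) simp
    then show "y' \<in> ?R" using i(1) by blast
  qed
  moreover have "finite ?R" using Suc cvgD[OF f(2)] by (intro finite_UN_I finite_imageI finite_SigmaI) auto
  ultimately show ?case by (rule finite_subset)
qed

lemma cvg_hat:
  assumes f: "\<And>w b. f w b \<in> energy_ge 0" "\<And>w. cvg (f w)" "\<And>b. f [] b \<in> energy_ge \<epsilon>" and "\<epsilon> > 0"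
  shows "cvg (hat f w)"
  unfolding cvg_def
proof
  fix E
  \<comment> \<open>Words longer than N have energy at least E by \<open>hat_ge\<close>, which
    leaves finitely many lengths.\<close>
  obtain N where N: "E / \<epsilon> + real (length w) \<le> real N" using real_arch_simple by blast
  have "{y. hat f w y \<notin> energy_ge E} \<subseteq> (\<Union>n\<in>{..N}. {y. length y = n \<and> hat f w y \<notin> energy_ge E})"
  proof
    fix y assume y: "y \<in> {y. hat f w y \<notin> energy_ge E}"
    have "length y \<le> N"
    proof (rule ccontr)
      assume "\<not> length y \<le> N"
      then have "E / \<epsilon> \<le> real (length y) - real (length w)" using N by linarith
      then have "E \<le> \<epsilon> * (real (length y) - real (length w))"
        using \<open>\<epsilon> > 0\<close> by (simp add: pos_divide_le_eq mult.commute)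
      then have "hat f w y \<in> energy_ge E" using hat_ge[of f \<epsilon>, OF f(1) f(3) \<open>\<epsilon> > 0\<close>] energy_ge_mono by blast
      with y show False by simp
    qed
    with y show "y \<in> (\<Union>n\<in>{..N}. {y. length y = n \<and> hat f w y \<notin> energy_ge E})" by simp
  qed
  moreover have "finite (\<Union>n\<in>{..N}. {y. length y = n \<and> hat f w y \<notin> energy_ge E})"
    using finite_hat[where f = f, OF f(1,2)] by blast
  ultimately show "finite {y. hat f w y \<notin> energy_ge E}" by (rule finite_subset)
qed

lemma ssum_kron: "ssum u (\<lambda>a b. if a = p \<and> b = q then k a b else (0 :: nov)) = (if u = p @ q then k p q else 0)"
proof (induction u arbitrary: p k)
  case (Cons x u)
  show ?case
  proof (cases p)
    case (Cons y p')
    then have "ssum u (\<lambda>a b. if x # a = p \<and> b = q then k (x # a) b else 0) =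
      (if x = y then ssum u (\<lambda>a b. if a = p' \<and> b = q then k (x # a) b else 0) else 0)" by simp
    then show ?thesis using Cons.IH[of p' "\<lambda>a. k (x # a)"] Cons by auto
  qed auto
qed auto

text \<open>The energy conditions that make the coalgebra map a bounded matrix with summable rows.
  Degrees, supports and the chain property are added in \<open>ahom\<close>.\<close>

definition good :: "('a list \<Rightarrow> 'c vec) \<Rightarrow> bool" where
  "good g \<longleftrightarrow> (\<forall>w. vge 0 (g w)) \<and> (\<exists>\<epsilon>>0. vge \<epsilon> (g []))"

definition ghat :: "('a list \<Rightarrow> 'c vec) \<Rightarrow> 'a list \<Rightarrow> 'c list vec" where
  "ghat g w = Vec (hat (\<lambda>w. vnth (g w)) w)"

lemma vnth_ghat:
  assumes "good g" shows "ghat g w $ y = hat (\<lambda>w. vnth (g w)) w y"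
proof -
  obtain \<epsilon> where "\<epsilon> > 0" "vge \<epsilon> (g [])" using assms by (auto simp: good_def)
  then have "cvg (hat (\<lambda>w. vnth (g w)) w)"
    using assms by (intro cvg_hat[of _ \<epsilon>]) (auto simp: good_def vge_def)
  then show ?thesis by (simp add: ghat_def Vec_inverse)
qed

lemma vge_ghat: "good g \<Longrightarrow> vge 0 (ghat g w)"
  unfolding vge_def vnth_ghat by (auto intro!: hat_ge0 simp: good_def vge_def)

lemma bdd_ghat: "good g \<Longrightarrow> bdd (\<lambda>x. ghat g (f x))"
  by (rule bddI[of 0]) (rule vge_ghat)

text \<open>The map built from f is one of coalgebras: a cut of the output word separates the pieces
  of the input into two groups, which cuts the input as well.\<close>

lemma hat_append: "hat f u (p @ q) = ssum u (\<lambda>a b. hat f a p * hat f b q)"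
proof (induction p arbitrary: u)
  case Nil
  have "ssum u (\<lambda>a b. hat f a [] * hat f b q) = ssum u (\<lambda>a b. if a = [] then hat f b q else 0)"
    by (rule ssum_cong) simp
  then show ?case by (simp only: ssum_Nil1 append_Nil)
next
  case (Cons x p)
  have "hat f u ((x # p) @ q) = ssum u (\<lambda>c r. ssum r (\<lambda>a b. f c x * hat f a p * hat f b q))"
    by (simp only: append_Cons hat_ssum Cons.IH mult_ssum mult.assoc)
  also have "\<dots> = ssum u (\<lambda>d b. hat f b q * ssum d (\<lambda>c a. f c x * hat f a p))"
    by (simp only: ssum_assoc[symmetric] mult_ssum mult.commute)
  finally show ?case by (simp only: hat_ssum mult.commute)
qed

lemma bdd_split: "bdd (\<lambda>x. ssum x (\<lambda>a b. unitv (a, b)))"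
  by (rule bddI[of 0]) simp

lemma vnth_app_split: "app (\<lambda>x. ssum x (\<lambda>a b. unitv (a, b))) z $ (p, q) = z $ (p @ q)"
proof -
  have "ssum x (\<lambda>a b. unitv (a, b)) $ (p, q) = kron x (p @ q)" for x
    using ssum_kron[of x p q "\<lambda>_ _. 1"] by (simp add: vnth_ssum vnth_unitv kron_def)
  then show ?thesis
    by (simp add: vnth_app bdd_split, subst nov_sum_single[of "p @ q"], auto simp: kron_def)
qed

lemma split_ghat:
  assumes "good g"
  shows "app (\<lambda>x. ssum x (\<lambda>a b. unitv (a, b))) (ghat g u) = ssum u (\<lambda>a b. tensv (ghat g a) (ghat g b))"
  by (rule vec_eqI) (auto simp: vnth_app_split vnth_ghat[OF assms] vnth_ssum vnth_tensv hat_append)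

lemma ghat_coalg:
  assumes g: "good g" and F: "\<And>a b. vge c (F a b)"
  shows "app (\<lambda>x. ssum x F) (ghat g u) = ssum u (\<lambda>a b. app (\<lambda>x. app (\<lambda>y. F x y) (ghat g b)) (ghat g a))"
proof -
  have b: "bdd (\<lambda>(a, b). F a b)" by (rule bddI[of c]) (auto simp: F)
  have "app (\<lambda>x. ssum x F) (ghat g u) = app (\<lambda>(a, b). F a b) (app (\<lambda>x. ssum x (\<lambda>a b. unitv (a, b))) (ghat g u))"
    by (simp add: app_app[OF bdd_split b] app_ssum[OF b] b)
  also have "\<dots> = ssum u (\<lambda>a d. app (\<lambda>x. app (\<lambda>y. F x y) (ghat g d)) (ghat g a))"
    by (simp add: split_ghat[OF g] app_ssum[OF b] app_tensv[OF b])
  finally show ?thesis .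
qed

lemma tensv_app:
  assumes F: "\<And>i. vge c (F i)" and G: "\<And>i. vge c' (G i)"
  shows "app (\<lambda>x. app (\<lambda>z. tensv (F x) (G z)) Y) X = tensv (app F X) (app G Y)"
proof -
  have b: "bdd F" "bdd G" using F G by (auto intro: bddI)
  obtain d where d: "vge d Y" using vge_ex by blast
  have T: "vge (c + c') (tensv (F x) (G z))" for x z
    unfolding tensv_def by (rule vge_app[OF F]) (simp add: G)
  have b2: "bdd (\<lambda>x. app (\<lambda>z. tensv (F x) (G z)) Y)" "bdd (\<lambda>z. tensv (F x) (G z))" for x
    by (auto intro!: bddI vge_app[OF d] T)
  show ?thesis
  proof (rule vec_eqI)
    fix q :: "'b \<times> 'd" obtain i j where q: "q = (i, j)" by (cases q)
    have "app (\<lambda>x. app (\<lambda>z. tensv (F x) (G z)) Y) X $ (i, j) =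
      nov_sum (\<lambda>x. X $ x * nov_sum (\<lambda>z. Y $ z * (F x $ i * G z $ j)))"
      by (simp add: vnth_app b2 vnth_tensv)
    also have "\<dots> = nov_sum (\<lambda>x. X $ x * (F x $ i * nov_sum (\<lambda>z. Y $ z * G z $ j)))"
      by (simp add: nov_sum_mult[OF cvg_app1[OF b(2)], symmetric] mult.left_commute)
    also have "\<dots> = nov_sum (\<lambda>z. Y $ z * G z $ j) * nov_sum (\<lambda>x. X $ x * F x $ i)"
      by (subst nov_sum_mult[OF cvg_app1[OF b(1)], symmetric]) (simp only: mult_ac)
    finally show "app (\<lambda>x. app (\<lambda>z. tensv (F x) (G z)) Y) X $ q = tensv (app F X) (app G Y) $ q"
      by (simp add: q vnth_tensv vnth_app b mult.commute)
  qed
qed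

lemma hat_singleton: "hat f w [b] = f w b"
proof -
  have "hat f w [b] = ssum w (\<lambda>p q. if q = [] then f p b else 0)"
    unfolding hat_ssum by (rule ssum_cong) simp
  then show ?thesis by (simp only: ssum_Nil2)
qed

lemma good_comp:
  assumes f: "good f" and g: "good g" shows "good (\<lambda>w. app f (ghat g w))"
proof -
  obtain \<epsilon> where e: "\<epsilon> > 0" "vge \<epsilon> (f [])" using f by (auto simp: good_def)
  obtain \<delta> where d: "\<delta> > 0" "vge \<delta> (g [])" using g by (auto simp: good_def)
  have b: "bdd f" using f by (auto simp: good_def intro: bddI)
  have "vge 0 (app f (ghat g w))" for w
    using f by (intro vge_app_left vge_ghat g) (auto simp: good_def)
  moreover have "vge (min \<epsilon> \<delta>) (app f (ghat g []))"
    unfolding vge_def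
  proof
    fix i
    have "app f (ghat g []) $ i = nov_sum (\<lambda>x. ghat g [] $ x * f x $ i)" by (simp add: vnth_app b)
    also have "\<dots> \<in> energy_ge (min \<epsilon> \<delta>)"
    proof (rule nov_sum_ge[OF cvg_app1[OF b]])
      fix x
      \<comment> \<open>The positive energy of the composite at the empty word has two sources:
        f_0(1) if the intermediate word is empty, and g_0(1) for each of its letters
        otherwise.\<close>
      show "ghat g [] $ x * f x $ i \<in> energy_ge (min \<epsilon> \<delta>)"
      proof (cases x)
        case Nil
        then show ?thesis using e vge_ghat[OF g] by (auto simp: vge_def intro!: energy_ge_mult'[of _ 0 _ \<epsilon>])
      next
        case (Cons b y)
        have "ghat g [] $ x \<in> energy_ge (\<delta> * (real (length x) - real (length ([] :: 'c list))))"
          unfolding vnth_ghat[OF g] using g d by (intro hat_ge) (auto simp: good_def vge_def)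
        moreover have "\<delta> \<le> \<delta> * (real (length x) - real (length ([] :: 'c list)))" using Cons d(1) by simp
        ultimately have "ghat g [] $ x \<in> energy_ge \<delta>" using energy_ge_mono by blast
        moreover have "f x $ i \<in> energy_ge 0" using f by (auto simp: good_def vge_def)
        ultimately show ?thesis by (rule energy_ge_mult') simp
      qed
    qed
    finally show "app f (ghat g []) $ i \<in> energy_ge (min \<epsilon> \<delta>)" .
  qed
  ultimately show ?thesis unfolding good_def using e(1) d(1) by (meson min_less_iff_conj)
qed

text \<open>Both sides are coalgebra maps with the same corestriction. The induction on the output
  word cuts off its first letter with the comultiplication.\<close>

lemma ghat_comp:
  assumes f: "good f" and g: "good g"
  shows "app (ghat f) (ghat g u) = ghat (\<lambda>w. app f (ghat g w)) u"
proof (rule vec_eqI)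
  fix y
  have b: "bdd f" "bdd (ghat f)" "bdd (\<lambda>x. ghat f x)"
    using f bdd_ghat[OF f] by (auto simp: good_def intro: bddI)
  have T: "vge 0 (tensv (ghat f p) (ghat f q))" for p q
    unfolding tensv_def by (intro vge_app_left vge_ghat f) simp
  show "app (ghat f) (ghat g u) $ y = ghat (\<lambda>w. app f (ghat g w)) u $ y"
    unfolding vnth_ghat[OF good_comp[OF f g]]
  proof (induction y arbitrary: u)
    case Nil
    have "app (ghat f) (ghat g u) $ [] = nov_sum (\<lambda>x. ghat g u $ x * (if x = [] then 1 else 0))"
      by (simp add: vnth_app b vnth_ghat[OF f])
    also have "\<dots> = ghat g u $ []" by (subst nov_sum_single[of "[]"]) auto
    finally show ?case by (simp add: vnth_ghat[OF g])
  next
    case (Cons c y)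
    have "app (ghat f) (ghat g u) $ (c # y) = app (\<lambda>x. ssum x (\<lambda>a b. unitv (a, b))) (app (ghat f) (ghat g u)) $ ([c], y)"
      by (simp add: vnth_app_split)
    also have "\<dots> = app (\<lambda>x. ssum x (\<lambda>p q. tensv (ghat f p) (ghat f q))) (ghat g u) $ ([c], y)"
      by (simp add: app_app[OF b(2) bdd_split] split_ghat[OF f])
    also have "\<dots> = ssum u (\<lambda>p q. app (ghat f) (ghat g p) $ [c] * app (ghat f) (ghat g q) $ y)"
      by (simp add: ghat_coalg[OF g, of 0] T tensv_app[of 0 _ 0] vge_ghat[OF f] vnth_ssum vnth_tensv)
    also have "\<dots> = ssum u (\<lambda>p q. app f (ghat g p) $ c * hat (\<lambda>w. vnth (app f (ghat g w))) q y)"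
    proof -
      have "app (ghat f) (ghat g p) $ [c] = app f (ghat g p) $ c" for p
        by (simp only: vnth_app[OF b(1)] vnth_app[OF b(2)] vnth_ghat[OF f] hat_singleton)
      then show ?thesis by (simp only: Cons.IH)
    qed
    finally show ?case by (simp only: hat_ssum)
  qed
qed

definition idg :: "'a list \<Rightarrow> 'a vec" where
  "idg w = (case w of [b] \<Rightarrow> unitv b | _ \<Rightarrow> 0)"

lemma good_idg: "good idg"
  by (auto simp: good_def idg_def split: list.splits intro!: exI[of _ 1])

lemma vnth_idg: "idg w $ b = kron w [b]"
  by (auto simp: idg_def kron_def vnth_unitv split: list.splits)

lemma ghat_idg: "ghat idg w = unitv w"
proof (rule vec_eqI)
  fix y
  have "hat (\<lambda>w. vnth (idg w)) w y = kron w y"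
  proof (induction y arbitrary: w)
    case (Cons b y)
    have "hat (\<lambda>w. vnth (idg w)) w (b # y) = ssum w (\<lambda>p q. if p = [b] \<and> q = y then 1 else 0)"
      unfolding hat_ssum Cons.IH by (rule ssum_cong) (simp add: vnth_idg kron_def)
    then show ?case using ssum_kron[of w "[b]" y "\<lambda>_ _. 1"] by (simp add: kron_def)
  qed (simp add: kron_def)
  then show "ghat idg w $ y = unitv w $ y" by (simp add: vnth_ghat good_idg vnth_unitv)
qed

lemma par_ghat:
  assumes g: "good g" and p: "\<And>w. par d' (wd d w) (g w)"
  shows "par (wd d') (wd d w) (ghat g w)"
  unfolding par_def vnth_ghat[OF g]
proof (intro allI impI)
  fix y show "hat (\<lambda>w. vnth (g w)) w y \<noteq> 0 \<Longrightarrow> even (wd d' y - wd d w)"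
  proof (induction y arbitrary: w)
    case (Cons b y)
    have "\<exists>i\<le>length w. g (take i w) $ b * hat (\<lambda>w. vnth (g w)) (drop i w) y \<noteq> 0"
    proof (rule ccontr)
      assume "\<not> ?thesis"
      then have "hat (\<lambda>w. vnth (g w)) w (b # y) = 0" unfolding hat.simps by (intro sum.neutral) auto
      with Cons.prems show False by simp
    qed
    then obtain i where i: "i \<le> length w" "g (take i w) $ b \<noteq> 0" "hat (\<lambda>w. vnth (g w)) (drop i w) y \<noteq> 0"
      by (metis mult_zero_left mult_zero_right)
    have "wd d w = wd d (take i w) + wd d (drop i w)" using wd_simps(3)[of d "take i w" "drop i w"] by simp
    moreover have "even (d' b - wd d (take i w))" using p i(2) by (auto simp: par_def)
    ultimately show ?case using Cons.IH[OF i(3)] by auto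
  qed (auto split: if_splits)
qed

section \<open>Bimodules, homomorphisms and pull-backs\<close>

definition supv :: "'i set \<Rightarrow> 'i vec \<Rightarrow> bool" where
  "supv X x \<longleftrightarrow> (\<forall>i. x $ i \<noteq> 0 \<longrightarrow> i \<in> X)"

lemma supv_0 [simp]: "supv X 0" by (simp add: supv_def)
lemma supv_add: "supv X x \<Longrightarrow> supv X y \<Longrightarrow> supv X (x + y)"
  unfolding supv_def by (metis add_0 vnth_add)
lemma supv_scale: "supv X x \<Longrightarrow> supv X (a *v x)"
  unfolding supv_def by (metis mult_zero_right vnth_scale)
lemma supv_unitv [simp]: "supv X (unitv i) \<longleftrightarrow> i \<in> X"
proof -
  have "unitv i $ j \<noteq> 0 \<longleftrightarrow> j = i" for j by (auto simp: vnth_unitv kron_def)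
  then show ?thesis by (auto simp: supv_def)
qed
lemma supv_ssum: "(\<And>a b. a @ b = u \<Longrightarrow> supv X (f a b)) \<Longrightarrow> supv X (ssum u f)"
  by (induction u arbitrary: f) (simp_all add: supv_add)
lemma nov_sum_neq_0: "nov_sum f \<noteq> 0 \<Longrightarrow> \<exists>i. f i \<noteq> 0"
proof (rule ccontr)
  assume "nov_sum f \<noteq> 0" "\<nexists>i. f i \<noteq> 0"
  then have "f = (\<lambda>_. 0)" by auto
  with \<open>nov_sum f \<noteq> 0\<close> show False by simp
qed
lemma vnth_app_neq_0: "bdd D \<Longrightarrow> app D x $ j \<noteq> 0 \<Longrightarrow> \<exists>i. x $ i \<noteq> 0 \<and> D i $ j \<noteq> 0"
  unfolding vnth_app by (drule nov_sum_neq_0) (metis mult_zero_left mult_zero_right)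
lemma supv_app: "bdd D \<Longrightarrow> supv X x \<Longrightarrow> (\<And>i. i \<in> X \<Longrightarrow> supv Y (D i)) \<Longrightarrow> supv Y (app D x)"
  unfolding supv_def using vnth_app_neq_0[of D x] by blast
lemma supv_push: "supv X x \<Longrightarrow> (\<And>i. i \<in> X \<Longrightarrow> f i \<in> Y) \<Longrightarrow> supv Y (app (\<lambda>i. unitv (f i)) x)"
  by (rule supv_app) auto
lemma app_cong_supv: "supv X x \<Longrightarrow> (\<And>i. i \<in> X \<Longrightarrow> D i = D' i) \<Longrightarrow> app D x = app D' x"
  by (rule app_cong_nz) (auto simp: supv_def)

lemma par_app: "bdd D \<Longrightarrow> par d k x \<Longrightarrow> (\<And>i. par d' (d i + s) (D i)) \<Longrightarrow> par d' (k + s) (app D x)"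
proof -
  assume *: "bdd D" "par d k x" "\<And>i. par d' (d i + s) (D i)"
  show ?thesis unfolding par_def
  proof (intro allI impI)
    fix j assume "app D x $ j \<noteq> 0"
    then obtain i where "x $ i \<noteq> 0" "D i $ j \<noteq> 0" using vnth_app_neq_0[OF *(1)] by blast
    then have "even (d i - k)" "even (d' j - (d i + s))" using *(2,3) by (auto simp: par_def)
    then show "even (d' j - (k + s))" by auto
  qed
qed

text \<open>Vector form of a filtered algebra. The operations are total functions of the word, while
  \<open>alg\<close> and \<open>ahom\<close> impose the differential identities on basis words
  only.\<close>

record 'a valg =
  ad :: "'a \<Rightarrow> int"
  am :: "'a list \<Rightarrow> 'a vec"
  aX :: "'a set"

record ('a, 'v, 'b) vbim =
  bv :: "'v \<Rightarrow> int"
  bn :: "'a list \<times> 'v \<times> 'b list \<Rightarrow> 'v vec"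
  bV :: "'v set"

definition abar :: "'a valg \<Rightarrow> 'a list \<Rightarrow> 'a list vec" where
  "abar A = bar (ad A) (am A)"

definition alg :: "'a valg \<Rightarrow> bool" where
  "alg A \<longleftrightarrow> (\<forall>w. vge 0 (am A w)) \<and> (\<forall>w. par (ad A) (wd (ad A) w + 1) (am A w)) \<and>
     (\<forall>w. supv (aX A) (am A w)) \<and> (\<forall>w\<in>lists (aX A). app (abar A) (abar A w) = 0)"

definition ahom :: "'a valg \<Rightarrow> 'b valg \<Rightarrow> ('a list \<Rightarrow> 'b vec) \<Rightarrow> bool" where
  "ahom A B g \<longleftrightarrow> good g \<and> (\<forall>w. par (ad B) (wd (ad A) w) (g w)) \<and> (\<forall>w\<in>lists (aX A). supv (aX B) (g w)) \<and>
     (\<forall>w\<in>lists (aX A). app (ghat g) (abar A w) = app (abar B) (ghat g w))"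

definition tbas :: "'a valg \<Rightarrow> 'b valg \<Rightarrow> ('a, 'v, 'b) vbim \<Rightarrow> ('a list \<times> 'v \<times> 'b list) set" where
  "tbas A1 A0 M = lists (aX A1) \<times> bV M \<times> lists (aX A0)"

definition tdeg :: "'a valg \<Rightarrow> 'b valg \<Rightarrow> ('v \<Rightarrow> int) \<Rightarrow> 'a list \<times> 'v \<times> 'b list \<Rightarrow> int" where
  "tdeg A1 A0 dv = (\<lambda>(u, v, w). wd (ad A1) u + dv v + wd (ad A0) w)"

definition tB :: "'a valg \<Rightarrow> 'b valg \<Rightarrow> ('v \<Rightarrow> int) \<Rightarrow> 'a list \<times> 'v \<times> 'b list \<Rightarrow> ('a list \<times> 'v \<times> 'b list) vec" where
  "tB A1 A0 dv = Bd (ad A1) dv (ad A0) (am A1) (am A0)"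

definition tD :: "'a valg \<Rightarrow> 'b valg \<Rightarrow> ('a, 'v, 'b) vbim \<Rightarrow> 'a list \<times> 'v \<times> 'b list \<Rightarrow> ('a list \<times> 'v \<times> 'b list) vec" where
  "tD A1 A0 M t = tB A1 A0 (bv M) t + bhat 1 (ad A1) (bn M) t"

definition fam :: "'a valg \<Rightarrow> 'b valg \<Rightarrow> ('v \<Rightarrow> int) \<Rightarrow> ('u \<Rightarrow> int) \<Rightarrow> 'u set \<Rightarrow> int \<Rightarrow>
    ('a list \<times> 'v \<times> 'b list \<Rightarrow> 'u vec) \<Rightarrow> bool" where
  "fam A1 A0 dv du U s \<alpha> \<longleftrightarrow> bdd \<alpha> \<and> (\<forall>t. par du (tdeg A1 A0 dv t + s) (\<alpha> t)) \<and> (\<forall>t. supv U (\<alpha> t))"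

definition bim :: "'a valg \<Rightarrow> 'b valg \<Rightarrow> ('a, 'v, 'b) vbim \<Rightarrow> bool" where
  "bim A1 A0 M \<longleftrightarrow> (\<forall>t. vge 0 (bn M t)) \<and> fam A1 A0 (bv M) (bv M) (bV M) 1 (bn M) \<and>
     (\<forall>t\<in>tbas A1 A0 M. app (tD A1 A0 M) (tD A1 A0 M t) = 0)"

text \<open>The tensor product of the two coalgebra maps with the identity of the module in the
  middle; it changes the outer words only.\<close>

fun Gh :: "('a list \<Rightarrow> 'c vec) \<Rightarrow> ('b list \<Rightarrow> 'd vec) \<Rightarrow> 'a list \<times> 'v \<times> 'b list \<Rightarrow> ('c list \<times> 'v \<times> 'd list) vec" where
  "Gh g1 g0 (u, v, w) = app (\<lambda>x. app (\<lambda>z. unitv (x, v, z)) (ghat g0 w)) (ghat g1 u)"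

text \<open>The map of bar constructions induced by \<phi> over (f1, f0) is factored as the comodule
  map \<open>bhat 0\<close> over the old algebras followed by the change of outer words
  \<open>Gh\<close>.\<close>

definition fhom :: "'a valg \<Rightarrow> 'b valg \<Rightarrow> ('a, 'v, 'b) vbim \<Rightarrow> 'c valg \<Rightarrow> 'd valg \<Rightarrow> ('c, 'u, 'd) vbim \<Rightarrow>
    ('a list \<Rightarrow> 'c vec) \<Rightarrow> ('b list \<Rightarrow> 'd vec) \<Rightarrow> ('a list \<times> 'v \<times> 'b list \<Rightarrow> 'u vec) \<Rightarrow> bool" where
  "fhom A1 A0 M B1 B0 N f1 f0 \<phi> \<longleftrightarrow> fam A1 A0 (bv M) (bv N) (bV N) 0 \<phi> \<and>
     (\<forall>t\<in>tbas A1 A0 M. app (Gh f1 f0) (app (bhat 0 (ad A1) \<phi>) (tD A1 A0 M t)) =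
        app (tD B1 B0 N) (app (Gh f1 f0) (bhat 0 (ad A1) \<phi> t)))"

text \<open>Restriction along algebra homomorphisms: the module stays, and its operations are
  applied after the outer words have been mapped.\<close>

definition pull :: "('a list \<Rightarrow> 'c vec) \<Rightarrow> ('b list \<Rightarrow> 'd vec) \<Rightarrow> ('c, 'v, 'd) vbim \<Rightarrow> ('a, 'v, 'b) vbim" where
  "pull g1 g0 M = \<lparr>bv = bv M, bn = \<lambda>t. app (bn M) (Gh g1 g0 t), bV = bV M\<rparr>"

lemma pull_sel [simp]: "bv (pull g1 g0 M) = bv M" "bV (pull g1 g0 M) = bV M"
  "bn (pull g1 g0 M) = (\<lambda>t. app (bn M) (Gh g1 g0 t))"
  by (simp_all add: pull_def)

lemma vge_abar: "alg A \<Longrightarrow> vge 0 (abar A w)"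
  by (simp add: abar_def alg_def vge_bar)

lemma bdd_abar: "alg A \<Longrightarrow> bdd (\<lambda>x. abar A (f x))"
  by (rule bddI[of 0]) (rule vge_abar)

lemma par_abar: "alg A \<Longrightarrow> par (wd (ad A)) (wd (ad A) w + 1) (abar A w)"
  by (simp add: abar_def alg_def par_bar)

lemma supv_abar: "alg A \<Longrightarrow> w \<in> lists (aX A) \<Longrightarrow> supv (lists (aX A)) (abar A w)"
  unfolding abar_def bar_def
proof (intro supv_ssum supv_scale)
  fix a x b c assume *: "alg A" "w \<in> lists (aX A)" "a @ x = w" "b @ c = x"
  show "supv (lists (aX A)) (app (\<lambda>y. unitv (a @ y # c)) (am A b))"
    by (rule supv_push[of "aX A"]) (use * in \<open>auto simp: alg_def\<close>)
qed

lemma tB_simps: "tB A1 A0 dv (u, v, w) = app (\<lambda>x. unitv (x, v, w)) (abar A1 u) +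
     ksign (wd (ad A1) u + dv v) *v app (\<lambda>x. unitv (u, v, x)) (abar A0 w)"
  by (simp add: tB_def abar_def)

lemma vge_tB: "alg A1 \<Longrightarrow> alg A0 \<Longrightarrow> vge 0 (tB A1 A0 dv t)"
  unfolding tB_def by (rule vge_Bd) (auto simp: alg_def)

lemma vge_tD: "alg A1 \<Longrightarrow> alg A0 \<Longrightarrow> (\<And>t. vge 0 (bn M t)) \<Longrightarrow> vge 0 (tD A1 A0 M t)"
  unfolding tD_def by (intro vge_add vge_tB vge_bhat)

lemma bdd_tB: "alg A1 \<Longrightarrow> alg A0 \<Longrightarrow> bdd (tB A1 A0 dv)"
  by (rule bddI[of 0]) (rule vge_tB)

lemma bdd_tD: "alg A1 \<Longrightarrow> alg A0 \<Longrightarrow> (\<And>t. vge 0 (bn M t)) \<Longrightarrow> bdd (tD A1 A0 M)"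
  by (rule bddI[of 0]) (rule vge_tD)

lemma bdd_bhat: "bdd \<alpha> \<Longrightarrow> bdd (bhat s d \<alpha>)"
  unfolding bdd_def using vge_bhat by blast

lemma famD:
  assumes "fam A1 A0 dv du U s \<alpha>"
  shows "bdd \<alpha>" "par du (tdeg A1 A0 dv t + s) (\<alpha> t)" "supv U (\<alpha> t)" "bpar (ad A1) dv (ad A0) du s \<alpha>"
proof -
  show "bdd \<alpha>" "par du (tdeg A1 A0 dv t + s) (\<alpha> t)" for t
    using assms unfolding fam_def by blast+
  then show "bpar (ad A1) dv (ad A0) du s \<alpha>" using assms by (auto simp: bpar_def tdeg_def fam_def)
  show "supv U (\<alpha> t)" using assms unfolding fam_def by blast
qed

lemma algD:
  assumes "alg A"
  shows "vge 0 (am A w)" "par (ad A) (wd (ad A) w + 1) (am A w)" "supv (aX A) (am A w)"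
    "w \<in> lists (aX A) \<Longrightarrow> app (abar A) (abar A w) = 0"
  using assms by (auto simp: alg_def)

lemma supv_tB:
  assumes "alg A1" "alg A0" "t \<in> tbas A1 A0 M" shows "supv (tbas A1 A0 M) (tB A1 A0 dv t)"
proof -
  obtain u v w where t: "t = (u, v, w)" by (cases t)
  have "supv (tbas A1 A0 M) (app (\<lambda>x. unitv (x, v, w)) (abar A1 u))"
    by (rule supv_push[OF supv_abar[OF assms(1)]]) (use assms(3) t in \<open>auto simp: tbas_def\<close>)
  moreover have "supv (tbas A1 A0 M) (app (\<lambda>x. unitv (u, v, x)) (abar A0 w))"
    by (rule supv_push[OF supv_abar[OF assms(2)]]) (use assms(3) t in \<open>auto simp: tbas_def\<close>)
  ultimately show ?thesis by (simp add: t tB_simps supv_add supv_scale)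
qed

lemma supv_bhat:
  assumes "\<And>t. supv (bV N) (\<alpha> t)" "t \<in> tbas A1 A0 M" shows "supv (tbas A1 A0 N) (bhat s d \<alpha> t)"
proof -
  obtain u v w where t: "t = (u, v, w)" by (cases t)
  show ?thesis unfolding t bhat.simps
  proof (intro supv_ssum supv_scale)
    fix a b c e assume "a @ b = u" "c @ e = w"
    then show "supv (tbas A1 A0 N) (app (\<lambda>y. unitv (a, y, e)) (\<alpha> (b, v, c)))"
      by (intro supv_push[OF assms(1)]) (use assms(2) t in \<open>auto simp: tbas_def\<close>)
  qed
qed

lemma supv_tD:
  assumes "alg A1" "alg A0" "\<And>t. supv (bV M) (bn M t)" "t \<in> tbas A1 A0 M"
  shows "supv (tbas A1 A0 M) (tD A1 A0 M t)"
  unfolding tD_def using assms by (intro supv_add supv_tB supv_bhat)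

lemma bhat_cong:
  assumes "\<And>q. q \<in> tbas A1 A0 M \<Longrightarrow> \<alpha> q = \<beta> q" "t \<in> tbas A1 A0 M"
  shows "bhat s d \<alpha> t = bhat s d \<beta> t"
proof -
  obtain u v w where t: "t = (u, v, w)" by (cases t)
  show ?thesis unfolding t bhat.simps
  proof (intro ssum_cong)
    fix a b c e assume "a @ b = u" "c @ e = w"
    then have "(b, v, c) \<in> tbas A1 A0 M" using assms(2) t by (auto simp: tbas_def)
    then show "ksign (s * wd d a) *v app (\<lambda>y. unitv (a, y, e)) (\<alpha> (b, v, c)) =
      ksign (s * wd d a) *v app (\<lambda>y. unitv (a, y, e)) (\<beta> (b, v, c))" by (simp add: assms(1))
  qed
qed

lemma bhat_0 [simp]: "bhat s d (\<lambda>_. 0) t = 0"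
  by (cases t) simp

text \<open>The algebras act on different tensor factors. The squares vanish separately, and the
  mixed terms cancel because the left differential changes the parity that the sign of the right one
  sees.\<close>

lemma tB_tB:
  assumes A: "alg A1" "alg A0" and t: "t \<in> tbas A1 A0 M" shows "app (tB A1 A0 dv) (tB A1 A0 dv t) = 0"
proof -
  obtain u v w where q: "t = (u, v, w)" by (cases t)
  have uw: "u \<in> lists (aX A1)" "w \<in> lists (aX A0)" using t by (auto simp: q tbas_def)
  note b = bdd_tB[OF A] bdd_abar[OF A(1)] bdd_abar[OF A(2)]
  have b': "bdd (\<lambda>x. app (\<lambda>y. unitv (f x y)) (abar A1 (g x)))"
    "bdd (\<lambda>x. app (\<lambda>y. unitv (f' x y)) (abar A0 (g' x)))" for f f' g g'
    by (auto intro!: bddI[of 0] vge_push vge_abar A)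
  have s: "app (\<lambda>x. ksign (wd (ad A1) x + dv v) *v app (\<lambda>z. unitv (x, v, z)) (abar A0 w)) (abar A1 u) =
    ksign (wd (ad A1) u + 1 + dv v) *v app (\<lambda>x. app (\<lambda>z. unitv (x, v, z)) (abar A0 w)) (abar A1 u)"
    by (rule app_par[OF par_abar[OF A(1)] b'(2)]) auto
  have s': "ksign (wd (ad A1) u + 1 + dv v) = - ksign (wd (ad A1) u + dv v)"
    by (auto simp: ksign_def)
  have 1: "app (\<lambda>x. tB A1 A0 dv (x, v, w)) (abar A1 u) =
     - (ksign (wd (ad A1) u + dv v) *v app (\<lambda>x. app (\<lambda>z. unitv (x, v, z)) (abar A0 w)) (abar A1 u))"
    unfolding tB_simps
    by (subst app_row_add) (auto intro!: b' bdd_scale simp: s s' app_app[symmetric] b algD(4)[OF A(1) uw(1)])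
  have 2: "app (\<lambda>z. tB A1 A0 dv (u, v, z)) (abar A0 w) =
     app (\<lambda>z. app (\<lambda>x. unitv (x, v, z)) (abar A1 u)) (abar A0 w)"
    unfolding tB_simps
    by (subst app_row_add) (auto intro!: b' bdd_scalec simp: app_row_scale[OF b'(2)] app_app[symmetric] b algD(4)[OF A(2) uw(2)])
  have "app (tB A1 A0 dv) (tB A1 A0 dv t) = app (\<lambda>x. tB A1 A0 dv (x, v, w)) (abar A1 u) +
    ksign (wd (ad A1) u + dv v) *v app (\<lambda>z. tB A1 A0 dv (u, v, z)) (abar A0 w)"
    unfolding q by (subst tB_simps) (simp add: app_add app_scale app_push b)
  also have "app (\<lambda>z. tB A1 A0 dv (u, v, z)) (abar A0 w) =
     app (\<lambda>x. app (\<lambda>z. unitv (x, v, z)) (abar A0 w)) (abar A1 u)"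
    unfolding 2 by (rule app_swap[of 0]) simp
  finally show ?thesis by (simp add: 1)
qed

lemma bhat_add:
  assumes "bdd \<alpha>" "bdd \<beta>" shows "bhat s d (\<lambda>q. \<alpha> q + \<beta> q) t = bhat s d \<alpha> t + bhat s d \<beta> t"
  by (cases t) (simp add: app_add vscale_add ssum_add)

lemma bhat_tB:
  assumes A: "alg A1" "alg A0" and f: "fam A1 A0 dv du U s \<alpha>"
  shows "app (bhat s (ad A1) \<alpha>) (tB A1 A0 dv t) = ksign s *v app (tB A1 A0 du) (bhat s (ad A1) \<alpha> t) +
    bhat (s + 1) (ad A1) (\<lambda>q. app \<alpha> (tB A1 A0 dv q)) t"
proof -
  obtain c where c: "\<And>t. vge c (\<alpha> t)" using famD(1)[OF f] by (auto simp: bdd_def)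
  show ?thesis unfolding tB_def
    by (rule bhat_Bd[of _ _ _ c]) (auto intro: c famD(4)[OF f] algD[OF A(1)] algD[OF A(2)])
qed

lemma bhat_bhat':
  assumes "bdd \<alpha>" "bdd \<beta>"
  shows "app (bhat t da \<beta>) (bhat s da \<alpha> q) = bhat (s + t) da (\<lambda>q. app \<beta> (bhat s da \<alpha> q)) q"
  using assms bhat_bhat unfolding bdd_def by blast

text \<open>By \<open>bhat_tB\<close> and \<open>bhat_bhat'\<close> the square is a comodule map,
  the two mixed terms cancelling up to a corestriction. So it vanishes as soon as its corestriction
  does.\<close>

lemma tD_tD:
  assumes A: "alg A1" "alg A0" and n: "\<And>t. vge 0 (bn M t)" and f: "fam A1 A0 (bv M) (bv M) (bV M) 1 (bn M)"
    and t: "t \<in> tbas A1 A0 M"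
  shows "app (tD A1 A0 M) (tD A1 A0 M t) = bhat 2 (ad A1) (\<lambda>q. app (bn M) (tD A1 A0 M q)) t"
proof -
  have b: "bdd (bn M)" using n by (rule bddI)
  note bs = b bdd_tB[OF A] bdd_bhat[OF b]
  have "app (tD A1 A0 M) (tD A1 A0 M t) = app (tB A1 A0 (bv M)) (tB A1 A0 (bv M) t) +
    app (tB A1 A0 (bv M)) (bhat 1 (ad A1) (bn M) t) + app (bhat 1 (ad A1) (bn M)) (tB A1 A0 (bv M) t) +
    app (bhat 1 (ad A1) (bn M)) (bhat 1 (ad A1) (bn M) t)"
    unfolding tD_def by (simp add: app_row_add app_add bs)
  also have "\<dots> = bhat 2 (ad A1) (\<lambda>q. app (bn M) (tB A1 A0 (bv M) q)) t +
      bhat 2 (ad A1) (\<lambda>q. app (bn M) (bhat 1 (ad A1) (bn M) q)) t"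
    by (simp add: tB_tB[OF A t] bhat_tB[OF A f] bhat_bhat' b ksign_def)
  also have "\<dots> = bhat 2 (ad A1) (\<lambda>q. app (bn M) (tD A1 A0 M q)) t"
    unfolding tD_def by (simp add: app_add bs bhat_add[symmetric] bdd_app)
  finally show ?thesis .
qed

lemma bimD:
  assumes "bim A1 A0 M"
  shows "vge 0 (bn M t)" "fam A1 A0 (bv M) (bv M) (bV M) 1 (bn M)" "bdd (bn M)"
    "t \<in> tbas A1 A0 M \<Longrightarrow> app (tD A1 A0 M) (tD A1 A0 M t) = 0"
  using assms unfolding bim_def fam_def by blast+

text \<open>Each side is \<open>tB\<close> of the image plus the extension of a family, so
  compatibility has to be checked only after corestriction.\<close>

lemma hom_chain:
  assumes A: "alg A1" "alg A0" and M: "\<And>t. vge 0 (bn M t)" and N: "\<And>t. vge 0 (bn N t)"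
    and f: "fam A1 A0 (bv M) (bv N) (bV N) 0 \<alpha>"
    and r: "\<And>t. t \<in> tbas A1 A0 M \<Longrightarrow> app \<alpha> (tD A1 A0 M t) = app (bn N) (bhat 0 (ad A1) \<alpha> t)"
    and t: "t \<in> tbas A1 A0 M"
  shows "app (bhat 0 (ad A1) \<alpha>) (tD A1 A0 M t) = app (tD A1 A0 N) (bhat 0 (ad A1) \<alpha> t)"
proof -
  have b: "bdd (bn M)" "bdd (bn N)" using bddI[OF M] bddI[OF N] .
  note bs = b bdd_tB[OF A] bdd_bhat[OF b(1)] bdd_bhat[OF b(2)] famD(1)[OF f] bdd_bhat[OF famD(1)[OF f]]
  have "app (bhat 0 (ad A1) \<alpha>) (tD A1 A0 M t) = app (tB A1 A0 (bv N)) (bhat 0 (ad A1) \<alpha> t) +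
    (bhat 1 (ad A1) (\<lambda>q. app \<alpha> (tB A1 A0 (bv M) q)) t + bhat 1 (ad A1) (\<lambda>q. app \<alpha> (bhat 1 (ad A1) (bn M) q)) t)"
    unfolding tD_def by (simp add: app_add bs bhat_tB[OF A f] bhat_bhat')
  also have "bhat 1 (ad A1) (\<lambda>q. app \<alpha> (tB A1 A0 (bv M) q)) t + bhat 1 (ad A1) (\<lambda>q. app \<alpha> (bhat 1 (ad A1) (bn M) q)) t =
     bhat 1 (ad A1) (\<lambda>q. app \<alpha> (tD A1 A0 M q)) t"
    unfolding tD_def by (simp add: app_add bs bhat_add[symmetric] bdd_app)
  also have "\<dots> = bhat 1 (ad A1) (\<lambda>q. app (bn N) (bhat 0 (ad A1) \<alpha> q)) t"
    by (rule bhat_cong[of A1 A0 M]) (simp_all add: r t)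
  also have "\<dots> = app (bhat 1 (ad A1) (bn N)) (bhat 0 (ad A1) \<alpha> t)"
    by (simp add: bhat_bhat' bs)
  finally show ?thesis unfolding tD_def by (simp add: app_row_add bs)
qed

text \<open>The algebra operations always leave their output letter in an outer word, which
  \<open>pr\<close> rejects.\<close>

lemma pr_tB: "alg A1 \<Longrightarrow> alg A0 \<Longrightarrow> app pr (tB A1 A0 dv t) = 0"
proof -
  assume A: "alg A1" "alg A0"
  obtain u v w where t: "t = (u, v, w)" by (cases t)
  have "app (\<lambda>x. pr (x, v, w)) (abar A1 u) = 0" "app (\<lambda>x. pr (u, v, x)) (abar A0 w) = 0"
    unfolding abar_def bar_def app_ssum[OF bdd_pr] app_scale[OF bdd_pr] app_push[OF bdd_pr] by simp_all
  then show ?thesis by (simp add: t tB_simps app_add app_scale app_push)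
qed

lemma pr_tD: "alg A1 \<Longrightarrow> alg A0 \<Longrightarrow> app pr (tD A1 A0 M t) = bn M t"
  by (simp add: tD_def app_add pr_tB pr_bhat)

section \<open>The change of outer words\<close>

lemma vge_Gh: "good g1 \<Longrightarrow> good g0 \<Longrightarrow> vge 0 (Gh g1 g0 t)"
  by (cases t) (auto intro!: vge_app_left vge_ghat vge_push)

lemma bdd_Gh: "good g1 \<Longrightarrow> good g0 \<Longrightarrow> bdd (\<lambda>x. Gh g1 g0 (f x))"
  by (rule bddI[of 0]) (rule vge_Gh)

lemma bdd_Gh': "good g1 \<Longrightarrow> good g0 \<Longrightarrow> bdd (Gh g1 g0)"
  by (rule bddI[of 0]) (rule vge_Gh)

lemma app_Gh:
  assumes g: "good g1" "good g0" and F: "\<And>t. vge c (F t)"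
  shows "app F (Gh g1 g0 (u, v, w)) = app (\<lambda>x. app (\<lambda>z. F (x, v, z)) (ghat g0 w)) (ghat g1 u)"
proof -
  have b: "bdd F" using F by (rule bddI)
  have b': "bdd (\<lambda>x. app (\<lambda>z. unitv (x, v, z)) (ghat g0 w))" by simp
  show ?thesis by (simp add: app_app b b' app_push)
qed

lemma par_Gh:
  assumes g: "good g1" "good g0" "\<And>w. par (ad B1) (wd (ad A1) w) (g1 w)" "\<And>w. par (ad B0) (wd (ad A0) w) (g0 w)"
  shows "par (tdeg B1 B0 dv) (tdeg A1 A0 dv t) (Gh g1 g0 t)"
proof -
  obtain u v w where t: "t = (u, v, w)" by (cases t)
  have "par (tdeg B1 B0 dv) (wd (ad A1) u + (dv v + wd (ad A0) w))
    (app (\<lambda>x. app (\<lambda>z. unitv (x, v, z)) (ghat g0 w)) (ghat g1 u))"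
    by (rule par_app[OF _ par_ghat[OF g(1,3)]], simp, rule par_push[OF par_ghat[OF g(2,4)]])
      (auto simp: tdeg_def)
  then show ?thesis by (simp add: t tdeg_def add.assoc)
qed

lemma supv_ghat:
  assumes g: "good g" and X: "\<And>w. w \<in> lists Y \<Longrightarrow> supv X (g w)" and w: "w \<in> lists Y"
  shows "supv (lists X) (ghat g w)"
  unfolding supv_def vnth_ghat[OF g]
proof (intro allI impI)
  fix y show "hat (\<lambda>w. vnth (g w)) w y \<noteq> 0 \<Longrightarrow> y \<in> lists X"
    using w
  proof (induction y arbitrary: w)
    case (Cons b y)
    have "\<exists>i\<le>length w. g (take i w) $ b * hat (\<lambda>w. vnth (g w)) (drop i w) y \<noteq> 0"
    proof (rule ccontr)
      assume "\<not> ?thesis"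
      then have "hat (\<lambda>w. vnth (g w)) w (b # y) = 0" unfolding hat.simps by (intro sum.neutral) auto
      with Cons.prems show False by simp
    qed
    then obtain i where i: "i \<le> length w" "g (take i w) $ b \<noteq> 0" "hat (\<lambda>w. vnth (g w)) (drop i w) y \<noteq> 0"
      by (metis mult_zero_left mult_zero_right)
    have "take i w \<in> lists Y" "drop i w \<in> lists Y"
      using Cons.prems(2) by (auto dest: in_set_takeD in_set_dropD)
    then show ?case using X[of "take i w"] Cons.IH[OF i(3)] i(2) by (auto simp: supv_def)
  qed simp
qed

lemma supv_Gh:
  assumes g: "good g1" "good g0" "\<And>w. w \<in> lists (aX A1) \<Longrightarrow> supv (aX B1) (g1 w)"
      "\<And>w. w \<in> lists (aX A0) \<Longrightarrow> supv (aX B0) (g0 w)"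
    and t: "t \<in> tbas A1 A0 M" and V: "bV M = bV N"
  shows "supv (tbas B1 B0 N) (Gh g1 g0 t)"
proof -
  obtain u v w where t': "t = (u, v, w)" by (cases t)
  have uw: "u \<in> lists (aX A1)" "w \<in> lists (aX A0)" "v \<in> bV N" using t t' V by (auto simp: tbas_def)
  show ?thesis unfolding t' Gh.simps
    by (rule supv_app[OF _ supv_ghat[OF g(1,3) uw(1)]], simp, simp,
        rule supv_push[OF supv_ghat[OF g(2,4) uw(2)]]) (use uw(3) in \<open>auto simp: tbas_def\<close>)
qed

lemma app_ghat_Nil:
  assumes "good g"
  shows "app (\<lambda>x. if x = [] then k else 0) (ghat g y) = (if y = [] then k else 0)"
proof (rule vec_eqI)
  fix i
  have "app (\<lambda>x. if x = [] then k else 0) (ghat g y) $ i =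
    nov_sum (\<lambda>x. ghat g y $ x * (if x = [] then k else 0) $ i)"
    by (rule vnth_app) (intro bdd_if bdd_const)
  also have "\<dots> = ghat g y $ [] * k $ i" by (subst nov_sum_single[of "[]"]) auto
  finally show "app (\<lambda>x. if x = [] then k else 0) (ghat g y) $ i = (if y = [] then k else 0) $ i"
    using assms by (simp add: vnth_ghat)
qed

text \<open>A coalgebra map has a nonzero coefficient at the empty output only on the empty input,
  so corestriction does not see the change of outer words.\<close>

lemma pr_Gh:
  fixes g1 :: "'a list \<Rightarrow> 'c vec"
  assumes g: "good g1" "good g0" shows "app pr (Gh g1 g0 t) = pr t"
proof -
  obtain u v w where t: "t = (u, v, w)" by (cases t)
  have "app (\<lambda>z. pr (x, v, z)) (ghat g0 w) = (if x = [] then if w = [] then unitv v else 0 else 0)" for x :: "'c list"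
  proof (cases "x = []")
    case True
    then show ?thesis using app_ghat_Nil[OF g(2), of "unitv v" w] by simp
  qed simp
  then have "app pr (Gh g1 g0 t) = app (\<lambda>x. if x = [] then if w = [] then unitv v else 0 else 0) (ghat g1 u)"
    unfolding t by (subst app_Gh[OF g, of 0], simp) (simp only:)
  also have "\<dots> = pr t" unfolding app_ghat_Nil[OF g(1)] by (auto simp: t)
  finally show ?thesis .
qed

lemma Gh_comp:
  assumes f: "good f1" "good f0" and g: "good g1" "good g0"
  shows "app (Gh f1 f0) (Gh g1 g0 t) = Gh (\<lambda>w. app f1 (ghat g1 w)) (\<lambda>w. app f0 (ghat g0 w)) t"
proof -
  obtain u v w where t: "t = (u, v, w)" by (cases t)
  have b: "bdd (ghat f1)" "bdd (ghat f0)" using bdd_ghat[OF f(1), of "\<lambda>x. x"] bdd_ghat[OF f(2), of "\<lambda>x. x"] by auto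
  have "app (Gh f1 f0) (Gh g1 g0 t) = app (\<lambda>x. app (\<lambda>z. app (\<lambda>x'. app (\<lambda>z'. unitv (x', v, z')) (ghat f0 z)) (ghat f1 x))
    (ghat g0 w)) (ghat g1 u)"
    unfolding t by (subst app_Gh[OF g, of 0], rule vge_Gh[OF f]) (simp only: Gh.simps)
  also have "\<dots> = app (\<lambda>x. app (\<lambda>x'. app (\<lambda>z. app (\<lambda>z'. unitv (x', v, z')) (ghat f0 z)) (ghat g0 w)) (ghat f1 x)) (ghat g1 u)"
    by (subst app_swap[of 0]) (auto intro!: vge_push vge_ghat f)
  also have "\<dots> = app (\<lambda>x. app (\<lambda>x'. app (\<lambda>z'. unitv (x', v, z')) (app (ghat f0) (ghat g0 w))) (ghat f1 x)) (ghat g1 u)"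
    by (simp add: app_app b)
  also have "\<dots> = app (\<lambda>x'. app (\<lambda>z'. unitv (x', v, z')) (app (ghat f0) (ghat g0 w))) (app (ghat f1) (ghat g1 u))"
    by (simp add: app_app[OF b(1)])
  finally show ?thesis by (simp add: t ghat_comp f g)
qed

lemma Gh_idg: "Gh idg idg t = unitv t"
  by (cases t) (simp add: ghat_idg)

text \<open>The outer words may be cut before or after they are mapped, since \<open>ghat\<close>
  respects deconcatenation, and the sign for passing the left word is unchanged because
  \<open>g1\<close> preserves parity. What \<alpha> then consumes are mapped words, as in the
  operations of the pull-back.\<close>

lemma Gh_bhat:
  assumes g: "good g1" "good g0" "\<And>w. par (ad B1) (wd (ad A1) w) (g1 w)"
    and a: "\<And>t. vge c (\<alpha> t)"
  shows "app (bhat s (ad B1) \<alpha>) (Gh g1 g0 t) = app (Gh g1 g0) (bhat s (ad A1) (\<lambda>t. app \<alpha> (Gh g1 g0 t)) t)"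
proof -
  obtain u v w where t: "t = (u, v, w)" by (cases t)
  have G: "bdd (Gh g1 g0)" using vge_Gh[OF g(1,2)] by (rule bddI)
  have GA: "vge c (app \<alpha> (Gh g1 g0 t))" for t by (intro vge_app_left vge_Gh g a)
  define K where "K a x e b z = app (\<lambda>y. unitv (a, y, e)) (\<alpha> (b, v, z))" for a x e b z
  \<comment> \<open>The common value of both sides for one choice of cuts: x and q are the outer
    words that \<alpha> leaves alone, y and p those that it consumes, all mapped by
    \<open>ghat\<close>.\<close>
  define I where "I x y p q = app (\<lambda>a. app (\<lambda>b. app (\<lambda>z. app (\<lambda>e. app (\<lambda>y. unitv (a, y, e)) (\<alpha> (b, v, z)))
     (ghat g0 q)) (ghat g0 p)) (ghat g1 y)) (ghat g1 x)" for x y p q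
  have vK: "vge c (app (\<lambda>y. unitv (f y)) (\<alpha> t))" for f t by (simp add: a)
  have vK1: "vge c (app (\<lambda>e. app (\<lambda>y. unitv (f e y)) (\<alpha> t)) (ghat g0 q))" for f t q
    by (intro vge_app_left vge_ghat g vK)
  have vK2: "vge c (app (\<lambda>z. app (\<lambda>e. app (\<lambda>y. unitv (f z e y)) (\<alpha> (t z))) (ghat g0 q)) (ghat g0 p))" for f t q p
    by (intro vge_app_left vge_ghat g vK)
  have vK3: "vge c (app (\<lambda>b. app (\<lambda>z. app (\<lambda>e. app (\<lambda>y. unitv (f b z e y)) (\<alpha> (t b z))) (ghat g0 q)) (ghat g0 p)) (ghat g1 r))"
    for f t q p r
    by (intro vge_app_left vge_ghat g vK)
  have "app (bhat s (ad B1) \<alpha>) (Gh g1 g0 t) =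
    app (\<lambda>x. app (\<lambda>z. bhat s (ad B1) \<alpha> (x, v, z)) (ghat g0 w)) (ghat g1 u)"
    unfolding t by (rule app_Gh[OF g(1,2) vge_bhat[OF a]])
  also have "\<dots> = app (\<lambda>x. ssum x (\<lambda>a b. app (\<lambda>z. ssum z (\<lambda>p e. ksign (s * wd (ad B1) a) *v
      app (\<lambda>y. unitv (a, y, e)) (\<alpha> (b, v, p)))) (ghat g0 w))) (ghat g1 u)"
    by (simp only: bhat.simps) (subst app_row_ssum[of c], simp add: a, rule refl)
  also have "\<dots> = app (\<lambda>x. ssum x (\<lambda>a b. ssum w (\<lambda>p q. ksign (s * wd (ad B1) a) *v
      app (\<lambda>z. app (\<lambda>e. app (\<lambda>y. unitv (a, y, e)) (\<alpha> (b, v, z))) (ghat g0 q)) (ghat g0 p)))) (ghat g1 u)"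
  proof -
    have "app (\<lambda>z. app (\<lambda>e. ksign (s * wd (ad B1) a) *v app (\<lambda>y. unitv (a, y, e)) (\<alpha> (b, v, z))) (ghat g0 q)) (ghat g0 p) =
      ksign (s * wd (ad B1) a) *v app (\<lambda>z. app (\<lambda>e. app (\<lambda>y. unitv (a, y, e)) (\<alpha> (b, v, z))) (ghat g0 q)) (ghat g0 p)"
      for a b p q
      by (subst app_row_scale, rule bddI[of c], rule vK, subst app_row_scale, rule bddI[of c], rule vK1, rule refl)
    then show ?thesis by (subst ghat_coalg[OF g(2), of c]) (simp_all add: a)
  qed
  also have "\<dots> = ssum u (\<lambda>x y. ssum w (\<lambda>p q. ksign (s * wd (ad A1) x) *v I x y p q))"
  proof (subst ghat_coalg[OF g(1), of c], simp add: vK2, rule ssum_cong)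
    fix x y
    have "app (\<lambda>a. app (\<lambda>b. ssum w (\<lambda>p q. ksign (s * wd (ad B1) a) *v
        app (\<lambda>z. app (\<lambda>e. app (\<lambda>y. unitv (a, y, e)) (\<alpha> (b, v, z))) (ghat g0 q)) (ghat g0 p))) (ghat g1 y)) (ghat g1 x) =
      app (\<lambda>a. ssum w (\<lambda>p q. ksign (s * wd (ad B1) a) *v
        app (\<lambda>b. app (\<lambda>z. app (\<lambda>e. app (\<lambda>y. unitv (a, y, e)) (\<alpha> (b, v, z))) (ghat g0 q)) (ghat g0 p)) (ghat g1 y))) (ghat g1 x)"
      by (subst app_row_ssum[of c], simp add: vK2, subst app_row_scale, rule bddI[of c], rule vK2, rule refl)
    also have "\<dots> = ssum w (\<lambda>p q. app (\<lambda>a. ksign (s * wd (ad B1) a) *v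
        app (\<lambda>b. app (\<lambda>z. app (\<lambda>e. app (\<lambda>y. unitv (a, y, e)) (\<alpha> (b, v, z))) (ghat g0 q)) (ghat g0 p)) (ghat g1 y)) (ghat g1 x))"
      by (subst app_row_ssum[of c], simp add: vK3, rule refl)
    also have "\<dots> = ssum w (\<lambda>p q. ksign (s * wd (ad A1) x) *v I x y p q)"
    proof (rule ssum_cong)
      fix p q
      show "app (\<lambda>a. ksign (s * wd (ad B1) a) *v
        app (\<lambda>b. app (\<lambda>z. app (\<lambda>e. app (\<lambda>y. unitv (a, y, e)) (\<alpha> (b, v, z))) (ghat g0 q)) (ghat g0 p)) (ghat g1 y)) (ghat g1 x)
        = ksign (s * wd (ad A1) x) *v I x y p q"
        unfolding I_def
        by (rule app_par[OF par_ghat[OF g(1) g(3)]], rule bddI[of c], rule vK3)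
          (metis dvd_mult right_diff_distrib)
    qed
    finally show "app (\<lambda>a. app (\<lambda>b. ssum w (\<lambda>p q. ksign (s * wd (ad B1) a) *v
        app (\<lambda>z. app (\<lambda>e. app (\<lambda>y. unitv (a, y, e)) (\<alpha> (b, v, z))) (ghat g0 q)) (ghat g0 p))) (ghat g1 y)) (ghat g1 x) =
        ssum w (\<lambda>p q. ksign (s * wd (ad A1) x) *v I x y p q)" .
  qed
  also have "\<dots> = ssum u (\<lambda>x y. ssum w (\<lambda>p q. ksign (s * wd (ad A1) x) *v
      app (\<lambda>y. Gh g1 g0 (x, y, q)) (app \<alpha> (Gh g1 g0 (y, v, p)))))"
  proof (intro ssum_cong arg_cong[of _ _ "vscale _"])
    fix x y p q
    have b: "bdd (\<lambda>y. Gh g1 g0 (x, y, q))" by (rule bddI[of 0]) (rule vge_Gh[OF g(1,2)])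
    have v: "vge 0 (app (\<lambda>e. unitv (a, y, e)) (ghat g0 q))" for a and y :: 'v
      by (intro vge_push vge_ghat g)
    have v': "vge c (app (\<lambda>y. app (\<lambda>e. unitv (a, y, e)) (ghat g0 q)) (\<alpha> t))" for a t
      by (intro vge_app_right v a)
    have "app (\<lambda>y. Gh g1 g0 (x, y, q)) (app \<alpha> (Gh g1 g0 (y, v, p))) =
      app (\<lambda>b. app (\<lambda>z. app (\<lambda>y. app (\<lambda>a. app (\<lambda>e. unitv (a, y, e)) (ghat g0 q)) (ghat g1 x)) (\<alpha> (b, v, z))) (ghat g0 p)) (ghat g1 y)"
      unfolding app_app[OF bddI[OF a] b]
      by (subst app_Gh[OF g(1,2), of c], rule vge_app_right[OF a vge_Gh[OF g(1,2)]]) simp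
    also have "\<dots> = app (\<lambda>b. app (\<lambda>z. app (\<lambda>a. app (\<lambda>y. app (\<lambda>e. unitv (a, y, e)) (ghat g0 q)) (\<alpha> (b, v, z))) (ghat g1 x)) (ghat g0 p)) (ghat g1 y)"
      by (subst app_swap[of 0], rule v, rule refl)
    also have "\<dots> = app (\<lambda>b. app (\<lambda>a. app (\<lambda>z. app (\<lambda>y. app (\<lambda>e. unitv (a, y, e)) (ghat g0 q)) (\<alpha> (b, v, z))) (ghat g0 p)) (ghat g1 x)) (ghat g1 y)"
      by (subst app_swap[of c], rule v', rule refl)
    also have "\<dots> = app (\<lambda>a. app (\<lambda>b. app (\<lambda>z. app (\<lambda>y. app (\<lambda>e. unitv (a, y, e)) (ghat g0 q)) (\<alpha> (b, v, z))) (ghat g0 p)) (ghat g1 y)) (ghat g1 x)"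
      by (subst app_swap[of c], rule vge_app_left[OF vge_ghat[OF g(2)] v'], rule refl)
    also have "\<dots> = I x y p q"
      unfolding I_def by (subst (2) app_swap[of 0]) simp_all
    finally show "I x y p q = app (\<lambda>y. Gh g1 g0 (x, y, q)) (app \<alpha> (Gh g1 g0 (y, v, p)))" ..
  qed
  also have "\<dots> = app (Gh g1 g0) (bhat s (ad A1) (\<lambda>t. app \<alpha> (Gh g1 g0 t)) t)"
    by (simp only: t bhat.simps app_ssum[OF G] app_scale[OF G] app_push[OF G])
  finally show ?thesis .
qed

text \<open>Each outer word is treated by the chain property of its own coalgebra map; the sign in
  front of the right-hand differential depends on the left word only through its parity.\<close>

lemma Gh_tB:
  assumes A: "alg A1" "alg A0" "alg B1" "alg B0" and h: "ahom A1 B1 g1" "ahom A0 B0 g0" and t: "t \<in> tbas A1 A0 M"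
  shows "app (tB B1 B0 dv) (Gh g1 g0 t) = app (Gh g1 g0) (tB A1 A0 dv t)"
proof -
  obtain u v w where q: "t = (u, v, w)" by (cases t)
  have g: "good g1" "good g0" "\<And>w. par (ad B1) (wd (ad A1) w) (g1 w)" using h by (auto simp: ahom_def)
  have c: "app (ghat g1) (abar A1 u) = app (abar B1) (ghat g1 u)" "app (ghat g0) (abar A0 w) = app (abar B0) (ghat g0 w)"
    using h t by (auto simp: ahom_def tbas_def q)
  note b = bdd_Gh'[OF g(1,2)] bdd_ghat[OF g(1), of "\<lambda>x. x"] bdd_ghat[OF g(2), of "\<lambda>x. x"]
    bdd_abar[OF A(3), of "\<lambda>x. x"] bdd_abar[OF A(4), of "\<lambda>x. x"]
  have b1: "bdd (\<lambda>x. app (\<lambda>z. unitv (f x z)) (Q x))" if "\<And>x. vge 0 (Q x)" for f Q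
    by (rule bddI[of 0]) (simp add: that)
  have v: "vge 0 (app (\<lambda>z. unitv (f z)) (abar B0 z'))" "vge 0 (app (\<lambda>z. unitv (f' z)) (abar B1 z''))" for f f' z' z''
    by (simp_all add: vge_abar A)
  have "app (tB B1 B0 dv) (Gh g1 g0 t) =
    app (\<lambda>x. app (\<lambda>z. app (\<lambda>x'. unitv (x', v, z)) (abar B1 x)) (ghat g0 w)) (ghat g1 u) +
    app (\<lambda>x. ksign (wd (ad B1) x + dv v) *v app (\<lambda>z. app (\<lambda>z'. unitv (x, v, z')) (abar B0 z)) (ghat g0 w)) (ghat g1 u)"
    (is "_ = ?X + ?Y")
  proof -
    have "app (tB B1 B0 dv) (Gh g1 g0 t) = app (\<lambda>x. app (\<lambda>z. tB B1 B0 dv (x, v, z)) (ghat g0 w)) (ghat g1 u)"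
      unfolding q by (rule app_Gh[OF g(1,2), of 0]) (rule vge_tB[OF A(3,4)])
    also have "\<dots> = app (\<lambda>x. app (\<lambda>z. app (\<lambda>x'. unitv (x', v, z)) (abar B1 x)) (ghat g0 w) +
      ksign (wd (ad B1) x + dv v) *v app (\<lambda>z. app (\<lambda>z'. unitv (x, v, z')) (abar B0 z)) (ghat g0 w)) (ghat g1 u)"
      unfolding tB_simps
      by (subst app_row_add, (auto intro!: bdd_scalec b1 vge_abar A simp: app_row_scale[OF b1[OF vge_abar[OF A(4)]]])[3])
    also have "\<dots> = ?X + ?Y"
      by (rule app_row_add) (auto intro!: bddI[of 0] vge_app_left vge_ghat g v simp del: vge_push)
    finally show ?thesis .
  qed
  also have "?X = app (\<lambda>x. app (\<lambda>x'. app (\<lambda>z. unitv (x', v, z)) (ghat g0 w)) (abar B1 x)) (ghat g1 u)"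
    by (subst app_swap[of 0]) simp_all
  also have "\<dots> = app (\<lambda>x'. app (\<lambda>z. unitv (x', v, z)) (ghat g0 w)) (app (ghat g1) (abar A1 u))"
    by (simp add: c app_app b)
  also have "\<dots> = app (\<lambda>x. Gh g1 g0 (x, v, w)) (abar A1 u)"
    by (simp add: app_app b)
  also have "?Y = ksign (wd (ad A1) u + dv v) *v app (\<lambda>x. app (\<lambda>z. app (\<lambda>z'. unitv (x, v, z')) (abar B0 z)) (ghat g0 w)) (ghat g1 u)"
    by (rule app_par[OF par_ghat[OF g(1,3)]]) (auto intro!: bddI[of 0] vge_app_left vge_ghat g v simp del: vge_push)
  also have "app (\<lambda>x. app (\<lambda>z. app (\<lambda>z'. unitv (x, v, z')) (abar B0 z)) (ghat g0 w)) (ghat g1 u) =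
     app (\<lambda>x. app (\<lambda>z'. unitv (x, v, z')) (app (ghat g0) (abar A0 w))) (ghat g1 u)"
    by (simp add: c app_app b)
  also have "\<dots> = app (\<lambda>x. app (\<lambda>z. app (\<lambda>z'. unitv (x, v, z')) (ghat g0 z)) (abar A0 w)) (ghat g1 u)"
    by (simp add: app_app b)
  also have "\<dots> = app (\<lambda>z. app (\<lambda>x. app (\<lambda>z'. unitv (x, v, z')) (ghat g0 z)) (ghat g1 u)) (abar A0 w)"
    by (rule app_swap[of 0]) (intro vge_push vge_ghat g)
  also have "\<dots> = app (\<lambda>z. Gh g1 g0 (u, v, z)) (abar A0 w)" by simp
  finally show ?thesis unfolding q tB_simps
    by (simp only: app_add[OF b(1)] app_scale[OF b(1)] app_push[OF b(1)])
qed

lemma ahomD: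
  assumes "ahom A B g"
  shows "good g" "par (ad B) (wd (ad A) w) (g w)" "w \<in> lists (aX A) \<Longrightarrow> supv (aX B) (g w)"
    "w \<in> lists (aX A) \<Longrightarrow> app (ghat g) (abar A w) = app (abar B) (ghat g w)"
  using assms by (auto simp: ahom_def)

lemma fam_pull:
  assumes g: "ahom A1 B1 g1" "ahom A0 B0 g0" and f: "fam B1 B0 dv du U s \<alpha>"
  shows "fam A1 A0 dv du U s (\<lambda>t. app \<alpha> (Gh g1 g0 t))"
  unfolding fam_def
proof (intro conjI allI)
  note gg = ahomD(1)[OF g(1)] ahomD(1)[OF g(2)]
  show "bdd (\<lambda>t. app \<alpha> (Gh g1 g0 t))" using bdd_app[OF bdd_Gh'[OF gg] famD(1)[OF f]] by simp
  fix t
  show "par du (tdeg A1 A0 dv t + s) (app \<alpha> (Gh g1 g0 t))"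
    by (rule par_app[OF famD(1)[OF f] par_Gh[OF gg ahomD(2)[OF g(1)] ahomD(2)[OF g(2)]] famD(2)[OF f]])
  show "supv U (app \<alpha> (Gh g1 g0 t))"
    by (rule supv_app[of _ UNIV]) (auto simp: famD[OF f] supv_def[of UNIV] simp del: split_paired_All)
qed

lemma fam_comp:
  fixes \<alpha> :: "'a list \<times> 'v \<times> 'b list \<Rightarrow> 'u vec"
  assumes f: "fam A1 A0 dv du U 0 \<alpha>" and g: "fam A1 A0 du dw W 0 \<beta>"
  shows "fam A1 A0 dv dw W 0 (\<lambda>t. app \<beta> (bhat 0 (ad A1) \<alpha> t))"
  unfolding fam_def
proof (intro conjI allI)
  show "bdd (\<lambda>t. app \<beta> (bhat 0 (ad A1) \<alpha> t))"
    using bdd_app[OF bdd_bhat[OF famD(1)[OF f]] famD(1)[OF g]] by simp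
  fix t :: "'a list \<times> 'v \<times> 'b list"
  obtain u v w where t: "t = (u, v, w)" by (cases t)
  have "par (tdeg A1 A0 du) (tdeg A1 A0 dv t) (bhat 0 (ad A1) \<alpha> t)"
    unfolding t bhat.simps
  proof (intro par_ssum par_scale)
    fix a b c e assume *: "a @ b = u" "c @ e = w"
    show "par (tdeg A1 A0 du) (tdeg A1 A0 dv (u, v, w)) (app (\<lambda>y. unitv (a, y, e)) (\<alpha> (b, v, c)))"
      by (rule par_push[OF famD(2)[OF f]]) (use * in \<open>auto simp: tdeg_def\<close>)
  qed
  from par_app[OF famD(1)[OF g] this famD(2)[OF g]]
  show "par dw (tdeg A1 A0 dv t + 0) (app \<beta> (bhat 0 (ad A1) \<alpha> t))" .
  show "supv W (app \<beta> (bhat 0 (ad A1) \<alpha> t))"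
    by (rule supv_app[of _ UNIV]) (auto simp: famD[OF g] supv_def[of UNIV] simp del: split_paired_All)
qed

section \<open>Pull-back of bimodules and of homomorphisms\<close>

context
  fixes A1 A0 B1 B0 g1 g0
  assumes A: "alg A1" "alg A0" "alg B1" "alg B0" and g: "ahom A1 B1 g1" "ahom A0 B0 g0"
begin

lemma supv_Gh':
  assumes "t \<in> tbas A1 A0 (pull g1 g0 M)" shows "supv (tbas B1 B0 M) (Gh g1 g0 t)"
  by (rule supv_Gh[OF ahomD(1)[OF g(1)] ahomD(1)[OF g(2)] _ _ assms])
    (erule ahomD(3)[OF g(1)], erule ahomD(3)[OF g(2)], simp)

lemma Gh_tD:
  assumes M: "bim B1 B0 M" and t: "t \<in> tbas A1 A0 (pull g1 g0 M)"
  shows "app (Gh g1 g0) (tD A1 A0 (pull g1 g0 M) t) = app (tD B1 B0 M) (Gh g1 g0 t)"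
proof -
  note gg = ahomD(1)[OF g(1)] ahomD(1)[OF g(2)]
  have "app (tD B1 B0 M) (Gh g1 g0 t) = app (tB B1 B0 (bv M)) (Gh g1 g0 t) + app (bhat 1 (ad B1) (bn M)) (Gh g1 g0 t)"
    unfolding tD_def by (rule app_row_add) (auto intro: bdd_tB A bdd_bhat bimD(3)[OF M])
  then show ?thesis
    unfolding tD_def
    by (simp add: app_add bdd_Gh'[OF gg] Gh_tB[OF A g t] Gh_bhat[where c = 0, OF gg ahomD(2)[OF g(1)] bimD(1)[OF M]])
qed

text \<open>By \<open>tD_tD\<close> only the corestriction of the square matters. Since
  \<open>Gh\<close> intertwines the differentials, it is obtained by applying the corestriction of
  the square over the target algebras to mapped words.\<close>

lemma bim_pull:
  assumes M: "bim B1 B0 M" shows "bim A1 A0 (pull g1 g0 M)"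
proof -
  note gg = ahomD(1)[OF g(1)] ahomD(1)[OF g(2)]
  have n: "vge 0 (bn (pull g1 g0 M) t)" for t :: "'a list \<times> 'e \<times> 'b list"
    by (simp add: vge_app_left vge_Gh[OF gg] bimD(1)[OF M])
  have f: "fam A1 A0 (bv (pull g1 g0 M)) (bv (pull g1 g0 M)) (bV (pull g1 g0 M)) 1 (bn (pull g1 g0 M))"
    using fam_pull[OF g bimD(2)[OF M]] by simp
  have "app (tD A1 A0 (pull g1 g0 M)) (tD A1 A0 (pull g1 g0 M) t) = 0"
    if t: "t \<in> tbas A1 A0 (pull g1 g0 M)" for t
  proof -
    have "app (bn (pull g1 g0 M)) (tD A1 A0 (pull g1 g0 M) q) = 0" if q: "q \<in> tbas A1 A0 (pull g1 g0 M)" for q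
    proof -
      have "app (bn (pull g1 g0 M)) (tD A1 A0 (pull g1 g0 M) q) = app (bn M) (app (tD B1 B0 M) (Gh g1 g0 q))"
        unfolding Gh_tD[OF M q, symmetric] by (simp add: app_app bdd_Gh'[OF gg] bimD(3)[OF M])
      also have "\<dots> = app (\<lambda>t. app pr (tD B1 B0 M t)) (app (tD B1 B0 M) (Gh g1 g0 q))"
        by (simp add: pr_tD A)
      also have "\<dots> = app pr (app (\<lambda>t. app (tD B1 B0 M) (tD B1 B0 M t)) (Gh g1 g0 q))"
        by (simp add: app_app bdd_tD A bimD[OF M] bdd_app)
      also have "app (\<lambda>t. app (tD B1 B0 M) (tD B1 B0 M t)) (Gh g1 g0 q) = app (\<lambda>_. 0) (Gh g1 g0 q)"
        by (rule app_cong_supv[OF supv_Gh'[OF q]]) (rule bimD(4)[OF M])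
      finally show ?thesis by simp
    qed
    then have "bhat 2 (ad A1) (\<lambda>q. app (bn (pull g1 g0 M)) (tD A1 A0 (pull g1 g0 M) q)) t = bhat 2 (ad A1) (\<lambda>_. 0) t"
      by (intro bhat_cong[OF _ t])
    then show ?thesis by (simp only: tD_tD[OF A(1,2) n f t] bhat_0)
  qed
  then show ?thesis unfolding bim_def using n f by blast
qed

end

definition comph :: "('c list \<Rightarrow> 'd vec) \<Rightarrow> ('a list \<Rightarrow> 'c vec) \<Rightarrow> 'a list \<Rightarrow> 'd vec" where
  "comph f g w = app f (ghat g w)"

text \<open>Over its own algebras \<phi> covers (f1, f0). After pull-back along g its source lives
  over C and its target is pulled back along the composite of f and g, so that it covers the
  identity. The maps h are compared with the composites on basis words, where translated families
  are determined by the given ones.\<close>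

lemma hom_pull:
  assumes A: "alg A1" "alg A0" "alg B1" "alg B0" "alg C1" "alg C0"
    and g: "ahom C1 A1 g1" "ahom C0 A0 g0" and f: "good f1" "good f0"
    and fg: "good h1" "good h0"
      "\<And>w. w \<in> lists (aX C1) \<Longrightarrow> ghat h1 w = ghat (comph f1 g1) w"
      "\<And>w. w \<in> lists (aX C0) \<Longrightarrow> ghat h0 w = ghat (comph f0 g0) w"
    and M: "bim A1 A0 M" and N: "bim B1 B0 N" and N': "\<And>t. vge 0 (bn (pull h1 h0 N) t)"
    and h: "fhom A1 A0 M B1 B0 N f1 f0 \<phi>" and t: "t \<in> tbas C1 C0 (pull g1 g0 M)"
  shows "app (bhat 0 (ad C1) (\<lambda>t. app \<phi> (Gh g1 g0 t))) (tD C1 C0 (pull g1 g0 M) t) =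
    app (tD C1 C0 (pull h1 h0 N)) (bhat 0 (ad C1) (\<lambda>t. app \<phi> (Gh g1 g0 t)) t)"
proof -
  note gg = ahomD(1)[OF g(1)] ahomD(1)[OF g(2)]
  have fm: "fam A1 A0 (bv M) (bv N) (bV N) 0 \<phi>" using h by (simp add: fhom_def)
  obtain c where c: "\<And>t. vge c (\<phi> t)" using famD(1)[OF fm] by (auto simp: bdd_def simp del: split_paired_All)
  have gn: "bdd (bn N)" and gm: "bdd (bn M)" using bimD(3) M N by blast+
  define \<alpha> where "\<alpha> t = app \<phi> (Gh g1 g0 t)" for t
  have fa: "fam C1 C0 (bv M) (bv N) (bV N) 0 \<alpha>" unfolding \<alpha>_def by (rule fam_pull[OF g fm])
  note b = famD(1)[OF fm] bdd_bhat[OF famD(1)[OF fm]] bdd_tD[OF A(1,2) bimD(1)[OF M]]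
    bdd_tD[OF A(3,4) bimD(1)[OF N]] bdd_Gh'[OF f] bdd_Gh'[OF gg] bdd_bhat[OF famD(1)[OF fa]] gn gm
  have pM: "bim C1 C0 (pull g1 g0 M)" by (rule bim_pull[OF A(5,6,1,2) g M])
  \<comment> \<open>The hypothesis on \<phi> is an identity after \<open>Gh\<close>. As
    \<open>Gh\<close> leaves corestrictions alone, \<phi> can be recovered behind it.\<close>
  have prF: "app pr (app (Gh f1 f0) (bhat 0 (ad A1) \<phi> t)) = \<phi> t" for t
    by (simp add: app_app b pr_Gh[OF f] pr_bhat)
  have r: "app \<alpha> (tD C1 C0 (pull g1 g0 M) q) = app (bn (pull h1 h0 N)) (bhat 0 (ad C1) \<alpha> q)"
    if q: "q \<in> tbas C1 C0 (pull g1 g0 M)" for q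
  proof -
    have sq: "supv (tbas C1 C0 (pull h1 h0 N)) (bhat 0 (ad C1) \<alpha> q)"
      by (rule supv_bhat[OF _ q]) (simp add: famD[OF fa])
    have "app \<alpha> (tD C1 C0 (pull g1 g0 M) q) = app \<phi> (app (Gh g1 g0) (tD C1 C0 (pull g1 g0 M) q))"
      by (simp add: \<alpha>_def[abs_def] app_app b)
    also have "\<dots> = app \<phi> (app (tD A1 A0 M) (Gh g1 g0 q))"
      by (simp only: Gh_tD[OF A(5,6,1,2) g M q])
    also have "\<dots> = app (\<lambda>t. app pr (app (Gh f1 f0) (bhat 0 (ad A1) \<phi> t))) (app (tD A1 A0 M) (Gh g1 g0 q))"
      by (simp only: prF)
    also have "\<dots> = app pr (app (\<lambda>t. app (Gh f1 f0) (app (bhat 0 (ad A1) \<phi>) (tD A1 A0 M t))) (Gh g1 g0 q))"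
      by (simp add: app_app b bdd_app)
    also have "app (\<lambda>t. app (Gh f1 f0) (app (bhat 0 (ad A1) \<phi>) (tD A1 A0 M t))) (Gh g1 g0 q) =
      app (\<lambda>t. app (tD B1 B0 N) (app (Gh f1 f0) (bhat 0 (ad A1) \<phi> t))) (Gh g1 g0 q)"
      by (rule app_cong_supv[OF supv_Gh'[OF A(5,6,1,2) g q]]) (use h in \<open>simp add: fhom_def\<close>)
    also have "app pr (app (\<lambda>t. app (tD B1 B0 N) (app (Gh f1 f0) (bhat 0 (ad A1) \<phi> t))) (Gh g1 g0 q)) =
      app (\<lambda>t. app pr (tD B1 B0 N t)) (app (Gh f1 f0) (app (bhat 0 (ad A1) \<phi>) (Gh g1 g0 q)))"
      by (simp add: app_app b bdd_app)
    also have "\<dots> = app (bn N) (app (Gh f1 f0) (app (bhat 0 (ad A1) \<phi>) (Gh g1 g0 q)))"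
      by (simp only: pr_tD A)
    also have "app (bhat 0 (ad A1) \<phi>) (Gh g1 g0 q) = app (Gh g1 g0) (bhat 0 (ad C1) \<alpha> q)"
      unfolding \<alpha>_def by (rule Gh_bhat[OF gg ahomD(2)[OF g(1)] c])
    also have "app (Gh f1 f0) (app (Gh g1 g0) (bhat 0 (ad C1) \<alpha> q)) = app (Gh h1 h0) (bhat 0 (ad C1) \<alpha> q)"
    proof -
      have "app (Gh f1 f0) (app (Gh g1 g0) (bhat 0 (ad C1) \<alpha> q)) =
        app (Gh (comph f1 g1) (comph f0 g0)) (bhat 0 (ad C1) \<alpha> q)"
        by (simp add: app_app b Gh_comp[OF f gg] comph_def[abs_def])
      also have "\<dots> = app (Gh h1 h0) (bhat 0 (ad C1) \<alpha> q)"
      proof (rule app_cong_supv[OF sq])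
        fix t :: "'e list \<times> 'h \<times> 'f list"
        obtain u v w where t: "t = (u, v, w)" by (cases t)
        assume "t \<in> tbas C1 C0 (pull h1 h0 N)"
        then have "u \<in> lists (aX C1)" "w \<in> lists (aX C0)" by (auto simp: t tbas_def)
        then show "Gh (comph f1 g1) (comph f0 g0) t = Gh h1 h0 t" by (simp only: t Gh.simps fg(3,4))
      qed
      finally show ?thesis .
    qed
    also have "app (bn N) (app (Gh h1 h0) (bhat 0 (ad C1) \<alpha> q)) = app (bn (pull h1 h0 N)) (bhat 0 (ad C1) \<alpha> q)"
      by (simp add: app_app bdd_Gh'[OF fg(1,2)] gn)
    finally show ?thesis .
  qed
  have "app (bhat 0 (ad C1) \<alpha>) (tD C1 C0 (pull g1 g0 M) t) = app (tD C1 C0 (pull h1 h0 N)) (bhat 0 (ad C1) \<alpha> t)"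
    by (rule hom_chain[OF A(5,6) bimD(1)[OF pM] N' _ r t]) (use fa in simp)
  then show ?thesis by (simp add: \<alpha>_def[abs_def])
qed

section \<open>The Hochschild complex inside the two-sided bar complex\<close>

definition hS :: "'a valg \<Rightarrow> 'v set \<Rightarrow> ('v \<times> 'a list) set" where
  "hS A V = V \<times> lists (aX A)"

text \<open>\<open>cc\<close> is the sum of the cyclic rotations of a word with a bimodule element, an injection into the
  two-sided bar construction which intertwines \<open>hD\<close> with the bar differential.\<close>

fun cc :: "'a valg \<Rightarrow> ('v \<Rightarrow> int) \<Rightarrow> 'v \<times> 'a list \<Rightarrow> ('a list \<times> 'v \<times> 'a list) vec" where
  "cc A dv (v, w) = ssum w (\<lambda>r l. ksign (wd (ad A) l * (dv v + wd (ad A) r)) *v unitv (l, v, r))"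

text \<open>The word is cut as w = r @ z @ l: the tail l is moved in front of v and consumed
  together with the beginning r, and z is what remains of the cyclic word.\<close>

fun Wr :: "'a valg \<Rightarrow> ('v \<Rightarrow> int) \<Rightarrow> ('a list \<times> 'v \<times> 'a list \<Rightarrow> 'u vec) \<Rightarrow> 'v \<times> 'a list \<Rightarrow> ('u \<times> 'a list) vec" where
  "Wr A dv \<alpha> (v, w) = ssum w (\<lambda>x l. ssum x (\<lambda>r z.
     ksign (wd (ad A) l * (dv v + wd (ad A) x)) *v app (\<lambda>y. unitv (y, z)) (\<alpha> (l, v, r))))"

fun Wb :: "'a valg \<Rightarrow> ('v \<Rightarrow> int) \<Rightarrow> 'v \<times> 'a list \<Rightarrow> ('v \<times> 'a list) vec" where
  "Wb A dv (v, w) = ksign (dv v) *v app (\<lambda>x. unitv (v, x)) (abar A w)"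

definition hD :: "'a valg \<Rightarrow> ('a, 'v, 'a) vbim \<Rightarrow> 'v \<times> 'a list \<Rightarrow> ('v \<times> 'a list) vec" where
  "hD A M t = Wb A (bv M) t + Wr A (bv M) (bn M) t"

lemma vge_cc: "vge 0 (cc A dv t)" by (cases t) simp
lemma bdd_cc: "bdd (cc A dv)" by (rule bddI[of 0]) (rule vge_cc)
lemma vge_Wr: "(\<And>t. vge c (\<alpha> t)) \<Longrightarrow> vge c (Wr A dv \<alpha> q)" by (cases q) simp
lemma bdd_Wr: "bdd \<alpha> \<Longrightarrow> bdd (Wr A dv \<alpha>)" unfolding bdd_def using vge_Wr by blast
lemma vge_Wb: "alg A \<Longrightarrow> vge 0 (Wb A dv q)" by (cases q) (simp add: vge_abar)
lemma bdd_Wb: "alg A \<Longrightarrow> bdd (Wb A dv)" by (rule bddI[of 0]) (rule vge_Wb)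
lemma vge_hD: "alg A \<Longrightarrow> (\<And>t. vge 0 (bn M t)) \<Longrightarrow> vge 0 (hD A M q)"
  unfolding hD_def by (intro vge_add vge_Wb vge_Wr)
lemma bdd_hD: "alg A \<Longrightarrow> (\<And>t. vge 0 (bn M t)) \<Longrightarrow> bdd (hD A M)"
  by (rule bddI[of 0]) (rule vge_hD)

text \<open>With w = r1 @ r2 @ l1 @ l2, rotating after wrapping and extending after rotating both
  sum l1 \<otimes> \<alpha>(l2, v, r1) \<otimes> r2 over all cuts. The proof regroups the cuts and
  compares the signs.\<close>

lemma Wr_cc:
  fixes \<alpha> :: "'a list \<times> 'v \<times> 'a list \<Rightarrow> 'u vec"
  assumes a: "bdd \<alpha>" and p: "\<And>t. par du (tdeg A A dv t + s) (\<alpha> t)"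
  shows "app (cc A du) (Wr A dv \<alpha> q) = app (bhat s (ad A) \<alpha>) (cc A dv q)"
proof -
  obtain v w where q: "q = (v, w)" by (cases q)
  define Q where "Q l1 l2 r1 r2 = app (\<lambda>y. unitv (l1, y, r2)) (\<alpha> (l2, v, r1))"
    for l1 l2 r1 r2 :: "'a list"
  let ?d = "wd (ad A)"
  have "app (cc A du) (Wr A dv \<alpha> q) = ssum w (\<lambda>x l2. ssum x (\<lambda>r1 z. ksign (?d l2 * (dv v + ?d x)) *v
     app (\<lambda>y. cc A du (y, z)) (\<alpha> (l2, v, r1))))"
    by (simp only: q Wr.simps app_ssum[OF bdd_cc] app_scale[OF bdd_cc] app_push[OF bdd_cc])
  also have "\<dots> = ssum w (\<lambda>x l2. ssum x (\<lambda>r1 z. ssum z (\<lambda>r2 l1.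
     ksign ((?d l1 + ?d l2) * (dv v + ?d r1 + ?d r2) + s * ?d l1) *v Q l1 l2 r1 r2)))"
  proof (intro ssum_cong)
    fix x l2 r1 z :: "'a list" assume x: "r1 @ z = x"
    have "app (\<lambda>y. cc A du (y, z)) (\<alpha> (l2, v, r1)) = ssum z (\<lambda>r2 l1.
      ksign (?d l1 * (?d l2 + dv v + ?d r1 + s + ?d r2)) *v Q l1 l2 r1 r2)"
      unfolding cc.simps
    proof (subst app_row_ssum[of 0], simp, rule ssum_cong)
      fix r2 l1
      show "app (\<lambda>y. ksign (?d l1 * (du y + ?d r2)) *v unitv (l1, y, r2)) (\<alpha> (l2, v, r1)) =
        ksign (?d l1 * (?d l2 + dv v + ?d r1 + s + ?d r2)) *v Q l1 l2 r1 r2"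
        unfolding Q_def by (rule app_par[OF p]) (auto simp: tdeg_def)
    qed
    then show "ksign (?d l2 * (dv v + ?d x)) *v app (\<lambda>y. cc A du (y, z)) (\<alpha> (l2, v, r1)) =
      ssum z (\<lambda>r2 l1. ksign ((?d l1 + ?d l2) * (dv v + ?d r1 + ?d r2) + s * ?d l1) *v Q l1 l2 r1 r2)"
      by (auto simp: vscale_ssum ksign_add[symmetric] x[symmetric] intro!: ssum_cong arg_cong2[of _ _ _ _ vscale] ksign_cong)
  qed
  also have "\<dots> = ssum w (\<lambda>x l2. ssum x (\<lambda>r l1. ssum r (\<lambda>r1 r2.
     ksign ((?d l1 + ?d l2) * (dv v + ?d r1 + ?d r2) + s * ?d l1) *v Q l1 l2 r1 r2)))"
    by (simp only: ssum_assoc)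
  also have "\<dots> = ssum w (\<lambda>r l. ssum l (\<lambda>l1 l2. ssum r (\<lambda>r1 r2.
     ksign ((?d l1 + ?d l2) * (dv v + ?d r1 + ?d r2) + s * ?d l1) *v Q l1 l2 r1 r2)))"
    by (rule ssum_assoc)
  also have "\<dots> = ssum w (\<lambda>r l. ksign (?d l * (dv v + ?d r)) *v bhat s (ad A) \<alpha> (l, v, r))"
    by (auto simp: vscale_ssum ksign_add[symmetric] Q_def intro!: ssum_cong arg_cong2[of _ _ _ _ vscale] ksign_cong)
  also have "\<dots> = app (bhat s (ad A) \<alpha>) (cc A dv q)"
    by (simp add: q app_ssum app_scale bdd_bhat[OF a])
  finally show ?thesis .
qed

text \<open>The coderivation rule at the cut of the rotation sorts the terms by whether the
  operation acts to the right of v or in the part moved to its left, which gives the two summands of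
  \<open>tB\<close>.\<close>

lemma Wb_cc:
  assumes A: "alg A"
  shows "app (cc A dv) (Wb A dv q) = app (tB A A dv) (cc A dv q)"
proof -
  obtain v w where q: "q = (v, w)" by (cases q)
  let ?d = "wd (ad A)"
  note b = bdd_tB[OF A A]
  have c: "app (\<lambda>x. ssum x (\<lambda>r l. ksign (?d l * (dv v + ?d r)) *v unitv (l, v, r))) (abar A w) =
    ssum w (\<lambda>r l. ksign (?d l * (dv v + ?d r + 1)) *v app (\<lambda>x. unitv (l, v, x)) (abar A r) +
      ksign (?d r + (?d l + 1) * (dv v + ?d r)) *v app (\<lambda>x. unitv (x, v, r)) (abar A l))"
    unfolding abar_def
  proof (subst bar_coleibniz[of _ 0], rule algD[OF A], simp, rule ssum_cong, unfold abar_def[symmetric])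
    fix r l
    have "app (\<lambda>x. ksign (?d l * (dv v + ?d x)) *v unitv (l, v, x)) (abar A r) =
      ksign (?d l * (dv v + ?d r + 1)) *v app (\<lambda>x. unitv (l, v, x)) (abar A r)"
      by (rule app_par[OF par_abar[OF A]]) auto
    moreover have "app (\<lambda>x. ksign (?d x * (dv v + ?d r)) *v unitv (x, v, r)) (abar A l) =
      ksign ((?d l + 1) * (dv v + ?d r)) *v app (\<lambda>x. unitv (x, v, r)) (abar A l)"
      by (rule app_par[OF par_abar[OF A]]) auto
    ultimately show "app (\<lambda>x. ksign (?d l * (dv v + ?d x)) *v unitv (l, v, x)) (abar A r) +
        ksign (?d r) *v app (\<lambda>x. ksign (?d x * (dv v + ?d r)) *v unitv (x, v, r)) (abar A l) =
      ksign (?d l * (dv v + ?d r + 1)) *v app (\<lambda>x. unitv (l, v, x)) (abar A r) +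
      ksign (?d r + (?d l + 1) * (dv v + ?d r)) *v app (\<lambda>x. unitv (x, v, r)) (abar A l)"
      by (simp add: ksign_add)
  qed
  have "app (cc A dv) (Wb A dv q) = ksign (dv v) *v app (\<lambda>x. cc A dv (v, x)) (abar A w)"
    by (simp only: q Wb.simps app_scale[OF bdd_cc] app_push[OF bdd_cc])
  also have "\<dots> = ssum w (\<lambda>r l. ksign (dv v + ?d l * (dv v + ?d r + 1)) *v app (\<lambda>x. unitv (l, v, x)) (abar A r) +
      ksign (dv v + ?d r + (?d l + 1) * (dv v + ?d r)) *v app (\<lambda>x. unitv (x, v, r)) (abar A l))"
    by (simp add: c vscale_ssum vscale_add ksign_add mult.assoc)
  also have "\<dots> = ssum w (\<lambda>r l. ksign (?d l * (dv v + ?d r)) *v tB A A dv (l, v, r))"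
  proof (rule ssum_cong)
    fix r l
    have "ksign (dv v + ?d l * (dv v + ?d r + 1)) = ksign (?d l * (dv v + ?d r)) * ksign (?d l + dv v)"
      unfolding ksign_add[symmetric] by (rule ksign_cong) auto
    moreover have "ksign (dv v + ?d r + (?d l + 1) * (dv v + ?d r)) = ksign (?d l * (dv v + ?d r))"
      by (rule ksign_cong) auto
    ultimately show "ksign (dv v + ?d l * (dv v + ?d r + 1)) *v app (\<lambda>x. unitv (l, v, x)) (abar A r) +
      ksign (dv v + ?d r + (?d l + 1) * (dv v + ?d r)) *v app (\<lambda>x. unitv (x, v, r)) (abar A l) =
      ksign (?d l * (dv v + ?d r)) *v tB A A dv (l, v, r)"
      by (simp add: tB_simps vscale_add add.commute)
  qed
  also have "\<dots> = app (tB A A dv) (cc A dv q)"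
    by (simp add: q app_ssum app_scale b)
  finally show ?thesis .
qed

text \<open>Left inverse of \<open>cc\<close>: among the rotations of a word only the trivial one
  has nothing to the left of v.\<close>

fun cr :: "'a list \<times> 'v \<times> 'a list \<Rightarrow> ('v \<times> 'a list) vec" where
  "cr (l, v, r) = (if l = [] then unitv (v, r) else 0)"

lemma vge_cr: "vge 0 (cr t)" by (cases t) simp
lemma bdd_cr: "bdd cr" by (rule bddI[of 0]) (rule vge_cr)

lemma cr_cc: "app cr (cc A dv q) = unitv q"
proof -
  obtain v w where q: "q = (v, w)" by (cases q)
  have "app cr (cc A dv q) = ssum w (\<lambda>r l. if l = [] then unitv (v, r) else 0)"
    by (auto simp: q app_ssum bdd_cr app_scale intro!: ssum_cong)
  then show ?thesis by (simp only: ssum_Nil2 q)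
qed

lemma cc_inj: "app (cc A dv) x = app (cc A dv) y \<Longrightarrow> x = y"
proof -
  have *: "app cr (app (cc A dv) x) = x" for x
    by (simp add: app_app bdd_cc bdd_cr cr_cc app_unitv_row)
  assume "app (cc A dv) x = app (cc A dv) y"
  then show "x = y" using * by metis
qed

lemma supv_cc: "q \<in> hS A (bV M) \<Longrightarrow> supv (tbas A A M) (cc A dv q)"
  by (cases q) (auto simp: hS_def tbas_def intro!: supv_ssum supv_scale)

lemma hD_cc:
  assumes A: "alg A" and M: "bim A A M"
  shows "app (cc A (bv M)) (hD A M q) = app (tD A A M) (cc A (bv M) q)"
proof -
  have "app (tD A A M) (cc A (bv M) q) = app (tB A A (bv M)) (cc A (bv M) q) + app (bhat 1 (ad A) (bn M)) (cc A (bv M) q)"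
    unfolding tD_def by (rule app_row_add) (auto intro: bdd_tB A bdd_bhat bimD(3)[OF M])
  then show ?thesis
    unfolding hD_def by (simp add: app_add bdd_cc Wb_cc[OF A] Wr_cc[OF bimD(3)[OF M] famD(2)[OF bimD(2)[OF M]]])
qed

lemma hD_hD:
  assumes A: "alg A" and M: "bim A A M" and q: "q \<in> hS A (bV M)"
  shows "app (hD A M) (hD A M q) = 0"
proof (rule cc_inj)
  note b = bdd_cc bdd_hD[OF A bimD(1)[OF M]] bdd_tD[OF A A bimD(1)[OF M]]
  have "app (cc A (bv M)) (app (hD A M) (hD A M q)) = app (\<lambda>t. app (tD A A M) (tD A A M t)) (cc A (bv M) q)"
    by (simp add: app_app b hD_cc[OF A M]) (simp add: app_app[symmetric] b hD_cc[OF A M])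
  also have "\<dots> = app (\<lambda>_. 0) (cc A (bv M) q)"
    by (rule app_cong_supv[OF supv_cc[OF q]]) (rule bimD(4)[OF M])
  finally show "app (cc A (bv M)) (app (hD A M) (hD A M q)) = app (cc A (bv M)) 0" by simp
qed

text \<open>After \<open>cc\<close> both sides become composites of comodule maps, so the cyclic
  bookkeeping is confined to \<open>Wr_cc\<close>.\<close>

lemma Wr_Wr:
  assumes f: "fam A A dv du U 0 \<alpha>" and g: "fam A A du dw W 0 \<beta>"
  shows "app (Wr A du \<beta>) (Wr A dv \<alpha> q) = Wr A dv (\<lambda>t. app \<beta> (bhat 0 (ad A) \<alpha> t)) q"
proof (rule cc_inj)
  note b = bdd_cc bdd_Wr[OF famD(1)[OF f]] bdd_Wr[OF famD(1)[OF g]] bdd_bhat[OF famD(1)[OF f]] bdd_bhat[OF famD(1)[OF g]]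
  note h = fam_comp[OF f g]
  have "app (cc A dw) (app (Wr A du \<beta>) (Wr A dv \<alpha> q)) = app (bhat 0 (ad A) \<beta>) (app (cc A du) (Wr A dv \<alpha> q))"
    by (simp add: app_app b Wr_cc[OF famD(1,2)[OF g]])
  also have "\<dots> = app (\<lambda>t. app (bhat 0 (ad A) \<beta>) (bhat 0 (ad A) \<alpha> t)) (cc A dv q)"
    by (simp add: app_app b Wr_cc[OF famD(1,2)[OF f]])
  also have "\<dots> = app (bhat 0 (ad A) (\<lambda>t. app \<beta> (bhat 0 (ad A) \<alpha> t))) (cc A dv q)"
    by (simp add: bhat_bhat'[OF famD(1)[OF f] famD(1)[OF g]])
  finally show "app (cc A dw) (app (Wr A du \<beta>) (Wr A dv \<alpha> q)) =
    app (cc A dw) (Wr A dv (\<lambda>t. app \<beta> (bhat 0 (ad A) \<alpha> t)) q)"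
    by (simp only: Wr_cc[OF famD(1,2)[OF h]])
qed

lemma Wr_hD:
  assumes A: "alg A" and M: "bim A A M" and N: "bim A A N" and f: "fam A A (bv M) (bv N) (bV N) 0 \<alpha>"
    and r: "\<And>t. t \<in> tbas A A M \<Longrightarrow> app (bhat 0 (ad A) \<alpha>) (tD A A M t) = app (tD A A N) (bhat 0 (ad A) \<alpha> t)"
    and q: "q \<in> hS A (bV M)"
  shows "app (Wr A (bv M) \<alpha>) (hD A M q) = app (hD A N) (Wr A (bv M) \<alpha> q)"
proof (rule cc_inj)
  note b = bdd_cc bdd_Wr[OF famD(1)[OF f]] bdd_bhat[OF famD(1)[OF f]] bdd_hD[OF A bimD(1)[OF M]] bdd_hD[OF A bimD(1)[OF N]]
    bdd_tD[OF A A bimD(1)[OF M]] bdd_tD[OF A A bimD(1)[OF N]]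
  have "app (cc A (bv N)) (app (Wr A (bv M) \<alpha>) (hD A M q)) = app (bhat 0 (ad A) \<alpha>) (app (cc A (bv M)) (hD A M q))"
    by (simp add: app_app b Wr_cc[OF famD(1,2)[OF f]])
  also have "\<dots> = app (\<lambda>t. app (bhat 0 (ad A) \<alpha>) (tD A A M t)) (cc A (bv M) q)"
    by (simp add: app_app b hD_cc[OF A M])
  also have "\<dots> = app (\<lambda>t. app (tD A A N) (bhat 0 (ad A) \<alpha> t)) (cc A (bv M) q)"
    by (rule app_cong_supv[OF supv_cc[OF q]]) (rule r)
  also have "\<dots> = app (tD A A N) (app (cc A (bv N)) (Wr A (bv M) \<alpha> q))"
    by (simp add: app_app b Wr_cc[OF famD(1,2)[OF f]])
  also have "\<dots> = app (cc A (bv N)) (app (hD A N) (Wr A (bv M) \<alpha> q))"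
    by (simp add: app_app b hD_cc[OF A N])
  finally show "app (cc A (bv N)) (app (Wr A (bv M) \<alpha>) (hD A M q)) = app (cc A (bv N)) (app (hD A N) (Wr A (bv M) \<alpha> q))" .
qed

section \<open>Quasi-isomorphisms and perturbation\<close>

text \<open>Injectivity on homology in terms of elements, with \<open>hsur\<close> as its
  counterpart for surjectivity. Quotients are thereby postponed to the final comparison with
  \<open>homology\<close>.\<close>

definition hinj :: "'x::ab_group_add set \<Rightarrow> ('x \<Rightarrow> 'x) \<Rightarrow> 'y::ab_group_add set \<Rightarrow> ('y \<Rightarrow> 'y) \<Rightarrow> ('x \<Rightarrow> 'y) \<Rightarrow> bool" where
  "hinj S D S' D' f \<longleftrightarrow> (\<forall>x\<in>S. D x = 0 \<longrightarrow> (\<exists>z\<in>S'. f x = D' z) \<longrightarrow> (\<exists>u\<in>S. x = D u))"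

definition hsur :: "'x::ab_group_add set \<Rightarrow> ('x \<Rightarrow> 'x) \<Rightarrow> 'y::ab_group_add set \<Rightarrow> ('y \<Rightarrow> 'y) \<Rightarrow> ('x \<Rightarrow> 'y) \<Rightarrow> bool" where
  "hsur S D S' D' f \<longleftrightarrow> (\<forall>y\<in>S'. D' y = 0 \<longrightarrow> (\<exists>x\<in>S. D x = 0 \<and> (\<exists>z\<in>S'. f x = y + D' z)))"

definition addh :: "('x::ab_group_add \<Rightarrow> 'y::ab_group_add) \<Rightarrow> bool" where
  "addh f \<longleftrightarrow> (\<forall>x y. f (x + y) = f x + f y)"

lemma addhD:
  assumes "addh f" shows "f (x + y) = f x + f y" "f 0 = 0" "f (- x) = - f x" "f (x - y) = f x - f y"
proof -
  show a: "f (x + y) = f x + f y" for x y using assms by (simp add: addh_def)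
  show z: "f 0 = 0" using a[of 0 0] by simp
  show m: "f (- x) = - f x" for x using a[of x "- x"] z by (simp add: eq_neg_iff_add_eq_0 add.commute)
  show "f (x - y) = f x - f y" using a[of x "- y"] m by simp
qed

definition subgrp :: "'x::ab_group_add set \<Rightarrow> bool" where
  "subgrp S \<longleftrightarrow> 0 \<in> S \<and> (\<forall>x\<in>S. \<forall>y\<in>S. x - y \<in> S)"

lemma subgrpD: "subgrp S \<Longrightarrow> 0 \<in> S" "subgrp S \<Longrightarrow> x \<in> S \<Longrightarrow> y \<in> S \<Longrightarrow> x - y \<in> S"
  "subgrp S \<Longrightarrow> x \<in> S \<Longrightarrow> - x \<in> S" "subgrp S \<Longrightarrow> x \<in> S \<Longrightarrow> y \<in> S \<Longrightarrow> x + y \<in> S"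
proof -
  show 0: "subgrp S \<Longrightarrow> 0 \<in> S" and d: "\<And>x y. subgrp S \<Longrightarrow> x \<in> S \<Longrightarrow> y \<in> S \<Longrightarrow> x - y \<in> S"
    by (auto simp: subgrp_def)
  show m: "\<And>x. subgrp S \<Longrightarrow> x \<in> S \<Longrightarrow> - x \<in> S" using d[of 0] 0 by fastforce
  show "subgrp S \<Longrightarrow> x \<in> S \<Longrightarrow> y \<in> S \<Longrightarrow> x + y \<in> S" using d[of x "- y"] m by simp
qed

text \<open>With \<open>\<pi> = 1 - J E\<close>, the operator \<open>\<pi> H\<close> contracts the kernel of \<open>E\<close> up to the perturbation \<open>N\<close>.\<close>

lemma perturbation_iso:
  fixes D H N :: "'x::ab_group_add \<Rightarrow> 'x" and D' :: "'y::ab_group_add \<Rightarrow> 'y" and E :: "'x \<Rightarrow> 'y"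
  assumes add: "addh D" "addh D'" "addh E" "addh J" "addh H"
    and S: "subgrp S" and S': "subgrp S'"
    and maps: "\<And>x. x \<in> S \<Longrightarrow> D x \<in> S" "\<And>y. y \<in> S' \<Longrightarrow> D' y \<in> S'" "\<And>x. x \<in> S \<Longrightarrow> E x \<in> S'"
      "\<And>y. y \<in> S' \<Longrightarrow> J y \<in> S" "\<And>x. x \<in> S \<Longrightarrow> H x \<in> S"
    and DD: "\<And>x. x \<in> S \<Longrightarrow> D (D x) = 0"
    and ED: "\<And>x. x \<in> S \<Longrightarrow> E (D x) = D' (E x)" and EJ: "\<And>y. y \<in> S' \<Longrightarrow> E (J y) = y"
    and N: "\<And>x. x \<in> S \<Longrightarrow> N x = x - J (E x) + D (H x - J (E (H x))) + (H (D x) - J (E (H (D x))))"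
    and solv: "\<And>x. x \<in> S \<Longrightarrow> \<exists>y\<in>S. y = x + N y"
    and uniq: "\<And>z. z \<in> S \<Longrightarrow> z = N z \<Longrightarrow> z = 0"
  shows "hinj S D S' D' E" "hsur S D S' D' E"
proof -
  note a = addhD[OF add(1)] addhD[OF add(2)] addhD[OF add(3)] addhD[OF add(4)] addhD[OF add(5)]
  define H' where "H' x = H x - J (E (H x))" for x
  have H': "H' x \<in> S" "E (H' x) = 0" if "x \<in> S" for x
    using that by (auto simp: H'_def a intro!: subgrpD[OF S] maps) (simp add: EJ maps)
  \<comment> \<open>On the kernel of E the map N is 1 + D H' + H' D. For a cycle x the solution of y
    = x + N y satisfies D H' y + H' D y = - x, so D y is a fixed point of N and vanishes, and x = -
    D H' y.\<close>
  have ker: "\<exists>u\<in>S. x = D u \<and> E u = 0" if x: "x \<in> S" "D x = 0" "E x = 0" for x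
  proof -
    obtain y where y: "y \<in> S" "y = x + N y" using solv[OF x(1)] by blast
    have EN: "E (N z) = 0" if z: "z \<in> S" for z
    proof -
      have "E (N z) = E (z - J (E z)) + E (D (H' z)) + E (H' (D z))"
        by (simp add: N[OF z] a H'_def)
      also have "E (z - J (E z)) = 0" using z by (simp add: a EJ maps)
      finally show ?thesis using z by (simp add: ED H' maps a)
    qed
    have Ey: "E y = 0" using y EN x(3) by (metis a(9) add_0)
    have Q: "N z = z + (D (H' z) + H' (D z))" if "z \<in> S" "E z = 0" for z
      using that by (simp add: N H'_def a algebra_simps)
    have Qy: "D (H' y) + H' (D y) = - x"
      using Q[OF y(1) Ey] y(2) by (simp add: algebra_simps add_eq_0_iff)
    have Dy: "D y = 0"
    proof (rule uniq)
      show "D y \<in> S" using maps y by blast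
      have "D (H' (D y)) = D (D (H' y) + H' (D y))" using y by (simp add: a DD H')
      also have "\<dots> = 0" by (simp add: Qy a x(2))
      finally show "D y = N (D y)" using Q[of "D y"] y Ey by (simp add: maps ED a DD H'_def)
    qed
    have "H' (D y) = 0" by (simp add: Dy a H'_def)
    then have "x = D (- H' y)" using Qy by (simp add: a minus_equation_iff[of x])
    moreover have "E (- H' y) = 0" using H'(2)[OF y(1)] by (simp add: a)
    ultimately show ?thesis using H'(1)[OF y(1)] subgrpD(3)[OF S] by blast
  qed
  show "hinj S D S' D' E"
    unfolding hinj_def
  proof (intro ballI impI)
    fix x assume x: "x \<in> S" "D x = 0" and "\<exists>z\<in>S'. E x = D' z"
    then obtain z where z: "z \<in> S'" "E x = D' z" by blast
    \<comment> \<open>J is not assumed to be a chain map, but x - D (J z) is a cycle, and E sends it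
      to D' z - D' (E (J z)) = 0.\<close>
    have Jz: "J z \<in> S" using maps(4)[OF z(1)] .
    have "x - D (J z) \<in> S" "D (x - D (J z)) = 0" "E (x - D (J z)) = 0"
      using x z subgrpD(2)[OF S x(1) maps(1)[OF Jz]] by (simp_all add: a DD[OF Jz] ED[OF Jz] EJ)
    then obtain u where "u \<in> S" "x - D (J z) = D u" using ker by blast
    then show "\<exists>u\<in>S. x = D u" using z(1) maps subgrpD(4)[OF S]
      by (intro bexI[of _ "u + J z"]) (auto simp: a algebra_simps)
  qed
  show "hsur S D S' D' E"
    unfolding hsur_def
  proof (intro ballI impI)
    fix y assume y: "y \<in> S'" "D' y = 0"
    \<comment> \<open>The defect D (J y) is a cycle in the kernel of E. As the kernel is acyclic, J
      y can be corrected inside it to a cycle over y.\<close>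
    have "D (J y) \<in> S" "D (D (J y)) = 0" "E (D (J y)) = 0" using y by (auto simp: maps DD ED EJ)
    then obtain v where "v \<in> S" "D (J y) = D v" "E v = 0" using ker by blast
    then show "\<exists>x\<in>S. D x = 0 \<and> (\<exists>z\<in>S'. E x = y + D' z)"
      using y by (intro bexI[of _ "J y - v"] conjI bexI[of _ 0])
       (auto simp: a EJ subgrpD[OF S'] intro!: subgrpD[OF S] maps)
  qed
qed

section \<open>The filtration by energy and word length, and Neumann series\<close>

lemma nov_sum_shift:
  fixes f :: "nat \<Rightarrow> nov"
  assumes "cvg f" shows "nov_sum f = f 0 + nov_sum (\<lambda>n. f (Suc n))"
proof (rule nov_eq_approx)
  fix E
  have fin: "finite {n. f n \<notin> energy_ge E}" using cvgD[OF assms] .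
  obtain N where N: "\<And>n. f n \<notin> energy_ge E \<Longrightarrow> n < N"
    using fin[unfolded finite_nat_set_iff_bounded] by blast
  have c: "cvg (\<lambda>n. f (Suc n))" unfolding cvg_def
  proof
    fix E
    have *: "{n. f (Suc n) \<notin> energy_ge E} = Suc -` {n. f n \<notin> energy_ge E}" by auto
    show "finite {n. f (Suc n) \<notin> energy_ge E}"
      unfolding * by (rule finite_vimageI[OF cvgD[OF assms]]) simp
  qed
  have 1: "nov_sum f - sum f {..N} \<in> energy_ge E"
    by (rule nov_sum_approx[OF assms]) (use N in force)+
  have 2: "nov_sum (\<lambda>n. f (Suc n)) - (\<Sum>n<N. f (Suc n)) \<in> energy_ge E"
    by (rule nov_sum_approx[OF c]) (use N in force)+
  have "sum f {..N} = f 0 + (\<Sum>n<N. f (Suc n))"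
    by (simp only: sum.atMost_shift)
  then show "nov_sum f - (f 0 + nov_sum (\<lambda>n. f (Suc n))) \<in> energy_ge E"
    using energy_ge_diff[OF 1 2] by (simp add: algebra_simps)
qed

text \<open>The filtration of the vectors by the energy minus \<open>\<epsilon>\<close> times the word length.\<close>

definition smr :: "real \<Rightarrow> ('i \<Rightarrow> nat) \<Rightarrow> real \<Rightarrow> 'i vec \<Rightarrow> bool" where
  "smr \<epsilon> len L x \<longleftrightarrow> (\<forall>j. x $ j \<in> energy_ge (max 0 (\<epsilon> * (L + real (len j)))))"

text \<open>The map raises the filtration by k steps of size \<epsilon>: k = 0 for instance if it
  loses no energy and lengthens no word, k = 1 for perturbations. The \<open>max 0\<close> in
  \<open>smr\<close> also records that no energy is lost, which keeps Neumann series over the ring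
  with non-negative exponents.\<close>

definition smF :: "real \<Rightarrow> ('i \<Rightarrow> nat) \<Rightarrow> ('j \<Rightarrow> nat) \<Rightarrow> real \<Rightarrow> ('i \<Rightarrow> 'j vec) \<Rightarrow> bool" where
  "smF \<epsilon> ls lt k F \<longleftrightarrow> (\<forall>i. smr \<epsilon> lt (k - real (ls i)) (F i))"

lemma smr_vge: "smr \<epsilon> len L x \<Longrightarrow> vge 0 x"
  by (auto simp: smr_def vge_def intro: energy_ge_mono)

lemma smF_vge: "smF \<epsilon> ls lt k F \<Longrightarrow> vge 0 (F i)"
  by (auto simp: smF_def intro: smr_vge)

lemma smF_bdd: "smF \<epsilon> ls lt k F \<Longrightarrow> bdd F"
  by (rule bddI[of 0]) (rule smF_vge)

lemma smr_0 [simp]: "smr \<epsilon> len L 0" by (simp add: smr_def)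
lemma smr_add: "smr \<epsilon> len L x \<Longrightarrow> smr \<epsilon> len L y \<Longrightarrow> smr \<epsilon> len L (x + y)"
  by (simp add: smr_def energy_ge_add)
lemma smr_diff: "smr \<epsilon> len L x \<Longrightarrow> smr \<epsilon> len L y \<Longrightarrow> smr \<epsilon> len L (x - y)"
  by (simp add: smr_def energy_ge_diff)
lemma smr_scale: "smr \<epsilon> len L x \<Longrightarrow> a \<in> energy_ge 0 \<Longrightarrow> smr \<epsilon> len L (a *v x)"
  by (auto simp: smr_def intro: energy_ge_mult')
lemma smr_ssum: "(\<And>a b. a @ b = u \<Longrightarrow> smr \<epsilon> len L (f a b)) \<Longrightarrow> smr \<epsilon> len L (ssum u f)"
  by (induction u arbitrary: f) (simp_all add: smr_add)

lemma smF_add: "smF \<epsilon> ls lt k F \<Longrightarrow> smF \<epsilon> ls lt k G \<Longrightarrow> smF \<epsilon> ls lt k (\<lambda>i. F i + G i)"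
  by (simp add: smF_def smr_add)
lemma smF_diff: "smF \<epsilon> ls lt k F \<Longrightarrow> smF \<epsilon> ls lt k G \<Longrightarrow> smF \<epsilon> ls lt k (\<lambda>i. F i - G i)"
  by (simp add: smF_def smr_diff)

lemma smr_app:
  assumes "\<epsilon> > 0" "smr \<epsilon> ls L x" "smF \<epsilon> ls lt k F" shows "smr \<epsilon> lt (L + k) (app F x)"
  unfolding smr_def vnth_app[OF smF_bdd[OF assms(3)]]
proof
  fix j
  show "nov_sum (\<lambda>i. x $ i * F i $ j) \<in> energy_ge (max 0 (\<epsilon> * (L + k + real (lt j))))"
  proof (rule nov_sum_ge[OF cvg_app1[OF smF_bdd[OF assms(3)]]])
    fix i
    have 1: "x $ i \<in> energy_ge (max 0 (\<epsilon> * (L + real (ls i))))"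
      "F i $ j \<in> energy_ge (max 0 (\<epsilon> * (k - real (ls i) + real (lt j))))"
      using assms(2,3) by (auto simp: smr_def smF_def)
    \<comment> \<open>The length \<open>ls i\<close> of the intermediate word cancels, and the
      positive part is subadditive.\<close>
    have "max 0 (\<epsilon> * (L + k + real (lt j))) \<le>
      max 0 (\<epsilon> * (L + real (ls i))) + max 0 (\<epsilon> * (k - real (ls i) + real (lt j)))"
      by (auto simp: algebra_simps max_def)
    then show "x $ i * F i $ j \<in> energy_ge (max 0 (\<epsilon> * (L + k + real (lt j))))"
      using 1 by (rule energy_ge_mult'[rotated 2])
  qed
qed

lemma smF_app:
  assumes "\<epsilon> > 0" "smF \<epsilon> ls lt k F" "smF \<epsilon> lt lu l G" shows "smF \<epsilon> ls lu (k + l) (\<lambda>i. app G (F i))"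
  unfolding smF_def
proof
  fix i
  have "smr \<epsilon> lu (k - real (ls i) + l) (app G (F i))"
    using assms by (intro smr_app[OF assms(1) _ assms(3)]) (simp add: smF_def)
  then show "smr \<epsilon> lu (k + l - real (ls i)) (app G (F i))" by (simp add: algebra_simps)
qed

primrec iter :: "('i \<Rightarrow> 'i vec) \<Rightarrow> 'i vec \<Rightarrow> nat \<Rightarrow> 'i vec" where
  "iter F x 0 = x" | "iter F x (Suc n) = app F (iter F x n)"

context
  fixes F :: "'i \<Rightarrow> 'i vec" and \<epsilon> :: real and len :: "'i \<Rightarrow> nat"
  assumes e: "\<epsilon> > 0" and F: "smF \<epsilon> len len 1 F"
begin

lemma bF: "bdd F" using smF_bdd[OF F] .

lemma smF_iter: "smF \<epsilon> len len (real n) (\<lambda>i. iter F (unitv i) n)"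
proof (induction n)
  case 0
  show ?case by (auto simp: smF_def smr_def vnth_unitv kron_def)
next
  case (Suc n)
  have "smF \<epsilon> len len (real n + 1) (\<lambda>i. app F (iter F (unitv i) n))"
    by (rule smF_app[OF e Suc F])
  then show ?case by (simp add: add.commute)
qed

lemma iter_app: "iter F x n = app (\<lambda>i. iter F (unitv i) n) x"
proof (induction n)
  case (Suc n)
  have "app (\<lambda>i. app F (iter F (unitv i) n)) x = app F (app (\<lambda>i. iter F (unitv i) n) x)"
    by (rule app_app[OF smF_bdd[OF smF_iter] bF, symmetric])
  then show ?case by (simp add: Suc)
qed (simp add: app_unitv_row)

text \<open>The n-th iterate is known to gain energy on a word only once n exceeds its length, and x
  may involve arbitrarily long words. Only finitely many of them carry coefficients of energy below
  E, however, and on the others no energy is lost.\<close>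

lemma iter_tendsto: "\<exists>n0. \<forall>n\<ge>n0. vge E (iter F x n)"
proof -
  let ?I = "{i. x $ i \<notin> energy_ge E}"
  have fin: "finite ?I" using cvgD[OF cvg_vnth] .
  obtain c where c: "vge c x" using vge_ex by blast
  define L where "L = Max (insert 0 (len ` ?I))"
  have L: "len i \<le> L" if "i \<in> ?I" for i unfolding L_def using fin that by (intro Max_ge) auto
  \<comment> \<open>Chosen so that \<epsilon> (n - L) is at least E - c, where L bounds the lengths
    of the words of low energy and c bounds the energy of x from below.\<close>
  obtain n0 where n0: "(E - c) / \<epsilon> + real L \<le> real n0" using real_arch_simple by blast
  have "vge E (iter F x n)" if n: "n \<ge> n0" for n
    unfolding iter_app[of x] vge_def vnth_app[OF smF_bdd[OF smF_iter]]
  proof (intro allI nov_sum_ge[OF cvg_app1[OF smF_bdd[OF smF_iter]]])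
    fix j i
    show "x $ i * iter F (unitv i) n $ j \<in> energy_ge E"
    proof (cases "i \<in> ?I")
      case True
      have "(E - c) / \<epsilon> \<le> real n - real (len i)" using n0 n L[OF True] by linarith
      then have "E - c \<le> \<epsilon> * (real n - real (len i))"
        using e by (simp add: pos_divide_le_eq mult.commute)
      also have "\<dots> \<le> \<epsilon> * (real n - real (len i) + real (len j))" using e by simp
      also have "\<dots> \<le> max 0 (\<epsilon> * (real n - real (len i) + real (len j)))" by simp
      finally have "E - c \<le> max 0 (\<epsilon> * (real n - real (len i) + real (len j)))" .
      moreover have "iter F (unitv i) n $ j \<in> energy_ge (max 0 (\<epsilon> * (real n - real (len i) + real (len j))))"
        using smF_iter[of n] by (simp add: smF_def smr_def)
      ultimately have "iter F (unitv i) n $ j \<in> energy_ge (E - c)" using energy_ge_mono by blast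
      then show ?thesis using c by (auto simp: vge_def intro: energy_ge_mult'[of _ c])
    next
      case False
      moreover have "iter F (unitv i) n $ j \<in> energy_ge 0" using smF_vge[OF smF_iter] by (auto simp: vge_def)
      ultimately show ?thesis by (auto intro: energy_ge_mult'[of _ E _ 0])
    qed
  qed
  then show ?thesis by blast
qed

lemma iter_uniq:
  assumes "z = app F z" shows "z = 0"
proof (rule vge_all_0)
  fix E
  have "iter F z n = z" for n by (induction n) (simp_all add: assms[symmetric])
  then show "vge E z" using iter_tendsto[of E z] by auto
qed

text \<open>The Neumann series. Its terms are assembled into one vector z indexed by pairs (n, j),
  whereby applying F to the infinite sum becomes an instance of \<open>app_app\<close>.\<close>

lemma iter_solve: "\<exists>y. y = x + app F y \<and> (vge 0 x \<longrightarrow> vge 0 y)"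
proof -
  define f where "f = (\<lambda>(n, j). iter F x n $ j)"
  have cf: "cvg f"
  proof (rule cvg_pairI)
    show "cvg (\<lambda>j. f (n, j))" for n by (simp add: f_def)
    fix E
    obtain n0 where n0: "\<And>n. n \<ge> n0 \<Longrightarrow> vge E (iter F x n)" using iter_tendsto by blast
    have "{n. \<exists>j. f (n, j) \<notin> energy_ge E} \<subseteq> {..<n0}"
      using n0 by (auto simp: f_def vge_def) (meson leI)
    then show "finite {n. \<exists>j. f (n, j) \<notin> energy_ge E}" using finite_subset by blast
  qed
  define z where "z = Vec f"
  have z: "z $ (n, j) = iter F x n $ j" for n j using cf by (simp add: z_def Vec_inverse f_def)
  have sum: "app (\<lambda>(n, j). G j) z $ k = nov_sum (\<lambda>n. app G (iter F x n) $ k)"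
    and cv: "cvg (\<lambda>n. app G (iter F x n) $ k)" if G: "\<And>j. vge 0 (G j)" for G :: "'i \<Rightarrow> 'i vec" and k
  proof -
    have bG: "bdd G" using G by (rule bddI)
    have bG': "bdd (\<lambda>(n :: nat, j). G j)" by (rule bddI[of 0]) (auto simp: G)
    have c2: "cvg (\<lambda>(n, j). z $ (n, j) * G j $ k)"
      using cvg_app1[OF bG', of z k] by (simp add: case_prod_unfold)
    have "app (\<lambda>(n, j). G j) z $ k = nov_sum (\<lambda>(n, j). z $ (n, j) * G j $ k)"
      using vnth_app[OF bG', of z k] by (simp add: case_prod_unfold)
    also have "\<dots> = nov_sum (\<lambda>n. nov_sum (\<lambda>j. z $ (n, j) * G j $ k))"
      using nov_sum_Fubini[OF c2] by simp
    finally show "app (\<lambda>(n, j). G j) z $ k = nov_sum (\<lambda>n. app G (iter F x n) $ k)"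
      by (simp add: z vnth_app[OF bG])
    show "cvg (\<lambda>n. app G (iter F x n) $ k)"
      unfolding cvg_def
    proof
      fix E
      obtain n0 where n0: "\<And>n. n \<ge> n0 \<Longrightarrow> vge E (iter F x n)" using iter_tendsto by blast
      have "app G (iter F x n) $ k \<in> energy_ge E" if "n \<ge> n0" for n
        using vge_app_right[OF n0[OF that], of G] G by (auto simp: vge_def)
      then have "{n. app G (iter F x n) $ k \<notin> energy_ge E} \<subseteq> {..<n0}" by (auto simp: not_le[symmetric])
      then show "finite {n. app G (iter F x n) $ k \<notin> energy_ge E}" using finite_subset by blast
    qed
  qed
  define y where "y = app (\<lambda>(n, j). unitv j) z"
  have bu: "bdd (\<lambda>(n :: nat, j :: 'i). unitv j)" by (rule bddI[of 0]) auto
  have y: "y $ k = nov_sum (\<lambda>n. iter F x n $ k)" for k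
    unfolding y_def using sum[of unitv k] by (simp add: app_unitv_row)
  have cy: "cvg (\<lambda>n. iter F x n $ k)" for k using cv[of unitv k] by (simp add: app_unitv_row)
  have "y = x + app F y"
  proof (rule vec_eqI)
    fix k
    have "app F y = app (\<lambda>(n, j). F j) z"
      unfolding y_def using app_app[OF bu bF, of z] by (simp add: case_prod_unfold bF)
    then have "app F y $ k = nov_sum (\<lambda>n. iter F x (Suc n) $ k)"
      using sum[of F k] smF_vge[OF F] by simp
    then show "y $ k = (x + app F y) $ k" using nov_sum_shift[OF cy[of k]] by (simp add: y)
  qed
  moreover have "vge 0 y" if "vge 0 x"
  proof -
    have "vge 0 (iter F x n)" for n
      using that by (induction n) (auto intro: vge_app_left smF_vge[OF F])
    then show ?thesis unfolding vge_def y by (auto intro!: nov_sum_ge cy)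
  qed
  ultimately show ?thesis by blast
qed

end

section \<open>Maps f \<otimes> 1 and the leading part of the differential\<close>

fun tt :: "('v \<Rightarrow> 'u vec) \<Rightarrow> 'v \<times> 'a list \<Rightarrow> ('u \<times> 'a list) vec" where
  "tt f (v, w) = app (\<lambda>y. unitv (y, w)) (f v)"

definition wlen :: "'v \<times> 'a list \<Rightarrow> nat" where "wlen q = length (snd q)"

lemma vgeD: "vge c x \<Longrightarrow> x $ i \<in> energy_ge c" by (simp add: vge_def)

lemma vge_tt: "(\<And>v. vge c (f v)) \<Longrightarrow> vge c (tt f q)" by (cases q) simp

lemma bdd_tt: "bdd f \<Longrightarrow> bdd (tt f)" unfolding bdd_def using vge_tt by blast

lemma tt_tt: "bdd f \<Longrightarrow> bdd g \<Longrightarrow> app (tt g) (tt f q) = tt (\<lambda>v. app g (f v)) q"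
  by (cases q) (simp add: app_push bdd_tt app_app)

lemma tt_add: "tt (\<lambda>v. f v + g v) q = tt f q + tt g q"
  by (cases q) (simp add: app_add)

lemma tt_diff: "tt (\<lambda>v. f v - g v) q = tt f q - tt g q"
  by (cases q) (simp add: app_diff)

lemma smr_push:
  assumes "vge c x" "0 \<le> c" "\<epsilon> * (L + real (length z)) \<le> c"
  shows "smr \<epsilon> wlen L (app (\<lambda>y. unitv (y, z)) x)"
  unfolding smr_def
proof
  fix j
  show "app (\<lambda>y. unitv (y, z)) x $ j \<in> energy_ge (max 0 (\<epsilon> * (L + real (wlen j))))"
  proof (cases "snd j = z")
    case True
    have "vge c (app (\<lambda>y. unitv (y, z)) x)" using assms(1) by (rule vge_push)
    from vgeD[OF this, of j] show ?thesis
      by (rule energy_ge_mono) (use assms(2,3) True in \<open>simp add: wlen_def\<close>)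
  next
    case False
    have "app (\<lambda>y. unitv (y, z)) x $ j = 0"
    proof (rule ccontr)
      assume "app (\<lambda>y. unitv (y, z)) x $ j \<noteq> 0"
      then obtain i where "unitv (i, z) $ j \<noteq> 0" using vnth_app_neq_0[of "\<lambda>y. unitv (y, z)" x j] by auto
      with False show False by (auto simp: vnth_unitv kron_def split: if_splits)
    qed
    then show ?thesis by simp
  qed
qed

lemma smF_tt0: "\<epsilon> > 0 \<Longrightarrow> (\<And>v. vge 0 (f v)) \<Longrightarrow> smF \<epsilon> wlen wlen 0 (tt f)"
  unfolding smF_def by (intro allI, case_tac i) (auto intro!: smr_push simp: wlen_def)

lemma smF_tt1: "\<epsilon> > 0 \<Longrightarrow> (\<And>v. vge \<epsilon> (f v)) \<Longrightarrow> smF \<epsilon> wlen wlen 1 (tt f)"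
  unfolding smF_def by (intro allI, case_tac i) (auto intro!: smr_push simp: wlen_def)

text \<open>The two maps act on different tensor factors. This exact identity covers all algebra
  operations on the word, in particular the insertion of m_0(1), so that \<open>Wb\<close> is never
  estimated in the filtration.\<close>

lemma Wb_tt:
  assumes A: "alg A" and f: "bdd f" "\<And>v. par du (dv v + s) (f v)"
  shows "app (tt f) (Wb A dv q) = ksign s *v app (Wb A du) (tt f q)"
proof -
  obtain v w where q: "q = (v, w)" by (cases q)
  obtain c where c: "\<And>v. vge c (f v)" using f(1) by (auto simp: bdd_def)
  note b = bdd_tt[OF f(1)] bdd_Wb[OF A]
  have b1: "bdd (\<lambda>y. app (\<lambda>x. unitv (y, x)) (abar A w))"
    by (rule bddI[of 0]) (simp add: vge_abar A)
  have "app (Wb A du) (tt f q) = ksign (dv v + s) *v app (\<lambda>y. app (\<lambda>x. unitv (y, x)) (abar A w)) (f v)"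
    unfolding q tt.simps app_push[OF b(2)] Wb.simps
    by (rule app_par[OF f(2) b1]) auto
  also have "app (\<lambda>y. app (\<lambda>x. unitv (y, x)) (abar A w)) (f v) = app (\<lambda>x. app (\<lambda>y. unitv (y, x)) (f v)) (abar A w)"
    by (rule app_swap[of 0]) simp
  also have "\<dots> = app (\<lambda>x. tt f (v, x)) (abar A w)" by simp
  finally have "app (Wb A du) (tt f q) = ksign (dv v + s) *v app (\<lambda>x. tt f (v, x)) (abar A w)" .
  moreover have "ksign s * ksign (dv v + s) = ksign (dv v)" by (simp add: ksign_def)
  ultimately show ?thesis by (simp add: q app_scale b app_push del: tt.simps)
qed

text \<open>A term either consumes a letter, so that the word becomes shorter, or it is n_{0,0},
  from which the leading part f has been removed with an error of energy \<epsilon>. Either way the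
  filtration rises by one step.\<close>

lemma smF_Wr:
  assumes e: "\<epsilon> > 0" and n: "\<And>t. vge 0 (n t)" and d: "\<And>v. vge \<epsilon> (n ([], v, []) - f v)"
  shows "smF \<epsilon> wlen wlen 1 (\<lambda>q. Wr A dv n q - tt f q)"
  unfolding smF_def
proof
  fix q :: "'b \<times> 'a list"
  obtain v w where q: "q = (v, w)" by (cases q)
  define T where "T x l r z = ksign (wd (ad A) l * (dv v + wd (ad A) x)) *v app (\<lambda>y. unitv (y, z)) (n (l, v, r))"
    for x l r z :: "'a list"
  \<comment> \<open>f \<otimes> 1 is written over the same cuts as \<open>Wr\<close>, concentrated
    where both consumed words are empty, so that the difference can be estimated cut by cut.\<close>
  define U where "U l r z = (if l = [] then if r = [] then app (\<lambda>y. unitv (y, z)) (f v) else 0 else 0)" for l r z :: "'a list"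
  have "ssum w (\<lambda>x l. ssum x (\<lambda>r z. U l r z)) = ssum w (\<lambda>x l. if l = [] then app (\<lambda>y. unitv (y, x)) (f v) else 0)"
    by (rule ssum_cong) (simp add: U_def ssum_Nil1)
  then have "tt f q = ssum w (\<lambda>x l. ssum x (\<lambda>r z. U l r z))" by (simp add: ssum_Nil2 q)
  then have "Wr A dv n q = tt f q + ssum w (\<lambda>x l. ssum x (\<lambda>r z. T x l r z - U l r z))"
    by (simp add: q T_def ssum_add[symmetric])
  moreover have "smr \<epsilon> wlen (1 - real (wlen q)) (ssum w (\<lambda>x l. ssum x (\<lambda>r z. T x l r z - U l r z)))"
  proof (intro smr_ssum)
    fix x l r z :: "'a list" assume w: "x @ l = w" "r @ z = x"
    show "smr \<epsilon> wlen (1 - real (wlen q)) (T x l r z - U l r z)"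
    proof (cases "l = [] \<and> r = []")
      case True
      then have "T x l r z - U l r z = app (\<lambda>y. unitv (y, z)) (n ([], v, []) - f v)"
        by (simp add: T_def U_def app_diff)
      also have "smr \<epsilon> wlen (1 - real (wlen q)) \<dots>"
        by (rule smr_push[OF d]) (use e w True q in \<open>auto simp: wlen_def\<close>)
      finally show ?thesis .
    next
      case False
      then have U: "U l r z = 0" and "length r + length l \<ge> 1" by (auto simp: U_def Suc_le_eq)
      then have "1 - real (wlen q) + real (length z) \<le> 0" using w q by (auto simp: wlen_def)
      then have "\<epsilon> * (1 - real (wlen q) + real (length z)) \<le> 0" using e by (simp add: mult_nonneg_nonpos)
      then have "smr \<epsilon> wlen (1 - real (wlen q)) (T x l r z)"
        unfolding T_def by (intro smr_scale smr_push[OF n]) auto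
      then show ?thesis by (simp add: U)
    qed
  qed
  ultimately show "smr \<epsilon> wlen (1 - real (wlen q)) (Wr A dv n q - tt f q)" by simp
qed

text \<open>Chains are cut out by an idempotent acting on the words: the projection to the words over the
  basis for Hochschild chains, followed by symmetrization for Chevalley-Eilenberg chains.\<close>

fun pj :: "'v set \<Rightarrow> ('a list \<Rightarrow> 'a list vec) \<Rightarrow> 'v \<times> 'a list \<Rightarrow> ('v \<times> 'a list) vec" where
  "pj V Q (v, w) = (if v \<in> V then app (\<lambda>x. unitv (v, x)) (Q w) else 0)"

text \<open>Idempotence makes chains the fixed vectors of the projection, and preservation of word
  length makes it compatible with the filtration.\<close>

definition wproj :: "'a valg \<Rightarrow> ('a list \<Rightarrow> 'a list vec) \<Rightarrow> bool" where
  "wproj A Q \<longleftrightarrow> (\<forall>w. vge 0 (Q w)) \<and> (\<forall>w. supv (lists (aX A)) (Q w)) \<and> (\<forall>w. app Q (Q w) = Q w) \<and>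
     (\<forall>w x. Q w $ x \<noteq> 0 \<longrightarrow> length x = length w)"

definition chn :: "bool \<Rightarrow> 'v set \<Rightarrow> ('a list \<Rightarrow> 'a list vec) \<Rightarrow> ('v \<times> 'a list) vec set" where
  "chn fil V Q = {x. app (pj V Q) x = x \<and> (fil \<longrightarrow> vge 0 x)}"

lemma wprojD:
  assumes "wproj A Q"
  shows "vge 0 (Q w)" "supv (lists (aX A)) (Q w)" "app Q (Q w) = Q w" "Q w $ x \<noteq> 0 \<Longrightarrow> length x = length w" "bdd Q"
  using assms by (auto simp: wproj_def intro: bddI)

lemma vge_pj: "wproj A Q \<Longrightarrow> vge 0 (pj V Q q)"
  by (cases q) (simp add: wprojD)

lemma bdd_pj: "wproj A Q \<Longrightarrow> bdd (pj V Q)"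
  by (rule bddI[of 0]) (rule vge_pj)

lemma pj_pj: assumes "wproj A Q" shows "app (pj V Q) (pj V Q q) = pj V Q q"
proof -
  obtain v w where q: "q = (v, w)" by (cases q)
  have "app (\<lambda>x. pj V Q (v, x)) (Q w) = app (\<lambda>x. unitv (v, x)) (app Q (Q w))" if "v \<in> V"
    using that by (simp add: app_app wprojD(5)[OF assms])
  then show ?thesis by (simp add: q app_push bdd_pj[OF assms] wprojD(3)[OF assms])
qed

lemma pj_pj': assumes "wproj A Q" shows "app (pj V Q) (app (pj V Q) x) = app (pj V Q) x"
  by (simp add: app_app bdd_pj[OF assms] pj_pj[OF assms])

lemma supv_pj: "wproj A Q \<Longrightarrow> supv (hS A V) (pj V Q q)"
  by (cases q) (auto simp: hS_def intro!: supv_push[of "lists (aX A)"] wprojD(2))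

lemma chn_supv: assumes "wproj A Q" "x \<in> chn fil V Q" shows "supv (hS A V) x"
proof -
  have "supv (hS A V) (app (pj V Q) x)"
    by (rule supv_app[OF bdd_pj[OF assms(1)], of UNIV]) (auto intro: supv_pj[OF assms(1)] simp: supv_def[of UNIV])
  then show ?thesis using assms(2) by (simp add: chn_def)
qed

lemma subgrp_chn: "wproj A Q \<Longrightarrow> subgrp (chn fil V Q)"
  by (auto simp: subgrp_def chn_def app_diff[OF bdd_pj] vge_diff)

lemma smF_pj:
  assumes "wproj A Q" "\<epsilon> > 0" shows "smF \<epsilon> wlen wlen 0 (pj V Q)"
  unfolding smF_def smr_def
proof (intro allI)
  fix q j :: "'b \<times> 'a list"
  show "pj V Q q $ j \<in> energy_ge (max 0 (\<epsilon> * (0 - real (wlen q) + real (wlen j))))"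
  proof (cases "pj V Q q $ j = 0")
    case False
    obtain v w where q: "q = (v, w)" by (cases q)
    have "app (\<lambda>x. unitv (v, x)) (Q w) $ j \<noteq> 0" using False by (auto simp: q split: if_splits)
    then obtain x where "Q w $ x \<noteq> 0" "unitv (v, x) $ j \<noteq> 0"
      using vnth_app_neq_0[of "\<lambda>x. unitv (v, x)" "Q w" j] by auto
    then have "wlen j = wlen q" using wprojD(4)[OF assms(1)] by (auto simp: q wlen_def vnth_unitv kron_def split: if_splits)
    then show ?thesis using vgeD[OF vge_pj[OF assms(1), of V q], of j] by simp
  qed simp
qed

lemma pj_tt:
  assumes Q: "wproj A Q" and f: "bdd f" "\<And>v. supv U (f v)" "\<And>v. v \<notin> V \<Longrightarrow> f v = 0"
  shows "app (pj U Q) (tt f q) = app (tt f) (pj V Q q)"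
proof -
  obtain v w where q: "q = (v, w)" by (cases q)
  have "app (pj U Q) (tt f q) = app (\<lambda>y. pj U Q (y, w)) (f v)"
    by (simp only: q tt.simps app_push[OF bdd_pj[OF Q]])
  also have "\<dots> = app (\<lambda>y. app (\<lambda>x. unitv (y, x)) (Q w)) (f v)"
    by (rule app_cong_supv[OF f(2)]) simp
  also have "\<dots> = app (\<lambda>x. tt f (v, x)) (Q w)"
    by (subst app_swap[of 0]) simp_all
  also have "\<dots> = app (tt f) (pj V Q q)"
    using f(3) by (simp add: q app_push bdd_tt[OF f(1)])
  finally show ?thesis .
qed

text \<open>A chain is its own image under \<open>pj\<close>, so it suffices that D sends the rows
  of the first idempotent into the image of the second.\<close>

lemma chn_map:
  assumes Q: "wproj A Q" and D: "bdd D" "fil \<Longrightarrow> (\<forall>q. vge 0 (D q))"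
    and P: "\<And>q. app (pj U Q) (app D (pj V Q q)) = app D (pj V Q q)" and x: "x \<in> chn fil V Q"
  shows "app D x \<in> chn fil U Q"
proof -
  have "app D x = app D (app (pj V Q) x)" using x by (simp add: chn_def)
  also have "\<dots> = app (\<lambda>q. app (pj U Q) (app D (pj V Q q))) x"
    by (simp add: app_app bdd_pj[OF Q] D P)
  also have "\<dots> = app (pj U Q) (app D (app (pj V Q) x))"
    by (simp add: app_app bdd_pj[OF Q] D bdd_app)
  finally have "app (pj U Q) (app D x) = app D x" using x by (simp add: chn_def)
  then show ?thesis using x D(2) by (auto simp: chn_def intro!: vge_app_left)
qed

lemma chn_tt:
  assumes Q: "wproj A Q" and f: "\<And>v. vge 0 (f v)" "\<And>v. supv U (f v)" "\<And>v. v \<notin> V \<Longrightarrow> f v = 0"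
    and x: "x \<in> chn fil V Q"
  shows "app (tt f) x \<in> chn fil U Q"
proof (rule chn_map[OF Q _ _ _ x])
  have b: "bdd f" using f(1) by (rule bddI)
  show "bdd (tt f)" by (rule bdd_tt[OF b])
  show "\<forall>q. vge 0 (tt f q)" using vge_tt[where f = f, OF f(1)] by blast
  show "app (pj U Q) (app (tt f) (pj V Q q)) = app (tt f) (pj V Q q)" for q
    using pj_tt[OF Q b f(2,3), of V q] pj_pj'[OF Q, of U "tt f q"] by simp
qed

lemma addh_app: "bdd D \<Longrightarrow> addh (app D)"
  by (simp add: addh_def app_add)

text \<open>\<open>dY\<close>, \<open>dN\<close>, \<open>jr\<close>, \<open>h\<close> and
  \<open>s\<close> are reduced data: the differentials, the inclusion, a homotopy and a homotopy
  inverse of the inclusion; \<open>e\<close> and \<open>j\<close> are unreduced. The reduced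
  homotopy contracts 1 - J s up to sign, and J s is annihilated by 1 - J E because E J = 1. All
  remaining discrepancies raise the filtration, and \<open>perturbation_iso\<close> applies with a
  Neumann series.\<close>

lemma eval_iso:
  fixes MY :: "('a, 'k, 'a) vbim" and MN :: "('a, 'n, 'a) vbim"
  assumes A: "alg A" and Y: "bim A A MY" and N: "bim A A MN" and Q: "wproj A Q" and eps: "\<epsilon> > 0"
    and vg: "\<And>v. vge 0 (e v)" "\<And>v. vge 0 (j v)" "\<And>v. vge 0 (h v)" "\<And>v. vge 0 (s v)" "\<And>v. vge 0 (dY v)"
      "\<And>v. vge 0 (dN v)" "\<And>v. vge 0 (jr v)"
    and sp: "\<And>v. supv (bV MN) (e v)" "\<And>v. supv (bV MY) (j v)" "\<And>v. supv (bV MY) (h v)" "\<And>v. supv (bV MN) (s v)"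
    and zr: "\<And>v. v \<notin> bV MY \<Longrightarrow> e v = 0" "\<And>v. v \<notin> bV MN \<Longrightarrow> j v = 0" "\<And>v. v \<notin> bV MY \<Longrightarrow> h v = 0"
    and pa: "\<And>v. par (bv MY) (bv MN v + 0) (j v)" "\<And>v. par (bv MY) (bv MY v + 1) (h v)"
    and ej: "\<And>v. v \<in> bV MN \<Longrightarrow> app e (j v) = unitv v"
    and red: "\<And>v. vge \<epsilon> (bn MY ([], v, []) - dY v)" "\<And>v. vge \<epsilon> (bn MN ([], v, []) - dN v)" "\<And>v. vge \<epsilon> (j v - jr v)"
    and hty: "\<And>v. v \<in> bV MY \<Longrightarrow> app h (dY v) + app dY (h v) = app jr (s v) - unitv v"
    and jch: "\<And>v. v \<in> bV MN \<Longrightarrow> app dY (jr v) = app jr (dN v)"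
    and ch: "\<And>q. q \<in> hS A (bV MY) \<Longrightarrow> app (tt e) (hD A MY q) = app (hD A MN) (tt e q)"
    and PY: "\<And>q. app (pj (bV MY) Q) (app (hD A MY) (pj (bV MY) Q q)) = app (hD A MY) (pj (bV MY) Q q)"
    and PN: "\<And>q. app (pj (bV MN) Q) (app (hD A MN) (pj (bV MN) Q q)) = app (hD A MN) (pj (bV MN) Q q)"
  shows "hinj (chn fil (bV MY) Q) (app (hD A MY)) (chn fil (bV MN) Q) (app (hD A MN)) (app (tt e))"
    "hsur (chn fil (bV MY) Q) (app (hD A MY)) (chn fil (bV MN) Q) (app (hD A MN)) (app (tt e))"
proof -
  define SY where "SY = chn fil (bV MY) Q"
  define SN where "SN = chn fil (bV MN) Q"
  define D where "D = app (hD A MY)"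
  define D' where "D' = app (hD A MN)"
  define E where "E = app (tt e :: 'k \<times> 'a list \<Rightarrow> _)"
  define J where "J = app (tt j :: 'n \<times> 'a list \<Rightarrow> _)"
  define H where "H = app (tt h :: 'k \<times> 'a list \<Rightarrow> _)"
  have nY: "\<And>t. vge 0 (bn MY t)" and nN: "\<And>t. vge 0 (bn MN t)" using bimD(1) Y N by blast+
  have bvec: "bdd e" "bdd j" "bdd h" "bdd s" "bdd dY" "bdd dN" "bdd jr"
    using vg by (auto intro: bddI[of 0])
  note bt = bvec[THEN bdd_tt]
  note bD = bdd_hD[OF A nY] bdd_hD[OF A nN] bdd_Wb[OF A] bdd_pj[OF Q]
  \<comment> \<open>The differential is split into the bar part \<open>Wb\<close>, the reduced
    linear part and a remainder. The first two obey exact identities, the remainder raises the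
    filtration.\<close>
  define ZY where "ZY q = Wr A (bv MY) (bn MY) q - tt dY q" for q
  define ZN where "ZN q = Wr A (bv MN) (bn MN) q - tt dN q" for q
  have ZY: "smF \<epsilon> wlen wlen 1 ZY" and ZN: "smF \<epsilon> wlen wlen 1 ZN"
    unfolding ZY_def[abs_def] ZN_def[abs_def]
    by (rule smF_Wr[where n = "bn MY" and f = dY, OF eps nY red(1)],
        rule smF_Wr[where n = "bn MN" and f = dN, OF eps nN red(2)])
  have hDY: "hD A MY q = Wb A (bv MY) q + tt dY q + ZY q" for q by (simp add: hD_def ZY_def)
  have hDN: "hD A MN q = Wb A (bv MN) q + tt dN q + ZN q" for q by (simp add: hD_def ZN_def)
  note bZ = smF_bdd[OF ZY] smF_bdd[OF ZN]
  have aY: "app (hD A MY) x = app (Wb A (bv MY)) x + app (tt dY) x + app ZY x" for x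
    using app_row_add[OF bdd_add[OF bdd_Wb[OF A, of "bv MY"] bt(5)] bZ(1), of x]
      app_row_add[OF bdd_Wb[OF A, of "bv MY"] bt(5), of x]
    by (simp add: hDY[THEN ext])
  have aN: "app (hD A MN) x = app (Wb A (bv MN)) x + app (tt dN) x + app ZN x" for x
    using app_row_add[OF bdd_add[OF bdd_Wb[OF A, of "bv MN"] bt(6)] bZ(2), of x]
      app_row_add[OF bdd_Wb[OF A, of "bv MN"] bt(6), of x]
    by (simp add: hDN[THEN ext])
  \<comment> \<open>K is the defect of the homotopy formula, R that of the chain map property of J.
    In both the contributions of \<open>Wb\<close> cancel by \<open>Wb_tt\<close>.\<close>
  define K where "K q = app (tt h) (ZY q) + app ZY (tt h q) - app (tt (\<lambda>v. j v - jr v)) (tt s q)" for q :: "'k \<times> 'a list"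
  define R where "R q = app ZY (tt j q) - app (tt j) (ZN q) + (app (tt dY) (tt (\<lambda>v. j v - jr v) q) - app (tt (\<lambda>v. j v - jr v)) (tt dN q))"
    for q :: "'n \<times> 'a list"
  have t0: "smF \<epsilon> wlen wlen 0 (tt e)" "smF \<epsilon> wlen wlen 0 (tt j)" "smF \<epsilon> wlen wlen 0 (tt h)" "smF \<epsilon> wlen wlen 0 (tt s)"
    "smF \<epsilon> wlen wlen 0 (tt dY)" "smF \<epsilon> wlen wlen 0 (tt dN)"
    by (auto intro!: smF_tt0 eps vg)
  have t1: "smF \<epsilon> wlen wlen 1 (tt (\<lambda>v. j v - jr v))" by (rule smF_tt1[OF eps red(3)])
  have bj: "bdd (\<lambda>v. j v - jr v)" by (rule bdd_diff[OF bvec(2) bvec(7)])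
  have sK: "smF \<epsilon> wlen wlen 1 K"
    unfolding K_def[abs_def]
    using smF_app[OF eps ZY t0(3)] smF_app[OF eps t0(3) ZY] smF_app[OF eps t0(4) t1] by (intro smF_diff smF_add) simp_all
  have sR: "smF \<epsilon> wlen wlen 1 R"
    unfolding R_def[abs_def]
    using smF_app[OF eps t0(2) ZY] smF_app[OF eps ZN t0(2)] smF_app[OF eps t1 t0(5)] smF_app[OF eps t0(6) t1]
    by (intro smF_diff smF_add) simp_all
  note bKR = smF_bdd[OF sK] smF_bdd[OF sR]
  have Kq: "app (hD A MY) (tt h q) + app (tt h) (hD A MY q) = app (tt j) (tt s q) - unitv q + K q"
    if "q \<in> hS A (bV MY)" for q :: "'k \<times> 'a list"
  proof -
    obtain v w where q: "q = (v, w)" by (cases q)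
    have "tt (\<lambda>v. app h (dY v) + app dY (h v)) q = tt (\<lambda>v. app jr (s v)) q - unitv q"
      using that by (simp add: q hS_def hty app_diff)
    then have m: "app (tt h) (tt dY q) + app (tt dY) (tt h q) = app (tt jr) (tt s q) - unitv q"
      by (simp add: tt_add tt_tt bvec)
    have wb: "app (tt h) (Wb A (bv MY) q) = - app (Wb A (bv MY)) (tt h q)"
      using Wb_tt[OF A bvec(3) pa(2), of q] by (simp add: ksign_def)
    have jj: "app (tt (\<lambda>v. j v - jr v)) x = app (tt j) x - app (tt jr) x" for x :: "('n \<times> 'a list) vec"
      unfolding tt_diff by (rule app_row_diff[OF bt(2) bt(7)])
    have "app (hD A MY) (tt h q) + app (tt h) (hD A MY q) =
      (app (tt h) (tt dY q) + app (tt dY) (tt h q)) + app (tt h) (ZY q) + app ZY (tt h q)"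
      unfolding aY by (simp add: hDY app_add bt wb)
    then show ?thesis unfolding m K_def jj by simp
  qed
  have Rq: "app (hD A MY) (tt j q) = app (tt j) (hD A MN q) + R q" if "q \<in> hS A (bV MN)" for q :: "'n \<times> 'a list"
  proof -
    obtain v w where q: "q = (v, w)" by (cases q)
    have "tt (\<lambda>v. app dY (jr v)) q = tt (\<lambda>v. app jr (dN v)) q"
      using that by (simp add: q hS_def jch)
    then have m: "app (tt dY) (tt jr q) = app (tt jr) (tt dN q)"
      by (simp add: tt_tt bvec)
    have wb: "app (tt j) (Wb A (bv MN) q) = app (Wb A (bv MY)) (tt j q)"
      using Wb_tt[OF A bvec(2) pa(1), of q] by simp
    have jj: "app (tt (\<lambda>v. j v - jr v)) x = app (tt j) x - app (tt jr) x" for x :: "('n \<times> 'a list) vec"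
      unfolding tt_diff by (rule app_row_diff[OF bt(2) bt(7)])
    show ?thesis unfolding aY by (simp add: hDN app_add app_diff bt wb R_def jj tt_diff m)
  qed
  have supY: "supv (hS A (bV MY)) x" if "x \<in> SY" for x using chn_supv[OF Q] that by (simp add: SY_def)
  have supN: "supv (hS A (bV MN)) x" if "x \<in> SN" for x using chn_supv[OF Q] that by (simp add: SN_def)
  have Kx: "D (H x) + H (D x) = J (app (tt s) x) - x + app K x" if "x \<in> SY" for x
  proof -
    have "D (H x) + H (D x) = app (\<lambda>q. app (hD A MY) (tt h q) + app (tt h) (hD A MY q)) x"
      by (simp add: D_def H_def app_app bt bD app_row_add bdd_app)
    also have "\<dots> = app (\<lambda>q. app (tt j) (tt s q) - unitv q + K q) x"
      by (rule app_cong_supv[OF supY[OF that]]) (rule Kq)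
    also have "\<dots> = J (app (tt s) x) - x + app K x"
      by (simp add: J_def app_app bt app_row_add app_row_diff bdd_app bdd_diff bKR app_unitv_row)
    finally show ?thesis .
  qed
  have Ry: "D (J y) = J (D' y) + app R y" if "y \<in> SN" for y
  proof -
    have "D (J y) = app (\<lambda>q. app (hD A MY) (tt j q)) y"
      by (simp add: D_def J_def app_app bt bD)
    also have "\<dots> = app (\<lambda>q. app (tt j) (hD A MN q) + R q) y"
      by (rule app_cong_supv[OF supN[OF that]]) (rule Rq)
    also have "\<dots> = J (D' y) + app R y"
      by (simp add: J_def D'_def app_app bt bD app_row_add bdd_app bKR)
    finally show ?thesis .
  qed
  have EJ: "E (J y) = y" if "supv (hS A (bV MN)) y" for y
  proof -
    have "E (J y) = app (tt (\<lambda>v. app e (j v))) y"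
      by (simp add: E_def J_def app_app bt tt_tt bvec)
    also have "\<dots> = app unitv y"
      by (rule app_cong_supv[OF that]) (auto simp: hS_def ej)
    finally show ?thesis by (simp add: app_unitv_row)
  qed
  have vgs: "\<And>q. vge 0 (hD A MY q)" "\<And>q. vge 0 (hD A MN q)" using vge_hD A nY nN by blast+
  have maps: "\<And>x. x \<in> SY \<Longrightarrow> D x \<in> SY" "\<And>y. y \<in> SN \<Longrightarrow> D' y \<in> SN" "\<And>x. x \<in> SY \<Longrightarrow> E x \<in> SN"
      "\<And>y. y \<in> SN \<Longrightarrow> J y \<in> SY" "\<And>x. x \<in> SY \<Longrightarrow> H x \<in> SY"
    unfolding SY_def SN_def D_def D'_def E_def J_def H_def
    by (auto intro!: chn_map[OF Q bD(1) _ PY] chn_map[OF Q bD(2) _ PN] chn_tt[OF Q vg(1) sp(1) zr(1)]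
      chn_tt[OF Q vg(2) sp(2) zr(2)] chn_tt[OF Q vg(3) sp(3) zr(3)] vgs)
  note S = subgrp_chn[OF Q, of fil "bV MY", folded SY_def] subgrp_chn[OF Q, of fil "bV MN", folded SN_def]
  \<comment> \<open>N has the shape asked for by \<open>perturbation_iso\<close>; \<open>Nr\<close>
    is a filtration-raising matrix that agrees with it on chains, as shown in
    \<open>NN\<close>.\<close>
  define N where "N x = x - J (E x) + D (H x - J (E (H x))) + (H (D x) - J (E (H (D x))))" for x
  define Nr where "Nr q = K q - app (tt j) (app (tt e) (K q)) - app R (app (tt e) (tt h q))" for q :: "'k \<times> 'a list"
  have sNr: "smF \<epsilon> wlen wlen 1 Nr"
    unfolding Nr_def[abs_def]
    using sK smF_app[OF eps smF_app[OF eps sK t0(1)] t0(2)] smF_app[OF eps smF_app[OF eps t0(3) t0(1)] sR]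
    by (intro smF_diff) simp_all
  note bNr = smF_bdd[OF sNr]
  \<comment> \<open>The Neumann series is run with the projected operator, which is defined on all
    vectors and still raises the filtration; the solution for a chain x is then itself fixed by the
    projection.\<close>
  define F where "F q = app (pj (bV MY) Q) (Nr q)" for q
  have sF: "smF \<epsilon> wlen wlen 1 F"
    unfolding F_def[abs_def] using smF_app[OF eps sNr smF_pj[OF Q eps]] by simp
  have Fx: "app F x = app (pj (bV MY) Q) (app Nr x)" for x
    by (simp add: F_def[abs_def] app_app bNr bD)
  have ad: "addh D" "addh D'" "addh E" "addh J" "addh H"
    unfolding D_def D'_def E_def J_def H_def by (intro addh_app bD bt)+
  note al = addhD[OF ad(1)] addhD[OF ad(2)] addhD[OF ad(3)] addhD[OF ad(4)] addhD[OF ad(5)]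
  have ED: "E (D x) = D' (E x)" if "x \<in> SY" for x
  proof -
    have "E (D x) = app (\<lambda>q. app (tt e) (hD A MY q)) x" by (simp add: E_def D_def app_app bt bD)
    also have "\<dots> = app (\<lambda>q. app (hD A MN) (tt e q)) x" by (rule app_cong_supv[OF supY[OF that]]) (rule ch)
    finally show ?thesis by (simp add: E_def D'_def app_app bt bD)
  qed
  have DD: "D (D x) = 0" if "x \<in> SY" for x
  proof -
    have "D (D x) = app (\<lambda>q. app (hD A MY) (hD A MY q)) x" by (simp add: D_def app_app bD)
    also have "\<dots> = app (\<lambda>_. 0) x" by (rule app_cong_supv[OF supY[OF that]]) (rule hD_hD[OF A Y])
    finally show ?thesis by simp
  qed
  have NN: "N x = app Nr x" if x: "x \<in> SY" for x
  proof -
    define W where "W = D (H x) + H (D x)"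
    have W: "W = J (app (tt s) x) - x + app K x" unfolding W_def by (rule Kx[OF x])
    have "supv (hS A (bV MN)) (app (tt s) x)"
      by (rule supv_app[OF bt(4) supY[OF x]]) (auto simp: hS_def intro!: supv_push[OF sp(4)])
    \<comment> \<open>E J = 1 makes J s drop out of W - J E W, whose term - (x - J E x) cancels the
      first summand of N.\<close>
    from EJ[OF this] have "J (E W) = J (app (tt s) x) - J (E x) + J (E (app K x))"
      unfolding W by (simp add: al)
    moreover have "D (J (E (H x))) = J (E (D (H x))) + app R (E (H x))"
      using Ry[OF maps(3)[OF maps(5)[OF x]]] ED[OF maps(5)[OF x]] by simp
    then have "N x = x - J (E x) + W - J (E W) - app R (E (H x))"
      unfolding N_def W_def by (simp add: al algebra_simps)
    ultimately have "N x = app K x - J (E (app K x)) - app R (E (H x))"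
      unfolding W by (simp add: algebra_simps)
    also have "\<dots> = app Nr x"
      by (simp add: Nr_def[abs_def] app_row_diff bdd_app bdd_diff bKR bt J_def E_def H_def app_app)
    finally show ?thesis .
  qed
  have Nmap: "N x \<in> SY" if "x \<in> SY" for x
    unfolding N_def using that by (intro subgrpD[OF S(1)] maps) auto
  have PJ: "app (pj (bV MY) Q) x = x" if "x \<in> SY" for x using that by (simp add: SY_def chn_def)
  have solv: "\<exists>y\<in>SY. y = x + N y" if x: "x \<in> SY" for x
  proof -
    obtain y where y: "y = x + app F y" "vge 0 x \<longrightarrow> vge 0 y" using iter_solve[OF eps sF] by blast
    have "app (pj (bV MY) Q) y = app (pj (bV MY) Q) x + app (pj (bV MY) Q) (app F y)"
      by (subst y(1)) (rule app_add[OF bD(4)])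
    also have "\<dots> = y" using y(1) by (simp add: PJ[OF x] Fx pj_pj'[OF Q])
    finally have yS: "y \<in> SY" using y(2) x by (auto simp: SY_def chn_def)
    then have "app F y = N y" by (simp add: Fx NN[symmetric] PJ Nmap)
    then show ?thesis using yS y(1) by metis
  qed
  have uniq: "z = 0" if z: "z \<in> SY" "z = N z" for z
  proof (rule iter_uniq[OF eps sF])
    show "z = app F z" using z by (simp add: Fx NN[symmetric] PJ)
  qed
  have EJ': "E (J y) = y" if "y \<in> SN" for y using EJ supN that by blast
  have N': "N x = x - J (E x) + D (H x - J (E (H x))) + (H (D x) - J (E (H (D x))))" if "x \<in> SY" for x
    by (rule N_def)
  have "hinj SY D SN D' E" "hsur SY D SN D' E"
    by (rule perturbation_iso[where N = N and H = H and J = J], (fact ad S maps DD ED EJ' N' solv uniq)+)+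
  then show "hinj (chn fil (bV MY) Q) (app (hD A MY)) (chn fil (bV MN) Q) (app (hD A MN)) (app (tt e))"
    "hsur (chn fil (bV MY) Q) (app (hD A MY)) (chn fil (bV MN) Q) (app (hD A MN)) (app (tt e))"
    by (simp_all only: SY_def SN_def D_def D'_def E_def)
qed

section \<open>Signed symmetrization of words\<close>

text \<open>Signed sum of G over all orders of the letters, generated by inserting the first letter
  at every position. This replaces permutations in the inductions; \<open>sum_perms\<close> is the
  link.\<close>

primrec symsum :: "('a \<Rightarrow> int) \<Rightarrow> 'a list \<Rightarrow> ('a list \<Rightarrow> nov) \<Rightarrow> nov" where
  "symsum d [] G = G []"
| "symsum d (x # w) G = symsum d w (\<lambda>y. ssum y (\<lambda>p q. ksign (d x * wd d p) * G (p @ x # q)))"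

text \<open>Signed sum over the ways of distributing the letters, in order, to two words. A letter
  sent to the second word passes those of the first, hence the sign.\<close>

primrec shsum :: "('a \<Rightarrow> int) \<Rightarrow> 'a list \<Rightarrow> ('a list \<Rightarrow> 'a list \<Rightarrow> nov) \<Rightarrow> nov" where
  "shsum d [] F = F [] []"
| "shsum d (x # w) F = shsum d w (\<lambda>a b. F (x # a) b) + shsum d w (\<lambda>a b. ksign (d x * wd d a) * F a (x # b))"

lemma symsum_cong: "(\<And>y. mset y = mset w \<Longrightarrow> G y = G' y) \<Longrightarrow> symsum d w G = symsum d w G'"
proof (induction w arbitrary: G G')
  case (Cons x w)
  show ?case unfolding symsum.simps
  proof (rule Cons.IH, rule ssum_cong)
    fix y p q assume "mset y = mset w" "p @ q = y"
    then have "mset (p @ x # q) = mset (x # w)" by auto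
    then show "ksign (d x * wd d p) * G (p @ x # q) = ksign (d x * wd d p) * G' (p @ x # q)"
      by (simp only: Cons.prems)
  qed
qed simp

lemma symsum_add: "symsum d w (\<lambda>y. G y + G' y) = symsum d w G + symsum d w G'"
  by (induction w arbitrary: G G') (simp_all add: ssum_add distrib_left)

lemma symsum_mult: "symsum d w (\<lambda>y. k * G y) = k * symsum d w G"
  by (induction w arbitrary: G) (simp_all only: symsum.simps mult.left_commute[of _ k] mult_ssum[of k, symmetric])

lemma shsum_cong: "(\<And>a b. mset (a @ b) = mset w \<Longrightarrow> F a b = F' a b) \<Longrightarrow> shsum d w F = shsum d w F'"
proof (induction w arbitrary: F F')
  case (Cons x w)
  have "shsum d w (\<lambda>a b. F (x # a) b) = shsum d w (\<lambda>a b. F' (x # a) b)"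
    by (rule Cons.IH, rule Cons.prems) simp
  moreover have "shsum d w (\<lambda>a b. ksign (d x * wd d a) * F a (x # b)) = shsum d w (\<lambda>a b. ksign (d x * wd d a) * F' a (x # b))"
    by (rule Cons.IH, rule arg_cong[of _ _ "times _"], rule Cons.prems) simp
  ultimately show ?case by simp
qed simp

lemma wd_mset: "mset y = mset w \<Longrightarrow> wd d y = wd d w"
  unfolding wd_def by (metis mset_map sum_mset_sum_list)

text \<open>Distributing the letters and then ordering both groups is the same as ordering all of
  them and then cutting.\<close>

lemma shsum_symsum:
  "shsum d w (\<lambda>a b. symsum d a (\<lambda>a'. symsum d b (\<lambda>b'. F a' b'))) = symsum d w (\<lambda>y. ssum y F)"
proof (induction w arbitrary: F)
  case (Cons x w)
  define F1 where "F1 a' b' = ssum a' (\<lambda>p q. ksign (d x * wd d p) * F (p @ x # q) b')" for a' b'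
  define F2 where "F2 a' b' = ksign (d x * wd d a') * ssum b' (\<lambda>p q. ksign (d x * wd d p) * F a' (p @ x # q))" for a' b'
  have 1: "symsum d (x # a) (\<lambda>a'. symsum d b (\<lambda>b'. F a' b')) = symsum d a (\<lambda>a'. symsum d b (\<lambda>b'. F1 a' b'))" for a b
  proof -
    have s: "symsum d b (\<lambda>b'. ssum y (\<lambda>p q. H p q b')) = ssum y (\<lambda>p q. symsum d b (\<lambda>b'. H p q b'))" for y :: "'a list" and H
      by (induction y arbitrary: H) (simp_all add: symsum_add)
    show ?thesis unfolding F1_def symsum.simps s symsum_mult ..
  qed
  have 2: "ksign (d x * wd d a) * symsum d a (\<lambda>a'. symsum d (x # b) (\<lambda>b'. F a' b')) = symsum d a (\<lambda>a'. symsum d b (\<lambda>b'. F2 a' b'))" for a b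
  proof -
    have "symsum d a (\<lambda>a'. symsum d b (\<lambda>b'. F2 a' b')) = symsum d a (\<lambda>a'. ksign (d x * wd d a) * symsum d (x # b) (\<lambda>b'. F a' b'))"
    proof (rule symsum_cong)
      fix y assume "mset y = mset a"
      then have "wd d y = wd d a" by (rule wd_mset)
      then show "symsum d b (\<lambda>b'. F2 y b') = ksign (d x * wd d a) * symsum d (x # b) (\<lambda>b'. F y b')"
        by (simp add: F2_def symsum_mult)
    qed
    then show ?thesis by (simp only: symsum_mult)
  qed
  have "shsum d (x # w) (\<lambda>a b. symsum d a (\<lambda>a'. symsum d b (\<lambda>b'. F a' b'))) =
    symsum d w (\<lambda>y. ssum y F1) + symsum d w (\<lambda>y. ssum y F2)"
    unfolding shsum.simps 1 2 Cons.IH ..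
  also have "\<dots> = symsum d w (\<lambda>y. ssum y (\<lambda>p q. ksign (d x * wd d p) * ssum (p @ x # q) F))"
    unfolding symsum_add[symmetric]
  proof (rule symsum_cong)
    fix y
    have "ssum y (\<lambda>p q. ksign (d x * wd d p) * ssum (p @ x # q) F) =
      ssum y (\<lambda>p q. ssum p (\<lambda>p1 p2. ksign (d x * (wd d p1 + wd d p2)) * F p1 (p2 @ x # q))) +
      ssum y (\<lambda>p q. ssum q (\<lambda>q1 q2. ksign (d x * wd d p) * F (p @ x # q1) q2))"
      unfolding ssum_insert distrib_left ssum_add mult_ssum
      by (intro arg_cong2[of _ _ _ _ "(+)"] ssum_cong refl) (auto simp: distrib_left)
    also have "ssum y (\<lambda>p q. ssum p (\<lambda>p1 p2. ksign (d x * (wd d p1 + wd d p2)) * F p1 (p2 @ x # q))) = ssum y F2"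
      unfolding ssum_assoc F2_def mult_ssum by (simp add: distrib_left ksign_add mult.assoc)
    also have "ssum y (\<lambda>p q. ssum q (\<lambda>q1 q2. ksign (d x * wd d p) * F (p @ x # q1) q2)) = ssum y F1"
      unfolding F1_def ssum_assoc ..
    finally show "ssum y F1 + ssum y F2 = ssum y (\<lambda>p q. ksign (d x * wd d p) * ssum (p @ x # q) F)"
      by (simp add: add.commute)
  qed
  finally show ?case by simp
qed simp

text \<open>Exchanging the two pieces permutes the pairs consisting of an order and a cut, at the
  cost of the Koszul sign of the exchange.\<close>

lemma symsum_rotate:
  "symsum d w (\<lambda>y. ssum y H) = symsum d w (\<lambda>y. ssum y (\<lambda>a b. ksign (wd d a * wd d b) * H b a))"
proof (induction w arbitrary: H)
  case (Cons x w)
  define H1 where "H1 p q = ssum p (\<lambda>b c. ksign (d x * wd d b) * H (b @ x # c) q)" for p q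
  define H2 where "H2 p q = ksign (d x * wd d p) * ssum q (\<lambda>b c. ksign (d x * wd d b) * H p (b @ x # c))" for p q
  \<comment> \<open>The inserted letter x lies in the first or in the second piece; the exchange of
    pieces interchanges the two cases, as shown in \<open>A\<close> and \<open>B\<close>.\<close>
  have L: "symsum d (x # w) (\<lambda>y. ssum y K) = symsum d w (\<lambda>y. ssum y (\<lambda>p q. ssum p (\<lambda>b c. ksign (d x * wd d b) * K (b @ x # c) q)))
    + symsum d w (\<lambda>y. ssum y (\<lambda>p q. ksign (d x * wd d p) * ssum q (\<lambda>b c. ksign (d x * wd d b) * K p (b @ x # c))))" for K
    unfolding symsum.simps symsum_add[symmetric]
  proof (rule symsum_cong)
    fix y
    have "ssum y (\<lambda>p q. ksign (d x * wd d p) * ssum (p @ x # q) K) =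
      ssum y (\<lambda>p q. ssum p (\<lambda>p1 p2. ksign (d x * (wd d p1 + wd d p2)) * K p1 (p2 @ x # q))) +
      ssum y (\<lambda>p q. ssum q (\<lambda>q1 q2. ksign (d x * wd d p) * K (p @ x # q1) q2))"
      unfolding ssum_insert distrib_left ssum_add mult_ssum
      by (intro arg_cong2[of _ _ _ _ "(+)"] ssum_cong refl) (auto simp: distrib_left)
    then show "ssum y (\<lambda>p q. ksign (d x * wd d p) * ssum (p @ x # q) K) =
      ssum y (\<lambda>p q. ssum p (\<lambda>b c. ksign (d x * wd d b) * K (b @ x # c) q)) +
      ssum y (\<lambda>p q. ksign (d x * wd d p) * ssum q (\<lambda>b c. ksign (d x * wd d b) * K p (b @ x # c)))"
      unfolding ssum_assoc mult_ssum by (simp add: distrib_left ksign_add mult.assoc add.commute)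
  qed
  have A: "ssum y (\<lambda>p q. ssum p (\<lambda>b c. ksign (d x * wd d b) * (ksign (wd d (b @ x # c) * wd d q) * H q (b @ x # c)))) =
    ssum y (\<lambda>p q. ksign (wd d p * wd d q) * H2 q p)" for y
    unfolding H2_def mult_ssum
  proof (intro ssum_cong)
    fix p q b c :: "'a list" assume "b @ c = p"
    then have "wd d p = wd d b + wd d c" by auto
    then have "ksign (d x * wd d b) * ksign (wd d (b @ x # c) * wd d q) = ksign (wd d p * wd d q) * ksign (d x * wd d q) * ksign (d x * wd d b)"
      unfolding ksign_add[symmetric] by (intro ksign_cong) auto
    then show "ksign (d x * wd d b) * (ksign (wd d (b @ x # c) * wd d q) * H q (b @ x # c)) =
       ksign (wd d p * wd d q) * (ksign (d x * wd d q) * (ksign (d x * wd d b) * H q (b @ x # c)))"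
      by (simp only: mult.assoc[symmetric])
  qed
  have B: "ssum y (\<lambda>p q. ksign (d x * wd d p) * ssum q (\<lambda>b c. ksign (d x * wd d b) * (ksign (wd d p * wd d (b @ x # c)) * H (b @ x # c) p))) =
    ssum y (\<lambda>p q. ksign (wd d p * wd d q) * H1 q p)" for y
    unfolding H1_def mult_ssum
  proof (intro ssum_cong)
    fix p q b c :: "'a list" assume "b @ c = q"
    then have "wd d q = wd d b + wd d c" by auto
    then have "ksign (d x * wd d p) * ksign (d x * wd d b) * ksign (wd d p * wd d (b @ x # c)) = ksign (wd d p * wd d q) * ksign (d x * wd d b)"
      unfolding ksign_add[symmetric] by (intro ksign_cong) auto
    then show "ksign (d x * wd d p) * (ksign (d x * wd d b) * (ksign (wd d p * wd d (b @ x # c)) * H (b @ x # c) p)) =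
       ksign (wd d p * wd d q) * (ksign (d x * wd d b) * H (b @ x # c) p)"
      by (simp only: mult.assoc[symmetric])
  qed
  have "symsum d (x # w) (\<lambda>y. ssum y (\<lambda>a b. ksign (wd d a * wd d b) * H b a)) =
    symsum d w (\<lambda>y. ssum y (\<lambda>p q. ksign (wd d p * wd d q) * H2 q p)) +
    symsum d w (\<lambda>y. ssum y (\<lambda>p q. ksign (wd d p * wd d q) * H1 q p))"
    unfolding L A B ..
  also have "\<dots> = symsum d w (\<lambda>y. ssum y H2) + symsum d w (\<lambda>y. ssum y H1)"
    by (simp only: Cons.IH[symmetric])
  also have "\<dots> = symsum d (x # w) (\<lambda>y. ssum y H)"
    unfolding L H1_def H2_def by (simp only: add.commute)
  finally show ?case ..
qed simp

text \<open>Once the letters of the prefix have been chosen, the prefix is itself symmetrized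
  (\<open>shsum_symsum\<close>), so \<open>symsum_rotate\<close> applies inside it.\<close>

lemma symsum_rotate_prefix:
  "symsum d w (\<lambda>y. ssum y (\<lambda>x z. ssum x (\<lambda>a b. H a b z))) =
   symsum d w (\<lambda>y. ssum y (\<lambda>x z. ssum x (\<lambda>a b. ksign (wd d a * wd d b) * H b a z)))"
proof -
  have s: "symsum d a (\<lambda>a'. symsum d b (\<lambda>b'. ssum a' (\<lambda>p q. K p q b'))) =
    symsum d a (\<lambda>a'. ssum a' (\<lambda>p q. symsum d b (\<lambda>b'. K p q b')))" for a b :: "'a list" and K
  proof -
    have "symsum d b (\<lambda>b'. ssum y (\<lambda>p q. K p q b')) = ssum y (\<lambda>p q. symsum d b (\<lambda>b'. K p q b'))" for y :: "'a list" and K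
      by (induction y arbitrary: K) (simp_all add: symsum_add)
    then show ?thesis by simp
  qed
  have K: "symsum d w (\<lambda>y. ssum y (\<lambda>x z. ssum x (\<lambda>a b. K a b z))) =
    shsum d w (\<lambda>a b. symsum d a (\<lambda>y. ssum y (\<lambda>p q. symsum d b (\<lambda>z. K p q z))))" for K
    unfolding shsum_symsum[where F = "\<lambda>x z. ssum x (\<lambda>a b. K a b z)", symmetric] s ..
  show ?thesis
    unfolding K
  proof (rule shsum_cong)
    fix a b
    show "symsum d a (\<lambda>y. ssum y (\<lambda>p q. symsum d b (\<lambda>z. H p q z))) =
      symsum d a (\<lambda>y. ssum y (\<lambda>p q. symsum d b (\<lambda>z. ksign (wd d p * wd d q) * H q p z)))"
      by (subst symsum_rotate) (simp only: symsum_mult)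
  qed
qed

section \<open>Permutations and shuffles\<close>

text \<open>The permutation of one letter more that puts the head of the word at position i and
  arranges the tail by \<tau>; the index shifts account for the head being letter 0.\<close>

definition pins :: "nat \<Rightarrow> (nat \<Rightarrow> nat) \<Rightarrow> nat \<Rightarrow> nat" where
  "pins i \<tau> j = (if j < i then Suc (\<tau> j) else if j = i then 0 else Suc (\<tau> (j - 1)))"

lemma perms_lt: "\<tau> \<in> perms n \<Longrightarrow> j < n \<Longrightarrow> \<tau> j < n"
  unfolding perms_def using permutes_in_image[of \<tau> "{..<n}" j] by simp

lemma perms_inj: "\<tau> \<in> perms n \<Longrightarrow> \<tau> a = \<tau> b \<longleftrightarrow> a = b"
  unfolding perms_def using permutes_inj[of \<tau> "{..<n}"] by (auto dest: injD)

lemma perms_out: "\<tau> \<in> perms n \<Longrightarrow> j \<ge> n \<Longrightarrow> \<tau> j = j"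
  unfolding perms_def using permutes_not_in[of \<tau> "{..<n}" j] by simp

lemma finite_perms [simp]: "finite (perms n)"
  unfolding perms_def by (rule finite_permutations) simp

lemma pins_perms:
  assumes t: "\<tau> \<in> perms n" and i: "i \<le> n" shows "pins i \<tau> \<in> perms (Suc n)"
proof -
  have inj: "inj_on (pins i \<tau>) {..<Suc n}"
    by (rule inj_onI) (auto simp: pins_def perms_inj[OF t] split: if_splits)
  have "pins i \<tau> ` {..<Suc n} \<subseteq> {..<Suc n}"
    using perms_lt[OF t] i by (auto simp: pins_def)
  with inj have "bij_betw (pins i \<tau>) {..<Suc n} {..<Suc n}"
    by (simp add: bij_betw_def endo_inj_surj)
  moreover have "pins i \<tau> j = j" if "j \<notin> {..<Suc n}" for j
    using that i perms_out[OF t, of "j - 1"] by (auto simp: pins_def)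
  ultimately have "pins i \<tau> permutes {..<Suc n}" by (rule bij_imp_permutes)
  then show ?thesis by (simp add: perms_def)
qed

text \<open>Injectivity is read off from the position of 0; surjectivity then follows by counting,
  as (n + 1) n! = (n + 1)!.\<close>

lemma pins_bij: "bij_betw (\<lambda>(i, \<tau>). pins i \<tau>) ({..n} \<times> perms n) (perms (Suc n))"
proof -
  have inj: "inj_on (\<lambda>(i, \<tau>). pins i \<tau>) ({..n} \<times> perms n)"
  proof (rule inj_onI, clarify)
    fix i \<tau> j \<sigma> assume e: "pins i \<tau> = pins j \<sigma>"
    have "pins i \<tau> i = 0" by (simp add: pins_def)
    then have "i = j" unfolding e by (auto simp: pins_def split: if_splits)
    moreover have "\<tau> k = \<sigma> k" for k
    proof (cases "k < i")
      case True
      then show ?thesis using fun_cong[OF e, of k] \<open>i = j\<close> by (simp add: pins_def)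
    next
      case False
      then show ?thesis using fun_cong[OF e, of "Suc k"] \<open>i = j\<close> by (simp add: pins_def)
    qed
    ultimately show "i = j \<and> \<tau> = \<sigma>" by auto
  qed
  have sub: "(\<lambda>(i, \<tau>). pins i \<tau>) ` ({..n} \<times> perms n) \<subseteq> perms (Suc n)"
    using pins_perms by auto
  have "card (perms k) = fact k" for k
    unfolding perms_def by (rule card_permutations) auto
  then have "card ((\<lambda>(i, \<tau>). pins i \<tau>) ` ({..n} \<times> perms n)) = card (perms (Suc n))"
    by (simp add: card_image[OF inj] card_cartesian_product)
  with sub have "(\<lambda>(i, \<tau>). pins i \<tau>) ` ({..n} \<times> perms n) = perms (Suc n)"
    by (intro card_subset_eq) auto
  with inj show ?thesis by (simp add: bij_betw_def)
qed

lemma sum_perms_Suc: "(\<Sum>\<pi>\<in>perms (Suc n). f \<pi>) = (\<Sum>\<tau>\<in>perms n. \<Sum>i\<le>n. f (pins i \<tau>))"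
proof -
  have "(\<Sum>\<pi>\<in>perms (Suc n). f \<pi>) = (\<Sum>(i, \<tau>)\<in>{..n} \<times> perms n. f (pins i \<tau>))"
    using sum.reindex_bij_betw[OF pins_bij, of f n] by (simp add: case_prod_unfold)
  also have "\<dots> = (\<Sum>i\<le>n. \<Sum>\<tau>\<in>perms n. f (pins i \<tau>))" by (simp add: sum.cartesian_product)
  finally show ?thesis by (simp only: sum.swap[of _ "perms n"])
qed

lemma permute_list_nth': "i < length w \<Longrightarrow> permute_list \<tau> w ! i = w ! \<tau> i"
  by (simp add: permute_list_def)

lemma permute_pins:
  assumes t: "\<tau> \<in> perms (length w)" and i: "i \<le> length w"
  shows "permute_list (pins i \<tau>) (x # w) = take i (permute_list \<tau> w) @ x # drop i (permute_list \<tau> w)"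
proof (rule nth_equalityI)
  show "length (permute_list (pins i \<tau>) (x # w)) = length (take i (permute_list \<tau> w) @ x # drop i (permute_list \<tau> w))"
    using i by simp
  fix j assume "j < length (permute_list (pins i \<tau>) (x # w))"
  then have j: "j < Suc (length w)" by simp
  then have "permute_list (pins i \<tau>) (x # w) ! j = (x # w) ! pins i \<tau> j" by (simp add: permute_list_nth')
  also have "\<dots> = (take i (permute_list \<tau> w) @ x # drop i (permute_list \<tau> w)) ! j"
  proof (cases "j < i")
    case True
    then show ?thesis using i by (simp add: pins_def nth_append permute_list_nth')
  next
    case False
    show ?thesis
    proof (cases "j = i")
      case True
      then show ?thesis using i by (simp add: pins_def nth_append)
    next
      case False
      with \<open>\<not> j < i\<close> obtain k where k: "j = Suc k" "i \<le> k" by (cases j) auto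
      then show ?thesis using i j by (simp add: pins_def nth_append permute_list_nth' min_def Suc_diff_le)
    qed
  qed
  finally show "permute_list (pins i \<tau>) (x # w) ! j = (take i (permute_list \<tau> w) @ x # drop i (permute_list \<tau> w)) ! j" .
qed

lemma ksign_prod: "finite F \<Longrightarrow> (\<Prod>a\<in>F. ksign (f a)) = ksign (\<Sum>a\<in>F. f a)"
  by (induction F rule: finite_induct) (simp_all add: ksign_add)

lemma wd_nth: "wd d w = (\<Sum>a<length w. d (w ! a))"
  unfolding wd_def by (simp add: sum_list_sum_nth atLeast0LessThan)

text \<open>The inversions of the new permutation are those of \<tau> and the i pairs formed by the
  head and the letters that now precede it.\<close>

lemma koszul_pins:
  assumes t: "\<tau> \<in> perms (length w)" and i: "i \<le> length w"
  shows "koszul A (pins i \<tau>) (x # w) =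
    ksign (sdeg A x * wd (sdeg A) (take i (permute_list \<tau> w))) * koszul A \<tau> w"
proof -
  let ?n = "length w"
  \<comment> \<open>Renumbers the positions of the tail by skipping position i.\<close>
  define s where "s j = (if j < i then j else Suc j)" for j
  define I where "I = {(a, b). a < b \<and> b < ?n \<and> \<tau> b < \<tau> a}"
  define f where "f = (\<lambda>(a, b). ksign (sdeg A ((x # w) ! pins i \<tau> a) * sdeg A ((x # w) ! pins i \<tau> b)))"
  have ps: "pins i \<tau> (s j) = Suc (\<tau> j)" for j by (auto simp: pins_def s_def)
  have "{(a, b). a < b \<and> b < length (x # w) \<and> pins i \<tau> b < pins i \<tau> a} =
    (\<lambda>a. (a, i)) ` {..<i} \<union> (\<lambda>(a, b). (s a, s b)) ` I" (is "?L = ?R1 \<union> ?R2")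
  proof (intro equalityI subsetI)
    fix q assume q: "q \<in> ?L"
    obtain a b where ab: "q = (a, b)" by (cases q)
    have a: "a < b" "b < Suc ?n" "pins i \<tau> b < pins i \<tau> a" using q by (auto simp: ab)
    have ai: "a \<noteq> i" using a(3) by (auto simp: pins_def)
    show "q \<in> ?R1 \<union> ?R2"
    proof (cases "b = i")
      case True
      then show ?thesis using a(1) by (simp add: ab)
    next
      case False
      have ex: "\<exists>j. k = s j \<and> (k < Suc ?n \<longrightarrow> j < ?n)" if "k \<noteq> i" for k
        by (rule exI[of _ "if k < i then k else k - 1"]) (use that i in \<open>auto simp: s_def\<close>)
      obtain a' where a': "a = s a'" using ex[OF ai] by blast
      obtain b' where b': "b = s b'" "b' < ?n" using ex[OF False] a(2) by blast
      have "a' < b'" using a(1) a' b' by (auto simp: s_def split: if_splits)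
      moreover have "\<tau> b' < \<tau> a'" using a(3) by (simp add: a' b' ps)
      ultimately have "(a', b') \<in> I" using b' by (simp add: I_def)
      then show ?thesis using a' b' ab by force
    qed
  next
    fix q assume "q \<in> ?R1 \<union> ?R2"
    then show "q \<in> ?L"
    proof
      assume "q \<in> ?R1"
      then show ?thesis using i by (auto simp: pins_def)
    next
      assume "q \<in> ?R2"
      then obtain a b where "q = (s a, s b)" "a < b" "b < ?n" "\<tau> b < \<tau> a" by (auto simp: I_def)
      moreover from this have "s a < s b" "s b < Suc ?n" by (auto simp: s_def)
      ultimately show ?thesis by (simp add: ps)
    qed
  qed
  then have "koszul A (pins i \<tau>) (x # w) = prod f (?R1 \<union> ?R2)"
    by (simp only: koszul_def f_def)
  also have "\<dots> = prod f ?R1 * prod f ?R2"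
  proof (rule prod.union_disjoint)
    show "finite ?R1" by simp
    have "I \<subseteq> {..<?n} \<times> {..<?n}" by (auto simp: I_def)
    then show "finite ?R2" by (meson finite_SigmaI finite_imageI finite_lessThan finite_subset)
    show "?R1 \<inter> ?R2 = {}" by (auto simp: s_def split: if_splits)
  qed
  also have "prod f ?R1 = (\<Prod>a<i. ksign (sdeg A x * sdeg A (permute_list \<tau> w ! a)))"
    using i by (subst prod.reindex) (auto simp: inj_on_def f_def pins_def permute_list_nth' mult.commute intro!: prod.cong)
  also have "\<dots> = ksign (sdeg A x * wd (sdeg A) (take i (permute_list \<tau> w)))"
    using i by (simp add: ksign_prod wd_nth sum_distrib_left)
  also have "prod f ?R2 = koszul A \<tau> w"
  proof -
    have "inj_on (\<lambda>(a, b). (s a, s b)) I" by (auto simp: inj_on_def s_def split: if_splits)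
    then have "prod f ?R2 = (\<Prod>(a, b)\<in>I. ksign (sdeg A (w ! \<tau> a) * sdeg A (w ! \<tau> b)))"
      by (subst prod.reindex) (auto simp: f_def ps intro!: prod.cong)
    then show ?thesis by (simp only: koszul_def I_def)
  qed
  finally show ?thesis .
qed

lemma sum_perms: "(\<Sum>\<tau>\<in>perms (length w). koszul A \<tau> w * G (permute_list \<tau> w)) = symsum (sdeg A) w G"
proof (induction w arbitrary: G)
  case Nil
  have "perms 0 = {id}" by (auto simp: perms_def)
  then show ?case by (simp add: koszul_def)
next
  case (Cons x w)
  have "(\<Sum>\<tau>\<in>perms (length (x # w)). koszul A \<tau> (x # w) * G (permute_list \<tau> (x # w))) =
    (\<Sum>\<tau>\<in>perms (length w). \<Sum>i\<le>length w. koszul A (pins i \<tau>) (x # w) * G (permute_list (pins i \<tau>) (x # w)))"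
    by (simp only: length_Cons sum_perms_Suc)
  also have "\<dots> = (\<Sum>\<tau>\<in>perms (length w). koszul A \<tau> w * ssum (permute_list \<tau> w)
      (\<lambda>p q. ksign (sdeg A x * wd (sdeg A) p) * G (p @ x # q)))"
    by (intro sum.cong refl) (simp add: ssum_conv sum_distrib_left koszul_pins permute_pins mult_ac)
  finally show ?case
    using Cons.IH[of "\<lambda>y. ssum y (\<lambda>p q. ksign (sdeg A x * wd (sdeg A) p) * G (p @ x # q))"]
    by (simp only: symsum.simps)
qed

text \<open>The head is the least letter, so in a shuffle it opens one of the two increasing blocks:
  it stands at position 0, provided that the first block is nonempty, or at position k.\<close>

lemma pins_shuffle:
  assumes t: "\<tau> \<in> perms n" and i: "i \<le> n" and k: "k \<le> Suc n"
  shows "pins i \<tau> \<in> shuffles_at k (Suc n) \<longleftrightarrow>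
    (i = 0 \<and> k \<ge> 1 \<and> \<tau> \<in> shuffles_at (k - 1) n) \<or> (i = k \<and> \<tau> \<in> shuffles_at k n)"
    (is "?L \<longleftrightarrow> ?R")
proof
  assume L: ?L
  then have m: "strict_mono_on {..<k} (pins i \<tau>)" "strict_mono_on {k..<Suc n} (pins i \<tau>)"
    by (auto simp: shuffles_at_def)
  show ?R
  proof (cases "i < k")
    case True
    have "i = 0"
    proof (rule ccontr)
      assume "i \<noteq> 0"
      then have "pins i \<tau> 0 < pins i \<tau> i" using m(1) True by (auto simp: strict_mono_on_def)
      then show False by (simp add: pins_def)
    qed
    have p: "pins 0 \<tau> (Suc j) = Suc (\<tau> j)" for j by (simp add: pins_def)
    have "strict_mono_on {..<k - 1} \<tau>"
    proof (rule strict_mono_onI)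
      fix a b assume "a \<in> {..<k - 1}" "b \<in> {..<k - 1}" "a < b"
      then show "\<tau> a < \<tau> b" using strict_mono_onD[OF m(1), of "Suc a" "Suc b"] by (auto simp: \<open>i = 0\<close> p)
    qed
    moreover have "strict_mono_on {k - 1..<n} \<tau>"
    proof (rule strict_mono_onI)
      fix a b assume "a \<in> {k - 1..<n}" "b \<in> {k - 1..<n}" "a < b"
      then show "\<tau> a < \<tau> b" using strict_mono_onD[OF m(2), of "Suc a" "Suc b"] by (auto simp: \<open>i = 0\<close> p)
    qed
    ultimately show ?thesis using t True \<open>i = 0\<close> by (auto simp: shuffles_at_def)
  next
    case False
    have ik: "i = k"
    proof (rule ccontr)
      assume "i \<noteq> k"
      then have "pins i \<tau> k < pins i \<tau> i" using m(2) False i by (auto simp: strict_mono_on_def)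
      then show False by (simp add: pins_def)
    qed
    have "strict_mono_on {..<k} \<tau>"
    proof (rule strict_mono_onI)
      fix a b assume "a \<in> {..<k}" "b \<in> {..<k}" "a < b"
      then show "\<tau> a < \<tau> b" using strict_mono_onD[OF m(1), of a b] by (auto simp: ik pins_def)
    qed
    moreover have "strict_mono_on {k..<n} \<tau>"
    proof (rule strict_mono_onI)
      fix a b assume "a \<in> {k..<n}" "b \<in> {k..<n}" "a < b"
      then show "\<tau> a < \<tau> b" using strict_mono_onD[OF m(2), of "Suc a" "Suc b"] by (auto simp: ik pins_def)
    qed
    ultimately show ?thesis using t ik by (auto simp: shuffles_at_def)
  qed
next
  assume ?R
  then show ?L
  proof (elim disjE conjE)
    assume *: "i = 0" "k \<ge> 1" "\<tau> \<in> shuffles_at (k - 1) n"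
    then have m: "strict_mono_on {..<k - 1} \<tau>" "strict_mono_on {k - 1..<n} \<tau>" by (auto simp: shuffles_at_def)
    have p: "pins 0 \<tau> j = (if j = 0 then 0 else Suc (\<tau> (j - 1)))" for j by (simp add: pins_def)
    have "strict_mono_on {..<k} (pins 0 \<tau>)"
      by (rule strict_mono_onI) (auto simp: p intro!: strict_mono_onD[OF m(1)])
    moreover have "strict_mono_on {k..<Suc n} (pins 0 \<tau>)"
      using *(2) by (intro strict_mono_onI) (auto simp: p intro!: strict_mono_onD[OF m(2)])
    ultimately show ?thesis using pins_perms[OF t i] * by (simp add: shuffles_at_def)
  next
    assume *: "i = k" "\<tau> \<in> shuffles_at k n"
    then have m: "strict_mono_on {..<k} \<tau>" "strict_mono_on {k..<n} \<tau>" by (auto simp: shuffles_at_def)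
    have "strict_mono_on {..<k} (pins k \<tau>)"
      by (rule strict_mono_onI) (auto simp: pins_def intro!: strict_mono_onD[OF m(1)])
    moreover have "strict_mono_on {k..<Suc n} (pins k \<tau>)"
      by (rule strict_mono_onI) (auto simp: pins_def intro!: strict_mono_onD[OF m(2)])
    ultimately show ?thesis using pins_perms[OF t i] * by (simp add: shuffles_at_def)
  qed
qed

lemma shuffles_perms: "shuffles_at k n \<subseteq> perms n"
  by (auto simp: shuffles_at_def)

lemma finite_shuffles [simp]: "finite (shuffles_at k n)"
  using finite_subset[OF shuffles_perms] by simp

lemma sum_shuffles_indicator:
  "(\<Sum>\<sigma>\<in>shuffles_at k n. f \<sigma>) = (\<Sum>\<sigma>\<in>perms n. if \<sigma> \<in> shuffles_at k n then f \<sigma> else (0 :: nov))"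
proof -
  have "perms n \<inter> shuffles_at k n = shuffles_at k n" using shuffles_perms by blast
  then show ?thesis using sum.inter_restrict[OF finite_perms, of f n "shuffles_at k n"] by simp
qed

lemma sum_shuffles_Suc:
  assumes "k \<le> Suc n"
  shows "(\<Sum>\<sigma>\<in>shuffles_at k (Suc n). f \<sigma> :: nov) =
    (if k \<ge> 1 then \<Sum>\<tau>\<in>shuffles_at (k - 1) n. f (pins 0 \<tau>) else 0) +
    (if k \<le> n then \<Sum>\<tau>\<in>shuffles_at k n. f (pins k \<tau>) else 0)"
proof -
  have "(\<Sum>\<sigma>\<in>shuffles_at k (Suc n). f \<sigma>) =
    (\<Sum>\<tau>\<in>perms n. \<Sum>i\<le>n. if pins i \<tau> \<in> shuffles_at k (Suc n) then f (pins i \<tau>) else 0)"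
    by (simp only: sum_shuffles_indicator sum_perms_Suc)
  also have "\<dots> = (\<Sum>\<tau>\<in>perms n. \<Sum>i\<le>n.
      (if i = 0 then if k \<ge> 1 \<and> \<tau> \<in> shuffles_at (k - 1) n then f (pins 0 \<tau>) else 0 else 0) +
      (if i = k then if \<tau> \<in> shuffles_at k n then f (pins k \<tau>) else 0 else 0))"
    by (intro sum.cong refl, subst pins_shuffle) (use assms in auto)
  also have "\<dots> = (\<Sum>\<tau>\<in>perms n. (if k \<ge> 1 \<and> \<tau> \<in> shuffles_at (k - 1) n then f (pins 0 \<tau>) else 0) +
      (if k \<le> n then if \<tau> \<in> shuffles_at k n then f (pins k \<tau>) else 0 else 0))"
    by (simp add: sum.distrib)
  finally show ?thesis
    by (auto simp: sum.distrib sum_shuffles_indicator)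
qed

lemma sum_shuffles:
  "(\<Sum>k\<le>length w. \<Sum>\<sigma>\<in>shuffles_at k (length w).
     koszul A \<sigma> w * F (take k (permute_list \<sigma> w)) (drop k (permute_list \<sigma> w))) = shsum (sdeg A) w F"
proof (induction w arbitrary: F)
  case Nil
  have "shuffles_at 0 0 = {id}" by (auto simp: shuffles_at_def perms_def strict_mono_on_def)
  then show ?case by (simp add: koszul_def)
next
  case (Cons x w)
  let ?n = "length w"
  define f where "f k \<sigma> = koszul A \<sigma> (x # w) * F (take k (permute_list \<sigma> (x # w))) (drop k (permute_list \<sigma> (x # w)))" for k \<sigma>
  have "(\<Sum>k\<le>length (x # w). \<Sum>\<sigma>\<in>shuffles_at k (length (x # w)). f k \<sigma>) =
    (\<Sum>k\<le>Suc ?n. if k \<ge> 1 then \<Sum>\<tau>\<in>shuffles_at (k - 1) ?n. f k (pins 0 \<tau>) else 0) +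
    (\<Sum>k\<le>Suc ?n. if k \<le> ?n then \<Sum>\<tau>\<in>shuffles_at k ?n. f k (pins k \<tau>) else 0)"
    by (simp only: length_Cons sum.distrib[symmetric]) (intro sum.cong refl sum_shuffles_Suc, simp)
  also have "(\<Sum>k\<le>Suc ?n. if k \<ge> 1 then \<Sum>\<tau>\<in>shuffles_at (k - 1) ?n. f k (pins 0 \<tau>) else 0) =
    (\<Sum>k\<le>?n. \<Sum>\<tau>\<in>shuffles_at k ?n. f (Suc k) (pins 0 \<tau>))"
    by (subst sum.atMost_Suc_shift) simp
  also have "(\<Sum>k\<le>Suc ?n. if k \<le> ?n then \<Sum>\<tau>\<in>shuffles_at k ?n. f k (pins k \<tau>) else 0) =
    (\<Sum>k\<le>?n. \<Sum>\<tau>\<in>shuffles_at k ?n. f k (pins k \<tau>))"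
    by simp
  also have "(\<Sum>k\<le>?n. \<Sum>\<tau>\<in>shuffles_at k ?n. f (Suc k) (pins 0 \<tau>)) = shsum (sdeg A) w (\<lambda>a b. F (x # a) b)"
    unfolding Cons.IH[symmetric]
  proof (intro sum.cong refl)
    fix k \<tau> assume "\<tau> \<in> shuffles_at k ?n"
    then have "\<tau> \<in> perms ?n" using shuffles_perms by blast
    then show "f (Suc k) (pins 0 \<tau>) = koszul A \<tau> w * F (x # take k (permute_list \<tau> w)) (drop k (permute_list \<tau> w))"
      by (simp add: f_def koszul_pins permute_pins)
  qed
  also have "(\<Sum>k\<le>?n. \<Sum>\<tau>\<in>shuffles_at k ?n. f k (pins k \<tau>)) =
    shsum (sdeg A) w (\<lambda>a b. ksign (sdeg A x * wd (sdeg A) a) * F a (x # b))"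
    unfolding Cons.IH[of "\<lambda>a b. ksign (sdeg A x * wd (sdeg A) a) * F a (x # b)", symmetric]
  proof (intro sum.cong refl)
    fix k \<tau> assume k: "k \<in> {..?n}" and "\<tau> \<in> shuffles_at k ?n"
    then have t: "\<tau> \<in> perms ?n" using shuffles_perms by blast
    have "take k (take k (permute_list \<tau> w) @ x # drop k (permute_list \<tau> w)) = take k (permute_list \<tau> w)"
      "drop k (take k (permute_list \<tau> w) @ x # drop k (permute_list \<tau> w)) = x # drop k (permute_list \<tau> w)"
      using k by (simp_all add: min_def)
    then show "f k (pins k \<tau>) = koszul A \<tau> w * (ksign (sdeg A x * wd (sdeg A) (take k (permute_list \<tau> w))) *
      F (take k (permute_list \<tau> w)) (x # drop k (permute_list \<tau> w)))"
      using k t by (simp add: f_def koszul_pins permute_pins mult_ac)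
  qed
  finally show ?case by (simp add: f_def)
qed

text \<open>The product now runs over all pairs of positions, independently of \<tau>, so that signs
  of different permutations can be multiplied factor by factor.\<close>

lemma koszul_alt:
  "koszul A \<tau> w = (\<Prod>(i, j)\<in>{(i, j). i < j \<and> j < length w}.
     if \<tau> j < \<tau> i then ksign (sdeg A (w ! \<tau> i) * sdeg A (w ! \<tau> j)) else 1)"
proof -
  have fin: "finite {(i, j). i < j \<and> j < length w}"
    by (rule finite_subset[of _ "{..<length w} \<times> {..<length w}"]) auto
  show ?thesis unfolding koszul_def
    by (rule prod.mono_neutral_cong_left[OF fin]) (auto split: if_splits)
qed

text \<open>For a pair of positions the composite reverses the two letters exactly if one of the two
  steps does; if both do, their equal signs cancel.\<close>

lemma koszul_comp:
  assumes s: "\<sigma> \<in> perms (length w)" and t: "\<tau> \<in> perms (length w)"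
  shows "koszul A (\<sigma> \<circ> \<tau>) w = koszul A \<sigma> w * koszul A \<tau> (permute_list \<sigma> w)"
proof -
  let ?n = "length w"
  define P where "P = {(i, j). i < j \<and> j < ?n}"
  \<comment> \<open>\<tau> permutes the unordered pairs of positions; sorting the images turns this
    into a bijection of the index set.\<close>
  define \<phi> where "\<phi> = (\<lambda>(i, j). (min (\<tau> i) (\<tau> j), max (\<tau> i) (\<tau> j)))"
  define c where "c = (\<lambda>(i, j). if \<sigma> j < \<sigma> i then ksign (sdeg A (w ! \<sigma> i) * sdeg A (w ! \<sigma> j)) else 1)"
  have fin: "finite P" unfolding P_def
    by (rule finite_subset[of _ "{..<?n} \<times> {..<?n}"]) auto
  have inj: "inj_on \<phi> P"
  proof (rule inj_onI, clarify)
    fix i j k l assume *: "(i, j) \<in> P" "(k, l) \<in> P" "\<phi> (i, j) = \<phi> (k, l)"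
    then have "{\<tau> i, \<tau> j} = {\<tau> k, \<tau> l}" by (auto simp: \<phi>_def min_def max_def split: if_splits)
    then have "{i, j} = {k, l}" by (auto simp: doubleton_eq_iff perms_inj[OF t])
    then show "i = k \<and> j = l" using * by (auto simp: P_def doubleton_eq_iff)
  qed
  have "\<phi> ` P \<subseteq> P"
  proof
    fix q assume "q \<in> \<phi> ` P"
    then obtain i j where ij: "i < j" "j < ?n" "q = \<phi> (i, j)" by (auto simp: P_def)
    then have "\<tau> i \<noteq> \<tau> j" "\<tau> i < ?n" "\<tau> j < ?n" using perms_inj[OF t] perms_lt[OF t] by auto
    then show "q \<in> P" using ij(3) by (auto simp: P_def \<phi>_def min_def max_def)
  qed
  with inj fin have im: "\<phi> ` P = P" by (intro endo_inj_surj)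
  have "koszul A \<sigma> w = prod c P" by (simp add: koszul_alt P_def c_def)
  also have "\<dots> = prod c (\<phi> ` P)" by (simp only: im)
  also have "\<dots> = (\<Prod>q\<in>P. c (\<phi> q))" by (simp add: prod.reindex[OF inj])
  finally have "koszul A \<sigma> w * koszul A \<tau> (permute_list \<sigma> w) = (\<Prod>q\<in>P. c (\<phi> q) *
    (case q of (i, j) \<Rightarrow> if \<tau> j < \<tau> i then ksign (sdeg A (permute_list \<sigma> w ! \<tau> i) * sdeg A (permute_list \<sigma> w ! \<tau> j)) else 1))"
    by (simp add: koszul_alt[of A \<tau>] P_def[symmetric] prod.distrib)
  also have "\<dots> = (\<Prod>(i, j)\<in>P. if (\<sigma> \<circ> \<tau>) j < (\<sigma> \<circ> \<tau>) i then ksign (sdeg A (w ! (\<sigma> \<circ> \<tau>) i) * sdeg A (w ! (\<sigma> \<circ> \<tau>) j)) else 1)"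
  proof (rule prod.cong[OF refl], clarify)
    fix i j assume "(i, j) \<in> P"
    then have ij: "i < j" "j < ?n" by (auto simp: P_def)
    then have n: "\<tau> i < ?n" "\<tau> j < ?n" "\<tau> i \<noteq> \<tau> j" using perms_lt[OF t] perms_inj[OF t] by auto
    then have ne: "\<sigma> (\<tau> i) \<noteq> \<sigma> (\<tau> j)" using perms_inj[OF s] by auto
    show "c (\<phi> (i, j)) * (if \<tau> j < \<tau> i then ksign (sdeg A (permute_list \<sigma> w ! \<tau> i) * sdeg A (permute_list \<sigma> w ! \<tau> j)) else 1) =
      (if (\<sigma> \<circ> \<tau>) j < (\<sigma> \<circ> \<tau>) i then ksign (sdeg A (w ! (\<sigma> \<circ> \<tau>) i) * sdeg A (w ! (\<sigma> \<circ> \<tau>) j)) else 1)"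
    proof (cases "\<tau> j < \<tau> i")
      case True
      then have "\<phi> (i, j) = (\<tau> j, \<tau> i)" by (simp add: \<phi>_def)
      then show ?thesis using True n ne
        by (auto simp: c_def permute_list_nth' mult.commute[of "sdeg A (w ! \<sigma> (\<tau> j))"])
    next
      case False
      then have "\<phi> (i, j) = (\<tau> i, \<tau> j)" using n(3) by (simp add: \<phi>_def)
      then show ?thesis using False by (simp add: c_def)
    qed
  qed
  also have "\<dots> = koszul A (\<sigma> \<circ> \<tau>) w" by (simp only: koszul_alt P_def)
  finally show ?thesis ..
qed

lemma koszul_sq: "koszul A \<tau> w * koszul A \<tau> w = 1"
  unfolding koszul_alt prod.distrib[symmetric] by (rule prod.neutral) auto

lemma permute_comp: "\<tau> \<in> perms (length w) \<Longrightarrow> permute_list (\<sigma> \<circ> \<tau>) w = permute_list \<tau> (permute_list \<sigma> w)"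
  by (rule permute_list_compose) (simp add: perms_def)

lemma sum_perms_left: "\<tau> \<in> perms n \<Longrightarrow> (\<Sum>\<sigma>\<in>perms n. f (\<tau> \<circ> \<sigma>)) = (\<Sum>\<sigma>\<in>perms n. f \<sigma>)"
  unfolding perms_def by (rule setum_permutations_compose_left[symmetric]) simp

lemma symsum_permute:
  assumes t: "\<tau> \<in> perms (length w)"
  shows "symsum (sdeg A) (permute_list \<tau> w) G = koszul A \<tau> w * symsum (sdeg A) w G"
proof -
  have "symsum (sdeg A) (permute_list \<tau> w) G =
    (\<Sum>\<sigma>\<in>perms (length w). koszul A \<sigma> (permute_list \<tau> w) * G (permute_list \<sigma> (permute_list \<tau> w)))"
    by (simp add: sum_perms[symmetric])
  also have "\<dots> = (\<Sum>\<sigma>\<in>perms (length w). koszul A \<tau> w * (koszul A (\<tau> \<circ> \<sigma>) w * G (permute_list (\<tau> \<circ> \<sigma>) w)))"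
  proof (rule sum.cong[OF refl])
    fix \<sigma> assume s: "\<sigma> \<in> perms (length w)"
    have "koszul A \<tau> w * koszul A (\<tau> \<circ> \<sigma>) w = koszul A \<sigma> (permute_list \<tau> w)"
      by (simp add: koszul_comp[OF t s] mult.assoc[symmetric] koszul_sq)
    then show "koszul A \<sigma> (permute_list \<tau> w) * G (permute_list \<sigma> (permute_list \<tau> w)) =
      koszul A \<tau> w * (koszul A (\<tau> \<circ> \<sigma>) w * G (permute_list (\<tau> \<circ> \<sigma>) w))"
      by (simp add: permute_comp[OF s] mult.assoc[symmetric])
  qed
  also have "\<dots> = koszul A \<tau> w * (\<Sum>\<sigma>\<in>perms (length w). koszul A \<sigma> w * G (permute_list \<sigma> w))"
    unfolding sum_distrib_left[symmetric] by (subst sum_perms_left[OF t]) (rule refl)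
  finally show ?thesis by (simp only: sum_perms)
qed

lemma sym_word_symsum: "sym_word A w y = symsum (sdeg A) w (\<lambda>z. kron z y)"
  unfolding sym_word_def by (rule sum_perms)

text \<open>The other variable of the matrix: permuting the output word composes with \<tau> on the
  right, whereas permuting the input in \<open>symsum_permute\<close> composes on the left.\<close>

lemma sym_word_permute:
  assumes t: "\<tau> \<in> perms (length y)"
  shows "sym_word A w (permute_list \<tau> y) = koszul A \<tau> y * sym_word A w y"
proof (cases "length w = length y")
  case False
  then have "kron (permute_list \<sigma> w) (permute_list \<tau> y) = 0" "kron (permute_list \<sigma> w) y = 0" for \<sigma>
    by (auto simp: kron_def dest: arg_cong[of _ _ length])
  then show ?thesis by (simp add: sym_word_def)
next
  case True
  have t': "\<tau> \<in> perms (length w)" using t True by simp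
  have eq: "permute_list \<tau> a = permute_list \<tau> b \<longleftrightarrow> a = b" if "length a = length y" "length b = length y" for a b :: "'a list"
  proof
    assume e: "permute_list \<tau> a = permute_list \<tau> b"
    show "a = b"
    proof (rule nth_equalityI)
      show "length a = length b" using that by simp
      fix i assume "i < length a"
      then have i: "i < length y" using that by simp
      have "\<tau> ` {..<length y} = {..<length y}" using t by (simp add: perms_def permutes_image)
      then obtain j where j: "j < length y" "i = \<tau> j" using i by (metis imageE lessThan_iff)
      have "permute_list \<tau> a ! j = permute_list \<tau> b ! j" using e by simp
      then show "a ! i = b ! i" using j that by (simp add: permute_list_nth')
    qed
  qed simp
  have "sym_word A w (permute_list \<tau> y) = (\<Sum>\<sigma>\<in>perms (length w). koszul A (\<sigma> \<circ> \<tau>) w * kron (permute_list (\<sigma> \<circ> \<tau>) w) (permute_list \<tau> y))"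
    using t' unfolding sym_word_def perms_def by (intro sum_permutations_compose_right) simp
  also have "\<dots> = (\<Sum>\<sigma>\<in>perms (length w). koszul A \<tau> y * (koszul A \<sigma> w * kron (permute_list \<sigma> w) y))"
  proof (rule sum.cong[OF refl])
    fix \<sigma> assume s: "\<sigma> \<in> perms (length w)"
    show "koszul A (\<sigma> \<circ> \<tau>) w * kron (permute_list (\<sigma> \<circ> \<tau>) w) (permute_list \<tau> y) =
      koszul A \<tau> y * (koszul A \<sigma> w * kron (permute_list \<sigma> w) y)"
      using True by (simp add: koszul_comp[OF s t'] permute_comp[OF t'] kron_def eq mult_ac)
  qed
  finally show ?thesis by (simp add: sym_word_def sum_distrib_left)
qed

section \<open>Chevalley-Eilenberg chains as symmetric Hochschild chains\<close>

lemma wdeg_wd: "wdeg A w = wd (sdeg A) w"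
  by (simp add: wdeg_def wd_def)

lemma tens_ssum: "tens x y w = ssum w (\<lambda>a b. x a * y b)"
  by (simp add: tens_def ssum_conv)

lemma tens_letter_kron: "tens (letter c) (kron q) t = (case t of [] \<Rightarrow> 0 | x # t' \<Rightarrow> c x * kron q t')"
proof (cases t)
  case (Cons x t')
  have "ssum t' (\<lambda>a b. letter c (x # a) * kron q b) = ssum t' (\<lambda>a b. if a = [] then c x * kron q b else 0)"
    by (rule ssum_cong) (auto simp: letter_def split: list.splits)
  then show ?thesis by (simp add: Cons tens_ssum ssum_Nil1) (simp add: letter_def)
qed (simp add: tens_ssum letter_def)

lemma tens_kron: "tens (kron p) Z y = (if take (length p) y = p then Z (drop (length p) y) else 0)"
  unfolding tens_ssum
proof (induction p arbitrary: y)
  case Nil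
  have "ssum y (\<lambda>a b. kron [] a * Z b) = ssum y (\<lambda>a b. if a = [] then Z b else 0)"
    by (rule ssum_cong) (simp add: kron_def)
  then show ?case by (simp add: ssum_Nil1)
next
  case (Cons c p)
  show ?case
  proof (cases y)
    case (Cons x t)
    have "ssum t (\<lambda>a b. kron (c # p) (x # a) * Z b) = ssum t (\<lambda>a b. if x = c then kron p a * Z b else 0)"
      by (rule ssum_cong) (auto simp: kron_def)
    then have "ssum (x # t) (\<lambda>a b. kron (c # p) a * Z b) = (if x = c then ssum t (\<lambda>a b. kron p a * Z b) else 0)"
      by (simp add: kron_def[of "c # p" "[]"])
    then show ?thesis by (auto simp: Cons Cons.IH)
  qed (simp add: kron_def)
qed

text \<open>A word y determines the letter b in y = p @ b # q if there is one, so the sum over b has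
  at most one nonzero term.\<close>

lemma bar_term: "tens (kron p) (tens (letter c) (kron q)) y = nov_sum (\<lambda>b. c b * kron (p @ b # q) y)"
proof (cases "\<exists>b. y = p @ b # q")
  case True
  then obtain b where b: "y = p @ b # q" by blast
  have "nov_sum (\<lambda>b. c b * kron (p @ b # q) y) = c b"
    by (subst nov_sum_single[of b]) (auto simp: b kron_def)
  then show ?thesis by (simp add: b tens_kron tens_letter_kron)
next
  case False
  then have k: "kron (p @ b # q) y = 0" for b by (auto simp: kron_def)
  have "take (length p) y = p \<Longrightarrow> drop (length p) y = x # t \<Longrightarrow> q \<noteq> t" for x t
    using False by (metis append_take_drop_id)
  then have "tens (kron p) (tens (letter c) (kron q)) y = 0"
    by (auto simp: tens_kron tens_letter_kron kron_def split: list.splits)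
  then show ?thesis by (simp add: k)
qed

lemma bar_d_ssum: "bar_d A w y = ssum w (\<lambda>p x. ssum x (\<lambda>a q. ksign (wdeg A p) * nov_sum (\<lambda>b. mop A a b * kron (p @ b # q) y)))"
  unfolding bar_d_def bar_term ssum_conv
  by (intro sum.cong refl) (simp_all add: add.commute)

lemma hoch_wrap_ssum:
  "hoch_wrap A M \<phi> (v, w) (v', w') = ssum w (\<lambda>x l. ssum x (\<lambda>r z.
     ksign (wdeg A l * (sdeg M v + wdeg A x)) * \<phi> l v r v' * kron z w'))"
proof -
  let ?k = "length w"
  define g where "g i = (\<Sum>j\<le>i. ksign (wdeg A (drop i w) * (sdeg M v + wdeg A (take i w))) *
    \<phi> (drop i w) v (take j (take i w)) v' * kron (drop j (take i w)) w')" for i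
  have "hoch_wrap A M \<phi> (v, w) (v', w') = (\<Sum>i\<le>?k. g (?k - i))"
    by (simp add: Let_def g_def)
  \<comment> \<open>\<open>hoch_wrap\<close> counts the letters moved to the front, whereas a cut
    counts those that stay.\<close>
  also have "\<dots> = (\<Sum>i\<le>?k. g i)"
    by (rule sum.reindex_bij_witness[of _ "\<lambda>i. ?k - i" "\<lambda>i. ?k - i"]) auto
  also have "\<dots> = ssum w (\<lambda>x l. ssum x (\<lambda>r z.
     ksign (wdeg A l * (sdeg M v + wdeg A x)) * \<phi> l v r v' * kron z w'))"
    unfolding ssum_conv g_def by (intro sum.cong refl) auto
  finally show ?thesis .
qed

lemma symmetrize_symsum:
  "symmetrize A M \<phi> v w v' = symsum (sdeg A) w (\<lambda>y. ssum y (\<lambda>l r. ksign (sdeg M v * wdeg A l) * \<phi> l v r v'))"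
  unfolding symmetrize_def sum_perms[symmetric] ssum_conv
  by (simp add: Let_def sum_distrib_left mult.assoc)

lemma ce_wrap_shsum: "ce_wrap A \<eta> (v, w) (v', w') = shsum (sdeg A) w (\<lambda>a b. \<eta> v a v' * sym_word A b w')"
  by (simp add: ce_wrap_def Let_def sum_shuffles[symmetric] mult.assoc)

lemma symsum_mult2: "symsum d a (\<lambda>x. symsum d b (\<lambda>y. f x * g y)) = symsum d a f * symsum d b g"
  by (simp only: symsum_mult mult.commute[of _ "symsum d b g"])

text \<open>All orders of the letters are summed, so the word l v r z may be replaced by the cyclic
  word v r z l. \<open>symsum_rotate\<close> performs this change; the sign of the rotation and that
  of moving l past v combine to the cyclic sign of \<open>hoch_wrap\<close>.\<close>

lemma ce_wrap_hoch:
  "ce_wrap A (symmetrize A M \<phi>) (v, w) (v', w') = symsum (sdeg A) w (\<lambda>y. hoch_wrap A M \<phi> (v, y) (v', w'))"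
proof -
  let ?d = "sdeg A"
  have "ce_wrap A (symmetrize A M \<phi>) (v, w) (v', w') = symsum ?d w (\<lambda>y. ssum y (\<lambda>a z.
    ssum a (\<lambda>l r. ksign (sdeg M v * wdeg A l) * \<phi> l v r v') * kron z w'))"
    unfolding ce_wrap_shsum symmetrize_symsum sym_word_symsum symsum_mult2[symmetric] shsum_symsum ..
  also have "\<dots> = symsum ?d w (\<lambda>y. ssum y (\<lambda>l x. ssum x (\<lambda>r z.
    ksign (sdeg M v * wdeg A l) * \<phi> l v r v' * kron z w')))"
    unfolding mult.commute[of _ "kron _ _"] mult_ssum ssum_assoc ..
  also have "\<dots> = symsum ?d w (\<lambda>y. ssum y (\<lambda>l x. ksign (wd ?d l * wd ?d x) * ssum x (\<lambda>r z.
    ksign (wdeg A l * (sdeg M v + wdeg A x)) * \<phi> l v r v' * kron z w')))"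
  proof (intro symsum_cong ssum_cong)
    fix y l x
    have "ksign (sdeg M v * wdeg A l) = ksign (wd ?d l * wd ?d x) * ksign (wdeg A l * (sdeg M v + wdeg A x))"
      unfolding ksign_add[symmetric] wdeg_wd by (rule ksign_cong) (auto simp: algebra_simps)
    then show "ssum x (\<lambda>r z. ksign (sdeg M v * wdeg A l) * \<phi> l v r v' * kron z w') =
      ksign (wd ?d l * wd ?d x) * ssum x (\<lambda>r z. ksign (wdeg A l * (sdeg M v + wdeg A x)) * \<phi> l v r v' * kron z w')"
      by (simp add: mult_ssum mult.assoc)
  qed
  also have "\<dots> = symsum ?d w (\<lambda>y. hoch_wrap A M \<phi> (v, y) (v', w'))"
    unfolding hoch_wrap_ssum by (rule symsum_rotate[symmetric])
  finally show ?thesis .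
qed

lemma cvg_0 [simp]: "cvg (\<lambda>_. 0)" by (rule cvg_finite) simp

lemma nov_sum_ssum:
  assumes "\<And>p q. p @ q = w \<Longrightarrow> cvg (F p q)"
  shows "nov_sum (\<lambda>b. ssum w (\<lambda>p q. F p q b)) = ssum w (\<lambda>p q. nov_sum (F p q)) \<and> cvg (\<lambda>b. ssum w (\<lambda>p q. F p q b))"
  using assms
proof (induction w arbitrary: F)
  case (Cons x w)
  have IH: "nov_sum (\<lambda>b. ssum w (\<lambda>p q. F (x # p) q b)) = ssum w (\<lambda>p q. nov_sum (F (x # p) q)) \<and>
    cvg (\<lambda>b. ssum w (\<lambda>p q. F (x # p) q b))"
    by (rule Cons.IH) (rule Cons.prems, simp)
  have "cvg (F [] (x # w))" by (rule Cons.prems) simp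
  then show ?case using IH by (simp add: nov_sum_add cvg_add)
qed simp

lemma nov_sum_symsum:
  assumes "\<And>a. mset a = mset w \<Longrightarrow> cvg (F a)"
  shows "nov_sum (\<lambda>b. symsum d w (\<lambda>a. F a b)) = symsum d w (\<lambda>a. nov_sum (F a)) \<and> cvg (\<lambda>b. symsum d w (\<lambda>a. F a b))"
  using assms
proof (induction w arbitrary: F)
  case (Cons x w)
  define F' where "F' y b = ssum y (\<lambda>p q. ksign (d x * wd d p) * F (p @ x # q) b)" for y b
  have c: "cvg (\<lambda>b. ksign (d x * wd d p) * F (p @ x # q) b)" if "mset (p @ q) = mset w" for p q
    by (rule cvg_multc, rule Cons.prems) (use that in auto)
  have F': "nov_sum (F' y) = ssum y (\<lambda>p q. ksign (d x * wd d p) * nov_sum (F (p @ x # q)))" "cvg (F' y)"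
    if y: "mset y = mset w" for y
  proof -
    have *: "nov_sum (F' y) = ssum y (\<lambda>p q. nov_sum (\<lambda>b. ksign (d x * wd d p) * F (p @ x # q) b)) \<and> cvg (F' y)"
      unfolding F'_def[abs_def] by (rule nov_sum_ssum) (rule c, use y in auto)
    then show "cvg (F' y)" by blast
    have "nov_sum (\<lambda>b. ksign (d x * wd d p) * F (p @ x # q) b) = ksign (d x * wd d p) * nov_sum (F (p @ x # q))"
      if "p @ q = y" for p q
      by (rule nov_sum_mult, rule Cons.prems) (use that y in auto)
    then show "nov_sum (F' y) = ssum y (\<lambda>p q. ksign (d x * wd d p) * nov_sum (F (p @ x # q)))"
      using * by (auto intro: ssum_cong)
  qed
  have "nov_sum (\<lambda>b. symsum d w (\<lambda>a. F' a b)) = symsum d w (\<lambda>a. nov_sum (F' a)) \<and> cvg (\<lambda>b. symsum d w (\<lambda>a. F' a b))"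
    by (rule Cons.IH) (rule F'(2))
  moreover have "symsum d w (\<lambda>a. nov_sum (F' a)) = symsum d w (\<lambda>y. ssum y (\<lambda>p q. ksign (d x * wd d p) * nov_sum (F (p @ x # q))))"
    by (rule symsum_cong) (rule F'(1))
  ultimately show ?case by (simp add: F'_def)
qed simp

text \<open>What symmetrization uses about the operations, restricted to words in the letters of w:
  summability, for exchanging infinite and finite sums, and the parity of each output letter, for
  its sign.\<close>

definition mok :: "'a ainf \<Rightarrow> 'a list \<Rightarrow> bool" where
  "mok A w \<longleftrightarrow> (\<forall>a. set a \<subseteq> set w \<longrightarrow> cvg (mop A a) \<and> (\<forall>b. mop A a b \<noteq> 0 \<longrightarrow> even (sdeg A b - (wd (sdeg A) a + 1))))"

lemma mok_mono: "mok A w \<Longrightarrow> set a \<subseteq> set w \<Longrightarrow> mok A a"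
  by (auto simp: mok_def)

lemma mokD:
  assumes "mok A w" "mset a = mset w"
  shows "cvg (mop A a)" "mop A a b \<noteq> 0 \<Longrightarrow> even (sdeg A b - (wd (sdeg A) a + 1))"
proof -
  have "set a \<subseteq> set w" using mset_eq_setD[OF assms(2)] by simp
  with assms(1) show "cvg (mop A a)" "mop A a b \<noteq> 0 \<Longrightarrow> even (sdeg A b - (wd (sdeg A) a + 1))"
    unfolding mok_def by blast+
qed

lemma set_permute: "\<tau> \<in> perms (length w) \<Longrightarrow> set (permute_list \<tau> w) = set w"
  by (rule set_permute_list) (simp add: perms_def)

lemma bracket_symsum: "bracket A w b = symsum (sdeg A) w (\<lambda>a. mop A a b)"
  unfolding bracket_def by (rule sum_perms)

lemma cvg_bracket:
  assumes "mok A w" shows "cvg (bracket A w)"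
proof -
  have "cvg (\<lambda>b. symsum (sdeg A) w (\<lambda>a. mop A a b))"
    using nov_sum_symsum[of w "mop A" "sdeg A"] mokD(1)[OF assms] by blast
  then show ?thesis by (simp add: bracket_symsum[abs_def])
qed

lemma energy_ge_prod: "(\<And>i. i \<in> F \<Longrightarrow> f i \<in> energy_ge 0) \<Longrightarrow> prod f F \<in> energy_ge 0"
  by (induction F rule: infinite_finite_induct) (auto intro: energy_ge_mult'[of _ 0 _ 0])

lemma energy_ge_sym_word: "sym_word A w y \<in> energy_ge 0"
  unfolding sym_word_def
proof (intro energy_ge_sum)
  fix \<tau>
  have "koszul A \<tau> w \<in> energy_ge 0"
    unfolding koszul_def by (rule energy_ge_prod) auto
  then show "koszul A \<tau> w * kron (permute_list \<tau> w) y \<in> energy_ge 0" by (rule energy_ge_mult'[of _ 0 _ 0]) simp_all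
qed

text \<open>The bracket produces a letter b that \<open>sym_word\<close> then inserts at every
  position. The sign of the insertion depends on b, but only through its parity, which is that of
  the consumed word plus one.\<close>

lemma ce_bracket:
  assumes a0: "mok A a0"
  shows "nov_sum (\<lambda>b. bracket A a0 b * sym_word A (b # z0) w') =
    symsum (sdeg A) a0 (\<lambda>a. symsum (sdeg A) z0 (\<lambda>z. ssum z (\<lambda>p q.
      ksign ((wd (sdeg A) a + 1) * wd (sdeg A) p) * nov_sum (\<lambda>b. mop A a b * kron (p @ b # q) w'))))"
proof -
  let ?d = "sdeg A"
  define F where "F a z p q b = mop A a b * (ksign (?d b * wd ?d p) * kron (p @ b # q) w')"
    for a z p q :: "'a list" and b
  have cF: "cvg (F a z p q)" if "mset a = mset a0" for a z p q
  proof -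
    have "cvg (mop A a)" by (rule mokD(1)[OF a0 that])
    then have "cvg (\<lambda>b. (ksign (?d b * wd ?d p) * kron (p @ b # q) w') * mop A a b)"
      by (rule cvg_mult[where c = 0]) (rule energy_ge_mult'[of _ 0 _ 0], simp_all)
    then show ?thesis by (simp add: F_def[abs_def] mult.commute)
  qed
  have sF: "nov_sum (F a z p q) = ksign ((wd ?d a + 1) * wd ?d p) * nov_sum (\<lambda>b. mop A a b * kron (p @ b # q) w')"
    if a: "mset a = mset a0" for a z p q
  proof -
    have "F a z p q b = ksign ((wd ?d a + 1) * wd ?d p) * (mop A a b * kron (p @ b # q) w')" for b
    proof (cases "mop A a b = 0")
      case False
      then have "even (?d b - (wd ?d a + 1))" by (rule mokD(2)[OF a0 a])
      then have "ksign (?d b * wd ?d p) = ksign ((wd ?d a + 1) * wd ?d p)" by (intro ksign_cong) auto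
      then show ?thesis by (simp add: F_def mult_ac)
    qed (simp add: F_def)
    then have "F a z p q = (\<lambda>b. ksign ((wd ?d a + 1) * wd ?d p) * (mop A a b * kron (p @ b # q) w'))" by blast
    moreover have "cvg (mop A a)" by (rule mokD(1)[OF a0 a])
    then have "cvg (\<lambda>b. kron (p @ b # q) w' * mop A a b)" by (rule cvg_mult[where c = 0]) simp
    then have "cvg (\<lambda>b. mop A a b * kron (p @ b # q) w')" by (simp add: mult.commute)
    ultimately show ?thesis by (simp add: nov_sum_mult)
  qed
  have e: "bracket A a0 b * sym_word A (b # z0) w' =
    symsum ?d a0 (\<lambda>a. symsum ?d z0 (\<lambda>z. ssum z (\<lambda>p q. F a z p q b)))" for b
    unfolding bracket_symsum sym_word_symsum symsum.simps symsum_mult2[symmetric] F_def mult_ssum ..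
  have z: "nov_sum (\<lambda>b. symsum ?d z0 (\<lambda>z. ssum z (\<lambda>p q. F a z p q b))) = symsum ?d z0 (\<lambda>z. ssum z (\<lambda>p q. nov_sum (F a z p q)))"
     "cvg (\<lambda>b. symsum ?d z0 (\<lambda>z. ssum z (\<lambda>p q. F a z p q b)))" if a: "mset a = mset a0" for a
  proof -
    have s: "nov_sum (\<lambda>b. ssum z (\<lambda>p q. F a z p q b)) = ssum z (\<lambda>p q. nov_sum (F a z p q)) \<and> cvg (\<lambda>b. ssum z (\<lambda>p q. F a z p q b))" for z
      by (rule nov_sum_ssum) (rule cF[OF a])
    have "nov_sum (\<lambda>b. symsum ?d z0 (\<lambda>z. ssum z (\<lambda>p q. F a z p q b))) = symsum ?d z0 (\<lambda>z. nov_sum (\<lambda>b. ssum z (\<lambda>p q. F a z p q b))) \<and>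
      cvg (\<lambda>b. symsum ?d z0 (\<lambda>z. ssum z (\<lambda>p q. F a z p q b)))"
      by (rule nov_sum_symsum) (use s in blast)
    then show "nov_sum (\<lambda>b. symsum ?d z0 (\<lambda>z. ssum z (\<lambda>p q. F a z p q b))) = symsum ?d z0 (\<lambda>z. ssum z (\<lambda>p q. nov_sum (F a z p q)))"
     "cvg (\<lambda>b. symsum ?d z0 (\<lambda>z. ssum z (\<lambda>p q. F a z p q b)))" using s by simp_all
  qed
  have "nov_sum (\<lambda>b. bracket A a0 b * sym_word A (b # z0) w') =
    symsum ?d a0 (\<lambda>a. nov_sum (\<lambda>b. symsum ?d z0 (\<lambda>z. ssum z (\<lambda>p q. F a z p q b))))"
    unfolding e by (rule nov_sum_symsum[THEN conjunct1]) (rule z(2))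
  also have "\<dots> = symsum ?d a0 (\<lambda>a. symsum ?d z0 (\<lambda>z. ssum z (\<lambda>p q.
      ksign ((wd ?d a + 1) * wd ?d p) * nov_sum (\<lambda>b. mop A a b * kron (p @ b # q) w'))))"
    by (rule symsum_cong) (simp add: z(1) sF)
  finally show ?thesis .
qed

text \<open>In the Chevalley-Eilenberg differential the consumed letters stand in front, in the bar
  differential they stand between p and q. Exchanging a and p in the prefix turns one into the other
  and leaves the Koszul sign of m passing p.\<close>

lemma symsum_bar_d:
  assumes w: "mok A w"
  shows "shsum (sdeg A) w (\<lambda>a0 z0. nov_sum (\<lambda>b. bracket A a0 b * sym_word A (b # z0) w')) =
    symsum (sdeg A) w (\<lambda>y. bar_d A y w')"
proof -
  let ?d = "sdeg A"
  define \<beta> where "\<beta> p a q = nov_sum (\<lambda>b. mop A a b * kron (p @ b # q) w')" for p a q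
  have "shsum ?d w (\<lambda>a0 z0. nov_sum (\<lambda>b. bracket A a0 b * sym_word A (b # z0) w')) =
    shsum ?d w (\<lambda>a0 z0. symsum ?d a0 (\<lambda>a. symsum ?d z0 (\<lambda>z. ssum z (\<lambda>p q. ksign ((wd ?d a + 1) * wd ?d p) * \<beta> p a q))))"
    unfolding \<beta>_def
  proof (rule shsum_cong, rule ce_bracket)
    fix a b assume "mset (a @ b) = mset w"
    then have "set a \<subseteq> set w" using mset_eq_setD by fastforce
    then show "mok A a" by (rule mok_mono[OF w])
  qed
  also have "\<dots> = symsum ?d w (\<lambda>y. ssum y (\<lambda>a z. ssum z (\<lambda>p q. ksign ((wd ?d a + 1) * wd ?d p) * \<beta> p a q)))"
    by (rule shsum_symsum)
  also have "\<dots> = symsum ?d w (\<lambda>y. ssum y (\<lambda>u q. ssum u (\<lambda>a p. ksign (wd ?d a * wd ?d p) * (ksign (wd ?d p) * \<beta> p a q))))"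
    unfolding ssum_assoc by (simp add: distrib_right ksign_add mult.assoc)
  also have "\<dots> = symsum ?d w (\<lambda>y. ssum y (\<lambda>u q. ssum u (\<lambda>p a. ksign (wd ?d p) * \<beta> p a q)))"
    by (rule symsum_rotate_prefix[symmetric])
  also have "\<dots> = symsum ?d w (\<lambda>y. bar_d A y w')"
    unfolding bar_d_ssum ssum_assoc \<beta>_def wdeg_wd ..
  finally show ?thesis .
qed

lemma ce_d_shsum: "ce_d A M (v, w) (v', w') = ce_wrap A (symmetrize A M (nop M)) (v, w) (v', w') +
   ksign (sdeg M v) * kron v v' * shsum (sdeg A) w (\<lambda>a z. nov_sum (\<lambda>b. bracket A a b * sym_word A (b # z) w'))"
  by (simp add: ce_d_def Let_def sum_shuffles[symmetric] sum_distrib_left mult_ac)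

lemma ce_d_hoch:
  assumes "mok A w"
  shows "ce_d A M (v, w) (v', w') = symsum (sdeg A) w (\<lambda>y. hoch_d A M (v, y) (v', w'))"
  by (simp add: ce_d_shsum ce_wrap_hoch symsum_bar_d[OF assms] symsum_add symsum_mult add.commute del: hoch_wrap.simps)

lemma shsum_mult: "shsum d w (\<lambda>a b. k * F a b) = k * shsum d w F"
  by (induction w arbitrary: F) (simp_all only: shsum.simps mult.left_commute[of _ k] distrib_left)

lemma ce_wrap_permute:
  assumes "\<tau> \<in> perms (length w')"
  shows "ce_wrap A \<eta> (v, w) (v', permute_list \<tau> w') = koszul A \<tau> w' * ce_wrap A \<eta> (v, w) (v', w')"
  unfolding ce_wrap_shsum sym_word_permute[OF assms] mult.left_commute[of _ "koszul A \<tau> w'"] shsum_mult ..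

text \<open>This is what keeps the differential inside the symmetric chains: \<open>sym_word\<close>
  makes its values on generators signed-symmetric in the output word.\<close>

lemma ce_d_permute:
  assumes w: "mok A w" and t: "\<tau> \<in> perms (length w')"
  shows "ce_d A M (v, w) (v', permute_list \<tau> w') = koszul A \<tau> w' * ce_d A M (v, w) (v', w')"
proof -
  have "shsum (sdeg A) w (\<lambda>a z. nov_sum (\<lambda>b. bracket A a b * sym_word A (b # z) (permute_list \<tau> w'))) =
    shsum (sdeg A) w (\<lambda>a z. koszul A \<tau> w' * nov_sum (\<lambda>b. bracket A a b * sym_word A (b # z) w'))"
  proof (rule shsum_cong)
    fix a z assume "mset (a @ z) = mset w"
    then have "set a \<subseteq> set w" using mset_eq_setD by fastforce
    then have "cvg (bracket A a)" using cvg_bracket mok_mono[OF w] by blast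
    then have "cvg (\<lambda>b. sym_word A (b # z) w' * bracket A a b)"
      by (rule cvg_mult[where c = 0]) (rule energy_ge_sym_word)
    then have "cvg (\<lambda>b. bracket A a b * sym_word A (b # z) w')" by (simp add: mult.commute)
    then show "nov_sum (\<lambda>b. bracket A a b * sym_word A (b # z) (permute_list \<tau> w')) =
      koszul A \<tau> w' * nov_sum (\<lambda>b. bracket A a b * sym_word A (b # z) w')"
      by (simp add: sym_word_permute[OF t] mult.left_commute[of _ "koszul A \<tau> w'"] nov_sum_mult)
  qed
  then show ?thesis
    by (simp add: ce_d_shsum ce_wrap_permute[OF t] shsum_mult distrib_left mult.left_commute)
qed

section \<open>Degrees\<close>

text \<open>A set of degrees is allowed because the complement of a single degree is needed to split
  a vector in \<open>app_dproj\<close>.\<close>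

definition hdeg :: "('i \<Rightarrow> int) \<Rightarrow> int set \<Rightarrow> 'i vec \<Rightarrow> bool" where
  "hdeg dg K x \<longleftrightarrow> (\<forall>i p. coeff (x $ i) p \<noteq> 0 \<longrightarrow> dg i + 2 * snd p \<in> K)"

lemma hdeg_homogeneous: "hdeg dg {k} x \<longleftrightarrow> homogeneous dg k (vnth x)"
  by (auto simp: hdeg_def homogeneous_def)

lemma coeff_0 [simp]: "coeff 0 p = 0" by (simp add: zero_nov.rep_eq)

lemma hdeg_0 [simp]: "hdeg dg K 0" by (simp add: hdeg_def)
lemma hdeg_add: "hdeg dg K x \<Longrightarrow> hdeg dg K y \<Longrightarrow> hdeg dg K (x + y)"
  unfolding hdeg_def by (simp add: plus_nov.rep_eq) (metis add_0)
lemma hdeg_uminus: "hdeg dg K x \<Longrightarrow> hdeg dg K (- x)"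
  by (simp add: hdeg_def uminus_nov.rep_eq)
lemma hdeg_ksign: "hdeg dg K x \<Longrightarrow> hdeg dg K (ksign s *v x)"
  by (auto simp: ksign_def hdeg_uminus)
lemma hdeg_ssum: "(\<And>a b. a @ b = u \<Longrightarrow> hdeg dg K (f a b)) \<Longrightarrow> hdeg dg K (ssum u f)"
  by (induction u arbitrary: f) (simp_all add: hdeg_add)
lemma hdeg_unitv: "dg i \<in> K \<Longrightarrow> hdeg dg K (unitv i)"
  by (auto simp: hdeg_def vnth_unitv kron_def one_nov.rep_eq zero_prod_def split: if_splits)

lemma hdegD: "hdeg dg K x \<Longrightarrow> coeff (x $ i) p \<noteq> 0 \<Longrightarrow> dg i + 2 * snd p \<in> K"
  unfolding hdeg_def by blast

lemma hdeg_app: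
  assumes D: "bdd D" and x: "hdeg dg K x" and h: "\<And>i. hdeg dg' {dg i + s} (D i)"
  shows "hdeg dg' ((\<lambda>k. k + s) ` K) (app D x)"
  unfolding hdeg_def
proof (intro allI impI)
  fix j p assume "coeff (app D x $ j) p \<noteq> 0"
  then have "Sum_any (\<lambda>i. coeff (x $ i * D i $ j) p) \<noteq> 0"
    by (simp add: vnth_app[OF D] coeff_nov_sum[OF cvg_app1[OF D]])
  then obtain i where "coeff (x $ i * D i $ j) p \<noteq> 0"
    using Sum_any.not_neutral_obtains_not_neutral by blast
  then have "nov_conv (coeff (x $ i)) (coeff (D i $ j)) p \<noteq> 0" by (simp add: times_nov.rep_eq)
  from nov_conv_nz[OF this] obtain a where a: "coeff (x $ i) a \<noteq> 0" "coeff (D i $ j) (p - a) \<noteq> 0" by blast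
  have "dg i + 2 * snd a \<in> K" by (rule hdegD[OF x a(1)])
  moreover have "dg' j + 2 * snd (p - a) = dg i + s" using h[of i] a(2) unfolding hdeg_def by blast
  then have "dg' j + 2 * snd p = (dg i + 2 * snd a) + s" by (simp add: snd_diff algebra_simps)
  ultimately show "dg' j + 2 * snd p \<in> (\<lambda>k. k + s) ` K" by blast
qed

lemma hdeg_push: "hdeg dg K x \<Longrightarrow> (\<And>i. dg' (f i) = dg i + s) \<Longrightarrow> hdeg dg' ((\<lambda>k. k + s) ` K) (app (\<lambda>i. unitv (f i)) x)"
  by (rule hdeg_app) (auto intro: hdeg_unitv)

section \<open>Homogeneous components of vectors\<close>

definition restr :: "int \<Rightarrow> nov \<Rightarrow> nov" where
  "restr m a = Abs_nov (\<lambda>p. if 2 * snd p = m then coeff a p else 0)"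

lemma coeff_restr: "coeff (restr m a) p = (if 2 * snd p = m then coeff a p else 0)"
proof -
  have "finite {p. fst p \<le> E \<and> (if 2 * snd p = m then coeff a p else 0) \<noteq> 0}" for E
    by (rule finite_subset[of _ "{p. fst p \<le> E \<and> coeff a p \<noteq> 0}"]) (use coeff[of a] in auto)
  then show ?thesis unfolding restr_def by (subst Abs_nov_inverse) auto
qed

lemma restr_energy: "a \<in> energy_ge E \<Longrightarrow> restr m a \<in> energy_ge E"
  unfolding energy_ge_def mem_Collect_eq coeff_restr by metis

text \<open>A summable vector can have infinitely many homogeneous components, so degrees are
  handled by projecting to one of them. The coefficient of i supplies the difference k -
  \<open>dg i\<close> by its exponent of e.\<close>

definition dproj :: "('i \<Rightarrow> int) \<Rightarrow> int \<Rightarrow> 'i vec \<Rightarrow> 'i vec" where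
  "dproj dg k x = Vec (\<lambda>i. restr (k - dg i) (x $ i))"

lemma vnth_dproj: "dproj dg k x $ i = restr (k - dg i) (x $ i)"
proof -
  have "cvg (\<lambda>i. restr (k - dg i) (x $ i))"
    by (rule cvg_mono[of "vnth x" _ 0]) (simp_all add: restr_energy)
  then show ?thesis by (simp add: dproj_def Vec_inverse)
qed

lemma coeff_dproj: "coeff (dproj dg k x $ i) p = (if dg i + 2 * snd p = k then coeff (x $ i) p else 0)"
  by (auto simp: vnth_dproj coeff_restr)

lemma dproj_vge: "vge c x \<Longrightarrow> vge c (dproj dg k x)"
  by (simp add: vge_def vnth_dproj restr_energy)

lemma dproj_add: "dproj dg k (x + y) = dproj dg k x + dproj dg k y"
  by (intro vec_eqI nov_eqI) (simp add: coeff_dproj plus_nov.rep_eq)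

lemma hdeg_dproj: "hdeg dg {k} (dproj dg k x)"
  by (simp add: hdeg_def coeff_dproj)

lemma dproj_eq: "hdeg dg {k} x \<Longrightarrow> dproj dg k x = x"
  by (intro vec_eqI nov_eqI) (use hdegD in \<open>fastforce simp: coeff_dproj\<close>)

lemma dproj_eq_0: "hdeg dg (- {k}) x \<Longrightarrow> dproj dg k x = 0"
  by (intro vec_eqI nov_eqI) (use hdegD in \<open>fastforce simp: coeff_dproj\<close>)

lemma dproj_0 [simp]: "dproj dg k 0 = 0" by (rule dproj_eq_0) simp

text \<open>What remains of x has all degrees but k; D shifts them by s, and so its image has no
  component of degree k + s.\<close>

lemma app_dproj:
  assumes D: "bdd D" and h: "\<And>i. hdeg dg' {dg i + s} (D i)"
  shows "app D (dproj dg k x) = dproj dg' (k + s) (app D x)"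
proof -
  define r where "r = x - dproj dg k x"
  have x: "x = dproj dg k x + r" by (simp add: r_def)
  have "hdeg dg (- {k}) r" unfolding hdeg_def r_def
    by (auto simp: coeff_diff coeff_dproj split: if_splits)
  moreover have "(\<lambda>j. j + s) ` (- {k}) = - {k + s}"
  proof (intro equalityI subsetI)
    fix j assume "j \<in> (\<lambda>j. j + s) ` (- {k})"
    then show "j \<in> - {k + s}" by auto
  next
    fix j assume "j \<in> - {k + s}"
    then show "j \<in> (\<lambda>j. j + s) ` (- {k})" by (intro image_eqI[of _ _ "j - s"]) auto
  qed
  ultimately have "hdeg dg' (- {k + s}) (app D r)" using hdeg_app[OF D _ h, of "- {k}" r] by simp
  then have 0: "dproj dg' (k + s) (app D r) = 0" by (rule dproj_eq_0)
  from hdeg_app[OF D hdeg_dproj[of dg k x] h] have "hdeg dg' {k + s} (app D (dproj dg k x))" by simp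
  then have 1: "dproj dg' (k + s) (app D (dproj dg k x)) = app D (dproj dg k x)" by (rule dproj_eq)
  have "dproj dg' (k + s) (app D x) = dproj dg' (k + s) (app D (dproj dg k x) + app D r)"
    by (subst (1) x) (simp add: app_add[OF D])
  then show ?thesis by (simp add: dproj_add 0 1)
qed

section \<open>Homology of complexes of vectors\<close>

text \<open>The interface between a complex of coefficient functions and the vector calculus.
  Closure under \<open>dproj\<close> is included so that homogeneous classes can be treated by
  projection.\<close>

definition vcplx :: "setting \<Rightarrow> 'i cplx \<Rightarrow> 'i vec set \<Rightarrow> ('i vec \<Rightarrow> 'i vec) \<Rightarrow> bool" where
  "vcplx \<kappa> X S D \<longleftrightarrow> chains X = vnth ` S \<and> (\<forall>x\<in>S. diff X (vnth x) = vnth (D x)) \<and>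
     subgrp S \<and> addh D \<and> (\<forall>x\<in>S. D x \<in> S) \<and> (\<forall>x\<in>S. D (D x) = 0) \<and>
     (\<forall>a\<in>scalars \<kappa>. \<forall>x\<in>S. a *v x \<in> S \<and> D (a *v x) = a *v D x) \<and>
     (\<forall>x\<in>S. \<forall>k. dproj (cdeg X) k x \<in> S \<and> D (dproj (cdeg X) k x) = dproj (cdeg X) (k + 1) (D x))"

context
  fixes \<kappa> X S D
  assumes C: "vcplx \<kappa> X S D"
begin

lemma inj_vnth: "inj vnth" by (rule injI) (simp add: vnth_inject)

lemma vcplxD:
  shows "chains X = vnth ` S" "x \<in> S \<Longrightarrow> diff X (vnth x) = vnth (D x)" "subgrp S" "addh D"
    "x \<in> S \<Longrightarrow> D x \<in> S" "x \<in> S \<Longrightarrow> D (D x) = 0"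
    "a \<in> scalars \<kappa> \<Longrightarrow> x \<in> S \<Longrightarrow> a *v x \<in> S" "a \<in> scalars \<kappa> \<Longrightarrow> x \<in> S \<Longrightarrow> D (a *v x) = a *v D x"
    "x \<in> S \<Longrightarrow> dproj (cdeg X) k x \<in> S"
    "x \<in> S \<Longrightarrow> D (dproj (cdeg X) k x) = dproj (cdeg X) (k + 1) (D x)"
  using C unfolding vcplx_def by blast+

lemma vnth_eq_0: "vnth x = (\<lambda>_. 0) \<longleftrightarrow> x = 0"
proof
  assume "vnth x = (\<lambda>_. 0)" then show "x = 0" by (intro vec_eqI) simp
qed (simp add: vec_rep_eq)

lemma vcycles: "cycles X = vnth ` {x \<in> S. D x = 0}"
  unfolding cycles_def vcplxD(1) using vcplxD(2) by (auto simp: vnth_eq_0)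

lemma vboundaries: "boundaries X = vnth ` (D ` S)"
  unfolding boundaries_def vcplxD(1) using vcplxD(2) by (auto simp: image_iff)

definition cls :: "'a vec \<Rightarrow> 'a vec set" where "cls z = {D u + z | u. u \<in> S}"

lemma vhclass: "hclass X (vnth z) = vnth ` cls z"
proof -
  have "hclass X (vnth z) = {\<lambda>i. b i + z $ i | b. b \<in> vnth ` (D ` S)}"
    unfolding hclass_def r_coset_def vboundaries by (auto simp: add_monoid_on_def)
  also have "\<dots> = vnth ` cls z"
  proof (intro equalityI subsetI)
    fix b assume "b \<in> {\<lambda>i. b i + z $ i | b. b \<in> vnth ` (D ` S)}"
    then obtain u where "u \<in> S" "b = (\<lambda>i. D u $ i + z $ i)" by blast
    then show "b \<in> vnth ` cls z" unfolding cls_def vec_rep_eq(2)[symmetric] by blast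
  next
    fix b assume "b \<in> vnth ` cls z"
    then obtain u where "u \<in> S" "b = vnth (D u + z)" by (auto simp: cls_def)
    then show "b \<in> {\<lambda>i. b i + z $ i | b. b \<in> vnth ` (D ` S)}" unfolding vec_rep_eq(2) by blast
  qed
  finally show ?thesis .
qed

lemma cls_self: "z \<in> cls z"
  unfolding cls_def using subgrpD(1)[OF vcplxD(3)] addhD(2)[OF vcplxD(4)] by force

lemma cls_eq: "cls z = cls z' \<longleftrightarrow> z - z' \<in> D ` S"
proof
  assume "cls z = cls z'"
  then have "z \<in> cls z'" using cls_self by blast
  then show "z - z' \<in> D ` S" by (auto simp: cls_def)
next
  note a = addhD[OF vcplxD(4)] and s = subgrpD[OF vcplxD(3)]
  have *: "cls z \<subseteq> cls z'" if zz: "z - z' \<in> D ` S" for z z'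
  proof
    fix y assume "y \<in> cls z"
    then obtain u where u: "u \<in> S" "y = D u + z" by (auto simp: cls_def)
    obtain v where v: "v \<in> S" "z - z' = D v" using zz by blast
    have "y = D (u + v) + z'" using u v by (simp add: a algebra_simps)
    then show "y \<in> cls z'" using s(4)[OF u(1) v(1)] by (auto simp: cls_def)
  qed
  assume z: "z - z' \<in> D ` S"
  then obtain v where v: "v \<in> S" "z - z' = D v" by blast
  then have "z' - z = D (- v)" by (simp add: a) (metis minus_diff_eq)
  then have "z' - z \<in> D ` S" using s(3)[OF v(1)] by blast
  then show "cls z = cls z'" using *[OF z] *[of z' z] by blast
qed

lemma vhclass_eq: "hclass X (vnth z) = hclass X (vnth z') \<longleftrightarrow> z - z' \<in> D ` S"
  unfolding vhclass cls_eq[symmetric] by (rule inj_image_eq_iff[OF inj_vnth])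

lemma vhom_carrier: "carrier (homology X) = {hclass X (vnth z) | z. z \<in> S \<and> D z = 0}"
  unfolding homology_def FactGroup_def RCOSETS_def hclass_def[symmetric]
  by (auto simp: add_monoid_on_def vcycles[unfolded add_monoid_on_def] hclass_def)

lemma vhom_mult:
  "hclass X (vnth z) \<otimes>\<^bsub>homology X\<^esub> hclass X (vnth z') = hclass X (vnth (z + z'))"
proof -
  note a = addhD[OF vcplxD(4)] and s = subgrpD[OF vcplxD(3)]
  have "hclass X (vnth z) \<otimes>\<^bsub>homology X\<^esub> hclass X (vnth z') = {\<lambda>i. x i + y i | x y. x \<in> vnth ` cls z \<and> y \<in> vnth ` cls z'}"
    unfolding vhclass by (auto simp: homology_def FactGroup_def set_mult_def add_monoid_on_def)
  also have "\<dots> = vnth ` {x + y | x y. x \<in> cls z \<and> y \<in> cls z'}"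
  proof safe
    fix a b assume "a \<in> cls z" "b \<in> cls z'"
    then show "(\<lambda>i. a $ i + b $ i) \<in> vnth ` {x + y | x y. x \<in> cls z \<and> y \<in> cls z'}"
      by (intro image_eqI[of _ _ "a + b"]) (auto simp: vec_rep_eq(2))
    show "\<exists>x y. vnth (a + b) = (\<lambda>i. x i + y i) \<and> x \<in> vnth ` cls z \<and> y \<in> vnth ` cls z'"
      using \<open>a \<in> cls z\<close> \<open>b \<in> cls z'\<close>
      by (intro exI[of _ "vnth a"] exI[of _ "vnth b"] conjI imageI) (simp_all add: vec_rep_eq(2))
  qed
  also have "{x + y | x y. x \<in> cls z \<and> y \<in> cls z'} = cls (z + z')"
  proof (intro equalityI subsetI)
    fix w assume "w \<in> {x + y | x y. x \<in> cls z \<and> y \<in> cls z'}"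
    then obtain u v where "u \<in> S" "v \<in> S" "w = D u + z + (D v + z')" by (auto simp: cls_def)
    then have "w = D (u + v) + (z + z')" "u + v \<in> S" by (auto simp: a s algebra_simps)
    then show "w \<in> cls (z + z')" by (auto simp: cls_def)
  next
    fix w assume "w \<in> cls (z + z')"
    then obtain u where u: "u \<in> S" "w = D u + (z + z')" by (auto simp: cls_def)
    then have "w = (D u + z) + z'" "D u + z \<in> cls z" by (auto simp: cls_def algebra_simps)
    then show "w \<in> {x + y | x y. x \<in> cls z \<and> y \<in> cls z'}" using cls_self by blast
  qed
  finally show ?thesis by (simp only: vhclass)
qed

lemma vhscale:
  assumes a: "a \<in> scalars \<kappa>" and z: "z \<in> S"
  shows "hscale X a (hclass X (vnth z)) = hclass X (vnth (a *v z))"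
proof -
  have e: "hclass X (\<lambda>i. a * y $ i) = hclass X (vnth (a *v z))" if y: "y \<in> cls z" for y
  proof -
    obtain u where u: "u \<in> S" "y = D u + z" using y by (auto simp: cls_def)
    have "a *v y - a *v z = D (a *v u)" using a u by (simp add: vcplxD(8) vscale_add)
    then have "hclass X (vnth (a *v y)) = hclass X (vnth (a *v z))"
      unfolding vhclass_eq using vcplxD(7)[OF a u(1)] by blast
    moreover have "vnth (a *v y) = (\<lambda>i. a * y $ i)" by (rule ext) simp
    ultimately show ?thesis by simp
  qed
  then have "(\<Union>y\<in>vnth ` cls z. hclass X (\<lambda>i. a * y i)) = hclass X (vnth (a *v z))"
    using cls_self by auto
  then show ?thesis by (simp add: hscale_def vhclass)
qed

lemma vhom_deg: "homology_deg X k = {hclass X (vnth z) | z. z \<in> S \<and> D z = 0 \<and> hdeg (cdeg X) {k} z}"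
  unfolding homology_deg_def vcycles hdeg_homogeneous by blast

lemma vcplx_complex: "is_complex X"
  unfolding is_complex_def vcplxD(1)
proof (intro ballI conjI allI impI)
  fix y assume "y \<in> vnth ` S"
  then obtain x where x: "x \<in> S" "y = vnth x" by blast
  show "diff X y \<in> vnth ` S" using x vcplxD(2,5) by auto
  show "diff X (diff X y) = (\<lambda>_. 0)" using x vcplxD(2)[OF x(1)] vcplxD(2)[OF vcplxD(5)[OF x(1)]] vcplxD(6)[OF x(1)]
    by (simp add: vnth_eq_0)
  fix k assume "homogeneous (cdeg X) k y"
  then have "dproj (cdeg X) k x = x" using dproj_eq x(2) by (simp add: hdeg_homogeneous)
  then have "D x = dproj (cdeg X) (k + 1) (D x)" using vcplxD(10)[OF x(1), of k] by simp
  then have "hdeg (cdeg X) {k + 1} (D x)" using hdeg_dproj by metis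
  then show "homogeneous (cdeg X) (k + 1) (diff X y)" using x vcplxD(2)[OF x(1)] by (simp add: hdeg_homogeneous)
qed

end

lemma vcplx_iso:
  assumes X: "vcplx \<kappa> X S D" and Y: "vcplx \<kappa> Y S' D'"
    and f: "\<And>x. x \<in> S \<Longrightarrow> f (vnth x) = vnth (F x)" and add: "addh F"
    and FS: "\<And>x. x \<in> S \<Longrightarrow> F x \<in> S'" and FD: "\<And>x. x \<in> S \<Longrightarrow> F (D x) = D' (F x)"
    and Fa: "\<And>a x. a \<in> scalars \<kappa> \<Longrightarrow> x \<in> S \<Longrightarrow> F (a *v x) = a *v F x"
    and Fk: "\<And>x k. x \<in> S \<Longrightarrow> F (dproj (cdeg X) k x) = dproj (cdeg Y) k (F x)"
    and inj: "hinj S D S' D' F" and sur: "hsur S D S' D' F"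
  shows "induces_homology_iso \<kappa> X Y f"
proof -
  note x = vcplxD[OF X] and y = vcplxD[OF Y] and a = addhD[OF add]
  have ind: "induced Y f (hclass X (vnth z)) = hclass Y (vnth (F z))" if z: "z \<in> S" for z
  proof -
    have e: "hclass Y (f (vnth w)) = hclass Y (vnth (F z))" if w: "w \<in> cls S D z" for w
    proof -
      obtain u where u: "u \<in> S" "w = D u + z" using w by (auto simp: cls_def[OF X])
      have "w \<in> S" using u z subgrpD(4)[OF x(3)] x(5) by auto
      moreover have "F w - F z \<in> D' ` S'" using u z by (simp add: a FD FS)
      ultimately show ?thesis using f vhclass_eq[OF Y] by auto
    qed
    then have "(\<Union>y\<in>vnth ` cls S D z. hclass Y (f y)) = hclass Y (vnth (F z))"
      using cls_self[OF X, of z] by auto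
    then show ?thesis by (simp add: induced_def vhclass[OF X])
  qed
  have chain: "is_chain_map X Y f"
    unfolding is_chain_map_def x(1) y(1)
  proof (intro ballI conjI allI impI)
    fix c assume "c \<in> vnth ` S"
    then obtain z where z: "z \<in> S" "c = vnth z" by blast
    show "f c \<in> vnth ` S'" using z f FS by auto
    show "f (diff X c) = diff Y (f c)" using z by (simp add: x(2) f x(5) y(2) FS FD)
    fix k assume "homogeneous (cdeg X) k c"
    then have "dproj (cdeg X) k z = z" using dproj_eq z(2) by (simp add: hdeg_homogeneous)
    then have "F z = dproj (cdeg Y) k (F z)" using Fk[OF z(1), of k] by simp
    then have "hdeg (cdeg Y) {k} (F z)" using hdeg_dproj by metis
    then show "homogeneous (cdeg Y) k (f c)" using z f by (simp add: hdeg_homogeneous)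
  qed
  have cyc: "F z \<in> S'" "D' (F z) = 0" if "z \<in> S" "D z = 0" for z
    using that FS FD[of z] a(2) by auto
  have iso: "induced Y f \<in> iso (homology X) (homology Y)"
  proof (rule isoI)
    show "induced Y f \<in> hom (homology X) (homology Y)"
    proof (rule homI)
      fix c assume "c \<in> carrier (homology X)"
      then show "induced Y f c \<in> carrier (homology Y)"
        using cyc by (auto simp: vhom_carrier[OF X] vhom_carrier[OF Y] ind)
    next
      fix c c' assume "c \<in> carrier (homology X)" "c' \<in> carrier (homology X)"
      then obtain z z' where z: "z \<in> S" "c = hclass X (vnth z)" "z' \<in> S" "c' = hclass X (vnth z')"
        by (auto simp: vhom_carrier[OF X])
      then show "induced Y f (c \<otimes>\<^bsub>homology X\<^esub> c') = induced Y f c \<otimes>\<^bsub>homology Y\<^esub> induced Y f c'"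
        using subgrpD(4)[OF x(3)] by (simp add: vhom_mult[OF X] vhom_mult[OF Y] ind a)
    qed
    show "bij_betw (induced Y f) (carrier (homology X)) (carrier (homology Y))"
      unfolding bij_betw_def
    proof
      show "inj_on (induced Y f) (carrier (homology X))"
      proof (rule inj_onI)
        fix c c' assume "c \<in> carrier (homology X)" "c' \<in> carrier (homology X)" and e: "induced Y f c = induced Y f c'"
        then obtain z z' where z: "z \<in> S" "D z = 0" "c = hclass X (vnth z)" "z' \<in> S" "D z' = 0" "c' = hclass X (vnth z')"
          by (auto simp: vhom_carrier[OF X])
        then have "F (z - z') \<in> D' ` S'" using e by (simp add: ind vhclass_eq[OF Y] a)
        moreover have "z - z' \<in> S" "D (z - z') = 0" using z subgrpD(2)[OF x(3)] addhD[OF x(4)] by auto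
        ultimately have "z - z' \<in> D ` S" using inj unfolding hinj_def by (metis imageE image_eqI)
        then show "c = c'" using z by (simp add: vhclass_eq[OF X])
      qed
      show "induced Y f ` carrier (homology X) = carrier (homology Y)"
      proof (intro equalityI subsetI)
        fix c assume "c \<in> induced Y f ` carrier (homology X)"
        then show "c \<in> carrier (homology Y)"
          using cyc by (auto simp: vhom_carrier[OF X] vhom_carrier[OF Y] ind)
      next
        fix c assume "c \<in> carrier (homology Y)"
        then obtain w where w: "w \<in> S'" "D' w = 0" "c = hclass Y (vnth w)" by (auto simp: vhom_carrier[OF Y])
        then obtain z u where z: "z \<in> S" "D z = 0" "u \<in> S'" "F z = w + D' u" using sur unfolding hsur_def by blast
        then have "c = induced Y f (hclass X (vnth z))" using w by (simp add: ind vhclass_eq[OF Y])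
          (metis (no_types, lifting) addhD(3) diff_add_cancel diff_diff_eq2 diff_self image_eqI minus_diff_eq subgrpD(3) y(3) y(4) add_diff_cancel_left')
        then show "c \<in> induced Y f ` carrier (homology X)" using z by (auto simp: vhom_carrier[OF X])
      qed
    qed
  qed
  have deg: "induced Y f ` homology_deg X k = homology_deg Y k" for k
  proof (intro equalityI subsetI)
    fix c assume "c \<in> induced Y f ` homology_deg X k"
    then obtain z where z: "z \<in> S" "D z = 0" "hdeg (cdeg X) {k} z" "c = hclass Y (vnth (F z))"
      by (auto simp: vhom_deg[OF X] ind)
    then have "F z = dproj (cdeg Y) k (F z)" using Fk[OF z(1), of k] by (simp add: dproj_eq)
    then have "hdeg (cdeg Y) {k} (F z)" using hdeg_dproj by metis
    then show "c \<in> homology_deg Y k" using z cyc by (auto simp: vhom_deg[OF Y])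
  next
    fix c assume "c \<in> homology_deg Y k"
    then obtain w where w: "w \<in> S'" "D' w = 0" "hdeg (cdeg Y) {k} w" "c = hclass Y (vnth w)"
      by (auto simp: vhom_deg[OF Y])
    then obtain z u where z: "z \<in> S" "D z = 0" "u \<in> S'" "F z = w + D' u" using sur unfolding hsur_def by blast
    \<comment> \<open>The preimage z and the bounding u may be inhomogeneous. Their components of
      degrees k and k - 1 serve as well, since all maps commute with \<open>dproj\<close>.\<close>
    define z' where "z' = dproj (cdeg X) k z"
    define u' where "u' = dproj (cdeg Y) (k - 1) u"
    have z': "z' \<in> S" "D z' = 0" "hdeg (cdeg X) {k} z'"
      using z by (auto simp: z'_def x(9,10) hdeg_dproj)
    have u': "u' \<in> S'" "D' u' = dproj (cdeg Y) k (D' u)" using z y(10)[OF z(3), of "k - 1"] by (auto simp: u'_def y(9))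
    have "F z' = w + D' u'" using z w by (simp add: z'_def Fk u'(2) dproj_add dproj_eq)
    then have "w - F z' = D' (- u')" by (simp add: addhD[OF y(4)])
    then have "w - F z' \<in> D' ` S'" using subgrpD(3)[OF y(3) u'(1)] by blast
    then have "c = induced Y f (hclass X (vnth z'))" using w z' by (simp add: ind vhclass_eq[OF Y])
    then show "c \<in> induced Y f ` homology_deg X k" using z' by (auto simp: vhom_deg[OF X])
  qed
  have scale: "induced Y f (hscale X b c) = hscale Y b (induced Y f c)"
    if b: "b \<in> scalars \<kappa>" and "c \<in> carrier (homology X)" for b c
  proof -
    obtain z where "z \<in> S" "c = hclass X (vnth z)" using \<open>c \<in> _\<close> by (auto simp: vhom_carrier[OF X])
    then show ?thesis using b by (simp add: vhscale[OF X] vhscale[OF Y] ind FS Fa x(7))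
  qed
  show ?thesis
    unfolding induces_homology_iso_def
    using vcplx_complex[OF X] vcplx_complex[OF Y] chain iso deg scale by blast
qed

section \<open>Translation of the structures into vectors\<close>

definition vof :: "('i \<Rightarrow> nov) \<Rightarrow> 'i vec" where
  "vof f = (if cvg f then Vec f else 0)"

lemma vnth_vof [simp]: "cvg f \<Longrightarrow> vnth (vof f) = f"
  by (simp add: vof_def Vec_inverse)

lemma completed_cvg: "x \<in> completed \<kappa> X \<Longrightarrow> cvg x"
  by (simp add: completed_def cvg_def)

lemma completed_vof:
  assumes "x \<in> completed \<kappa> X"
  shows "vnth (vof x) = x" "supv X (vof x)" "\<kappa> = Filtered \<Longrightarrow> vge 0 (vof x)"
proof -
  show v: "vnth (vof x) = x" using completed_cvg[OF assms] by simp
  show "supv X (vof x)" unfolding supv_def v using assms by (auto simp: completed_def)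
  show "\<kappa> = Filtered \<Longrightarrow> vge 0 (vof x)" unfolding vge_def v using assms by (auto simp: completed_def)
qed

lemma vnth_completed: "supv X x \<Longrightarrow> (\<kappa> = Filtered \<longrightarrow> vge 0 x) \<Longrightarrow> vnth x \<in> completed \<kappa> X"
  using cvg_vnth[of x] by (cases \<kappa>) (auto simp: completed_def supv_def cvg_def vge_def)

text \<open>Agreement with R is asked on the rows in X, outside of which x vanishes; the given
  families may be arbitrary off the basis.\<close>

lemma lin_vec:
  assumes R: "bdd R" and x: "supv X x" and e: "\<And>i j. i \<in> X \<Longrightarrow> D i j = R i $ j"
  shows "lin D (vnth x) = vnth (app R x)"
proof
  fix j
  have "(\<lambda>i. x $ i * D i j) = (\<lambda>i. x $ i * R i $ j)"
  proof
    fix i show "x $ i * D i j = x $ i * R i $ j" using x e by (cases "x $ i = 0") (auto simp: supv_def)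
  qed
  then show "lin D (vnth x) j = app R x $ j" by (simp add: lin_def vnth_app[OF R])
qed

lemma homogeneous_par: "homogeneous d k (vnth x) \<Longrightarrow> par d k x"
  unfolding par_def
proof (intro allI impI)
  fix i assume h: "homogeneous d k (vnth x)" and "x $ i \<noteq> 0"
  then obtain p where "coeff (x $ i) p \<noteq> 0" by (metis nov_eqI zero_nov.rep_eq)
  then have "d i + 2 * snd p = k" using h unfolding homogeneous_def by blast
  then show "even (d i - k)" by presburger
qed

lemma push_nth:
  assumes "\<And>y. kron (f y) j = kron y i * k"
  shows "app (\<lambda>y. unitv (f y)) x $ j = x $ i * k"
  unfolding vnth_app[OF bdd_unitv] vnth_unitv assms
  by (subst nov_sum_single[of i]) (auto simp: kron_def)

text \<open>Outside the words in the basis the given families are arbitrary; their translations vanish there.\<close>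

definition va :: "'a ainf \<Rightarrow> 'a valg" where
  "va A = \<lparr>ad = sdeg A, am = (\<lambda>w. if w \<in> lists (basis A) then vof (mop A w) else 0), aX = basis A\<rparr>"

lemma va_sel [simp]: "ad (va A) = sdeg A" "aX (va A) = basis A"
  "am (va A) w = (if w \<in> lists (basis A) then vof (mop A w) else 0)"
  by (simp_all add: va_def)

lemma filtered_ainfD:
  assumes "filtered_ainf A" "w \<in> lists (basis A)"
  shows "mop A w \<in> completed Filtered (basis A)" "homogeneous (sdeg A) (wdeg A w + 1) (mop A w)" "cvg (mop A w)"
  using assms completed_cvg unfolding filtered_ainf_def by blast+

lemma vge_va: "filtered_ainf A \<Longrightarrow> vge 0 (am (va A) w)"
  by (cases "w \<in> lists (basis A)")
    (simp_all add: completed_vof(3)[OF filtered_ainfD(1)] del: in_lists_conv_set)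

lemma bar_d_va:
  assumes A: "filtered_ainf A" and w: "w \<in> lists (basis A)"
  shows "bar_d A w y = abar (va A) w $ y"
  unfolding bar_d_ssum abar_def bar_def vnth_ssum va_sel(1)
proof (intro ssum_cong)
  fix p x a q assume "p @ x = w" "a @ q = x"
  then have a: "a \<in> lists (basis A)" using w by auto
  show "ksign (wdeg A p) * nov_sum (\<lambda>b. mop A a b * kron (p @ b # q) y) =
    (ksign (wd (sdeg A) p) *v app (\<lambda>y. unitv (p @ y # q)) (am (va A) a)) $ y"
    using a filtered_ainfD(3)[OF A a] by (simp add: vnth_app vnth_unitv wdeg_wd)
qed

lemma alg_va: assumes A: "filtered_ainf A" shows "alg (va A)"
proof -
  have vg: "vge 0 (am (va A) w)" for w by (rule vge_va[OF A])
  have pa: "par (sdeg A) (wd (sdeg A) w + 1) (am (va A) w)" for w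
    by (cases "w \<in> lists (basis A)")
      (use filtered_ainfD(2,3)[OF A, of w] in \<open>simp_all add: wdeg_wd homogeneous_par del: in_lists_conv_set\<close>)
  have su: "supv (basis A) (am (va A) w)" for w
    by (cases "w \<in> lists (basis A)")
      (simp_all add: completed_vof(2)[OF filtered_ainfD(1)[OF A]] del: in_lists_conv_set)
  have b: "bdd (abar (va A))" unfolding abar_def by (rule bddI[of 0]) (rule vge_bar[OF vg])
  have sb: "supv (lists (basis A)) (abar (va A) w)" if w: "w \<in> lists (basis A)" for w
    unfolding abar_def bar_def
  proof (intro supv_ssum supv_scale)
    fix a x b c assume "a @ x = w" "b @ c = x"
    then show "supv (lists (basis A)) (app (\<lambda>y. unitv (a @ y # c)) (am (va A) b))"
      using w by (intro supv_push[OF su]) auto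
  qed
  have "app (abar (va A)) (abar (va A) w) = 0" if w: "w \<in> lists (basis A)" for w
  proof -
    \<comment> \<open>The axiom for all chains is tested on unit vectors, which gives the identity
      row by row.\<close>
    have "lin (bar_d A) (vnth (unitv w)) = vnth (app (abar (va A)) (unitv w))"
      by (rule lin_vec[OF b, of "lists (basis A)"]) (simp_all add: w bar_d_va[OF A] del: in_lists_conv_set)
    then have "lin (bar_d A) (lin (bar_d A) (vnth (unitv w))) = lin (bar_d A) (vnth (abar (va A) w))"
      by (simp add: b)
    also have "\<dots> = vnth (app (abar (va A)) (abar (va A) w))"
      by (rule lin_vec[OF b sb[OF w]]) (rule bar_d_va[OF A])
    finally have "vnth (app (abar (va A)) (abar (va A) w)) = lin (bar_d A) (lin (bar_d A) (vnth (unitv w)))" ..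
    also have "\<dots> = (\<lambda>_. 0)"
    proof -
      have "vnth (unitv w) \<in> completed Filtered (lists (basis A))"
        by (rule vnth_completed) (simp_all add: w del: in_lists_conv_set)
      then show ?thesis using A unfolding filtered_ainf_def by blast
    qed
    finally show ?thesis by (intro vec_eqI) simp
  qed
  then show ?thesis using vg pa su unfolding alg_def by simp
qed

section \<open>Translation of bimodule operations and homomorphisms\<close>

definition vphi :: "'a ainf \<Rightarrow> 'b ainf \<Rightarrow> ('v, 'z) gmod_scheme \<Rightarrow> ('a, 'v, 'b, 'u) bi_family \<Rightarrow>
    'a list \<times> 'v \<times> 'b list \<Rightarrow> 'u vec" where
  "vphi A1 A0 M \<phi> = (\<lambda>(u, v, w). if (u, v, w) \<in> bi_basis A1 A0 M then vof (\<phi> u v w) else 0)"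

definition vb :: "'a ainf \<Rightarrow> 'b ainf \<Rightarrow> ('a, 'v, 'b) bimod \<Rightarrow> ('a, 'v, 'b) vbim" where
  "vb A1 A0 M = \<lparr>bv = sdeg M, bn = vphi A1 A0 M (nop M), bV = basis M\<rparr>"

lemma vb_sel [simp]: "bv (vb A1 A0 M) = sdeg M" "bn (vb A1 A0 M) = vphi A1 A0 M (nop M)" "bV (vb A1 A0 M) = basis M"
  by (simp_all add: vb_def)

lemma tbas_vb: "tbas (va A1) (va A0) (vb A1 A0 M) = bi_basis A1 A0 M"
  by (simp add: tbas_def bi_basis_def)

text \<open>One predicate for operations (s = 1, c = 0), filtered homomorphisms (s = 0, c = 0) and
  weakly filtered ones (s = 0, c at most 0), so that all of them are translated at once.\<close>

definition okfam :: "'a ainf \<Rightarrow> 'b ainf \<Rightarrow> ('v, 'z) gmod_scheme \<Rightarrow> ('u, 'y) gmod_scheme \<Rightarrow> int \<Rightarrow> real \<Rightarrow>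
    ('a, 'v, 'b, 'u) bi_family \<Rightarrow> bool" where
  "okfam A1 A0 M N s c \<phi> \<longleftrightarrow> (\<forall>(u, v, w)\<in>bi_basis A1 A0 M.
     \<phi> u v w \<in> completed Weakly_filtered (basis N) \<and> (\<forall>b. \<phi> u v w b \<in> energy_ge c) \<and>
     homogeneous (sdeg N) (wdeg A1 u + sdeg M v + wdeg A0 w + s) (\<phi> u v w))"

lemma okfamD:
  assumes "okfam A1 A0 M N s c \<phi>" "(u, v, w) \<in> bi_basis A1 A0 M"
  shows "\<phi> u v w \<in> completed Weakly_filtered (basis N)" "\<phi> u v w b \<in> energy_ge c"
    "homogeneous (sdeg N) (wdeg A1 u + sdeg M v + wdeg A0 w + s) (\<phi> u v w)" "cvg (\<phi> u v w)"
    "vnth (vphi A1 A0 M \<phi> (u, v, w)) = \<phi> u v w"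
proof -
  show 1: "\<phi> u v w \<in> completed Weakly_filtered (basis N)" and "\<phi> u v w b \<in> energy_ge c"
    and "homogeneous (sdeg N) (wdeg A1 u + sdeg M v + wdeg A0 w + s) (\<phi> u v w)"
    using assms unfolding okfam_def by blast+
  show "cvg (\<phi> u v w)" by (rule completed_cvg[OF 1])
  then show "vnth (vphi A1 A0 M \<phi> (u, v, w)) = \<phi> u v w" using assms(2) by (simp add: vphi_def)
qed

lemma vphi_off: "t \<notin> bi_basis A1 A0 M \<Longrightarrow> vphi A1 A0 M \<phi> t = 0"
  by (cases t) (simp add: vphi_def)

lemma vge_vphi:
  assumes f: "okfam A1 A0 M N s c \<phi>" shows "vge c (vphi A1 A0 M \<phi> t)"
proof (cases "t \<in> bi_basis A1 A0 M")
  case True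
  obtain u v w where t: "t = (u, v, w)" by (cases t)
  show ?thesis unfolding vge_def t okfamD(5)[OF f True[unfolded t]]
    using okfamD(2)[OF f True[unfolded t]] by blast
qed (simp add: vphi_off)

lemma fam_vphi:
  assumes f: "okfam A1 A0 M N s c \<phi>"
  shows "fam (va A1) (va A0) (sdeg M) (sdeg N) (basis N) s (vphi A1 A0 M \<phi>)"
  unfolding fam_def
proof (intro conjI allI)
  show "bdd (vphi A1 A0 M \<phi>)" by (rule bddI) (rule vge_vphi[OF f])
  fix t
  show "par (sdeg N) (tdeg (va A1) (va A0) (sdeg M) t + s) (vphi A1 A0 M \<phi> t)"
  proof (cases "t \<in> bi_basis A1 A0 M")
    case True
    obtain u v w where t: "t = (u, v, w)" by (cases t)
    show ?thesis
      using okfamD(3)[OF f True[unfolded t]] okfamD(5)[OF f True[unfolded t]]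
      by (intro homogeneous_par) (simp add: t tdeg_def wdeg_wd)
  qed (simp add: vphi_off)
  show "supv (basis N) (vphi A1 A0 M \<phi> t)"
  proof (cases "t \<in> bi_basis A1 A0 M")
    case True
    obtain u v w where t: "t = (u, v, w)" by (cases t)
    show ?thesis
      using completed_vof(2)[OF okfamD(1)[OF f True[unfolded t]]] True by (simp add: t vphi_def)
  qed (simp add: vphi_off)
qed

lemma okfam_nop:
  assumes "filtered_bimod A1 A0 M" shows "okfam A1 A0 M M 1 0 (nop M)"
  unfolding okfam_def
proof (clarify, intro conjI allI)
  fix u v w b assume "(u, v, w) \<in> bi_basis A1 A0 M"
  with assms have *: "nop M u v w \<in> completed Filtered (basis M)"
    "homogeneous (sdeg M) (wdeg A1 u + sdeg M v + wdeg A0 w + 1) (nop M u v w)"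
    unfolding filtered_bimod_def by blast+
  then show "nop M u v w \<in> completed Weakly_filtered (basis M)" "nop M u v w b \<in> energy_ge 0"
    "homogeneous (sdeg M) (wdeg A1 u + sdeg M v + wdeg A0 w + 1) (nop M u v w)"
    by (auto simp: completed_def)
qed

lemma bimod_d_va:
  assumes A: "filtered_ainf A1" "filtered_ainf A0" and f: "okfam A1 A0 M M 1 0 (nop M)"
    and t: "t \<in> bi_basis A1 A0 M"
  shows "bimod_d A1 A0 M t q = tD (va A1) (va A0) (vb A1 A0 M) t $ q"
proof -
  obtain u v w where t': "t = (u, v, w)" by (cases t)
  obtain u' v' w' where q: "q = (u', v', w')" by (cases q)
  have uw: "u \<in> lists (basis A1)" "w \<in> lists (basis A0)" "v \<in> basis M" using t by (auto simp: t' bi_basis_def)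
  have 1: "app (\<lambda>x. unitv (x, v, w)) (abar (va A1) u) $ q = bar_d A1 u u' * (kron v v' * kron w w')"
    unfolding bar_d_va[OF A(1) uw(1)] by (rule push_nth) (simp add: q kron_def)
  have 2: "app (\<lambda>x. unitv (u, v, x)) (abar (va A0) w) $ q = bar_d A0 w w' * (kron u u' * kron v v')"
    unfolding bar_d_va[OF A(2) uw(2)] by (rule push_nth) (simp add: q kron_def)
  have 3: "bhat 1 (sdeg A1) (vphi A1 A0 M (nop M)) (u, v, w) $ q =
    (\<Sum>i\<le>length u. \<Sum>j\<le>length w. ksign (wdeg A1 (take i u)) *
        kron (take i u) u' * nop M (drop i u) v (take j w) v' * kron (drop j w) w')"
    unfolding bhat.simps vnth_ssum ssum_conv vnth_sum
  proof (intro sum.cong refl)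
    fix i j assume "i \<in> {..length u}" "j \<in> {..length w}"
    have "(drop i u, v, take j w) \<in> bi_basis A1 A0 M"
      using uw by (auto simp: bi_basis_def dest: in_set_takeD in_set_dropD)
    from okfamD(5)[OF f this]
    have "app (\<lambda>y. unitv (take i u, y, drop j w)) (vphi A1 A0 M (nop M) (drop i u, v, take j w)) $ q =
      nop M (drop i u) v (take j w) v' * (kron (take i u) u' * kron (drop j w) w')"
      by (subst push_nth[where i = v' and k = "kron (take i u) u' * kron (drop j w) w'"]) (simp_all add: q kron_def)
    then show "(ksign (1 * wd (sdeg A1) (take i u)) *v app (\<lambda>y. unitv (take i u, y, drop j w))
        (vphi A1 A0 M (nop M) (drop i u, v, take j w))) $ q =
      ksign (wdeg A1 (take i u)) * kron (take i u) u' * nop M (drop i u) v (take j w) v' * kron (drop j w) w'"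
      by (simp add: wdeg_wd mult_ac)
  qed
  show ?thesis unfolding t' q bimod_d.simps tD_def tB_simps va_sel vb_sel vnth_add vnth_scale
    1[unfolded q] 2[unfolded q] 3[unfolded q] by (simp add: wdeg_wd mult_ac add_ac)
qed

lemma bim_vb:
  assumes A: "filtered_ainf A1" "filtered_ainf A0" and M: "filtered_bimod A1 A0 M"
  shows "bim (va A1) (va A0) (vb A1 A0 M)"
proof -
  note f = okfam_nop[OF M]
  let ?D = "tD (va A1) (va A0) (vb A1 A0 M)"
  have n: "vge 0 (bn (vb A1 A0 M) t)" for t using vge_vphi[OF f] by simp
  note b = bdd_tD[where M = "vb A1 A0 M", OF alg_va[OF A(1)] alg_va[OF A(2)] n]
  have fm: "fam (va A1) (va A0) (bv (vb A1 A0 M)) (bv (vb A1 A0 M)) (bV (vb A1 A0 M)) 1 (bn (vb A1 A0 M))"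
    using fam_vphi[OF f] by simp
  have "app ?D (?D t) = 0" if t: "t \<in> tbas (va A1) (va A0) (vb A1 A0 M)" for t
  proof -
    have t': "t \<in> bi_basis A1 A0 M" using t by (simp add: tbas_vb)
    have "lin (bimod_d A1 A0 M) (vnth (unitv t)) = vnth (?D t)"
      using lin_vec[OF b, of "bi_basis A1 A0 M" "unitv t" "bimod_d A1 A0 M"] t' bimod_d_va[OF A f] b by simp
    moreover have "lin (bimod_d A1 A0 M) (vnth (?D t)) = vnth (app ?D (?D t))"
      by (rule lin_vec[OF b, of "bi_basis A1 A0 M"])
        (use supv_tD[OF alg_va[OF A(1)] alg_va[OF A(2)] famD(3)[OF fm] t] bimod_d_va[OF A f] in \<open>simp_all add: tbas_vb\<close>)
    moreover have "vnth (unitv t) \<in> completed Filtered (bi_basis A1 A0 M)"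
      by (rule vnth_completed) (simp_all add: t')
    ultimately have "vnth (app ?D (?D t)) = (\<lambda>_. 0)" using M unfolding filtered_bimod_def by metis
    then show ?thesis by (intro vec_eqI) simp
  qed
  then show ?thesis using n fm unfolding bim_def by blast
qed

definition vh :: "'a ainf \<Rightarrow> ('a, 'b) hom_family \<Rightarrow> 'a list \<Rightarrow> 'b vec" where
  "vh A f w = (if w \<in> lists (basis A) then vof (f w) else 0)"

text \<open>F stands for f if the induced coalgebra maps agree on basis words. This covers
  translated homomorphisms and also \<open>idg\<close> for \<open>id_hom\<close>, which is not cut
  off outside the basis.\<close>

definition hrep :: "'a ainf \<Rightarrow> ('a, 'b) hom_family \<Rightarrow> ('a list \<Rightarrow> 'b vec) \<Rightarrow> bool" where
  "hrep A f F \<longleftrightarrow> good F \<and> (\<forall>w\<in>lists (basis A). \<forall>y. ghat F w $ y = hat f w y)"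

lemma hat_cong: "(\<And>a. set a \<subseteq> set w \<Longrightarrow> f a = g a) \<Longrightarrow> hat f w y = hat g w y"
proof (induction y arbitrary: w)
  case (Cons b y)
  show ?case unfolding hat.simps
  proof (intro sum.cong refl)
    fix i
    have s: "set (take i w) \<subseteq> set w" "set (drop i w) \<subseteq> set w" by (auto dest: in_set_takeD in_set_dropD)
    have "hat f (drop i w) y = hat g (drop i w) y"
      by (rule Cons.IH) (use s(2) Cons.prems in blast)
    then show "f (take i w) b * hat f (drop i w) y = g (take i w) b * hat g (drop i w) y"
      using Cons.prems[OF s(1)] by simp
  qed
qed simp

lemma hrepI:
  assumes "good F" "\<And>w. w \<in> lists (basis A) \<Longrightarrow> vnth (F w) = f w"
  shows "hrep A f F"
  unfolding hrep_def
proof (intro conjI ballI allI)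
  fix w y assume w: "w \<in> lists (basis A)"
  show "ghat F w $ y = hat f w y"
    unfolding vnth_ghat[OF assms(1)] by (rule hat_cong) (use w assms(2) in auto)
qed (rule assms(1))

lemma hrep_id: "hrep A id_hom idg"
  by (rule hrepI[OF good_idg]) (simp add: fun_eq_iff vnth_idg id_hom_def)

lemma filtered_homD:
  assumes "filtered_hom A B f" "w \<in> lists (basis A)"
  shows "f w \<in> completed Filtered (basis B)" "homogeneous (sdeg B) (wdeg A w) (f w)" "cvg (f w)"
    "vnth (vh A f w) = f w"
proof -
  show "f w \<in> completed Filtered (basis B)" "homogeneous (sdeg B) (wdeg A w) (f w)" "cvg (f w)"
    using assms completed_cvg unfolding filtered_hom_def by blast+
  then show "vnth (vh A f w) = f w" using assms(2) by (simp add: vh_def)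
qed

lemma good_vh: assumes f: "filtered_hom A B f" shows "good (vh A f)"
proof -
  obtain \<epsilon> where e: "\<epsilon> > 0" "\<And>b. f [] b \<in> energy_ge \<epsilon>" using f unfolding filtered_hom_def by blast
  have "vge 0 (vh A f w)" for w
    using completed_vof(3)[OF filtered_homD(1)[OF f]] by (simp add: vh_def)
  moreover have "vge \<epsilon> (vh A f [])" unfolding vge_def using e(2) filtered_homD(4)[OF f, of "[]"] by simp
  ultimately show ?thesis using e(1) unfolding good_def by blast
qed

lemma hrep_vh: "filtered_hom A B f \<Longrightarrow> hrep A f (vh A f)"
  by (rule hrepI) (auto intro: good_vh simp: filtered_homD(4))

lemma lin_hat:
  assumes "hrep A f F" "supv (lists (basis A)) x" shows "lin (hat f) (vnth x) = vnth (app (ghat F) x)"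
  by (rule lin_vec[OF bdd_ghat[of F "\<lambda>x. x"] assms(2)]) (use assms(1) in \<open>auto simp: hrep_def\<close>)

lemma ahom_vh:
  assumes A: "filtered_ainf A" "filtered_ainf B" and f: "filtered_hom A B f"
  shows "ahom (va A) (va B) (vh A f)"
proof -
  note g = good_vh[OF f] and hr = hrep_vh[OF f]
  have su: "supv (basis B) (vh A f w)" for w
    using completed_vof(2)[OF filtered_homD(1)[OF f]] by (simp add: vh_def)
  have pa: "par (sdeg B) (wd (sdeg A) w) (vh A f w)" for w
  proof (cases "w \<in> lists (basis A)")
    case True
    then show ?thesis using filtered_homD(2,4)[OF f True] by (intro homogeneous_par) (simp add: wdeg_wd)
  qed (simp add: vh_def)
  have bl: "lin (bar_d A) (vnth x) = vnth (app (abar (va A)) x)" if "supv (lists (basis A)) x" for x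
    by (rule lin_vec[OF bdd_abar[OF alg_va[OF A(1)], of "\<lambda>x. x"] that]) (rule bar_d_va[OF A(1)])
  have bl': "lin (bar_d B) (vnth x) = vnth (app (abar (va B)) x)" if "supv (lists (basis B)) x" for x
    by (rule lin_vec[OF bdd_abar[OF alg_va[OF A(2)], of "\<lambda>x. x"] that]) (rule bar_d_va[OF A(2)])
  have "app (ghat (vh A f)) (abar (va A) w) = app (abar (va B)) (ghat (vh A f) w)"
    if w: "w \<in> lists (basis A)" for w
  proof -
    have sw: "supv (lists (basis A)) (unitv w)" using w by (simp del: in_lists_conv_set)
    have sg: "supv (lists (basis B)) (ghat (vh A f) w)" by (rule supv_ghat[OF g su w])
    have "lin (hat f) (lin (bar_d A) (vnth (unitv w))) = lin (bar_d B) (lin (hat f) (vnth (unitv w)))"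
      using f vnth_completed[OF sw, of Filtered] unfolding filtered_hom_def by simp
    then have "lin (hat f) (vnth (abar (va A) w)) = lin (bar_d B) (vnth (ghat (vh A f) w))"
      by (simp add: bl[OF sw] lin_hat[OF hr sw] bdd_ghat[OF g, of "\<lambda>x. x"] bdd_abar[OF alg_va[OF A(1)], of "\<lambda>x. x"])
    then show ?thesis using supv_abar[OF alg_va[OF A(1)], of w] w
      by (simp add: lin_hat[OF hr] bl'[OF sg] vnth_inject)
  qed
  then show ?thesis unfolding ahom_def using g pa su by simp
qed

lemma ahom_idg: "alg A \<Longrightarrow> ahom A A idg"
  unfolding ahom_def
proof (intro conjI allI ballI)
  fix w assume A: "alg A"
  show "par (ad A) (wd (ad A) w) (idg w)"
    by (auto simp: idg_def par_def vnth_unitv kron_def split: list.splits)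
  have g: "ghat idg = unitv" by (rule ext) (rule ghat_idg)
  show "app (ghat idg) (abar A w) = app (abar A) (ghat idg w)"
    unfolding g using bdd_abar[OF A, of "\<lambda>x. x"] by (simp add: app_unitv_row)
qed (auto simp: good_idg idg_def split: list.splits)

lemma bi_hat_va:
  assumes f1: "hrep A1 f1 F1" and f0: "hrep A0 f0 F0" and p: "okfam A1 A0 M N 0 c \<phi>"
    and t: "t \<in> bi_basis A1 A0 M"
  shows "bi_hat f1 f0 \<phi> t q = app (Gh F1 F0) (bhat 0 d (vphi A1 A0 M \<phi>) t) $ q"
proof -
  obtain u v w where t': "t = (u, v, w)" by (cases t)
  obtain u' v' w' where q: "q = (u', v', w')" by (cases q)
  have uw: "u \<in> lists (basis A1)" "w \<in> lists (basis A0)" "v \<in> basis M" using t by (auto simp: t' bi_basis_def)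
  have g: "good F1" "good F0" using f1 f0 by (auto simp: hrep_def)
  note bG = bdd_Gh'[OF g]
  have G: "Gh F1 F0 (a, y, e) $ q = ghat F1 a $ u' * (ghat F0 e $ w' * kron y v')" for a y e
  proof -
    have "app (\<lambda>z. unitv (x, y, z)) (ghat F0 e) $ q = ghat F0 e $ w' * (kron x u' * kron y v')" for x
      by (rule push_nth) (simp add: q kron_def)
    then have "Gh F1 F0 (a, y, e) $ q = nov_sum (\<lambda>x. ghat F1 a $ x * (ghat F0 e $ w' * (kron x u' * kron y v')))"
      by (simp add: vnth_app)
    also have "\<dots> = ghat F1 a $ u' * (ghat F0 e $ w' * kron y v')"
      by (subst nov_sum_single[of u']) (auto simp: kron_def)
    finally show ?thesis .
  qed
  have "app (Gh F1 F0) (bhat 0 d (vphi A1 A0 M \<phi>) t) $ q =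
    (\<Sum>i\<le>length u. \<Sum>j\<le>length w. app (\<lambda>y. Gh F1 F0 (take i u, y, drop j w)) (vphi A1 A0 M \<phi> (drop i u, v, take j w)) $ q)"
    unfolding t' bhat.simps app_ssum[OF bG] app_scale[OF bG] app_push[OF bG] vnth_ssum
    by (simp add: ssum_conv vnth_sum del: Gh.simps)
  also have "\<dots> = (\<Sum>i\<le>length u. \<Sum>j\<le>length w.
        hat f1 (take i u) u' * \<phi> (drop i u) v (take j w) v' * hat f0 (drop j w) w')"
  proof (intro sum.cong refl)
    fix i j
    have i: "take i u \<in> lists (basis A1)" "drop j w \<in> lists (basis A0)"
      "(drop i u, v, take j w) \<in> bi_basis A1 A0 M"
      using uw by (auto simp: bi_basis_def dest: in_set_takeD in_set_dropD)
    have h: "ghat F1 (take i u) $ u' = hat f1 (take i u) u'" "ghat F0 (drop j w) $ w' = hat f0 (drop j w) w'"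
      using f1 f0 i(1,2) unfolding hrep_def by blast+
    have b: "bdd (\<lambda>y. Gh F1 F0 (take i u, y, drop j w))" by (rule bdd_Gh[OF g])
    have "app (\<lambda>y. Gh F1 F0 (take i u, y, drop j w)) (vphi A1 A0 M \<phi> (drop i u, v, take j w)) $ q =
      nov_sum (\<lambda>y. \<phi> (drop i u) v (take j w) y * (hat f1 (take i u) u' * (hat f0 (drop j w) w' * kron y v')))"
      unfolding vnth_app[OF b] G h okfamD(5)[OF p i(3)] ..
    also have "\<dots> = hat f1 (take i u) u' * \<phi> (drop i u) v (take j w) v' * hat f0 (drop j w) w'"
      by (subst nov_sum_single[of v']) (auto simp: kron_def mult_ac)
    finally show "app (\<lambda>y. Gh F1 F0 (take i u, y, drop j w)) (vphi A1 A0 M \<phi> (drop i u, v, take j w)) $ q =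
      hat f1 (take i u) u' * \<phi> (drop i u) v (take j w) v' * hat f0 (drop j w) w'" .
  qed
  finally show ?thesis by (simp add: t' q)
qed

section \<open>The two complexes as images of idempotents on words\<close>

text \<open>A module with prescribed shifted degrees, which lets \<open>hoch_wrap\<close> and the
  symmetrization identities be used for arbitrary families of vectors.\<close>

definition gm :: "('v \<Rightarrow> int) \<Rightarrow> 'v gmod" where
  "gm dv = \<lparr>basis = UNIV, gdeg = \<lambda>v. dv v + 1\<rparr>"

lemma sdeg_gm [simp]: "sdeg (gm dv) = dv" by (rule ext) (simp add: gm_def sdeg_def)

lemma Wr_hoch:
  fixes A :: "'a ainf" and \<alpha> :: "'a list \<times> 'v \<times> 'a list \<Rightarrow> 'u vec"
  shows "Wr (va A) dv \<alpha> (v, w) $ (v', w') = hoch_wrap A (gm dv) (\<lambda>u v w. vnth (\<alpha> (u, v, w))) (v, w) (v', w')"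
  unfolding hoch_wrap_ssum Wr.simps vnth_ssum va_sel sdeg_gm wdeg_wd
proof (intro ssum_cong)
  fix x l r z :: "'a list"
  have "app (\<lambda>y. unitv (y, z)) (\<alpha> (l, v, r)) $ (v', w') = \<alpha> (l, v, r) $ v' * kron z w'"
    by (rule push_nth) (simp add: kron_def)
  then show "(ksign (wd (sdeg A) l * (dv v + wd (sdeg A) x)) *v app (\<lambda>y. unitv (y, z)) (\<alpha> (l, v, r))) $ (v', w') =
    ksign (wd (sdeg A) l * (dv v + wd (sdeg A) x)) * \<alpha> (l, v, r) $ v' * kron z w'"
    by (simp add: mult.assoc)
qed

lemma hoch_wrap_Wr:
  assumes "\<And>l r. l @ r \<in> lists (basis A) \<Longrightarrow> vnth (\<alpha> (l, v, r)) = \<phi> l v r" "w \<in> lists (basis A)"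
  shows "hoch_wrap A M \<phi> (v, w) q = Wr (va A) (sdeg M) \<alpha> (v, w) $ q"
proof -
  obtain v' w' where q: "q = (v', w')" by (cases q)
  show ?thesis unfolding q Wr_hoch hoch_wrap_ssum sdeg_gm
  proof (intro ssum_cong)
    fix x l r z assume "x @ l = w" "r @ z = x"
    then have "vnth (\<alpha> (l, v, r)) = \<phi> l v r" using assms by (intro assms(1)) auto
    then show "ksign (wdeg A l * (sdeg M v + wdeg A x)) * \<phi> l v r v' * kron z w' =
      ksign (wdeg A l * (sdeg M v + wdeg A x)) * \<alpha> (l, v, r) $ v' * kron z w'" by simp
  qed
qed

text \<open>Translation back from vectors. It makes \<open>hoch_d\<close> and \<open>ce_d\<close>
  available for pull-backs, which arise only in vector form.\<close>

definition tobi :: "('a, 'v, 'b) vbim \<Rightarrow> ('a, 'v, 'b) bimod" where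
  "tobi M = \<lparr>basis = bV M, gdeg = \<lambda>v. bv M v + 1, nop = \<lambda>u v w. vnth (bn M (u, v, w))\<rparr>"

lemma tobi_sel [simp]: "sdeg (tobi M) = bv M" "nop (tobi M) = (\<lambda>u v w. vnth (bn M (u, v, w)))"
  by (auto simp: tobi_def sdeg_def)

lemma hD_hoch:
  assumes A: "filtered_ainf A" and w: "w \<in> lists (basis A)"
  shows "hD (va A) M (v, w) $ q = hoch_d A (tobi M) (v, w) q"
proof -
  obtain v' w' where q: "q = (v', w')" by (cases q)
  have 1: "app (\<lambda>x. unitv (v, x)) (abar (va A) w) $ (v', w') = bar_d A w w' * kron v v'"
    unfolding bar_d_va[OF A w] by (rule push_nth) (simp add: kron_def)
  have 2: "hoch_wrap A (tobi M) (nop (tobi M)) (v, w) (v', w') = Wr (va A) (bv M) (bn M) (v, w) $ (v', w')"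
    using hoch_wrap_Wr[where \<alpha> = "bn M" and \<phi> = "nop (tobi M)" and M = "tobi M" and q = "(v', w')", OF _ w] by simp
  show ?thesis unfolding q hoch_d.simps 2 hD_def Wb.simps vnth_add vnth_scale 1 by (simp add: mult_ac)
qed

lemma hoch_d_hD:
  assumes A: "filtered_ainf A" and q: "q \<in> basis M \<times> lists (basis A)"
    and ok: "okfam A A M M 1 0 (nop M)"
  shows "hoch_d A M q p = hD (va A) (vb A A M) q $ p"
proof -
  obtain v w where q': "q = (v, w)" "v \<in> basis M" "w \<in> lists (basis A)" using q by auto
  obtain v' w' where p: "p = (v', w')" by (cases p)
  have "hoch_wrap A M (nop M) (v, w) (v', w') = Wr (va A) (sdeg M) (vphi A A M (nop M)) (v, w) $ (v', w')"
    by (rule hoch_wrap_Wr[OF _ q'(3)], rule okfamD(5)[OF ok]) (use q'(2) in \<open>simp add: bi_basis_def\<close>)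
  also have "\<dots> = hoch_wrap A (tobi (vb A A M)) (nop (tobi (vb A A M))) (v, w) (v', w')"
    using hoch_wrap_Wr[where \<alpha> = "vphi A A M (nop M)" and \<phi> = "nop (tobi (vb A A M))" and M = "tobi (vb A A M)" and v = v
        and q = "(v', w')", OF _ q'(3)] by simp
  finally show ?thesis unfolding q'(1) p hD_hoch[OF A q'(3)] hoch_d.simps by (simp only: tobi_sel(1) vb_sel(1))
qed

lemma mok_filtered:
  assumes A: "filtered_ainf A" and w: "w \<in> lists (basis A)" shows "mok A w"
  unfolding mok_def
proof (intro allI impI conjI)
  fix a assume "set a \<subseteq> set w"
  then have a: "a \<in> lists (basis A)" using w by auto
  show "cvg (mop A a)" by (rule filtered_ainfD(3)[OF A a])
  fix b assume nz: "mop A a b \<noteq> 0"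
  have "par (sdeg A) (wdeg A a + 1) (vof (mop A a))"
    using filtered_ainfD(2,3)[OF A a] by (intro homogeneous_par) simp
  then show "even (sdeg A b - (wd (sdeg A) a + 1))"
    using nz filtered_ainfD(3)[OF A a] by (simp add: par_def wdeg_wd)
qed

section \<open>The idempotents that cut out the two complexes\<close>

definition Qh :: "'a ainf \<Rightarrow> 'a list \<Rightarrow> 'a list vec" where
  "Qh A w = (if w \<in> lists (basis A) then unitv w else 0)"

text \<open>The factor 1/k! makes the signed sum over all orders idempotent; the same factor appears
  in \<open>ce_lin\<close>.\<close>

definition Qs :: "'a ainf \<Rightarrow> 'a list \<Rightarrow> 'a list vec" where
  "Qs A w = (if w \<in> lists (basis A) then nov_const (1 / fact (length w)) *v
     (\<Sum>\<tau>\<in>perms (length w). koszul A \<tau> w *v unitv (permute_list \<tau> w)) else 0)"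

lemma lists_permute: "\<tau> \<in> perms (length w) \<Longrightarrow> permute_list \<tau> w \<in> lists X \<longleftrightarrow> w \<in> lists X"
  unfolding in_lists_conv_set set_permute ..

lemma lists_mset: "mset y = mset w \<Longrightarrow> y \<in> lists X \<longleftrightarrow> w \<in> lists X"
  unfolding in_lists_conv_set by (metis set_mset_mset)

lemma card_perms: "card (perms n) = fact n"
  unfolding perms_def using card_permutations[of "{..<n}" n] by simp

lemma koszul_energy: "koszul A \<tau> w \<in> energy_ge 0"
  unfolding koszul_def by (rule energy_ge_prod) (auto split: prod.splits)

lemma koszul_ksign: "\<exists>s. koszul A \<tau> w = ksign s"
proof -
  have "{(i, j). i < j \<and> j < length w \<and> \<tau> j < \<tau> i} \<subseteq> {..<length w} \<times> {..<length w}" by force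
  then have f: "finite {(i, j). i < j \<and> j < length w \<and> \<tau> j < \<tau> i}"
    by (rule finite_subset) simp
  have "koszul A \<tau> w = (\<Prod>p\<in>{(i, j). i < j \<and> j < length w \<and> \<tau> j < \<tau> i}.
      ksign (sdeg A (w ! \<tau> (fst p)) * sdeg A (w ! \<tau> (snd p))))"
    unfolding koszul_def by (rule prod.cong) auto
  then show ?thesis unfolding ksign_prod[OF f] by blast
qed

lemma Qs_nth: "Qs A w $ y = (if w \<in> lists (basis A) then nov_const (1 / fact (length w)) * sym_word A w y else 0)"
  by (simp add: Qs_def vnth_sum vnth_unitv sym_word_def)

lemma Qs_app:
  assumes "bdd R" "w \<in> lists (basis A)"
  shows "app R (Qs A w) $ q = nov_const (1 / fact (length w)) * symsum (sdeg A) w (\<lambda>y. R y $ q)"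
  using assms(2) by (simp add: Qs_def app_scale[OF assms(1)] app_sum[OF assms(1)] vnth_sum assms(1) sum_perms[where G = "\<lambda>y. R y $ q"] del: in_lists_conv_set)

lemma Qs_permute:
  assumes t: "\<tau> \<in> perms (length w)" shows "Qs A (permute_list \<tau> w) = koszul A \<tau> w *v Qs A w"
proof (rule vec_eqI)
  fix y show "Qs A (permute_list \<tau> w) $ y = (koszul A \<tau> w *v Qs A w) $ y"
    by (simp add: Qs_nth lists_permute[OF t] sym_word_symsum symsum_permute[OF t] mult_ac del: in_lists_conv_set)
qed

lemma fact_const: "nov_const (1 / fact n) * of_nat (fact n) = 1"
  using nov_const_inverse_of_nat[of "fact n"] by simp

text \<open>All k! terms of the sum equal x w because Koszul signs square to 1.\<close>

lemma symsum_fixed: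
  assumes "\<And>\<tau>. \<tau> \<in> perms (length w) \<Longrightarrow> x (permute_list \<tau> w) = koszul A \<tau> w * x w"
  shows "nov_const (1 / fact (length w)) * symsum (sdeg A) w x = x w"
proof -
  have "symsum (sdeg A) w x = (\<Sum>\<tau>\<in>perms (length w). koszul A \<tau> w * x (permute_list \<tau> w))"
    by (rule sum_perms[symmetric])
  also have "\<dots> = (\<Sum>\<tau>\<in>perms (length w). x w)"
    by (rule sum.cong[OF refl]) (simp add: assms mult.assoc[symmetric] koszul_sq)
  also have "\<dots> = of_nat (fact (length w)) * x w" by (simp add: card_perms)
  finally have "nov_const (1 / fact (length w)) * symsum (sdeg A) w x =
      (nov_const (1 / fact (length w)) * of_nat (fact (length w))) * x w" by (simp only: mult.assoc)
  then show ?thesis unfolding fact_const by simp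
qed

lemma bddQs: "vge 0 (Qs A w)"
  unfolding Qs_def by (auto intro!: vge_scale vge_sum koszul_energy)

lemma wproj_Qh: "wproj (va A) (Qh A)"
proof -
  have "bdd (Qh A)" by (rule bddI[of 0]) (simp add: Qh_def del: in_lists_conv_set)
  then show ?thesis unfolding wproj_def by (auto simp: Qh_def vnth_unitv kron_def split: if_splits simp del: in_lists_conv_set)
qed

lemma wproj_Qs: "wproj (va A) (Qs A)"
  unfolding wproj_def
proof (intro conjI allI impI)
  fix w x
  show "vge 0 (Qs A w)" by (rule bddQs)
  have b: "bdd (Qs A)" by (rule bddI) (rule bddQs)
  show "supv (lists (aX (va A))) (Qs A w)"
  proof (cases "w \<in> lists (basis A)")
    case True
    have "\<tau> \<in> perms (length w) \<Longrightarrow> supv (lists (basis A)) (unitv (permute_list \<tau> w))" for \<tau>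
      unfolding supv_unitv using lists_permute True by blast
    then show ?thesis using True unfolding supv_def by (simp add: Qs_def vnth_sum del: in_lists_conv_set)
       (metis (no_types, lifting) mult_zero_right sum.not_neutral_contains_not_neutral)
  qed (simp add: Qs_def del: in_lists_conv_set)
  show "length x = length w" if nz: "Qs A w $ x \<noteq> 0"
  proof -
    have "sym_word A w x \<noteq> 0" using nz by (auto simp: Qs_nth split: if_splits)
    then obtain \<tau> where "kron (permute_list \<tau> w) x \<noteq> 0"
      unfolding sym_word_def by (metis (no_types, lifting) mult_zero_right sum.not_neutral_contains_not_neutral)
    then show ?thesis by (auto simp: kron_def split: if_splits)
  qed
  show "app (Qs A) (Qs A w) = Qs A w"
  proof (cases "w \<in> lists (basis A)")
    case True
    show ?thesis
    proof (rule vec_eqI)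
      fix q
      have "nov_const (1 / fact (length w)) * symsum (sdeg A) w (\<lambda>y. Qs A y $ q) = Qs A w $ q"
        by (rule symsum_fixed) (simp add: Qs_permute)
      then show "app (Qs A) (Qs A w) $ q = Qs A w $ q" by (simp only: Qs_app[OF b True])
    qed
  qed (simp add: Qs_def del: in_lists_conv_set)
qed

lemma pj_Qs_app:
  assumes "bdd R" "w \<in> lists (basis A)" "v \<in> V"
  shows "app R (pj V (Qs A) (v, w)) $ q = nov_const (1 / fact (length w)) * symsum (sdeg A) w (\<lambda>y. R (v, y) $ q)"
  using assms(3) Qs_app[OF bdd_comp[OF assms(1)] assms(2), of "\<lambda>y. (v, y)" q]
  by (simp add: app_push[OF assms(1)] del: in_lists_conv_set)

lemma sum_perms_inv: "(\<Sum>\<tau>\<in>perms n. f (inv_into UNIV \<tau>)) = (\<Sum>\<tau>\<in>perms n. f \<tau>)"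
  unfolding perms_def by (rule sum_permutations_inverse[symmetric])

text \<open>Replacing \<tau> by its inverse exchanges the two words, and on them the two
  permutations have the same sign by \<open>koszul_comp\<close>.\<close>

lemma sym_word_swap: "sym_word A w y = sym_word A y w"
proof (cases "length y = length w")
  case True
  have "sym_word A w y = (\<Sum>\<tau>\<in>perms (length w). koszul A (inv_into UNIV \<tau>) w * kron (permute_list (inv_into UNIV \<tau>) w) y)"
    unfolding sym_word_def by (rule sum_perms_inv[symmetric])
  also have "\<dots> = (\<Sum>\<tau>\<in>perms (length w). koszul A \<tau> y * kron (permute_list \<tau> y) w)"
  proof (rule sum.cong[OF refl])
    fix \<tau> assume t: "\<tau> \<in> perms (length w)"
    then have i: "inv_into UNIV \<tau> \<in> perms (length w)" and b: "\<tau> permutes {..<length w}" by (auto simp: perms_def permutes_inv)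
    have c: "\<tau> \<circ> inv_into UNIV \<tau> = id" "inv_into UNIV \<tau> \<circ> \<tau> = id" using permutes_inv_o[OF b] by auto
    have one: "koszul A id u = 1" for u
      unfolding koszul_def by (rule prod.neutral) auto
    have *: "permute_list (inv_into UNIV \<tau>) w = y \<longleftrightarrow> permute_list \<tau> y = w"
    proof
      assume "permute_list (inv_into UNIV \<tau>) w = y"
      then show "permute_list \<tau> y = w" using permute_comp[OF t, of "inv_into UNIV \<tau>"] by (simp only: c permute_list_id)
    next
      have i': "inv_into UNIV \<tau> \<in> perms (length y)" using i by (simp only: True)
      assume "permute_list \<tau> y = w"
      then show "permute_list (inv_into UNIV \<tau>) w = y" using permute_comp[OF i', of \<tau>] by (simp only: c permute_list_id)
    qed
    show "koszul A (inv_into UNIV \<tau>) w * kron (permute_list (inv_into UNIV \<tau>) w) y = koszul A \<tau> y * kron (permute_list \<tau> y) w"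
    proof (cases "permute_list (inv_into UNIV \<tau>) w = y")
      case eq: True
      have "1 = koszul A (inv_into UNIV \<tau>) w * koszul A \<tau> y"
        using koszul_comp[OF i t, of A] one[of w] unfolding c eq by simp
      then have "koszul A (inv_into UNIV \<tau>) w = koszul A \<tau> y"
        using koszul_sq[of A \<tau> y] by (metis mult.assoc mult.left_neutral mult.right_neutral)
      then show ?thesis using eq * by simp
    qed (use * in \<open>simp add: kron_def\<close>)
  qed
  finally show ?thesis by (simp add: sym_word_def True)
next
  case False
  then have "kron (permute_list \<tau> w) y = 0" "kron (permute_list \<tau> y) w = 0" for \<tau>
    by (auto simp: kron_def)
  then show ?thesis by (simp add: sym_word_def)
qed

text \<open>By \<open>sym_word_swap\<close> the matrix of the projection is symmetric, so it
  averages coefficients in the same way as it averages words.\<close>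

lemma pj_Qs_nth:
  assumes v: "v \<in> V" and y: "y \<in> lists (basis A)"
  shows "app (pj V (Qs A)) x $ (v, y) = nov_const (1 / fact (length y)) * symsum (sdeg A) y (\<lambda>z. x $ (v, z))"
proof -
  define c where "c = nov_const (1 / fact (length y))"
  have t: "x $ q * pj V (Qs A) q $ (v, y) = symsum (sdeg A) y (\<lambda>z. c * x $ (v, z) * kron (v, z) q)" for q
  proof -
    obtain v' w where q: "q = (v', w)" by (cases q)
    have e: "symsum (sdeg A) y (\<lambda>z. c * x $ (v, z) * kron (v, z) q) = c * x $ q * kron v v' * sym_word A w y"
    proof -
      have "symsum (sdeg A) y (\<lambda>z. c * x $ (v, z) * kron (v, z) q) =
          symsum (sdeg A) y (\<lambda>z. (c * x $ q * kron v v') * kron z w)"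
        by (rule symsum_cong) (auto simp: q kron_def)
      then show ?thesis unfolding symsum_mult sym_word_swap[of A w y] sym_word_symsum[of A y w] .
    qed
    show ?thesis
    proof (cases "v' \<in> V \<and> w \<in> lists (basis A)")
      case True
      have "pj V (Qs A) q $ (v, y) = Qs A w $ y * kron v v'"
        using True by (simp add: q del: in_lists_conv_set) (rule push_nth, auto simp: kron_def)
      also have "\<dots> = c * kron v v' * sym_word A w y"
      proof (cases "length w = length y")
        case False
        then have "sym_word A w y = 0" by (auto simp: sym_word_def kron_def intro!: sum.neutral)
        then show ?thesis by (simp add: Qs_nth)
      qed (use True in \<open>simp add: Qs_nth c_def mult_ac del: in_lists_conv_set\<close>)
      finally show ?thesis unfolding e by (simp add: mult_ac)
    next
      case False
      have "kron v v' * sym_word A w y = 0"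
      proof (cases "v = v'")
        case True
        then have w: "w \<notin> lists (basis A)" using False v by simp
        have "sym_word A w y = symsum (sdeg A) y (\<lambda>z. 0 * kron z w)" unfolding sym_word_swap[of A w y] sym_word_symsum[of A y w]
        proof (rule symsum_cong)
          fix z assume "mset z = mset y"
          then have "z \<noteq> w" using w y lists_mset by blast
          then show "kron z w = 0 * kron z w" by (simp add: kron_def)
        qed
        then show ?thesis unfolding symsum_mult by simp
      qed (simp add: kron_def)
      moreover have "pj V (Qs A) q = 0" using False by (auto simp: q Qs_def simp del: in_lists_conv_set)
      ultimately show ?thesis unfolding e by (simp add: mult.assoc)
    qed
  qed
  have k: "nov_sum (\<lambda>q. c * x $ (v, z) * kron (v, z) q) = c * x $ (v, z)" for z
    by (subst nov_sum_single[of "(v, z)"]) (auto simp: kron_def)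
  have "app (pj V (Qs A)) x $ (v, y) = nov_sum (\<lambda>q. symsum (sdeg A) y (\<lambda>z. c * x $ (v, z) * kron (v, z) q))"
    unfolding vnth_app[OF bdd_pj[OF wproj_Qs]] t ..
  also have "\<dots> = symsum (sdeg A) y (\<lambda>z. nov_sum (\<lambda>q. c * x $ (v, z) * kron (v, z) q))"
    by (rule conjunct1[OF nov_sum_symsum]) (intro cvg_multc cvg_kron)
  also have "\<dots> = c * symsum (sdeg A) y (\<lambda>z. x $ (v, z))" unfolding k by (rule symsum_mult)
  finally show ?thesis by (simp add: c_def)
qed

text \<open>Identifies the fixed vectors with the signed-symmetric ones in the definition of
  \<open>ce_chains\<close>: an average is symmetric by \<open>symsum_permute\<close>, and a
  symmetric vector is its own average by \<open>symsum_fixed\<close>.\<close>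

lemma fixed_Qs:
  fixes x :: "('v \<times> 'a list) vec" and A :: "'a ainf"
  shows "app (pj V (Qs A)) x = x \<longleftrightarrow> supv (hS (va A) V) x \<and>
     (\<forall>v w. \<forall>\<tau>\<in>perms (length w). x $ (v, permute_list \<tau> w) = koszul A \<tau> w * x $ (v, w))"
proof safe
  assume x: "app (pj V (Qs A)) x = x"
  show s: "supv (hS (va A) V) x" using chn_supv[OF wproj_Qs, of x False V A] x by (simp add: chn_def)
  fix v and w :: "'a list" and \<tau> assume t: "\<tau> \<in> perms (length w)"
  show "x $ (v, permute_list \<tau> w) = koszul A \<tau> w * x $ (v, w)"
  proof (cases "v \<in> V \<and> w \<in> lists (basis A)")
    case True
    then have "x $ (v, y) = nov_const (1 / fact (length y)) * symsum (sdeg A) y (\<lambda>z. x $ (v, z))"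
      if "y \<in> lists (basis A)" for y
      using pj_Qs_nth[of v V y A x] x that by simp
    from this[of w] this[of "permute_list \<tau> w"] show ?thesis
      using True lists_permute[OF t] by (simp add: symsum_permute[OF t] mult_ac del: in_lists_conv_set)
  next
    case False
    then have "(v, w) \<notin> hS (va A) V" "(v, permute_list \<tau> w) \<notin> hS (va A) V"
      using lists_permute[OF t, of "basis A"] by (auto simp: hS_def simp del: in_lists_conv_set)
    then have "x $ (v, w) = 0" "x $ (v, permute_list \<tau> w) = 0" using s unfolding supv_def by blast+
    then show ?thesis by simp
  qed
next
  assume s: "supv (hS (va A) V) x"
    and p: "\<forall>v w. \<forall>\<tau>\<in>perms (length w). x $ (v, permute_list \<tau> w) = koszul A \<tau> w * x $ (v, w)"
  have s': "supv (hS (va A) V) (app (pj V (Qs A)) x)"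
    by (rule chn_supv[OF wproj_Qs, of _ False]) (simp add: chn_def pj_pj'[OF wproj_Qs])
  show "app (pj V (Qs A)) x = x"
  proof (rule vec_eqI)
    fix q :: "'v \<times> 'a list" obtain v w where q: "q = (v, w)" by (cases q)
    show "app (pj V (Qs A)) x $ q = x $ q"
    proof (cases "q \<in> hS (va A) V")
      case True
      then show ?thesis unfolding q
        by (subst pj_Qs_nth) (use p in \<open>auto simp: hS_def intro!: symsum_fixed[where x = "\<lambda>z. x $ (v, z)"]\<close>)
    next
      case False
      then have "app (pj V (Qs A)) x $ q = 0" "x $ q = 0" using s s' unfolding supv_def by blast+
      then show ?thesis by simp
    qed
  qed
qed

lemma fixed_Qh: "app (pj V (Qh A)) x = x \<longleftrightarrow> supv (hS (va A) V) x"
proof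
  assume "app (pj V (Qh A)) x = x"
  then show "supv (hS (va A) V) x" using chn_supv[OF wproj_Qh, of x False V A] by (simp add: chn_def)
next
  assume "supv (hS (va A) V) x"
  then have "app (pj V (Qh A)) x = app unitv x"
    by (rule app_cong_supv) (auto simp: hS_def Qh_def)
  then show "app (pj V (Qh A)) x = x" by (simp add: app_unitv_row)
qed

lemma hoch_chains: "completed \<kappa> (basis M \<times> lists (basis A)) = vnth ` chn (\<kappa> = Filtered) (basis M) (Qh A)"
proof safe
  fix x assume "x \<in> completed \<kappa> (basis M \<times> lists (basis A))"
  note c = completed_vof[OF this]
  have "vof x \<in> chn (\<kappa> = Filtered) (basis M) (Qh A)"
    using c(2,3) by (auto simp: chn_def fixed_Qh hS_def)
  then show "x \<in> vnth ` chn (\<kappa> = Filtered) (basis M) (Qh A)" using c(1) by (metis image_eqI)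
next
  fix x assume "x \<in> chn (\<kappa> = Filtered) (basis M) (Qh A)"
  then show "vnth x \<in> completed \<kappa> (basis M \<times> lists (basis A))"
    by (intro vnth_completed) (auto simp: chn_def fixed_Qh hS_def)
qed

lemma ce_chains_chn: "ce_chains \<kappa> A M = vnth ` chn (\<kappa> = Filtered) (basis M) (Qs A)"
proof safe
  fix x assume "x \<in> ce_chains \<kappa> A M"
  then have x: "x \<in> completed \<kappa> (basis M \<times> lists (basis A))"
    and p: "\<forall>v w. \<forall>\<tau>\<in>perms (length w). x (v, permute_list \<tau> w) = koszul A \<tau> w * x (v, w)"
    by (auto simp: ce_chains_def)
  note c = completed_vof[OF x]
  have "vof x \<in> chn (\<kappa> = Filtered) (basis M) (Qs A)"
    using c(2,3) p by (auto simp: chn_def fixed_Qs hS_def c(1))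
  then show "x \<in> vnth ` chn (\<kappa> = Filtered) (basis M) (Qs A)" using c(1) by (metis image_eqI)
next
  fix x assume x: "x \<in> chn (\<kappa> = Filtered) (basis M) (Qs A)"
  then have "vnth x \<in> completed \<kappa> (basis M \<times> lists (basis A))"
    by (intro vnth_completed) (auto simp: chn_def fixed_Qs hS_def)
  then show "vnth x \<in> ce_chains \<kappa> A M" using x by (simp add: ce_chains_def chn_def fixed_Qs)
qed

section \<open>Degrees of the idempotents and of the differentials\<close>

definition hcdeg :: "('v \<Rightarrow> int) \<Rightarrow> 'a ainf \<Rightarrow> 'v \<times> 'a list \<Rightarrow> int" where
  "hcdeg dv A = (\<lambda>(v, w). dv v + wdeg A w)"

lemma hdeg_pushI:
  assumes "hdeg dg {k} x" "\<And>i. dg' (f i) = dg i + s" "k' = k + s"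
  shows "hdeg dg' {k'} (app (\<lambda>i. unitv (f i)) x)"
  using hdeg_push[where f = f and s = s, OF assms(1,2)] assms(3) by simp

lemma coeff_const_mult: "coeff (nov_const c * a) p = c * coeff a p"
proof -
  have "nov_conv (\<lambda>p. if p = 0 then c else 0) (coeff a) p
      = (\<Sum>i\<in>{0}. (if i = 0 then c else 0) * coeff a (p - i))"
    unfolding nov_conv_def by (rule Sum_any.expand_superset) auto
  then show ?thesis by (simp add: times_nov.rep_eq nov_const.rep_eq)
qed

lemma hdeg_const: "hdeg dg K x \<Longrightarrow> hdeg dg K (nov_const c *v x)"
  unfolding hdeg_def vnth_scale coeff_const_mult by (metis mult_zero_right)

lemma hdeg_sum: "(\<And>i. i \<in> F \<Longrightarrow> hdeg dg K (f i)) \<Longrightarrow> hdeg dg K (sum f F)"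
  by (induction F rule: infinite_finite_induct) (auto intro: hdeg_add)

lemma hdeg_Qh: "hdeg (wdeg A) {wdeg A w} (Qh A w)"
  by (simp add: Qh_def hdeg_unitv del: in_lists_conv_set)

lemma hdeg_Qs: "hdeg (wdeg A) {wdeg A w} (Qs A w)"
proof -
  have "hdeg (wdeg A) {wdeg A w} (koszul A \<tau> w *v unitv (permute_list \<tau> w))" if t: "\<tau> \<in> perms (length w)" for \<tau>
  proof -
    have "mset (permute_list \<tau> w) = mset w" using t by (simp add: perms_def mset_permute_list)
    then have "wdeg A (permute_list \<tau> w) = wdeg A w" unfolding wdeg_wd by (rule wd_mset)
    moreover obtain s where "koszul A \<tau> w = ksign s" using koszul_ksign by blast
    ultimately show ?thesis by (simp add: hdeg_ksign hdeg_unitv)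
  qed
  then show ?thesis unfolding Qs_def by (auto intro!: hdeg_const hdeg_sum)
qed

text \<open>The two complexes differ only in the idempotent, and the arguments that follow treat
  both at once.\<close>

definition wsym :: "'a ainf \<Rightarrow> ('a list \<Rightarrow> 'a list vec) \<Rightarrow> bool" where
  "wsym A Q \<longleftrightarrow> Q = Qh A \<or> Q = Qs A"

lemma wsymD: assumes "wsym A Q" shows "wproj (va A) Q" "hdeg (wdeg A) {wdeg A w} (Q w)"
  using assms wproj_Qh wproj_Qs hdeg_Qh hdeg_Qs unfolding wsym_def by metis+

lemma hdeg_pj:
  assumes "wsym A Q" shows "hdeg (hcdeg dv A) {hcdeg dv A q} (pj V Q q)"
proof -
  obtain v w where q: "q = (v, w)" by (cases q)
  show ?thesis unfolding q pj.simps
    by (auto simp: hcdeg_def intro!: hdeg_pushI[OF wsymD(2)[OF assms], of _ _ "dv v"])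
qed

lemma hdeg_vphi:
  assumes "okfam A1 A0 M N s c \<phi>"
  shows "hdeg (sdeg N) {tdeg (va A1) (va A0) (sdeg M) t + s} (vphi A1 A0 M \<phi> t)"
proof (cases "t \<in> bi_basis A1 A0 M")
  case True
  obtain u v w where t: "t = (u, v, w)" by (cases t)
  show ?thesis using okfamD(3,5)[OF assms True[unfolded t]]
    by (simp add: hdeg_homogeneous t tdeg_def wdeg_wd)
qed (simp add: vphi_off)

lemma hdeg_Wr:
  assumes "\<And>t. hdeg du {tdeg (va A) (va A) dv t + s} (\<alpha> t)"
  shows "hdeg (hcdeg du A) {hcdeg dv A q + s} (Wr (va A) dv \<alpha> q)"
proof -
  obtain v w where q: "q = (v, w)" by (cases q)
  show ?thesis unfolding q Wr.simps
  proof (intro hdeg_ssum hdeg_ksign)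
    fix x l r z assume e: "x @ l = w" "r @ z = x"
    show "hdeg (hcdeg du A) {hcdeg dv A (v, w) + s} (app (\<lambda>y. unitv (y, z)) (\<alpha> (l, v, r)))"
      by (rule hdeg_pushI[OF assms, of _ _ "wdeg A z"])
        (auto simp: hcdeg_def tdeg_def wdeg_wd e[symmetric])
  qed
qed

lemma hdeg_abar:
  assumes A: "filtered_ainf A" shows "hdeg (wdeg A) {wdeg A w + 1} (abar (va A) w)"
  unfolding abar_def bar_def
proof (intro hdeg_ssum hdeg_ksign)
  fix a x b c assume e: "a @ x = w" "b @ c = x"
  have "hdeg (sdeg A) {wdeg A b + 1} (am (va A) b)"
    by (cases "b \<in> lists (basis A)")
      (use filtered_ainfD(2,3)[OF A, of b] in \<open>simp_all add: hdeg_homogeneous del: in_lists_conv_set\<close>)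
  then show "hdeg (wdeg A) {wdeg A w + 1} (app (\<lambda>y. unitv (a @ y # c)) (am (va A) b))"
    by (rule hdeg_pushI[of _ _ _ _ _ "wdeg A a + wdeg A c"]) (auto simp: wdeg_wd e[symmetric])
qed

lemma hdeg_hD:
  assumes A: "filtered_ainf A" and M: "okfam A A M M 1 0 (nop M)"
  shows "hdeg (hcdeg (sdeg M) A) {hcdeg (sdeg M) A q + 1} (hD (va A) (vb A A M) q)"
  unfolding hD_def vb_sel
proof (rule hdeg_add)
  show "hdeg (hcdeg (sdeg M) A) {hcdeg (sdeg M) A q + 1} (Wr (va A) (sdeg M) (vphi A A M (nop M)) q)"
    by (rule hdeg_Wr) (rule hdeg_vphi[OF M])
  obtain v w where q: "q = (v, w)" by (cases q)
  show "hdeg (hcdeg (sdeg M) A) {hcdeg (sdeg M) A q + 1} (Wb (va A) (sdeg M) q)"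
    unfolding q Wb.simps
    by (rule hdeg_ksign, rule hdeg_pushI[OF hdeg_abar[OF A], of _ _ "sdeg M v"]) (auto simp: hcdeg_def)
qed

text \<open>For \<open>Qh\<close> this is a statement about supports. For \<open>Qs\<close> the rows
  of the composite are symmetrized sums, and \<open>sy\<close> says that these are signed-symmetric
  in the output word, hence fixed by the average.\<close>

lemma pj_stable:
  fixes R :: "'v \<times> 'a list \<Rightarrow> ('u \<times> 'a list) vec"
  assumes Q: "wsym A Q" and R: "bdd R" "\<And>q. q \<in> hS (va A) V \<Longrightarrow> supv (hS (va A) U) (R q)"
    and sy: "\<And>v w v' w' \<tau>. w \<in> lists (basis A) \<Longrightarrow> \<tau> \<in> perms (length w') \<Longrightarrow>
      symsum (sdeg A) w (\<lambda>y. R (v, y) $ (v', permute_list \<tau> w')) =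
      koszul A \<tau> w' * symsum (sdeg A) w (\<lambda>y. R (v, y) $ (v', w'))"
  shows "app (pj U Q) (app R (pj V Q q)) = app R (pj V Q q)"
proof -
  have s: "supv (hS (va A) U) (app R (pj V Q q))"
    by (rule supv_app[OF R(1) supv_pj[OF wsymD(1)[OF Q]] R(2)])
  show ?thesis
  proof (cases "Q = Qh A")
    case True
    then show ?thesis using s unfolding True fixed_Qh by simp
  next
    case False
    then have Qs: "Q = Qs A" using Q by (simp add: wsym_def)
    obtain v w where q: "q = (v, w)" by (cases q)
    show ?thesis
    proof (cases "v \<in> V \<and> w \<in> lists (basis A)")
      case True
      then have n: "app R (pj V Q q) $ p = nov_const (1 / fact (length w)) * symsum (sdeg A) w (\<lambda>y. R (v, y) $ p)" for p
        unfolding q Qs by (intro pj_Qs_app[OF R(1)]) auto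
      show ?thesis unfolding Qs fixed_Qs
      proof (intro conjI allI ballI)
        show "supv (hS (va A) U) (app R (pj V (Qs A) q))" using s unfolding Qs .
        fix v' and w' :: "'a list" and \<tau> assume t: "\<tau> \<in> perms (length w')"
        show "app R (pj V (Qs A) q) $ (v', permute_list \<tau> w') = koszul A \<tau> w' * app R (pj V (Qs A) q) $ (v', w')"
          unfolding n[unfolded Qs] sy[OF conjunct2[OF True] t] by (simp only: mult_ac)
      qed
    next
      case False
      then have "pj V Q q = 0" by (auto simp: q Qs Qs_def simp del: in_lists_conv_set)
      then show ?thesis by simp
    qed
  qed
qed

lemma supv_Wr:
  assumes "\<And>t. supv U (\<alpha> t)" "q \<in> hS (va A) V" shows "supv (hS (va A) U) (Wr (va A) dv \<alpha> q)"
proof -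
  obtain v w where q: "q = (v, w)" "w \<in> lists (basis A)" using assms(2) by (auto simp: hS_def)
  show ?thesis unfolding q Wr.simps
  proof (intro supv_ssum supv_scale)
    fix x l r z assume e: "x @ l = w" "r @ z = x"
    show "supv (hS (va A) U) (app (\<lambda>y. unitv (y, z)) (\<alpha> (l, v, r)))"
      by (rule supv_push[OF assms(1)]) (use q(2) e in \<open>auto simp: hS_def\<close>)
  qed
qed

lemma pj_Wr:
  fixes A :: "'a ainf"
  assumes Q: "wsym A Q" and a: "bdd \<alpha>" "\<And>t. supv U (\<alpha> t)"
  shows "app (pj U Q) (app (Wr (va A) dv \<alpha>) (pj V Q q)) = app (Wr (va A) dv \<alpha>) (pj V Q q)"
proof (rule pj_stable[OF Q bdd_Wr[OF a(1)] supv_Wr[OF a(2)]])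
  fix v w v' and w' :: "'a list" and \<tau> assume t: "\<tau> \<in> perms (length w')"
  show "symsum (sdeg A) w (\<lambda>y. Wr (va A) dv \<alpha> (v, y) $ (v', permute_list \<tau> w')) =
      koszul A \<tau> w' * symsum (sdeg A) w (\<lambda>y. Wr (va A) dv \<alpha> (v, y) $ (v', w'))"
    unfolding Wr_hoch ce_wrap_hoch[symmetric] by (rule ce_wrap_permute[OF t])
qed

lemma pj_hD:
  fixes A :: "'a ainf"
  assumes A: "filtered_ainf A" and Q: "wsym A Q" and M: "bim (va A) (va A) M"
  shows "app (pj (bV M) Q) (app (hD (va A) M) (pj (bV M) Q q)) = app (hD (va A) M) (pj (bV M) Q q)"
proof (rule pj_stable[OF Q bdd_hD[OF alg_va[OF A] bimD(1)[OF M]]])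
  fix q assume q: "q \<in> hS (va A) (bV M)"
  then obtain v w where vw: "q = (v, w)" "v \<in> bV M" "w \<in> lists (basis A)" by (auto simp: hS_def)
  have "supv (hS (va A) (bV M)) (Wb (va A) (bv M) q)" unfolding vw(1) Wb.simps
    by (rule supv_scale, rule supv_push[OF supv_abar[OF alg_va[OF A]]]) (use vw in \<open>auto simp: hS_def\<close>)
  then show "supv (hS (va A) (bV M)) (hD (va A) M q)" unfolding hD_def
    by (rule supv_add) (rule supv_Wr[OF famD(3)[OF bimD(2)[OF M]] q])
next
  fix v w v' and w' :: "'a list" and \<tau> assume w: "w \<in> lists (basis A)" and t: "\<tau> \<in> perms (length w')"
  \<comment> \<open>The symmetrized Hochschild differential is the Chevalley-Eilenberg differential
    of the back-translated bimodule, whose values are signed-symmetric by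
    \<open>ce_d_permute\<close>.\<close>
  have e: "symsum (sdeg A) w (\<lambda>y. hD (va A) M (v, y) $ p) = ce_d A (tobi M) (v, w) p" for p
  proof -
    obtain p1 p2 where p: "p = (p1, p2)" by (cases p)
    have "symsum (sdeg A) w (\<lambda>y. hD (va A) M (v, y) $ p) = symsum (sdeg A) w (\<lambda>y. hoch_d A (tobi M) (v, y) p)"
      by (rule symsum_cong) (simp only: hD_hoch[OF A] lists_mset[of _ w] w)
    then show ?thesis unfolding p ce_d_hoch[OF mok_filtered[OF A w]] .
  qed
  show "symsum (sdeg A) w (\<lambda>y. hD (va A) M (v, y) $ (v', permute_list \<tau> w')) =
      koszul A \<tau> w' * symsum (sdeg A) w (\<lambda>y. hD (va A) M (v, y) $ (v', w'))"
    unfolding e by (rule ce_d_permute[OF mok_filtered[OF A w] t])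
qed

text \<open>On a symmetric chain the rows of R may be averaged first. The 1/k! of the average is the
  one in \<open>ce_lin\<close>, and the symmetrized sum is the value of D on a generator.\<close>

lemma ce_lin_app:
  fixes x :: "('v \<times> 'a list) vec" and A :: "'a ainf"
  assumes x: "x \<in> chn fil V (Qs A)" and R: "bdd R"
    and D: "\<And>v w p. v \<in> V \<Longrightarrow> w \<in> lists (basis A) \<Longrightarrow> D (v, w) p = symsum (sdeg A) w (\<lambda>y. R (v, y) $ p)"
  shows "ce_lin D (vnth x) = vnth (app R x)"
proof
  fix p
  note b = bdd_pj[OF wproj_Qs]
  have "app R x = app R (app (pj V (Qs A)) x)" using x by (simp add: chn_def)
  also have "\<dots> = app (\<lambda>q. app R (pj V (Qs A) q)) x" by (rule app_app[OF b R])
  finally have "app R x $ p = nov_sum (\<lambda>q. x $ q * app R (pj V (Qs A) q) $ p)"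
    by (simp add: vnth_app[OF bdd_app[OF b R]])
  also have "(\<lambda>q. x $ q * app R (pj V (Qs A) q) $ p) =
    (\<lambda>q. (case q of (v, w) \<Rightarrow> nov_const (1 / fact (length w)) * x $ (v, w)) * D q p)"
  proof
    fix q :: "'v \<times> 'a list" obtain v w where q: "q = (v, w)" by (cases q)
    show "x $ q * app R (pj V (Qs A) q) $ p = (case q of (v, w) \<Rightarrow> nov_const (1 / fact (length w)) * x $ (v, w)) * D q p"
    proof (cases "v \<in> V \<and> w \<in> lists (basis A)")
      case True
      then have v: "v \<in> V" "w \<in> lists (basis A)" by auto
      show ?thesis unfolding q pj_Qs_app[OF R v(2,1)] D[OF v] by (simp add: mult_ac)
    next
      case False
      then have "x $ q = 0" using chn_supv[OF wproj_Qs x] by (auto simp: supv_def hS_def q simp del: in_lists_conv_set)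
      then show ?thesis by (simp add: q)
    qed
  qed
  finally show "ce_lin D (vnth x) p = app R x $ p" by (simp add: ce_lin_def lin_def)
qed

section \<open>The Hochschild and Chevalley-Eilenberg complexes in vector form\<close>

lemma vcplx_chn:
  assumes A: "filtered_ainf A" and M: "filtered_bimod A A M" and Q: "wsym A Q"
    and X: "chains X = vnth ` chn (\<kappa> = Filtered) (basis M) Q" "cdeg X = hcdeg (sdeg M) A"
      "\<And>x. x \<in> chn (\<kappa> = Filtered) (basis M) Q \<Longrightarrow> diff X (vnth x) = vnth (app (hD (va A) (vb A A M)) x)"
  shows "vcplx \<kappa> X (chn (\<kappa> = Filtered) (basis M) Q) (app (hD (va A) (vb A A M)))"
proof -
  let ?S = "chn (\<kappa> = Filtered) (basis M) Q" and ?D = "hD (va A) (vb A A M)"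
  note a = alg_va[OF A] and m = bim_vb[OF A A M] and q = wsymD(1)[OF Q]
  note b = bdd_hD[OF a bimD(1)[OF m]] and bp = bdd_pj[OF q]
  have D: "app ?D x \<in> ?S" if "x \<in> ?S" for x
    by (rule chn_map[OF q b _ _ that]) (use vge_hD[OF a bimD(1)[OF m]] pj_hD[OF A Q m] in auto)
  have DD: "app ?D (app ?D x) = 0" if "x \<in> ?S" for x
  proof -
    have "app ?D (app ?D x) = app (\<lambda>q. app ?D (?D q)) x" by (rule app_app[OF b b])
    also have "\<dots> = app (\<lambda>_. 0) x"
      by (rule app_cong_supv[OF chn_supv[OF q that]]) (rule hD_hD[OF a m], simp)
    finally show ?thesis by simp
  qed
  have sc: "k *v x \<in> ?S" if "k \<in> scalars \<kappa>" "x \<in> ?S" for k x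
    using that by (cases \<kappa>) (auto simp: chn_def app_scale[OF bp] intro!: vge_scale)
  have dp: "dproj (hcdeg (sdeg M) A) k x \<in> ?S" if "x \<in> ?S" for k x
  proof -
    have "app (pj (basis M) Q) (dproj (hcdeg (sdeg M) A) k x) = dproj (hcdeg (sdeg M) A) (k + 0) (app (pj (basis M) Q) x)"
      by (rule app_dproj[OF bp]) (simp add: hdeg_pj[OF Q])
    then show ?thesis using that by (auto simp: chn_def intro: dproj_vge)
  qed
  show ?thesis unfolding vcplx_def X(1,2)
  proof (intro conjI ballI allI)
    fix x k assume x: "x \<in> ?S"
    show "app ?D (dproj (hcdeg (sdeg M) A) k x) = dproj (hcdeg (sdeg M) A) (k + 1) (app ?D x)"
      by (rule app_dproj[OF b hdeg_hD[OF A okfam_nop[OF M]]])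
  next
    fix k x show "app ?D (k *v x) = k *v app ?D x" by (rule app_scale[OF b])
  qed (use X(3) D DD sc dp subgrp_chn[OF q, of "\<kappa> = Filtered" "basis M"] addh_app[OF b] in \<open>assumption | blast\<close>)+
qed

lemma vcplx_hochschild:
  assumes A: "filtered_ainf A" and M: "filtered_bimod A A M"
  shows "vcplx \<kappa> (hochschild \<kappa> A M) (chn (\<kappa> = Filtered) (basis M) (Qh A)) (app (hD (va A) (vb A A M)))"
proof (rule vcplx_chn[OF A M])
  show "wsym A (Qh A)" by (simp add: wsym_def)
  show "chains (hochschild \<kappa> A M) = vnth ` chn (\<kappa> = Filtered) (basis M) (Qh A)"
    by (simp add: hochschild_def hoch_chains)
  show "cdeg (hochschild \<kappa> A M) = hcdeg (sdeg M) A" by (simp add: hochschild_def hcdeg_def)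
  fix x assume x: "x \<in> chn (\<kappa> = Filtered) (basis M) (Qh A)"
  have "lin (hoch_d A M) (vnth x) = vnth (app (hD (va A) (vb A A M)) x)"
    by (rule lin_vec[OF bdd_hD[OF alg_va[OF A] bimD(1)[OF bim_vb[OF A A M]]] chn_supv[OF wproj_Qh x]])
      (rule hoch_d_hD[OF A _ okfam_nop[OF M]], simp add: hS_def)
  then show "diff (hochschild \<kappa> A M) (vnth x) = vnth (app (hD (va A) (vb A A M)) x)"
    by (simp add: hochschild_def)
qed

lemma vcplx_ce:
  assumes A: "filtered_ainf A" and M: "filtered_bimod A A M"
  shows "vcplx \<kappa> (chevalley_eilenberg \<kappa> A M) (chn (\<kappa> = Filtered) (basis M) (Qs A)) (app (hD (va A) (vb A A M)))"
proof (rule vcplx_chn[OF A M])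
  show "wsym A (Qs A)" by (simp add: wsym_def)
  show "chains (chevalley_eilenberg \<kappa> A M) = vnth ` chn (\<kappa> = Filtered) (basis M) (Qs A)"
    by (simp add: chevalley_eilenberg_def ce_chains_chn)
  show "cdeg (chevalley_eilenberg \<kappa> A M) = hcdeg (sdeg M) A" by (simp add: chevalley_eilenberg_def hcdeg_def)
  fix x assume x: "x \<in> chn (\<kappa> = Filtered) (basis M) (Qs A)"
  have "ce_lin (ce_d A M) (vnth x) = vnth (app (hD (va A) (vb A A M)) x)"
  proof (rule ce_lin_app[OF x bdd_hD[OF alg_va[OF A] bimD(1)[OF bim_vb[OF A A M]]]])
    fix v w p assume v: "v \<in> basis M" and w: "w \<in> lists (basis A)"
    show "ce_d A M (v, w) p = symsum (sdeg A) w (\<lambda>y. hD (va A) (vb A A M) (v, y) $ p)"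
      by (cases p, simp only: ce_d_hoch[OF mok_filtered[OF A w]], rule symsum_cong, rule hoch_d_hD[OF A _ okfam_nop[OF M]])
        (simp add: v w lists_mset[of _ w] del: in_lists_conv_set)
  qed
  then show "diff (chevalley_eilenberg \<kappa> A M) (vnth x) = vnth (app (hD (va A) (vb A A M)) x)"
    by (simp add: chevalley_eilenberg_def)
qed

lemma okfam_vphi_nth:
  assumes "okfam A A M N s c \<phi>" "v \<in> basis M" "l @ r \<in> lists (basis A)"
  shows "vnth (vphi A A M \<phi> (l, v, r)) = \<phi> l v r"
  by (rule okfamD(5)[OF assms(1)]) (use assms(2,3) in \<open>simp add: bi_basis_def\<close>)

lemma hoch_map_Wr:
  assumes f: "okfam A A M N s c \<phi>" and x: "x \<in> chn fil (basis M) (Qh A)"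
  shows "hoch_map A M \<phi> (vnth x) = vnth (app (Wr (va A) (sdeg M) (vphi A A M \<phi>)) x)"
  unfolding hoch_map_def
proof (rule lin_vec[OF bdd_Wr[OF famD(1)[OF fam_vphi[OF f]]] chn_supv[OF wproj_Qh x]])
  fix q p assume "q \<in> hS (va A) (basis M)"
  then obtain v w where q: "q = (v, w)" "v \<in> basis M" "w \<in> lists (basis A)" by (auto simp: hS_def)
  show "hoch_wrap A M \<phi> q p = Wr (va A) (sdeg M) (vphi A A M \<phi>) q $ p"
    unfolding q(1) by (rule hoch_wrap_Wr[OF _ q(3)], rule okfam_vphi_nth[OF f q(2)])
qed

lemma ce_map_Wr:
  assumes f: "okfam A A M N s c \<phi>" and x: "x \<in> chn fil (basis M) (Qs A)"
  shows "ce_map A M \<phi> (vnth x) = vnth (app (Wr (va A) (sdeg M) (vphi A A M \<phi>)) x)"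
  unfolding ce_map_def
proof (rule ce_lin_app[OF x bdd_Wr[OF famD(1)[OF fam_vphi[OF f]]]])
  fix v w p assume v: "v \<in> basis M" and w: "w \<in> lists (basis A)"
  show "ce_wrap A (symmetrize A M \<phi>) (v, w) p = symsum (sdeg A) w (\<lambda>y. Wr (va A) (sdeg M) (vphi A A M \<phi>) (v, y) $ p)"
    by (cases p, simp only: ce_wrap_hoch, rule symsum_cong, rule hoch_wrap_Wr, rule okfam_vphi_nth[OF f v])
      (simp_all add: w lists_mset[of _ w] del: in_lists_conv_set)
qed

section \<open>Homomorphisms and the chain maps they induce\<close>

lemma bimod_hom_okfam:
  assumes "bimod_hom \<kappa> A1 A0 M B1 B0 N f1 f0 \<phi>"
  obtains c where "okfam A1 A0 M N 0 (- c) \<phi>" "c \<ge> 0" "\<kappa> = Filtered \<Longrightarrow> c = 0"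
proof -
  obtain c where "c \<ge> 0" "\<kappa> = Filtered \<longrightarrow> c = 0" "\<forall>(u, v, w)\<in>bi_basis A1 A0 M.
           \<phi> u v w \<in> completed Weakly_filtered (basis N) \<and> (\<forall>b. \<phi> u v w b \<in> energy_ge (- c)) \<and>
           homogeneous (sdeg N) (wdeg A1 u + sdeg M v + wdeg A0 w) (\<phi> u v w)"
    using assms unfolding bimod_hom_def by blast
  then show thesis using that[of c] unfolding okfam_def by simp
qed

text \<open>The support lemmas are stated for bimodules; zero operations turn a plain graded module
  into one.\<close>

definition free_vbim :: "('v \<Rightarrow> int) \<Rightarrow> 'v set \<Rightarrow> ('a, 'v, 'b) vbim" where
  "free_vbim d V = \<lparr>bv = d, bn = \<lambda>_. 0, bV = V\<rparr>"

lemma bV_free [simp]: "bV (free_vbim d V) = V" by (simp add: free_vbim_def)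

lemma supv_hat_row:
  fixes A1 :: "'a ainf" and A0 :: "'b ainf" and B1 :: "'c ainf" and B0 :: "'d ainf"
    and M :: "('v, 'z) gmod_scheme" and N :: "('u, 'y) gmod_scheme"
  assumes p: "okfam A1 A0 M N 0 c \<phi>" and F: "ahom (va A1) (va B1) F1" "ahom (va A0) (va B0) F0"
    and t: "t \<in> bi_basis A1 A0 M"
  shows "supv (bi_basis B1 B0 N) (app (Gh F1 F0) (bhat 0 d (vphi A1 A0 M \<phi>) t))"
proof -
  let ?N = "free_vbim (sdeg N) (basis N) :: ('a, 'u, 'b) vbim"
  let ?N' = "free_vbim (sdeg N) (basis N) :: ('c, 'u, 'd) vbim"
  have "supv (tbas (va A1) (va A0) ?N) (bhat 0 d (vphi A1 A0 M \<phi>) t)"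
    by (rule supv_bhat[where M = "free_vbim (sdeg M) (basis M)"])
      (use famD(3)[OF fam_vphi[OF p]] t in \<open>simp_all add: tbas_def bi_basis_def\<close>)
  then have "supv (tbas (va B1) (va B0) ?N') (app (Gh F1 F0) (bhat 0 d (vphi A1 A0 M \<phi>) t))"
  proof (rule supv_app[OF bdd_Gh'[OF ahomD(1)[OF F(1)] ahomD(1)[OF F(2)]]])
    fix i assume i: "i \<in> tbas (va A1) (va A0) ?N"
    have k: "bV ?N = bV ?N'" by simp
    show "supv (tbas (va B1) (va B0) ?N') (Gh F1 F0 i)"
      by (rule supv_Gh[OF ahomD(1)[OF F(1)] ahomD(1)[OF F(2)] ahomD(3)[OF F(1)] ahomD(3)[OF F(2)] i k])
  qed
  then show ?thesis by (simp add: tbas_def bi_basis_def)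
qed

lemma bdd_hat_row:
  assumes p: "okfam A1 A0 M N 0 c \<phi>" and g: "good F1" "good F0"
  shows "bdd (\<lambda>t. app (Gh F1 F0) (bhat 0 d (vphi A1 A0 M \<phi>) t))"
  by (rule bdd_app[OF bdd_bhat[OF famD(1)[OF fam_vphi[OF p]]] bdd_Gh'[OF g]])

lemma fhom_vphi:
  assumes A: "filtered_ainf A1" "filtered_ainf A0" and B: "filtered_ainf B1" "filtered_ainf B0"
    and M: "filtered_bimod A1 A0 M" and N: "filtered_bimod B1 B0 N"
    and h: "bimod_hom \<kappa> A1 A0 M B1 B0 N f1 f0 \<phi>"
    and r: "hrep A1 f1 F1" "hrep A0 f0 F0" and F: "ahom (va A1) (va B1) F1" "ahom (va A0) (va B0) F0"
  shows "fhom (va A1) (va A0) (vb A1 A0 M) (va B1) (va B0) (vb B1 B0 N) F1 F0 (vphi A1 A0 M \<phi>)"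
proof -
  obtain c where p: "okfam A1 A0 M N 0 (- c) \<phi>" using bimod_hom_okfam[OF h] by metis
  let ?b = "bhat 0 (sdeg A1) (vphi A1 A0 M \<phi>)"
  let ?R = "\<lambda>t. app (Gh F1 F0) (?b t)"
  let ?D = "tD (va A1) (va A0) (vb A1 A0 M)" and ?E = "tD (va B1) (va B0) (vb B1 B0 N)"
  note aA = alg_va[OF A(1)] alg_va[OF A(2)] and aB = alg_va[OF B(1)] alg_va[OF B(2)]
  note bM = bim_vb[OF A M] and bN = bim_vb[OF B N]
  note g = ahomD(1)[OF F(1)] ahomD(1)[OF F(2)]
  note bR = bdd_hat_row[OF p g, of "sdeg A1"] and bD = bdd_tD[OF aA bimD(1)[OF bM]] and bE = bdd_tD[OF aB bimD(1)[OF bN]]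
  have f: "fam (va A1) (va A0) (bv (vb A1 A0 M)) (bv (vb B1 B0 N)) (bV (vb B1 B0 N)) 0 (vphi A1 A0 M \<phi>)"
    using fam_vphi[OF p] by simp
  have "app (Gh F1 F0) (app ?b (?D t)) = app ?E (?R t)" if t: "t \<in> tbas (va A1) (va A0) (vb A1 A0 M)" for t
  proof -
    have t': "t \<in> bi_basis A1 A0 M" using t by (simp add: tbas_vb)
    \<comment> \<open>As for the square-zero identities, the chain property is extracted row by row
      from unit vectors.\<close>
    have x: "vnth (unitv t) \<in> completed \<kappa> (bi_basis A1 A0 M)"
      by (rule vnth_completed) (simp_all add: t')
    have 1: "lin (bimod_d A1 A0 M) (vnth (unitv t)) = vnth (?D t)"
      using lin_vec[OF bD, of "bi_basis A1 A0 M" "unitv t" "bimod_d A1 A0 M"] t' bimod_d_va[OF A okfam_nop[OF M]] bD by simp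
    have sD: "supv (bi_basis A1 A0 M) (?D t)"
      using supv_tD[OF aA famD(3)[OF bimD(2)[OF bM]] t] by (simp add: tbas_vb)
    have 2: "lin (bi_hat f1 f0 \<phi>) (vnth (?D t)) = vnth (app ?R (?D t))"
      by (rule lin_vec[OF bR sD]) (rule bi_hat_va[OF r p])
    have 3: "lin (bi_hat f1 f0 \<phi>) (vnth (unitv t)) = vnth (?R t)"
      using lin_vec[OF bR, of "bi_basis A1 A0 M" "unitv t" "bi_hat f1 f0 \<phi>"] bi_hat_va[OF r p] t' bR by simp
    have 4: "lin (bimod_d B1 B0 N) (vnth (?R t)) = vnth (app ?E (?R t))"
      by (rule lin_vec[OF bE supv_hat_row[OF p F t']]) (rule bimod_d_va[OF B okfam_nop[OF N]])
    have "lin (bi_hat f1 f0 \<phi>) (lin (bimod_d A1 A0 M) (vnth (unitv t))) =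
        lin (bimod_d B1 B0 N) (lin (bi_hat f1 f0 \<phi>) (vnth (unitv t)))"
      using h x unfolding bimod_hom_def by blast
    then have "app ?R (?D t) = app ?E (?R t)" unfolding 1 2 3 4 by (simp add: vnth_inject)
    then show ?thesis by (simp add: app_app[OF bdd_bhat[OF famD(1)[OF f]] bdd_Gh'[OF g]])
  qed
  then show ?thesis using f unfolding fhom_def va_sel by blast
qed

lemma comp_bi_va:
  assumes p: "okfam A1 A0 M N 0 c \<phi>" and s: "okfam B1 B0 N P 0 c' \<psi>"
    and r: "hrep A1 f1 F1" "hrep A0 f0 F0" and F: "ahom (va A1) (va B1) F1" "ahom (va A0) (va B0) F0"
    and t: "(u, v, w) \<in> bi_basis A1 A0 M"
  shows "comp_bi \<psi> f1 f0 \<phi> u v w =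
    vnth (app (vphi B1 B0 N \<psi>) (app (Gh F1 F0) (bhat 0 d (vphi A1 A0 M \<phi>) (u, v, w))))"
proof -
  have "bi_hat f1 f0 \<phi> (u, v, w) = vnth (app (Gh F1 F0) (bhat 0 d (vphi A1 A0 M \<phi>) (u, v, w)))"
    by (rule ext) (rule bi_hat_va[OF r p t])
  then show ?thesis unfolding comp_bi_def
    by (simp only:) (rule lin_vec[OF famD(1)[OF fam_vphi[OF s]] supv_hat_row[OF p F t]],
      auto simp: okfamD(5)[OF s])
qed

lemma vphi_comp:
  assumes p: "okfam A1 A0 M N 0 c \<phi>" and s: "okfam B1 B0 N P 0 c' \<psi>"
    and r: "hrep A1 f1 F1" "hrep A0 f0 F0" and F: "ahom (va A1) (va B1) F1" "ahom (va A0) (va B0) F0"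
    and e: "bi_eq A1 A0 M (comp_bi \<psi> f1 f0 \<phi>) \<chi>" and t: "t \<in> bi_basis A1 A0 M"
  shows "vphi A1 A0 M \<chi> t = app (vphi B1 B0 N \<psi>) (app (Gh F1 F0) (bhat 0 d (vphi A1 A0 M \<phi>) t))"
proof -
  obtain u v w where t': "t = (u, v, w)" by (cases t)
  let ?x = "app (vphi B1 B0 N \<psi>) (app (Gh F1 F0) (bhat 0 d (vphi A1 A0 M \<phi>) (u, v, w)))"
  have "\<chi> u v w = vnth ?x"
    using e t comp_bi_va[OF p s r F t[unfolded t'], of d] unfolding bi_eq_def t' by auto
  then have "vof (\<chi> u v w) = ?x" by (simp add: vof_def vnth_inverse)
  then show ?thesis using t by (simp add: vphi_def t')
qed

lemma ghat_cong:
  assumes "good f" "good g" "w \<in> lists X" "\<And>w. w \<in> lists X \<Longrightarrow> f w = g w"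
  shows "ghat f w = ghat g w"
proof (rule vec_eqI)
  fix y show "ghat f w $ y = ghat g w $ y"
    unfolding vnth_ghat[OF assms(1)] vnth_ghat[OF assms(2)]
  proof (rule hat_cong)
    fix a assume "set a \<subseteq> set w"
    then have "a \<in> lists X" using assms(3) by auto
    then show "vnth (f a) = vnth (g a)" by (simp only: assms(4))
  qed
qed

lemma good_bdd: "good g \<Longrightarrow> bdd g"
  unfolding good_def by (blast intro: bddI)

lemma comph_idg: assumes "good g" shows "comph idg g w = g w"
proof (rule vec_eqI)
  fix b
  have "comph idg g w $ b = nov_sum (\<lambda>y. ghat g w $ y * kron y [b])"
    by (simp add: comph_def vnth_app[OF good_bdd[OF good_idg]] vnth_idg)
  also have "\<dots> = ghat g w $ [b]" by (subst nov_sum_single[of "[b]"]) (auto simp: kron_def)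
  finally show "comph idg g w $ b = g w $ b" by (simp only: vnth_ghat[OF assms] hat_singleton)
qed

lemma comph_idg': "good g \<Longrightarrow> comph g idg w = g w"
  unfolding comph_def ghat_idg by (rule app_unitv[OF good_bdd])

lemma comp_hom_va:
  assumes f: "filtered_hom A B f" and g: "filtered_hom B C g" and w: "w \<in> lists (basis A)"
    and A: "filtered_ainf A" "filtered_ainf B"
  shows "comp_hom g f w = vnth (comph (vh B g) (vh A f) w)"
proof -
  note F = ahom_vh[OF A f]
  have "hat f w = vnth (ghat (vh A f) w)"
    using hrep_vh[OF f] w unfolding hrep_def by (intro ext) simp
  moreover have "lin g (vnth (ghat (vh A f) w)) = vnth (app (vh B g) (ghat (vh A f) w))"
  proof (rule lin_vec)
    show "bdd (vh B g)" by (rule good_bdd[OF good_vh[OF g]])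
    show "supv (lists (basis B)) (ghat (vh A f) w)"
      by (rule supv_ghat[OF ahomD(1)[OF F] _ w]) (use ahomD(3)[OF F] in simp)
  qed (simp add: filtered_homD(4)[OF g] del: in_lists_conv_set)
  ultimately show ?thesis unfolding comp_hom_def comph_def by simp
qed

lemma pull_idg: assumes "bim A1 A0 M" shows "pull idg idg M = M"
proof -
  have "(\<lambda>t. app (bn M) (Gh idg idg t)) = bn M"
    by (rule ext) (simp add: Gh_idg bimD(3)[OF assms])
  then show ?thesis unfolding pull_def by simp
qed

text \<open>\<open>hom_pull\<close> makes the pull-back of \<phi> a homomorphism over the identity
  of C, and \<open>Wr_hD\<close> carries this through the cyclic embedding.\<close>

lemma pull_hom_Wr:
  assumes A: "filtered_ainf A1" "filtered_ainf A0" "filtered_ainf B1" "filtered_ainf B0" "filtered_ainf C"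
    and M: "filtered_bimod A1 A0 M" and N: "filtered_bimod B1 B0 N"
    and h: "bimod_hom \<kappa> A1 A0 M B1 B0 N f1 f0 \<phi>"
    and r: "hrep A1 f1 F1" "hrep A0 f0 F0" and F: "ahom (va A1) (va B1) F1" "ahom (va A0) (va B0) F0"
    and G: "ahom (va C) (va A1) G1" "ahom (va C) (va A0) G0"
    and H: "ahom (va C) (va B1) H1" "ahom (va C) (va B0) H0"
      "\<And>w. w \<in> lists (basis C) \<Longrightarrow> H1 w = comph F1 G1 w"
      "\<And>w. w \<in> lists (basis C) \<Longrightarrow> H0 w = comph F0 G0 w"
    and q: "q \<in> hS (va C) (basis M)"
  shows "app (Wr (va C) (sdeg M) (\<lambda>t. app (vphi A1 A0 M \<phi>) (Gh G1 G0 t))) (hD (va C) (pull G1 G0 (vb A1 A0 M)) q) =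
    app (hD (va C) (pull H1 H0 (vb B1 B0 N))) (Wr (va C) (sdeg M) (\<lambda>t. app (vphi A1 A0 M \<phi>) (Gh G1 G0 t)) q)"
proof -
  note al = alg_va[OF A(1)] alg_va[OF A(2)] alg_va[OF A(3)] alg_va[OF A(4)] alg_va[OF A(5)]
  note bM = bim_vb[OF A(1,2) M] and bN = bim_vb[OF A(3,4) N]
  note pM = bim_pull[OF al(5,5,1,2) G bM] and pN = bim_pull[OF al(5,5,3,4) H(1,2) bN]
  note fh = fhom_vphi[OF A(1-4) M N h r F]
  have f: "fam (va A1) (va A0) (sdeg M) (sdeg N) (basis N) 0 (vphi A1 A0 M \<phi>)"
    using fh unfolding fhom_def by simp
  have gg: "ghat H1 w = ghat (comph F1 G1) w" if "w \<in> lists (aX (va C))" for w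
    by (rule ghat_cong[OF ahomD(1)[OF H(1)] _ that])
      (use good_comp[OF ahomD(1)[OF F(1)] ahomD(1)[OF G(1)]] H(3) in \<open>simp_all add: comph_def[abs_def] del: in_lists_conv_set\<close>)
  have gg': "ghat H0 w = ghat (comph F0 G0) w" if "w \<in> lists (aX (va C))" for w
    by (rule ghat_cong[OF ahomD(1)[OF H(2)] _ that])
      (use good_comp[OF ahomD(1)[OF F(2)] ahomD(1)[OF G(2)]] H(4) in \<open>simp_all add: comph_def[abs_def] del: in_lists_conv_set\<close>)
  have ff: "fam (va C) (va C) (bv (pull G1 G0 (vb A1 A0 M))) (bv (pull H1 H0 (vb B1 B0 N)))
      (bV (pull H1 H0 (vb B1 B0 N))) 0 (\<lambda>t. app (vphi A1 A0 M \<phi>) (Gh G1 G0 t))"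
    using fam_pull[OF G f] by simp
  have "app (Wr (va C) (bv (pull G1 G0 (vb A1 A0 M))) (\<lambda>t. app (vphi A1 A0 M \<phi>) (Gh G1 G0 t))) (hD (va C) (pull G1 G0 (vb A1 A0 M)) q) =
    app (hD (va C) (pull H1 H0 (vb B1 B0 N))) (Wr (va C) (bv (pull G1 G0 (vb A1 A0 M))) (\<lambda>t. app (vphi A1 A0 M \<phi>) (Gh G1 G0 t)) q)"
  proof (rule Wr_hD[OF al(5) pM pN ff])
    fix t assume t: "t \<in> tbas (va C) (va C) (pull G1 G0 (vb A1 A0 M))"
    show "app (bhat 0 (ad (va C)) (\<lambda>t. app (vphi A1 A0 M \<phi>) (Gh G1 G0 t))) (tD (va C) (va C) (pull G1 G0 (vb A1 A0 M)) t) =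
      app (tD (va C) (va C) (pull H1 H0 (vb B1 B0 N))) (bhat 0 (ad (va C)) (\<lambda>t. app (vphi A1 A0 M \<phi>) (Gh G1 G0 t)) t)"
      by (rule hom_pull[OF al(1-5,5) G ahomD(1)[OF F(1)] ahomD(1)[OF F(2)] ahomD(1)[OF H(1)] ahomD(1)[OF H(2)]
        gg gg' bM bN bimD(1)[OF pN] fh t])
  qed (use q in simp)
  then show ?thesis by simp
qed

text \<open>The case of \<open>pull_hom_Wr\<close> in which the source is pulled back along the
  identity: the price for \<phi> covering (F1, F0) is that the target is pulled back along (F1,
  F0).\<close>

lemma hom_Wr:
  assumes A: "filtered_ainf B1" "filtered_ainf B0" "filtered_ainf A"
    and M: "filtered_bimod A A M" and N: "filtered_bimod B1 B0 N"
    and h: "bimod_hom \<kappa> A A M B1 B0 N f1 f0 \<phi>"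
    and r: "hrep A f1 F1" "hrep A f0 F0" and F: "ahom (va A) (va B1) F1" "ahom (va A) (va B0) F0"
    and q: "q \<in> hS (va A) (basis M)"
  shows "app (Wr (va A) (sdeg M) (vphi A A M \<phi>)) (hD (va A) (vb A A M) q) =
    app (hD (va A) (pull F1 F0 (vb B1 B0 N))) (Wr (va A) (sdeg M) (vphi A A M \<phi>) q)"
proof -
  note al = alg_va[OF A(3)]
  obtain c where p: "okfam A A M N 0 (- c) \<phi>" using bimod_hom_okfam[OF h] by metis
  have e: "(\<lambda>t. app (vphi A A M \<phi>) (Gh idg idg t)) = vphi A A M \<phi>"
    by (rule ext) (simp add: Gh_idg famD(1)[OF fam_vphi[OF p]])
  show ?thesis
    using pull_hom_Wr[OF A(3,3,1,2,3) M N h r F ahom_idg[OF al] ahom_idg[OF al] F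
        comph_idg'[OF ahomD(1)[OF F(1)], symmetric] comph_idg'[OF ahomD(1)[OF F(2)], symmetric] q]
    unfolding e pull_idg[OF bim_vb[OF A(3,3) M]] .
qed

section \<open>Families with only a (0,0)-component\<close>

lemma Wr_pr:
  assumes e: "bdd e" shows "Wr A dv (\<lambda>t. app e (pr t)) q = tt e q"
proof -
  obtain v w where q: "q = (v, w)" by (cases q)
  have "Wr A dv (\<lambda>t. app e (pr t)) (v, w) = ssum w (\<lambda>x l. ssum x (\<lambda>r z.
     if l = [] then (if r = [] then app (\<lambda>y. unitv (y, z)) (e v) else 0) else 0))"
    unfolding Wr.simps by (intro ssum_cong) (simp add: e)
  also have "\<dots> = ssum w (\<lambda>x l. if l = [] then ssum x (\<lambda>r z.
     if r = [] then app (\<lambda>y. unitv (y, z)) (e v) else 0) else 0)"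
    by (intro ssum_cong) simp
  also have "\<dots> = tt e (v, w)" by (simp add: ssum_Nil1 ssum_Nil2)
  finally show ?thesis by (simp add: q)
qed

lemma linear_vphi:
  assumes "linear_bi A1 A0 M \<phi>" and bd: "bdd (vphi A1 A0 M \<phi>)"
  shows "vphi A1 A0 M \<phi> t = app (\<lambda>v. vphi A1 A0 M \<phi> ([], v, [])) (pr t)"
proof -
  obtain u v w where t: "t = (u, v, w)" by (cases t)
  have b: "bdd (\<lambda>v. vphi A1 A0 M \<phi> ([], v, []))" by (rule bdd_comp[OF bd])
  show ?thesis
  proof (cases "u = [] \<and> w = []")
    case False
    have "vphi A1 A0 M \<phi> (u, v, w) = 0"
    proof (cases "(u, v, w) \<in> bi_basis A1 A0 M")
      case True
      then have "\<phi> u v w = (\<lambda>_. 0)" using assms False unfolding linear_bi_def by blast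
      then show ?thesis by (simp add: vphi_def vof_def zero_vec_def)
    qed (simp add: vphi_off)
    then show ?thesis using False by (auto simp: t)
  qed (simp add: t b)
qed

lemma app_pr_Gh: "good g1 \<Longrightarrow> good g0 \<Longrightarrow> app pr (app (Gh g1 g0) x) = app pr x"
  by (simp add: app_app bdd_Gh' pr_Gh)

text \<open>A family with only a (0,0)-component factors through \<open>pr\<close>, and
  \<open>pr\<close> absorbs \<open>Gh\<close>. Composing with it is therefore composing with one
  linear map, and F1, F0 disappear from the formula.\<close>

lemma vphi_comp_linear:
  assumes p: "okfam A1 A0 M N 0 c \<phi>" and s: "okfam B1 B0 N P 0 c' \<psi>" and l: "linear_bi B1 B0 N \<psi>"
    and r: "hrep A1 f1 F1" "hrep A0 f0 F0" and F: "ahom (va A1) (va B1) F1" "ahom (va A0) (va B0) F0"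
    and e: "bi_eq A1 A0 M (comp_bi \<psi> f1 f0 \<phi>) \<chi>"
  shows "vphi A1 A0 M \<chi> t = app (\<lambda>v. vphi B1 B0 N \<psi> ([], v, [])) (vphi A1 A0 M \<phi> t)"
proof (cases "t \<in> bi_basis A1 A0 M")
  case True
  note bs = famD(1)[OF fam_vphi[OF s]] and g = ahomD(1)[OF F(1)] ahomD(1)[OF F(2)]
  let ?e = "\<lambda>v. vphi B1 B0 N \<psi> ([], v, [])"
  have be: "bdd ?e" by (rule bdd_comp[OF bs])
  have r: "vphi B1 B0 N \<psi> = (\<lambda>t. app ?e (pr t))" by (rule ext) (rule linear_vphi[OF l bs])
  have a: "app (vphi B1 B0 N \<psi>) x = app ?e (app pr x)" for x
    by (subst r) (simp add: app_app be)
  show ?thesis unfolding vphi_comp[OF p s assms(4,5) F e True, of "\<lambda>_. 0"] a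
    by (simp add: app_pr_Gh[OF g] pr_bhat)
qed (simp add: vphi_off)

section \<open>Reduction modulo positive energy\<close>

definition rmat :: "'i set \<Rightarrow> 'j set \<Rightarrow> ('i \<Rightarrow> 'j \<Rightarrow> real) \<Rightarrow> bool" where
  "rmat X Y S \<longleftrightarrow> (\<forall>a\<in>X. finite {b. S a b \<noteq> 0} \<and> (\<forall>b. S a b \<noteq> 0 \<longrightarrow> b \<in> Y))"

text \<open>A real matrix with its entries regarded as constants of the Novikov ring, which carries
  the homotopy identities of the reduced complexes over to vectors.\<close>

definition Rm :: "'i set \<Rightarrow> ('i \<Rightarrow> 'j \<Rightarrow> real) \<Rightarrow> 'i \<Rightarrow> 'j vec" where
  "Rm X S a = (if a \<in> X then vof (\<lambda>b. nov_const (S a b)) else 0)"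

lemma real_map_rmat: "real_map k X Y S \<Longrightarrow> rmat (basis X) (basis Y) S"
  unfolding real_map_def rmat_def by blast

lemma Rm_nth: assumes "rmat X Y S" "a \<in> X" shows "Rm X S a $ b = nov_const (S a b)"
proof -
  have "finite {b. nov_const (S a b) \<noteq> 0}"
    by (rule finite_subset[of _ "{b. S a b \<noteq> 0}"]) (use assms in \<open>auto simp: rmat_def\<close>)
  then show ?thesis using assms(2) by (simp add: Rm_def cvg_finite)
qed

lemma vge_Rm: "vge 0 (Rm X S a)"
  by (auto simp: Rm_def vof_def vge_def Vec_inverse)

lemma bdd_Rm: "bdd (Rm X S)" by (rule bddI) (rule vge_Rm)

lemma supv_Rm: assumes "rmat X Y S" shows "supv Y (Rm X S a)"
proof (cases "a \<in> X")
  case True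
  show ?thesis unfolding supv_def
  proof (intro allI impI)
    fix b assume "Rm X S a $ b \<noteq> 0"
    then have "S a b \<noteq> 0" using Rm_nth[OF assms True, of b] by auto
    then show "b \<in> Y" using assms True unfolding rmat_def by blast
  qed
qed (simp add: Rm_def)

lemma Rm_off: "a \<notin> X \<Longrightarrow> Rm X S a = 0" by (simp add: Rm_def)

lemma par_Rm:
  assumes "real_map k X Y S" shows "par (sdeg Y) (sdeg X a + k) (Rm (basis X) S a)"
proof (cases "a \<in> basis X")
  case True
  show ?thesis unfolding par_def
  proof (intro allI impI)
    fix b assume "Rm (basis X) S a $ b \<noteq> 0"
    then have "S a b \<noteq> 0" using Rm_nth[OF real_map_rmat[OF assms] True, of b] by auto
    then have "gdeg Y b = gdeg X a + k" using assms True unfolding real_map_def by blast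
    then show "even (sdeg Y b - (sdeg X a + k))" by (simp add: sdeg_def)
  qed
qed (simp add: Rm_off)

lemma Rm_comp:
  assumes S: "rmat X Y S" and T: "rmat Y Z T" and a: "a \<in> X"
  shows "app (Rm Y T) (Rm X S a) $ c = nov_const (real_comp T S a c)"
proof -
  let ?F = "{b. S a b \<noteq> 0}"
  have f: "finite ?F" and Y: "\<And>b. b \<in> ?F \<Longrightarrow> b \<in> Y" using S a by (auto simp: rmat_def)
  have "app (Rm Y T) (Rm X S a) $ c = nov_sum (\<lambda>b. nov_const (S a b) * Rm Y T b $ c)"
    by (simp add: vnth_app[OF bdd_Rm] Rm_nth[OF S a])
  also have "\<dots> = (\<Sum>b\<in>?F. nov_const (S a b) * Rm Y T b $ c)" by (rule nov_sum_finite[OF f]) simp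
  also have "\<dots> = (\<Sum>b\<in>?F. nov_const (S a b * T b c))"
    by (rule sum.cong[OF refl]) (simp add: Rm_nth[OF T Y] nov_const_mult)
  also have "\<dots> = nov_const (\<Sum>b\<in>?F. S a b * T b c)" by (rule nov_const_sum[symmetric])
  also have "(\<Sum>b\<in>?F. S a b * T b c) = real_comp T S a c"
    unfolding real_comp_def by (rule Sum_any.expand_superset[OF f, symmetric]) auto
  finally show ?thesis .
qed

lemma red_rmat:
  assumes "okfam A1 A0 M N s c \<phi>" shows "rmat (basis M) (basis N) (red_bi \<phi>)"
  unfolding rmat_def
proof (intro ballI conjI allI impI)
  fix v assume "v \<in> basis M"
  then have t: "([], v, []) \<in> bi_basis A1 A0 M" by (simp add: bi_basis_def)
  show "finite {b. red_bi \<phi> v b \<noteq> 0}"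
    unfolding red_bi_def by (rule cvg_coeff_finite[OF okfamD(4)[OF assms t]])
  fix b assume "red_bi \<phi> v b \<noteq> 0"
  then have "\<phi> [] v [] b \<noteq> 0" by (auto simp: red_bi_def)
  then show "b \<in> basis N" using okfamD(1)[OF assms t] by (auto simp: completed_def)
qed

text \<open>Local finiteness leaves finitely many energies of G in the interval from 0 to 1, and
  energy 0 occurs only for (0, 0).\<close>

lemma gap_eps:
  assumes G: "gap_monoid G"
  obtains \<epsilon> where "\<epsilon> > 0" "\<And>r \<mu>. (r, \<mu>) \<in> G \<Longrightarrow> (r, \<mu>) \<noteq> (0, 0) \<Longrightarrow> \<epsilon> \<le> r"
proof -
  \<comment> \<open>The 1 takes care of the energies above 1 and keeps the set nonempty.\<close>
  let ?F = "insert 1 {r \<in> fst ` G. r \<le> 1 \<and> 0 < r}"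
  have "finite {r \<in> fst ` G. r \<le> 1}" using G unfolding gap_monoid_def by blast
  moreover have "{r \<in> fst ` G. r \<le> 1 \<and> 0 < r} \<subseteq> {r \<in> fst ` G. r \<le> 1}" by blast
  ultimately have f: "finite ?F" using finite_subset by blast
  have pos: "Min ?F > 0" using f by (subst Min_gr_iff) auto
  show thesis
  proof (rule that[OF pos])
    fix r \<mu> assume r: "(r, \<mu>) \<in> G" "(r, \<mu>) \<noteq> (0, 0)"
    have "0 \<le> r" "r = 0 \<longrightarrow> \<mu> = 0" using G r unfolding gap_monoid_def by auto
    then have p: "0 < r" using r(2) by (cases "r = 0") auto
    show "Min ?F \<le> r"
    proof (cases "r \<le> 1")
      case True
      then have "r \<in> ?F" using p r(1) by force
      then show ?thesis using f by (rule Min_le[rotated])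
    next
      case False
      moreover have "Min ?F \<le> 1" using f by simp
      ultimately show ?thesis by linarith
    qed
  qed
qed

lemma supported_red:
  assumes e: "\<And>r \<mu>. (r, \<mu>) \<in> G \<Longrightarrow> (r, \<mu>) \<noteq> (0, 0) \<Longrightarrow> \<epsilon> \<le> r" and s: "supported G x"
  shows "x i - nov_const (coeff (x i) (0, 0)) \<in> energy_ge \<epsilon>"
  unfolding energy_ge_def mem_Collect_eq
proof (intro allI impI)
  fix p assume nz: "coeff (x i - nov_const (coeff (x i) (0, 0))) p \<noteq> 0"
  have "p \<noteq> (0, 0)" using nz by (auto simp: coeff_diff nov_const.rep_eq zero_prod_def)
  then have "coeff (x i) p \<noteq> 0" using nz by (auto simp: coeff_diff nov_const.rep_eq zero_prod_def)
  then have "(fst p, 2 * snd p) \<in> G" using s unfolding supported_def by blast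
  moreover have "(fst p, 2 * snd p) \<noteq> (0, 0)" using \<open>p \<noteq> (0, 0)\<close> by (cases p) auto
  ultimately show "\<epsilon> \<le> fst p" by (rule e)
qed

lemma gap_red:
  assumes f: "okfam A1 A0 M N s c \<phi>" and G: "gap_monoid G"
    and s: "\<forall>(u, v, w)\<in>bi_basis A1 A0 M. supported G (\<phi> u v w)"
  obtains \<epsilon> where "\<epsilon> > 0" "\<And>v. vge \<epsilon> (vphi A1 A0 M \<phi> ([], v, []) - Rm (basis M) (red_bi \<phi>) v)"
proof -
  obtain \<epsilon> where e: "\<epsilon> > 0" "\<And>r \<mu>. (r, \<mu>) \<in> G \<Longrightarrow> (r, \<mu>) \<noteq> (0, 0) \<Longrightarrow> \<epsilon> \<le> r"
    using gap_eps[OF G] by metis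
  show thesis
  proof (rule that[OF e(1)])
    fix v show "vge \<epsilon> (vphi A1 A0 M \<phi> ([], v, []) - Rm (basis M) (red_bi \<phi>) v)"
    proof (cases "v \<in> basis M")
      case True
      then have t: "([], v, []) \<in> bi_basis A1 A0 M" by (simp add: bi_basis_def)
      have su: "supported G (\<phi> [] v [])" using bspec[OF s t] by simp
      show ?thesis unfolding vge_def vnth_diff okfamD(5)[OF f t] Rm_nth[OF red_rmat[OF f] True] red_bi_def
        by (rule allI, rule supported_red[where G = G and x = "\<phi> [] v []"], erule e(2), assumption, rule su)
    next
      case False
      then have "([], v, []) \<notin> bi_basis A1 A0 M" by (simp add: bi_basis_def)
      then show ?thesis using False by (simp add: vphi_off Rm_off)
    qed
  qed
qed

text \<open>On the empty word every output other than the empty word is made of letters of g_0(1),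
  which have positive energy.\<close>

lemma ghat_Nil_red:
  assumes "good g"
  obtains \<epsilon> where "\<epsilon> > 0" "\<And>y. ghat g [] $ y - kron [] y \<in> energy_ge \<epsilon>"
proof -
  obtain \<epsilon> where e: "\<epsilon> > 0" "vge \<epsilon> (g [])" and g: "\<And>w. vge 0 (g w)" using assms unfolding good_def by blast
  show thesis
  proof (rule that[OF e(1)])
    fix y show "ghat g [] $ y - kron [] y \<in> energy_ge \<epsilon>"
    proof (cases y)
      case Nil then show ?thesis by (simp add: vnth_ghat[OF assms])
    next
      case (Cons b y')
      have "hat (\<lambda>w. vnth (g w)) [] y \<in> energy_ge (\<epsilon> * (real (length y) - real (length ([] :: 'a list))))"
        by (rule hat_ge) (use g e in \<open>simp_all add: vge_def\<close>)
      then show ?thesis unfolding vnth_ghat[OF assms] using e(1) Cons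
        by (auto simp: kron_def intro: energy_ge_mono)
    qed
  qed
qed

lemma Gh_red:
  fixes g1 :: "'a list \<Rightarrow> 'c vec" and g0 :: "'b list \<Rightarrow> 'd vec"
  assumes g: "good g1" "good g0"
  obtains \<epsilon> where "\<epsilon> > 0" "\<And>v :: 'v. vge \<epsilon> (Gh g1 g0 ([], v, []) - unitv ([], v, []))"
proof -
  obtain e1 where e1: "e1 > 0" "\<And>y. ghat g1 [] $ y - kron [] y \<in> energy_ge e1" using ghat_Nil_red[OF g(1)] by metis
  obtain e0 where e0: "e0 > 0" "\<And>y. ghat g0 [] $ y - kron [] y \<in> energy_ge e0" using ghat_Nil_red[OF g(2)] by metis
  let ?e = "min e1 e0"
  show thesis
  proof (rule that[of ?e])
    fix v :: 'v
    \<comment> \<open>The difference is telescoped, first in the right-hand word and then in the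
      left-hand one.\<close>
    have "Gh g1 g0 ([], v, []) - unitv ([], v, []) =
      app (\<lambda>x. app (\<lambda>z. unitv (x, v, z)) (ghat g0 [] - unitv [])) (ghat g1 []) +
      app (\<lambda>x. unitv (x, v, [])) (ghat g1 [] - unitv [])"
    proof -
      have "app (\<lambda>x. app (\<lambda>z. unitv (x, v, z)) (ghat g0 [] - unitv [])) (ghat g1 []) =
        app (\<lambda>x. app (\<lambda>z. unitv (x, v, z)) (ghat g0 []) - unitv (x, v, [])) (ghat g1 [])"
        by (simp add: app_diff)
      also have "\<dots> = Gh g1 g0 ([], v, []) - app (\<lambda>x. unitv (x, v, [])) (ghat g1 [])"
        unfolding Gh.simps by (rule app_row_diff) (rule bddI[of 0], simp add: vge_ghat[OF g(2)])+
      finally show ?thesis by (simp add: app_diff del: Gh.simps)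
    qed
    moreover have 0: "vge ?e (ghat g0 [] - unitv [])" and 1: "vge ?e (ghat g1 [] - unitv [])"
      unfolding vge_def vnth_diff vnth_unitv
      by (intro allI energy_ge_mono[OF e0(2)], simp) (intro allI energy_ge_mono[OF e1(2)], simp)
    moreover have "vge ?e (app (\<lambda>x. app (\<lambda>z. unitv (x, v, z)) (ghat g0 [] - unitv [])) (ghat g1 []))"
      by (rule vge_app_left[OF vge_ghat[OF g(1)]]) (rule vge_push[OF 0])
    moreover have "vge ?e (app (\<lambda>x. unitv (x, v, [])) (ghat g1 [] - unitv []))" by (rule vge_push[OF 1])
    ultimately show "vge ?e (Gh g1 g0 ([], v, []) - unitv ([], v, []))" by (metis vge_add)
  qed (use e1(1) e0(1) in simp)
qed

text \<open>The pull-back alters n_{0,0} only by inserting letters of g_0(1), which have positive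
  energy. Thus it has the same reduction as M.\<close>

lemma pull_red:
  fixes M :: "('c, 'v, 'd) bimod"
  assumes f: "okfam B1 B0 M M 1 0 (nop M)" and G: "gap_monoid G"
    and s: "\<forall>(u, v, w)\<in>bi_basis B1 B0 M. supported G (nop M u v w)" and g: "good g1" "good g0"
  obtains \<epsilon> where "\<epsilon> > 0" "\<And>v. vge \<epsilon> (bn (pull g1 g0 (vb B1 B0 M)) ([], v, []) - Rm (basis M) (red_bi (nop M)) v)"
proof -
  obtain e where e: "e > 0" "\<And>v. vge e (vphi B1 B0 M (nop M) ([], v, []) - Rm (basis M) (red_bi (nop M)) v)"
    using gap_red[OF f G s] by metis
  obtain e' where e': "e' > 0" "\<And>v :: 'v. vge e' (Gh g1 g0 ([], v, []) - unitv ([], v, []))"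
    using Gh_red[OF g] by metis
  note b = famD(1)[OF fam_vphi[OF f]]
  show thesis
  proof (rule that[of "min e e'"])
    fix v
    let ?n = "vphi B1 B0 M (nop M)"
    have "bn (pull g1 g0 (vb B1 B0 M)) ([], v, []) - Rm (basis M) (red_bi (nop M)) v =
      app ?n (Gh g1 g0 ([], v, []) - unitv ([], v, [])) + (?n ([], v, []) - Rm (basis M) (red_bi (nop M)) v)"
      using b by (simp add: app_diff del: Gh.simps)
    moreover have "vge (min e e') (app ?n (Gh g1 g0 ([], v, []) - unitv ([], v, [])))"
      by (rule vge_app_right[where D = ?n, OF vge_mono[OF e'(2)]], simp, rule vge_vphi[OF f])
    moreover have "vge (min e e') (?n ([], v, []) - Rm (basis M) (red_bi (nop M)) v)"
      by (rule vge_mono[OF e(2)]) simp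
    ultimately show "vge (min e e') (bn (pull g1 g0 (vb B1 B0 M)) ([], v, []) - Rm (basis M) (red_bi (nop M)) v)"
      by (simp only: vge_add)
  qed (use e(1) e'(1) in simp)
qed

section \<open>Homotopic homomorphisms\<close>

lemma is_alg_modelD:
  assumes "is_alg_model A X"
  shows "filtered_ainf (mod_alg X)" "filtered_hom A (mod_alg X) (alg_incl X)"
    "ev \<in> {alg_eval0 X, alg_eval1 X} \<Longrightarrow> filtered_hom (mod_alg X) A ev"
  using assms unfolding is_alg_model_def gapped_ainf_def gapped_hom_def by blast+

lemma is_bi_modelD:
  assumes "is_bi_model A1 A0 M X1 X0 Y"
  shows "gapped_bimod (mod_alg X1) (mod_alg X0) (mod_bi Y)"
    "gapped_bimod_hom Filtered A1 A0 M (mod_alg X1) (mod_alg X0) (mod_bi Y) (alg_incl X1) (alg_incl X0) (bi_incl Y)"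
    "linear_bi A1 A0 M (bi_incl Y)"
    "cochain_homotopy_equiv M (red_bi (nop M)) (mod_bi Y) (red_bi (nop (mod_bi Y))) (red_bi (bi_incl Y))"
    "(ev1, ev0, ev) \<in> {(alg_eval0 X1, alg_eval0 X0, bi_eval0 Y), (alg_eval1 X1, alg_eval1 X0, bi_eval1 Y)} \<Longrightarrow>
      gapped_bimod_hom Filtered (mod_alg X1) (mod_alg X0) (mod_bi Y) A1 A0 M ev1 ev0 ev"
    "(ev1, ev0, ev) \<in> {(alg_eval0 X1, alg_eval0 X0, bi_eval0 Y), (alg_eval1 X1, alg_eval1 X0, bi_eval1 Y)} \<Longrightarrow>
      linear_bi (mod_alg X1) (mod_alg X0) (mod_bi Y) ev"
    "(ev1, ev0, ev) \<in> {(alg_eval0 X1, alg_eval0 X0, bi_eval0 Y), (alg_eval1 X1, alg_eval1 X0, bi_eval1 Y)} \<Longrightarrow>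
      bi_eq A1 A0 M (comp_bi ev (alg_incl X1) (alg_incl X0) (bi_incl Y)) id_bi"
proof -
  note d = assms[unfolded is_bi_model_def]
  show "gapped_bimod (mod_alg X1) (mod_alg X0) (mod_bi Y)"
    "gapped_bimod_hom Filtered A1 A0 M (mod_alg X1) (mod_alg X0) (mod_bi Y) (alg_incl X1) (alg_incl X0) (bi_incl Y)"
    "linear_bi A1 A0 M (bi_incl Y)"
    "cochain_homotopy_equiv M (red_bi (nop M)) (mod_bi Y) (red_bi (nop (mod_bi Y))) (red_bi (bi_incl Y))"
    using d by - (elim conjE, assumption)+
  assume e: "(ev1, ev0, ev) \<in> {(alg_eval0 X1, alg_eval0 X0, bi_eval0 Y), (alg_eval1 X1, alg_eval1 X0, bi_eval1 Y)}"
  note b = bspec[OF conjunct1[OF conjunct2[OF conjunct2[OF conjunct2[OF conjunct2[OF d]]]]] e, unfolded prod.case]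
  show "gapped_bimod_hom Filtered (mod_alg X1) (mod_alg X0) (mod_bi Y) A1 A0 M ev1 ev0 ev"
    "linear_bi (mod_alg X1) (mod_alg X0) (mod_bi Y) ev"
    "bi_eq A1 A0 M (comp_bi ev (alg_incl X1) (alg_incl X0) (bi_incl Y)) id_bi"
    using b by - (elim conjE, assumption)+
qed

text \<open>The model is pulled back along F to a bimodule over A, and N along the composite of the
  evaluation with F, so that the evaluation becomes a homomorphism over the identity. Both
  evaluations are instances; the inclusion and the reduced homotopy serve for either.\<close>

lemma eval_qis:
  fixes A :: "'a ainf" and N :: "('a, 'n, 'a) bimod" and X1 X0 :: "('c, 'a) alg_model"
    and Y :: "('c, 'k, 'c, 'a, 'n, 'a) bi_model"
  assumes A: "filtered_ainf A" and N: "gapped_bimod A A N"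
    and X: "is_alg_model A X1" "is_alg_model A X0" and Y: "is_bi_model A A N X1 X0 Y"
    and F: "filtered_hom A (mod_alg X1) F1" "filtered_hom A (mod_alg X0) F0"
    and ev: "(ev1, ev0, ev) \<in> {(alg_eval0 X1, alg_eval0 X0, bi_eval0 Y), (alg_eval1 X1, alg_eval1 X0, bi_eval1 Y)}"
    and h: "ahom (va A) (va A) h1" "ahom (va A) (va A) h0"
      "\<And>w. w \<in> lists (basis A) \<Longrightarrow> vnth (h1 w) = comp_hom ev1 F1 w"
      "\<And>w. w \<in> lists (basis A) \<Longrightarrow> vnth (h0 w) = comp_hom ev0 F0 w"
    and Q: "wsym A Q"
    and MY_def: "MY = pull (vh A F1) (vh A F0) (vb (mod_alg X1) (mod_alg X0) (mod_bi Y))"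
    and MN_def: "MN = pull h1 h0 (vb A A N)"
    and e_def: "e = (\<lambda>v. vphi (mod_alg X1) (mod_alg X0) (mod_bi Y) ev ([], v, []))"
  shows "hinj (chn fil (basis (mod_bi Y)) Q) (app (hD (va A) MY)) (chn fil (basis N) Q) (app (hD (va A) MN)) (app (tt e))"
    "hsur (chn fil (basis (mod_bi Y)) Q) (app (hD (va A) MY)) (chn fil (basis N) Q) (app (hD (va A) MN)) (app (tt e))"
    "q \<in> hS (va A) (basis (mod_bi Y)) \<Longrightarrow> app (tt e) (hD (va A) MY q) = app (hD (va A) MN) (tt e q)"
proof -
  let ?C1 = "mod_alg X1" and ?C0 = "mod_alg X0" and ?Y = "mod_bi Y"
  note C = is_alg_modelD(1)[OF X(1)] is_alg_modelD(1)[OF X(2)]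
  note Yd = is_bi_modelD[OF Y]
  have Yf: "filtered_bimod ?C1 ?C0 ?Y" and Nf: "filtered_bimod A A N"
    using Yd(1) N unfolding gapped_bimod_def by simp_all
  note okY = okfam_nop[OF Yf] and okN = okfam_nop[OF Nf]
  obtain GY where GY: "gap_monoid GY" "\<forall>(u, v, w)\<in>bi_basis ?C1 ?C0 ?Y. supported GY (nop ?Y u v w)"
    using Yd(1)[unfolded gapped_bimod_def] by (elim conjE exE) (rule that)
  obtain GN where GN: "gap_monoid GN" "\<forall>(u, v, w)\<in>bi_basis A A N. supported GN (nop N u v w)"
    using N[unfolded gapped_bimod_def] by (elim conjE exE) (rule that)
  note lin = Yd(6)[OF ev] and comp = Yd(7)[OF ev] and heq = Yd(4)
  have incb: "bimod_hom Filtered A A N ?C1 ?C0 ?Y (alg_incl X1) (alg_incl X0) (bi_incl Y)"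
    and evb: "bimod_hom Filtered ?C1 ?C0 ?Y A A N ev1 ev0 ev"
    using Yd(2) Yd(5)[OF ev] unfolding gapped_bimod_hom_def by simp_all
  obtain GI GI' where GI': "gap_monoid GI" "if Filtered = Filtered then GI' = GI else gap_set GI GI'"
      "\<forall>(u, v, w)\<in>bi_basis A A N. supported GI' (bi_incl Y u v w)"
    using Yd(2)[unfolded gapped_bimod_hom_def] by (elim conjE exE) (rule that)
  have GI: "gap_monoid GI" "\<forall>(u, v, w)\<in>bi_basis A A N. supported GI (bi_incl Y u v w)"
    using GI' by simp_all
  have okI: "okfam A A N ?Y 0 0 (bi_incl Y)" by (rule bimod_hom_okfam[OF incb]) simp
  have okE: "okfam ?C1 ?C0 ?Y N 0 0 ev" by (rule bimod_hom_okfam[OF evb]) simp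
  have evf: "filtered_hom ?C1 A ev1" "filtered_hom ?C0 A ev0"
    using is_alg_modelD(3)[OF X(1), of ev1] is_alg_modelD(3)[OF X(2), of ev0] ev by auto
  note al = alg_va[OF A] alg_va[OF C(1)] alg_va[OF C(2)]
  note aF = ahom_vh[OF A C(1) F(1)] ahom_vh[OF A C(2) F(2)]
  note aE = ahom_vh[OF C(1) A evf(1)] ahom_vh[OF C(2) A evf(2)]
  note aI = ahom_vh[OF A C(1) is_alg_modelD(2)[OF X(1)]] ahom_vh[OF A C(2) is_alg_modelD(2)[OF X(2)]]
  note gF = ahomD(1)[OF aF(1)] ahomD(1)[OF aF(2)] and gh = ahomD(1)[OF h(1)] ahomD(1)[OF h(2)]
  have bMY: "bim (va A) (va A) MY" unfolding MY_def by (rule bim_pull[OF al(1,1,2,3) aF bim_vb[OF C Yf]])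
  have bMN: "bim (va A) (va A) MN" unfolding MN_def by (rule bim_pull[OF al(1,1,1,1) h(1,2) bim_vb[OF A A Nf]])
  have sel: "bV MY = basis ?Y" "bV MN = basis N" "bv MY = sdeg ?Y" "bv MN = sdeg N"
    unfolding MY_def MN_def by simp_all
  \<comment> \<open>Of the homotopy equivalence of reduced complexes the half on the model side is
    taken: the reduced inclusion composed with S' is homotopic to the identity of
    \<open>mod_bi Y\<close>.\<close>
  obtain S' H where S: "real_map 0 N ?Y (red_bi (bi_incl Y))" and S': "real_map 0 ?Y N S'"
    and Sc: "\<forall>a\<in>basis N. real_comp (red_bi (bi_incl Y)) (red_bi (nop N)) a = real_comp (red_bi (nop ?Y)) (red_bi (bi_incl Y)) a"
    and H: "real_map (- 1) ?Y ?Y H" and Hh: "\<forall>a\<in>basis ?Y. \<forall>c. real_comp (red_bi (bi_incl Y)) S' a c - (if a = c then 1 else 0) =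
        real_comp (red_bi (nop ?Y)) H a c + real_comp H (red_bi (nop ?Y)) a c"
    using heq unfolding cochain_homotopy_equiv_def cochain_map_def cochain_homotopic_id_def by blast
  note mS = real_map_rmat[OF S] and mS' = real_map_rmat[OF S'] and mH = real_map_rmat[OF H]
  note mY = red_rmat[OF okY] and mN = red_rmat[OF okN]
  obtain e1 where e1: "e1 > 0" "\<And>v. vge e1 (bn MY ([], v, []) - Rm (basis ?Y) (red_bi (nop ?Y)) v)"
    using pull_red[OF okY GY gF] unfolding MY_def by metis
  obtain e2 where e2: "e2 > 0" "\<And>v. vge e2 (bn MN ([], v, []) - Rm (basis N) (red_bi (nop N)) v)"
    using pull_red[OF okN GN gh] unfolding MN_def by metis
  obtain e3 where e3: "e3 > 0" "\<And>v. vge e3 (vphi A A N (bi_incl Y) ([], v, []) - Rm (basis N) (red_bi (bi_incl Y)) v)"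
    using gap_red[OF okI GI] by metis
  \<comment> \<open>One constant for three reductions: those of the two pulled-back differentials
    and that of the inclusion.\<close>
  define \<epsilon> where "\<epsilon> = min e1 (min e2 e3)"
  have eps: "\<epsilon> > 0" "\<epsilon> \<le> e1" "\<epsilon> \<le> e2" "\<epsilon> \<le> e3" using e1 e2 e3 by (auto simp: \<epsilon>_def)
  define j where "j v = vphi A A N (bi_incl Y) ([], v, [])" for v
  have be: "bdd e" unfolding e_def by (rule bdd_comp[OF famD(1)[OF fam_vphi[OF okE]]])
  have ej: "app e (j v) = unitv v" if v: "v \<in> basis N" for v
  proof -
    have "vphi A A N id_bi ([], v, []) = app e (j v)" unfolding e_def j_def
      by (rule vphi_comp_linear[OF okI okE lin hrep_vh[OF is_alg_modelD(2)[OF X(1)]]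
        hrep_vh[OF is_alg_modelD(2)[OF X(2)]] aI comp])
    moreover have "vphi A A N id_bi ([], v, []) = unitv v"
    proof -
      have "id_bi ([] :: 'a list) v ([] :: 'a list) = vnth (unitv v)" by (simp add: fun_eq_iff id_bi_def vnth_unitv)
      then show ?thesis using v by (simp add: vphi_def bi_basis_def vof_def vnth_inverse)
    qed
    ultimately show ?thesis by simp
  qed
  have ch: "app (tt e) (hD (va A) MY q) = app (hD (va A) MN) (tt e q)" if q: "q \<in> hS (va A) (basis ?Y)" for q
  proof -
    have hc: "h1 w = comph (vh ?C1 ev1) (vh A F1) w" "h0 w = comph (vh ?C0 ev0) (vh A F0) w" if w: "w \<in> lists (basis A)" for w
      using h(3,4)[OF w] comp_hom_va[OF F(1) evf(1) w A C(1)] comp_hom_va[OF F(2) evf(2) w A C(2)]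
      by (simp_all add: vnth_inject)
    \<comment> \<open>A strict evaluation is unaffected by the pull-back: \<open>Gh\<close> is
      absorbed by \<open>pr\<close>, which leaves e \<otimes> 1 on words.\<close>
    have r: "(\<lambda>t. app (vphi ?C1 ?C0 ?Y ev) (Gh (vh A F1) (vh A F0) t)) = (\<lambda>t. app e (pr t))"
    proof
      fix t
      have l: "vphi ?C1 ?C0 ?Y ev = (\<lambda>t. app e (pr t))"
        unfolding e_def by (rule ext) (rule linear_vphi[OF lin famD(1)[OF fam_vphi[OF okE]]])
      have "app (vphi ?C1 ?C0 ?Y ev) (Gh (vh A F1) (vh A F0) t) = app e (app pr (Gh (vh A F1) (vh A F0) t))"
        unfolding l by (simp add: app_app be)
      then show "app (vphi ?C1 ?C0 ?Y ev) (Gh (vh A F1) (vh A F0) t) = app e (pr t)" by (simp add: pr_Gh[OF gF])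
    qed
    have tt: "Wr (va A) (sdeg ?Y) (\<lambda>t. app e (pr t)) = tt e" by (rule ext) (rule Wr_pr[OF be])
    show ?thesis
      using pull_hom_Wr[OF C A A A Yf Nf evb hrep_vh[OF evf(1)] hrep_vh[OF evf(2)] aE aF h(1,2) hc q]
      unfolding r tt MY_def MN_def .
  qed
  have hty: "app (Rm (basis ?Y) H) (Rm (basis ?Y) (red_bi (nop ?Y)) v) + app (Rm (basis ?Y) (red_bi (nop ?Y))) (Rm (basis ?Y) H v) =
      app (Rm (basis N) (red_bi (bi_incl Y))) (Rm (basis ?Y) S' v) - unitv v" if v: "v \<in> basis ?Y" for v
  proof (rule vec_eqI)
    fix c
    have k: "kron v c = nov_const (if v = c then 1 else 0)" by (simp add: kron_def)
    have d: "nov_const r - nov_const r' = nov_const (r + - r')" for r r'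
      by (simp only: nov_const_add nov_const_minus diff_conv_add_uminus)
    have "real_comp H (red_bi (nop ?Y)) v c + real_comp (red_bi (nop ?Y)) H v c =
        real_comp (red_bi (bi_incl Y)) S' v c + - (if v = c then 1 else 0)"
      using Hh v by simp
    then show "(app (Rm (basis ?Y) H) (Rm (basis ?Y) (red_bi (nop ?Y)) v) + app (Rm (basis ?Y) (red_bi (nop ?Y))) (Rm (basis ?Y) H v)) $ c =
      (app (Rm (basis N) (red_bi (bi_incl Y))) (Rm (basis ?Y) S' v) - unitv v) $ c"
      unfolding vnth_add vnth_diff Rm_comp[OF mY mH v] Rm_comp[OF mH mY v] Rm_comp[OF mS' mS v] vnth_unitv k d
        nov_const_add[symmetric] by (simp only:)
  qed
  have jch: "app (Rm (basis ?Y) (red_bi (nop ?Y))) (Rm (basis N) (red_bi (bi_incl Y)) v) =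
      app (Rm (basis N) (red_bi (bi_incl Y))) (Rm (basis N) (red_bi (nop N)) v)" if v: "v \<in> basis N" for v
    by (rule vec_eqI) (simp add: Rm_comp[OF mS mY v] Rm_comp[OF mN mS v] bspec[OF Sc v])
  have off: "([], v, []) \<notin> bi_basis B1 B0 K" if "v \<notin> basis K" for v :: 'x and K :: "('x, 'z) gmod_scheme" and B1 :: "'y ainf" and B0 :: "'y2 ainf"
    using that by (simp add: bi_basis_def)
  have pj': "par (sdeg ?Y) (sdeg N v + 0) (j v)" for v
    using famD(2)[OF fam_vphi[OF okI], of "([], v, [])"] by (simp add: tdeg_def j_def)
  \<comment> \<open>H has degree -1, while \<open>eval_iso\<close> asks for parity 1; the two agree
    modulo 2.\<close>
  have pH: "par (sdeg ?Y) (sdeg ?Y v + 1) (Rm (basis ?Y) H v)" for v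
  proof -
    have "even (x - (y + - 1)) \<longleftrightarrow> even (x - (y + 1))" for x y :: int by presburger
    then show ?thesis using par_Rm[OF H, of v] unfolding par_def by (simp only:)
  qed
  note iso = eval_iso[where e = e and j = j and h = "Rm (basis ?Y) H" and s = "Rm (basis ?Y) S'"
      and dY = "Rm (basis ?Y) (red_bi (nop ?Y))" and dN = "Rm (basis N) (red_bi (nop N))"
      and jr = "Rm (basis N) (red_bi (bi_incl Y))" and \<epsilon> = \<epsilon> and fil = fil,
      OF al(1) bMY bMN wsymD(1)[OF Q] eps(1), unfolded sel]
  have ve: "vge 0 (e v)" for v unfolding e_def by (rule vge_vphi[OF okE])
  have vj: "vge 0 (j v)" for v unfolding j_def by (rule vge_vphi[OF okI])
  have se: "supv (basis N) (e v)" for v unfolding e_def by (rule famD(3)[OF fam_vphi[OF okE]])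
  have sj: "supv (basis ?Y) (j v)" for v unfolding j_def by (rule famD(3)[OF fam_vphi[OF okI]])
  have ze: "v \<notin> basis ?Y \<Longrightarrow> e v = 0" for v unfolding e_def by (rule vphi_off) (simp add: bi_basis_def)
  have zj: "v \<notin> basis N \<Longrightarrow> j v = 0" for v unfolding j_def by (rule vphi_off) (simp add: bi_basis_def)
  have r3: "vge \<epsilon> (j v - Rm (basis N) (red_bi (bi_incl Y)) v)" for v unfolding j_def by (rule vge_mono[OF e3(2) eps(4)])
  note iso' = iso[OF ve vj vge_Rm vge_Rm vge_Rm vge_Rm vge_Rm se sj supv_Rm[OF mH] supv_Rm[OF mS'] ze zj Rm_off
    pj' pH ej vge_mono[OF e1(2) eps(2)] vge_mono[OF e2(2) eps(3)] r3 hty jch ch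
    pj_hD[OF A Q bMY, unfolded sel] pj_hD[OF A Q bMN, unfolded sel]]
  show "hinj (chn fil (basis ?Y) Q) (app (hD (va A) MY)) (chn fil (basis N) Q) (app (hD (va A) MN)) (app (tt e))"
    by (rule iso'(1))
  show "hsur (chn fil (basis ?Y) Q) (app (hD (va A) MY)) (chn fil (basis N) Q) (app (hD (va A) MN)) (app (tt e))"
    by (rule iso'(2))
  show "q \<in> hS (va A) (basis ?Y) \<Longrightarrow> app (tt e) (hD (va A) MY q) = app (hD (va A) MN) (tt e q)" by (rule ch)
qed

text \<open>If \<open>W\<close> is a section of the quasi-isomorphism \<open>E1\<close>, it is inverse to it on homology.\<close>

lemma section_qis:
  fixes E1 :: "'y::ab_group_add \<Rightarrow> 'x::ab_group_add" and E0 :: "'y \<Rightarrow> 'z::ab_group_add"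
  assumes add: "addh W" "addh E1" "addh E0" "addh DY" "addh D'" "addh D"
    and S: "subgrp SY" "subgrp S'"
    and maps: "\<And>x. x \<in> S \<Longrightarrow> W x \<in> SY" "\<And>y. y \<in> SY \<Longrightarrow> E1 y \<in> S" "\<And>y. y \<in> SY \<Longrightarrow> E0 y \<in> S'"
    and ch: "\<And>x. x \<in> S \<Longrightarrow> W (D x) = DY (W x)" "\<And>y. y \<in> SY \<Longrightarrow> E1 (DY y) = D (E1 y)"
      "\<And>y. y \<in> SY \<Longrightarrow> E0 (DY y) = D' (E0 y)"
    and id: "\<And>x. x \<in> S \<Longrightarrow> E1 (W x) = x" and z: "0 \<in> S"
    and q1: "hinj SY DY S D E1" and q0: "hinj SY DY S' D' E0" "hsur SY DY S' D' E0"
  shows "hinj S D S' D' (\<lambda>x. E0 (W x))" "hsur S D S' D' (\<lambda>x. E0 (W x))"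
proof -
  note aW = addhD[OF add(1)] and a1 = addhD[OF add(2)] and a0 = addhD[OF add(3)]
    and aY = addhD[OF add(4)] and a' = addhD[OF add(5)] and aD = addhD[OF add(6)]
  show "hinj S D S' D' (\<lambda>x. E0 (W x))"
    unfolding hinj_def
  proof (intro ballI impI)
    fix x assume x: "x \<in> S" "D x = 0" and b: "\<exists>z\<in>S'. E0 (W x) = D' z"
    have "DY (W x) = 0" using ch(1)[OF x(1)] x(2) aW(2) by simp
    then obtain u where u: "u \<in> SY" "W x = DY u" using q0(1) maps(1)[OF x(1)] b unfolding hinj_def by blast
    then have "x = D (E1 u)" using id[OF x(1)] ch(2)[OF u(1)] by simp
    then show "\<exists>u\<in>S. x = D u" using maps(2)[OF u(1)] by blast
  qed
  show "hsur S D S' D' (\<lambda>x. E0 (W x))"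
    unfolding hsur_def
  proof (intro ballI impI)
    fix y assume y: "y \<in> S'" "D' y = 0"
    then obtain y' z where y': "y' \<in> SY" "DY y' = 0" "z \<in> S'" "E0 y' = y + D' z" using q0(2) unfolding hsur_def by blast
    define x where "x = E1 y'"
    have x: "x \<in> S" "D x = 0" using maps(2)[OF y'(1)] ch(2)[OF y'(1)] y'(2) a1(2) by (simp_all add: x_def)
    let ?d = "W x - y'"
    have d: "?d \<in> SY" "DY ?d = 0" "E1 ?d = D 0"
      using subgrpD(2)[OF S(1) maps(1)[OF x(1)] y'(1)] ch(1)[OF x(1)] x(2) y'(2) id[OF x(1)]
      by (simp_all add: aY(4) aW(2) a1(4) aD(2) x_def)
    \<comment> \<open>W x and y' are cycles with the same image under E1, so they differ by a
      boundary, and E0 (W x) represents the class of y.\<close>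
    then obtain u where u: "u \<in> SY" "?d = DY u" using q1 z unfolding hinj_def by blast
    have "E0 (W x) = E0 y' + E0 ?d" by (simp add: a0(4))
    also have "\<dots> = y + D' (z + E0 u)" using y'(4) u ch(3)[OF u(1)] by (simp add: a'(1))
    finally show "\<exists>x\<in>S. D x = 0 \<and> (\<exists>z\<in>S'. E0 (W x) = y + D' z)"
      using x subgrpD(4)[OF S(2) y'(3) maps(3)[OF u(1)]] by blast
  qed
qed

text \<open>Injectivity of P is inherited from \<Psi> P. For surjectivity, a class y is compared
  with P x for an x such that \<Psi> (P x) is homologous to \<Psi> y; injectivity of P' \<Psi> then
  makes P x homologous to y.\<close>

lemma two_of_six:
  fixes P :: "'m::ab_group_add \<Rightarrow> 'n::ab_group_add" and \<Psi> :: "'n \<Rightarrow> 'g::ab_group_add" and P' :: "'g \<Rightarrow> 'h::ab_group_add"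
  assumes add: "addh P" "addh \<Psi>" "addh DN" "addh DM" and S: "subgrp SN"
    and maps: "\<And>x. x \<in> SM \<Longrightarrow> P x \<in> SN" "\<And>y. y \<in> SN \<Longrightarrow> \<Psi> y \<in> SG" "\<And>z. z \<in> SG \<Longrightarrow> P' z \<in> SH"
    and ch: "\<And>x. x \<in> SM \<Longrightarrow> P (DM x) = DN (P x)" "\<And>y. y \<in> SN \<Longrightarrow> \<Psi> (DN y) = DG (\<Psi> y)"
      "\<And>z. z \<in> SG \<Longrightarrow> P' (DG z) = DH (P' z)"
    and dg: "DG 0 = 0"
    and X2: "hinj SM DM SG DG X2" "hsur SM DM SG DG X2" "\<And>x. x \<in> SM \<Longrightarrow> X2 x = \<Psi> (P x)"
    and X1: "hinj SN DN SH DH X1" "\<And>y. y \<in> SN \<Longrightarrow> X1 y = P' (\<Psi> y)"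
  shows "hinj SM DM SN DN P" "hsur SM DM SN DN P"
proof -
  note aP = addhD[OF add(1)] and a\<Psi> = addhD[OF add(2)] and aN = addhD[OF add(3)]
  show "hinj SM DM SN DN P"
    unfolding hinj_def
  proof (intro ballI impI)
    fix x assume x: "x \<in> SM" "DM x = 0" and "\<exists>z\<in>SN. P x = DN z"
    then obtain z where z: "z \<in> SN" "P x = DN z" by blast
    have "X2 x = DG (\<Psi> z)" using X2(3)[OF x(1)] z ch(2)[OF z(1)] by simp
    then show "\<exists>u\<in>SM. x = DM u" using X2(1) x maps(2)[OF z(1)] unfolding hinj_def by blast
  qed
  show "hsur SM DM SN DN P"
    unfolding hsur_def
  proof (intro ballI impI)
    fix y assume y: "y \<in> SN" "DN y = 0"
    have "DG (\<Psi> y) = 0" using ch(2)[OF y(1)] y(2) a\<Psi>(2) by simp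
    then obtain x z where x: "x \<in> SM" "DM x = 0" "z \<in> SG" "X2 x = \<Psi> y + DG z"
      using X2(2) maps(2)[OF y(1)] unfolding hsur_def by blast
    let ?d = "P x - y"
    have d: "?d \<in> SN" using subgrpD(2)[OF S maps(1)[OF x(1)] y(1)] .
    have Dd: "DN ?d = 0" using ch(1)[OF x(1)] x(2) y(2) by (simp add: aN(4) aP(2))
    have "\<Psi> ?d = DG z" using x(4) X2(3)[OF x(1)] by (simp add: a\<Psi>(4))
    then have "X1 ?d = DH (P' z)" using X1(2)[OF d] ch(3)[OF x(3)] by simp
    then obtain u where u: "u \<in> SN" "?d = DN u" using X1(1) d Dd maps(3)[OF x(3)] unfolding hinj_def by blast
    have "P x = y + DN u" using u(2) by (simp add: algebra_simps)
    then show "\<exists>x\<in>SM. DM x = 0 \<and> (\<exists>z\<in>SN. P x = y + DN z)" using x(1,2) u(1) by blast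
  qed
qed

lemma tt_Wr:
  assumes e: "bdd e" shows "app (tt e) (Wr A dv \<alpha> q) = Wr A dv (\<lambda>t. app e (\<alpha> t)) q"
proof -
  obtain v w where q: "q = (v, w)" by (cases q)
  note b = bdd_tt[OF e]
  show ?thesis unfolding q Wr.simps app_ssum[OF b] app_scale[OF b] app_push[OF b] tt.simps
    by (intro ssum_cong arg_cong[of _ _ "vscale _"]) (simp add: app_app e)
qed

lemma Wr_cong:
  assumes "\<And>t. t \<in> lists (aX A) \<times> V \<times> lists (aX A) \<Longrightarrow> \<alpha> t = \<beta> t" "q \<in> hS A V"
  shows "Wr A dv \<alpha> q = Wr A dv \<beta> q"
proof -
  obtain v w where q: "q = (v, w)" "v \<in> V" "w \<in> lists (aX A)" using assms(2) by (auto simp: hS_def)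
  show ?thesis unfolding q(1) Wr.simps
  proof (intro ssum_cong)
    fix x l r z assume "x @ l = w" "r @ z = x"
    then have "\<alpha> (l, v, r) = \<beta> (l, v, r)" using q by (intro assms(1)) auto
    then show "ksign (wd (ad A) l * (dv v + wd (ad A) x)) *v app (\<lambda>y. unitv (y, z)) (\<alpha> (l, v, r)) =
      ksign (wd (ad A) l * (dv v + wd (ad A) x)) *v app (\<lambda>y. unitv (y, z)) (\<beta> (l, v, r))" by simp
  qed
qed

lemma chn_chain:
  assumes Q: "wsym A Q" and x: "x \<in> chn fil V Q" and b: "bdd R" "bdd D" "bdd D'"
    and r: "\<And>q. q \<in> hS (va A) V \<Longrightarrow> app R (D q) = app D' (R q)"
  shows "app R (app D x) = app D' (app R x)"
  unfolding app_app[OF b(2,1)] app_app[OF b(1,3)]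
  by (rule app_cong_supv[OF chn_supv[OF wsymD(1)[OF Q] x] r])

lemma chn_Wr:
  assumes Q: "wsym A Q" and a: "bdd \<alpha>" "\<And>t. supv U (\<alpha> t)" "fil \<Longrightarrow> (\<forall>t. vge 0 (\<alpha> t))" and x: "x \<in> chn fil V Q"
  shows "app (Wr (va A) dv \<alpha>) x \<in> chn fil U Q"
  by (rule chn_map[OF wsymD(1)[OF Q] bdd_Wr[OF a(1)] _ pj_Wr[OF Q a(1,2)] x]) (use a(3) vge_Wr in blast)

lemma okfam_fil:
  assumes "bimod_hom \<kappa> A1 A0 M B1 B0 N f1 f0 \<phi>"
  shows "\<kappa> = Filtered \<Longrightarrow> (\<forall>t. vge 0 (vphi A1 A0 M \<phi> t))"
proof -
  obtain c where c: "okfam A1 A0 M N 0 (- c) \<phi>" "\<kappa> = Filtered \<Longrightarrow> c = 0" using bimod_hom_okfam[OF assms] by metis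
  show "\<kappa> = Filtered \<Longrightarrow> (\<forall>t. vge 0 (vphi A1 A0 M \<phi> t))" using vge_vphi[OF c(1)] c(2) by simp
qed

lemma is_homotopyD:
  assumes "is_homotopy A B f g X F"
  shows "is_alg_model B X" "filtered_hom A (mod_alg X) F"
    "w \<in> lists (basis A) \<Longrightarrow> comp_hom (alg_eval0 X) F w = f w"
    "w \<in> lists (basis A) \<Longrightarrow> comp_hom (alg_eval1 X) F w = g w"
  using assms unfolding is_homotopy_def gapped_hom_def hom_eq_def by simp_all

lemma idg_id: "vnth (idg w) = id_hom w"
  by (simp add: fun_eq_iff vnth_idg id_hom_def)

text \<open>The lift \<Phi> gives one chain map W into the pulled-back model. Followed by the
  evaluation at s = 1 it is the identity, followed by the one at s = 0 it is the map of \<chi>. Both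
  evaluations are isomorphisms on homology, so \<open>section_qis\<close> applies.\<close>

lemma homotopic_qis:
  fixes A :: "'a ainf" and N :: "('a, 'n, 'a) bimod"
  assumes A: "filtered_ainf A" and N: "gapped_bimod A A N"
    and hom: "homotopic_bi TYPE('c) TYPE('k) \<kappa> A A N A A N f1 f0 \<chi> id_hom id_hom id_bi"
    and h: "ahom (va A) (va A) h1" "ahom (va A) (va A) h0"
      "\<And>w. w \<in> lists (basis A) \<Longrightarrow> vnth (h1 w) = f1 w" "\<And>w. w \<in> lists (basis A) \<Longrightarrow> vnth (h0 w) = f0 w"
    and Q: "wsym A Q"
  shows "hinj (chn (\<kappa> = Filtered) (basis N) Q) (app (hD (va A) (vb A A N)))
      (chn (\<kappa> = Filtered) (basis N) Q) (app (hD (va A) (pull h1 h0 (vb A A N)))) (app (Wr (va A) (sdeg N) (vphi A A N \<chi>)))"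
    "hsur (chn (\<kappa> = Filtered) (basis N) Q) (app (hD (va A) (vb A A N)))
      (chn (\<kappa> = Filtered) (basis N) Q) (app (hD (va A) (pull h1 h0 (vb A A N)))) (app (Wr (va A) (sdeg N) (vphi A A N \<chi>)))"
proof -
  obtain X1 :: "('c, 'a) alg_model" and F1 and X0 :: "('c, 'a) alg_model" and F0
      and Y :: "('c, 'k, 'c, 'a, 'n, 'a) bi_model" and \<Phi>
    where H: "is_homotopy A A f1 id_hom X1 F1" "is_homotopy A A f0 id_hom X0 F0" "is_bi_model A A N X1 X0 Y"
      and P: "gapped_bimod_hom \<kappa> A A N (mod_alg X1) (mod_alg X0) (mod_bi Y) F1 F0 \<Phi>"
      and E: "bi_eq A A N (comp_bi (bi_eval0 Y) F1 F0 \<Phi>) \<chi>" "bi_eq A A N (comp_bi (bi_eval1 Y) F1 F0 \<Phi>) id_bi"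
    using hom[unfolded homotopic_bi_def] by (elim conjE exE) (rule that)
  let ?C1 = "mod_alg X1" and ?C0 = "mod_alg X0" and ?Y = "mod_bi Y" and ?fil = "\<kappa> = Filtered"
  note D1 = is_homotopyD[OF H(1)] and D0 = is_homotopyD[OF H(2)] and Yd = is_bi_modelD[OF H(3)]
  note C = is_alg_modelD(1)[OF D1(1)] is_alg_modelD(1)[OF D0(1)]
  note al = alg_va[OF A] alg_va[OF C(1)] alg_va[OF C(2)]
  note aF = ahom_vh[OF A C(1) D1(2)] ahom_vh[OF A C(2) D0(2)] and rF = hrep_vh[OF D1(2)] hrep_vh[OF D0(2)]
  have Yf: "filtered_bimod ?C1 ?C0 ?Y" and Nf: "filtered_bimod A A N"
    using Yd(1) N unfolding gapped_bimod_def by simp_all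
  have Pb: "bimod_hom \<kappa> A A N ?C1 ?C0 ?Y F1 F0 \<Phi>" using P unfolding gapped_bimod_hom_def by simp
  obtain c where okP: "okfam A A N ?Y 0 (- c) \<Phi>" by (rule bimod_hom_okfam[OF Pb])
  have m0: "(alg_eval0 X1, alg_eval0 X0, bi_eval0 Y) \<in> {(alg_eval0 X1, alg_eval0 X0, bi_eval0 Y), (alg_eval1 X1, alg_eval1 X0, bi_eval1 Y)}"
    and m1: "(alg_eval1 X1, alg_eval1 X0, bi_eval1 Y) \<in> {(alg_eval0 X1, alg_eval0 X0, bi_eval0 Y), (alg_eval1 X1, alg_eval1 X0, bi_eval1 Y)}"
    by simp_all
  have eb: "bimod_hom Filtered ?C1 ?C0 ?Y A A N (alg_eval0 X1) (alg_eval0 X0) (bi_eval0 Y)"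
    "bimod_hom Filtered ?C1 ?C0 ?Y A A N (alg_eval1 X1) (alg_eval1 X0) (bi_eval1 Y)"
    using Yd(5)[OF m0] Yd(5)[OF m1] unfolding gapped_bimod_hom_def by simp_all
  have ok0: "okfam ?C1 ?C0 ?Y N 0 0 (bi_eval0 Y)" by (rule bimod_hom_okfam[OF eb(1)]) simp
  have ok1: "okfam ?C1 ?C0 ?Y N 0 0 (bi_eval1 Y)" by (rule bimod_hom_okfam[OF eb(2)]) simp
  define VN where "VN = vb A A N"
  define MY where "MY = pull (vh A F1) (vh A F0) (vb ?C1 ?C0 ?Y)"
  define M0 where "M0 = pull h1 h0 (vb A A N)"
  define e0 where "e0 = (\<lambda>v. vphi ?C1 ?C0 ?Y (bi_eval0 Y) ([], v, []))"
  define e1 where "e1 = (\<lambda>v. vphi ?C1 ?C0 ?Y (bi_eval1 Y) ([], v, []))"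
  define W where "W = Wr (va A) (sdeg N) (vphi A A N \<Phi>)"
  have bN: "bim (va A) (va A) VN" unfolding VN_def by (rule bim_vb[OF A A Nf])
  have bY: "bim (va A) (va A) MY" unfolding MY_def by (rule bim_pull[OF al(1,1,2,3) aF bim_vb[OF C Yf]])
  have b0: "bim (va A) (va A) M0" unfolding M0_def by (rule bim_pull[OF al(1,1,1,1) h(1,2) bim_vb[OF A A Nf]])
  \<comment> \<open>N is written as a pull-back along the identity, because the homotopies of
    algebras end at the identity for s = 1.\<close>
  have V: "VN = pull idg idg (vb A A N)" unfolding VN_def by (rule pull_idg[OF bim_vb[OF A A Nf], symmetric])
  note i0 = eval_qis(1,2)[OF A N D1(1) D0(1) H(3) D1(2) D0(2) m0 h(1,2) _ _ Q MY_def M0_def e0_def, where fil = ?fil]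
    and k0 = eval_qis(3)[OF A N D1(1) D0(1) H(3) D1(2) D0(2) m0 h(1,2) _ _ Q MY_def M0_def e0_def]
  have q0: "hinj (chn ?fil (basis ?Y) Q) (app (hD (va A) MY)) (chn ?fil (basis N) Q) (app (hD (va A) M0)) (app (tt e0))"
    "hsur (chn ?fil (basis ?Y) Q) (app (hD (va A) MY)) (chn ?fil (basis N) Q) (app (hD (va A) M0)) (app (tt e0))"
    by (rule i0(1,2), simp only: h(3) D1(3), simp only: h(4) D0(3))+
  have c0: "app (tt e0) (hD (va A) MY q) = app (hD (va A) M0) (tt e0 q)" if "q \<in> hS (va A) (basis ?Y)" for q
    by (rule k0[OF _ _ that], simp only: h(3) D1(3), simp only: h(4) D0(3))
  note i1 = eval_qis(1,2)[OF A N D1(1) D0(1) H(3) D1(2) D0(2) m1 ahom_idg[OF al(1)] ahom_idg[OF al(1)] _ _ Q MY_def V e1_def, where fil = ?fil]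
    and k1 = eval_qis(3)[OF A N D1(1) D0(1) H(3) D1(2) D0(2) m1 ahom_idg[OF al(1)] ahom_idg[OF al(1)] _ _ Q MY_def V e1_def]
  have q1: "hinj (chn ?fil (basis ?Y) Q) (app (hD (va A) MY)) (chn ?fil (basis N) Q) (app (hD (va A) VN)) (app (tt e1))"
    by (rule i1(1), simp only: idg_id D1(4), simp only: idg_id D0(4))
  have c1: "app (tt e1) (hD (va A) MY q) = app (hD (va A) VN) (tt e1 q)" if "q \<in> hS (va A) (basis ?Y)" for q
    by (rule k1[OF _ _ that], simp only: idg_id D1(4), simp only: idg_id D0(4))
  have ve: "vge 0 (e0 v)" "vge 0 (e1 v)" for v unfolding e0_def e1_def by (rule vge_vphi[OF ok0], rule vge_vphi[OF ok1])
  have be: "bdd e0" "bdd e1" using ve by (auto intro: bddI)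
  have se: "supv (basis N) (e0 v)" "supv (basis N) (e1 v)" for v
    unfolding e0_def e1_def by (rule famD(3)[OF fam_vphi[OF ok0]], rule famD(3)[OF fam_vphi[OF ok1]])
  have ze: "v \<notin> basis ?Y \<Longrightarrow> e0 v = 0" "v \<notin> basis ?Y \<Longrightarrow> e1 v = 0" for v
    unfolding e0_def e1_def by (rule vphi_off, simp add: bi_basis_def)+
  note fP = fam_vphi[OF okP]
  note bW = bdd_Wr[OF famD(1)[OF fP], of "va A" "sdeg N", folded W_def]
  have x0: "vphi A A N \<chi> t = app e0 (vphi A A N \<Phi> t)" for t
    unfolding e0_def by (rule vphi_comp_linear[OF okP ok0 Yd(6)[OF m0] rF aF E(1)])
  have x1: "vphi A A N id_bi t = app e1 (vphi A A N \<Phi> t)" for t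
    unfolding e1_def by (rule vphi_comp_linear[OF okP ok1 Yd(6)[OF m1] rF aF E(2)])
  have EW0: "app (tt e0) (app W x) = app (Wr (va A) (sdeg N) (vphi A A N \<chi>)) x" for x
    unfolding app_app[OF bW bdd_tt[OF be(1)]] unfolding W_def tt_Wr[OF be(1)] x0[symmetric] ..
  \<comment> \<open>\<Phi> evaluates at s = 1 to \<open>id_bi\<close>, whose translation is
    \<open>pr\<close> on basis words, and \<open>Wr_pr\<close> turns this into the identity on
    chains.\<close>
  have EW1: "app (tt e1) (app W x) = x" if x: "x \<in> chn ?fil (basis N) Q" for x
  proof -
    have "app (tt e1) (app W x) = app (\<lambda>q. app (tt e1) (W q)) x" by (rule app_app[OF bW bdd_tt[OF be(2)]])
    also have "\<dots> = app unitv x"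
    proof (rule app_cong_supv[OF chn_supv[OF wsymD(1)[OF Q] x]])
      fix q assume q: "q \<in> hS (va A) (basis N)"
      have "app (tt e1) (W q) = Wr (va A) (sdeg N) (vphi A A N id_bi) q"
        unfolding W_def tt_Wr[OF be(2)] x1[symmetric] ..
      also have "\<dots> = Wr (va A) (sdeg N) (\<lambda>t. app unitv (pr t)) q"
      proof (rule Wr_cong[OF _ q])
        fix t assume t: "t \<in> lists (aX (va A)) \<times> basis N \<times> lists (aX (va A))"
        obtain u v w where t': "t = (u, v, w)" by (cases t)
        have "id_bi u v w = vnth (pr (u, v, w))" by (auto simp: fun_eq_iff id_bi_def vnth_unitv kron_def)
        then show "vphi A A N id_bi t = app unitv (pr t)"
          using t unfolding t' by (simp add: vphi_def bi_basis_def vof_def vnth_inverse app_unitv_row del: pr.simps in_lists_conv_set)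
      qed
      also have "\<dots> = unitv q" unfolding Wr_pr[OF bdd_unitv'] by (cases q) simp
      finally show "app (tt e1) (W q) = unitv q" .
    qed
    finally show ?thesis by (simp add: app_unitv_row)
  qed
  have WS: "app W x \<in> chn ?fil (basis ?Y) Q" if "x \<in> chn ?fil (basis N) Q" for x
    unfolding W_def by (rule chn_Wr[OF Q famD(1)[OF fP] famD(3)[OF fP] okfam_fil[OF Pb] that])
  have eS: "app (tt e0) y \<in> chn ?fil (basis N) Q" "app (tt e1) y \<in> chn ?fil (basis N) Q" if "y \<in> chn ?fil (basis ?Y) Q" for y
    by (rule chn_tt[OF wsymD(1)[OF Q] ve(1) se(1) ze(1) that], assumption)
      (rule chn_tt[OF wsymD(1)[OF Q] ve(2) se(2) ze(2) that], assumption)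
  note bh = bdd_hD[OF al(1) bimD(1)[OF bN]] bdd_hD[OF al(1) bimD(1)[OF bY]] bdd_hD[OF al(1) bimD(1)[OF b0]]
  have cW: "app W (app (hD (va A) VN) x) = app (hD (va A) MY) (app W x)" if x: "x \<in> chn ?fil (basis N) Q" for x
    by (rule chn_chain[OF Q x bW bh(1,2)])
      (unfold W_def VN_def MY_def, rule hom_Wr[OF C A Nf Yf Pb rF aF])
  have ec: "app (tt e0) (app (hD (va A) MY) y) = app (hD (va A) M0) (app (tt e0) y)"
    "app (tt e1) (app (hD (va A) MY) y) = app (hD (va A) VN) (app (tt e1) y)" if y: "y \<in> chn ?fil (basis ?Y) Q" for y
    by (rule chn_chain[OF Q y bdd_tt[OF be(1)] bh(2,3) c0], assumption)
      (rule chn_chain[OF Q y bdd_tt[OF be(2)] bh(2,1) c1], assumption)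
  note r = section_qis[OF addh_app[OF bW] addh_app[OF bdd_tt[OF be(2)]] addh_app[OF bdd_tt[OF be(1)]]
      addh_app[OF bh(2)] addh_app[OF bh(3)] addh_app[OF bh(1)]
      subgrp_chn[OF wsymD(1)[OF Q]] subgrp_chn[OF wsymD(1)[OF Q]] WS eS(2) eS(1) cW ec(2) ec(1) EW1
      subgrpD(1)[OF subgrp_chn[OF wsymD(1)[OF Q]]] q1 q0, unfolded EW0 VN_def M0_def]
  show "hinj (chn ?fil (basis N) Q) (app (hD (va A) (vb A A N)))
      (chn ?fil (basis N) Q) (app (hD (va A) (pull h1 h0 (vb A A N)))) (app (Wr (va A) (sdeg N) (vphi A A N \<chi>)))"
    by (rule r(1))
  show "hsur (chn ?fil (basis N) Q) (app (hD (va A) (vb A A N)))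
      (chn ?fil (basis N) Q) (app (hD (va A) (pull h1 h0 (vb A A N)))) (app (Wr (va A) (sdeg N) (vphi A A N \<chi>)))"
    by (rule r(2))
qed

section \<open>Isomorphisms on homology\<close>

lemma comp_id_left: "comp_hom id_hom g w = g w"
proof
  fix b
  have "comp_hom id_hom g w b = nov_sum (\<lambda>y. hat g w y * kron y [b])"
    by (simp add: comp_hom_def lin_def id_hom_def)
  also have "\<dots> = hat g w [b]" by (subst nov_sum_single[of "[b]"]) (auto simp: kron_def)
  finally show "comp_hom id_hom g w b = g w b" by (simp only: hat_singleton)
qed

lemma comp_id_right:
  fixes A :: "'a ainf"
  assumes "w \<in> lists (basis A)" shows "comp_hom g id_hom w = g w"
proof
  fix b
  have "hat id_hom w y = kron w y" for y
    using hrep_id[of A] assms unfolding hrep_def ghat_idg by (metis vnth_unitv)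
  then have "comp_hom g id_hom w b = nov_sum (\<lambda>y. kron w y * g y b)"
    by (simp add: comp_hom_def lin_def)
  also have "\<dots> = g w b" by (subst nov_sum_single[of w]) (auto simp: kron_def)
  finally show "comp_hom g id_hom w b = g w b" .
qed

text \<open>The homotopy inverse \<psi> covers (g1, g0), which is only homotopic to the identity of
  A, so \<psi> leads to the pull-back of M instead of M. The maps \<phi>, \<psi> and the pull-back
  of \<phi> form a sequence of three, whose two composites of neighbours are isomorphisms on
  homology by \<open>homotopic_qis\<close>; \<open>two_of_six\<close> gives the rest.\<close>

lemma homotopy_equivalence_qis:
  fixes A :: "'a ainf" and M :: "('a, 'm, 'a) bimod" and N :: "('a, 'n, 'a) bimod"
  assumes A: "filtered_ainf A" and M: "gapped_bimod A A M" and N: "gapped_bimod A A N"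
    and f: "gapped_bimod_hom \<kappa> A A M A A N id_hom id_hom \<phi>"
    and eq: "homotopy_equivalence_bi TYPE('c) TYPE('k) \<kappa> A A M A A N id_hom id_hom \<phi>"
    and Q: "wsym A Q"
  defines "W \<equiv> Wr (va A) (sdeg M) (vphi A A M \<phi>)"
  shows "hinj (chn (\<kappa> = Filtered) (basis M) Q) (app (hD (va A) (vb A A M)))
      (chn (\<kappa> = Filtered) (basis N) Q) (app (hD (va A) (vb A A N))) (app W)"
    "hsur (chn (\<kappa> = Filtered) (basis M) Q) (app (hD (va A) (vb A A M)))
      (chn (\<kappa> = Filtered) (basis N) Q) (app (hD (va A) (vb A A N))) (app W)"
    "x \<in> chn (\<kappa> = Filtered) (basis M) Q \<Longrightarrow> app W x \<in> chn (\<kappa> = Filtered) (basis N) Q"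
    "x \<in> chn (\<kappa> = Filtered) (basis M) Q \<Longrightarrow>
      app W (app (hD (va A) (vb A A M)) x) = app (hD (va A) (vb A A N)) (app W x)"
proof -
  let ?fil = "\<kappa> = Filtered"
  obtain g1 g0 \<psi> where G: "homotopy_inverse TYPE('c) A A id_hom g1" "homotopy_inverse TYPE('c) A A id_hom g0"
      and P: "gapped_bimod_hom \<kappa> A A N A A M g1 g0 \<psi>"
      and H1: "homotopic_bi TYPE('c) TYPE('k) \<kappa> A A N A A N
          (comp_hom id_hom g1) (comp_hom id_hom g0) (comp_bi \<phi> g1 g0 \<psi>) id_hom id_hom id_bi"
      and H2: "homotopic_bi TYPE('c) TYPE('k) \<kappa> A A M A A M
          (comp_hom g1 id_hom) (comp_hom g0 id_hom) (comp_bi \<psi> id_hom id_hom \<phi>) id_hom id_hom id_bi"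
    using eq[unfolded homotopy_equivalence_bi_def] by (elim conjE exE) (rule that)
  have g: "filtered_hom A A g1" "filtered_hom A A g0"
    using G unfolding homotopy_inverse_def gapped_hom_def by simp_all
  have Mf: "filtered_bimod A A M" and Nf: "filtered_bimod A A N"
    using M N unfolding gapped_bimod_def by simp_all
  have fb: "bimod_hom \<kappa> A A M A A N id_hom id_hom \<phi>" and pb: "bimod_hom \<kappa> A A N A A M g1 g0 \<psi>"
    using f P unfolding gapped_bimod_hom_def by simp_all
  note al = alg_va[OF A] and bM = bim_vb[OF A A Mf] and bN = bim_vb[OF A A Nf]
  note aI = ahom_idg[OF al] and aG = ahom_vh[OF A A g(1)] ahom_vh[OF A A g(2)]
  note rI = hrep_id[of A] and rG = hrep_vh[OF g(1)] hrep_vh[OF g(2)]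
  note gG = ahomD(1)[OF aG(1)] ahomD(1)[OF aG(2)]
  obtain c where okf: "okfam A A M N 0 (- c) \<phi>" by (rule bimod_hom_okfam[OF fb])
  obtain d where okp: "okfam A A N M 0 (- d) \<psi>" by (rule bimod_hom_okfam[OF pb])
  note ff = fam_vphi[OF okf] and fp = fam_vphi[OF okp]
  define GM where "GM = pull (vh A g1) (vh A g0) (vb A A M)"
  define GN where "GN = pull (vh A g1) (vh A g0) (vb A A N)"
  have bGM: "bim (va A) (va A) GM" and bGN: "bim (va A) (va A) GN"
    unfolding GM_def GN_def by (rule bim_pull[OF al al al al aG bM], rule bim_pull[OF al al al al aG bN])
  \<comment> \<open>\<phi> pulled back along (g1, g0), a homomorphism over the identity between the
    pull-backs of M and N.\<close>
  let ?fg = "\<lambda>t. app (vphi A A M \<phi>) (Gh (vh A g1) (vh A g0) t)"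
  have fg: "fam (va A) (va A) (sdeg M) (sdeg N) (basis N) 0 ?fg" by (rule fam_pull[OF aG ff])
  define P1 where "P1 = Wr (va A) (sdeg N) (vphi A A N \<psi>)"
  define P2 where "P2 = Wr (va A) (sdeg M) ?fg"
  note bW = bdd_Wr[OF famD(1)[OF ff], of "va A" "sdeg M", folded W_def]
    and b1 = bdd_Wr[OF famD(1)[OF fp], of "va A" "sdeg N", folded P1_def]
    and b2 = bdd_Wr[OF famD(1)[OF fg], of "va A" "sdeg M", folded P2_def]
  note bh = bdd_hD[OF al bimD(1)[OF bM]] bdd_hD[OF al bimD(1)[OF bN]] bdd_hD[OF al bimD(1)[OF bGM]] bdd_hD[OF al bimD(1)[OF bGN]]
  have WS: "app W x \<in> chn ?fil (basis N) Q" if "x \<in> chn ?fil (basis M) Q" for x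
    unfolding W_def by (rule chn_Wr[OF Q famD(1)[OF ff] famD(3)[OF ff] okfam_fil[OF fb] that])
  have S1: "app P1 x \<in> chn ?fil (basis M) Q" if "x \<in> chn ?fil (basis N) Q" for x
    unfolding P1_def by (rule chn_Wr[OF Q famD(1)[OF fp] famD(3)[OF fp] okfam_fil[OF pb] that])
  have S2: "app P2 x \<in> chn ?fil (basis N) Q" if x: "x \<in> chn ?fil (basis M) Q" for x
    unfolding P2_def
  proof (rule chn_Wr[OF Q famD(1)[OF fg] famD(3)[OF fg] _ x])
    assume "?fil"
    then show "\<forall>t. vge 0 (?fg t)" using okfam_fil[OF fb] vge_app_left[OF vge_Gh[OF gG]] by blast
  qed
  have idi: "pull idg idg (vb A A N) = vb A A N" by (rule pull_idg[OF bN])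
  have cW: "app W (app (hD (va A) (vb A A M)) x) = app (hD (va A) (vb A A N)) (app W x)" if x: "x \<in> chn ?fil (basis M) Q" for x
    by (rule chn_chain[OF Q x bW bh(1,2)])
      (unfold W_def, rule hom_Wr[OF A A A Mf Nf fb rI rI aI aI, unfolded idi])
  have c1: "app P1 (app (hD (va A) (vb A A N)) x) = app (hD (va A) GM) (app P1 x)" if x: "x \<in> chn ?fil (basis N) Q" for x
    by (rule chn_chain[OF Q x b1 bh(2,3)])
      (unfold P1_def GM_def, rule hom_Wr[OF A A A Nf Mf pb rG aG])
  have c2: "app P2 (app (hD (va A) GM) x) = app (hD (va A) GN) (app P2 x)" if x: "x \<in> chn ?fil (basis M) Q" for x
    by (rule chn_chain[OF Q x b2 bh(3,4)])
      (unfold P2_def GM_def GN_def, rule pull_hom_Wr[OF A A A A A Mf Nf fb rI rI aI aI aG aG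
        comph_idg[OF gG(1), symmetric] comph_idg[OF gG(2), symmetric]])
  have n1: "vnth (vh A g1 w) = comp_hom id_hom g1 w" "vnth (vh A g0 w) = comp_hom id_hom g0 w"
    "vnth (vh A g1 w) = comp_hom g1 id_hom w" "vnth (vh A g0 w) = comp_hom g0 id_hom w" if w: "w \<in> lists (basis A)" for w
    unfolding comp_id_left comp_id_right[OF w] by (rule filtered_homD(4)[OF g(1) w] filtered_homD(4)[OF g(2) w])+
  note q1 = homotopic_qis[OF A N H1 aG n1(1,2) Q, folded GN_def]
    and q2 = homotopic_qis[OF A M H2 aG n1(3,4) Q, folded GM_def]
  have x2: "app (Wr (va A) (sdeg M) (vphi A A M (comp_bi \<psi> id_hom id_hom \<phi>))) x = app P1 (app W x)"
    if x: "x \<in> chn ?fil (basis M) Q" for x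
    unfolding app_app[OF bW b1]
  proof (rule app_cong_supv[OF chn_supv[OF wsymD(1)[OF Q] x]])
    fix q assume q: "q \<in> hS (va A) (basis M)"
    have "app P1 (W q) = Wr (va A) (sdeg M) (\<lambda>t. app (vphi A A N \<psi>) (bhat 0 (ad (va A)) (vphi A A M \<phi>) t)) q"
      unfolding P1_def W_def by (rule Wr_Wr[OF ff fp])
    also have "\<dots> = Wr (va A) (sdeg M) (vphi A A M (comp_bi \<psi> id_hom id_hom \<phi>)) q"
    proof (rule Wr_cong[OF _ q])
      fix t assume "t \<in> lists (aX (va A)) \<times> basis M \<times> lists (aX (va A))"
      then have t: "t \<in> bi_basis A A M" by (simp add: bi_basis_def)
      have "Gh idg idg = (unitv :: 'a list \<times> 'n \<times> 'a list \<Rightarrow> _)" by (rule ext) (rule Gh_idg)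
      then show "app (vphi A A N \<psi>) (bhat 0 (ad (va A)) (vphi A A M \<phi>) t) = vphi A A M (comp_bi \<psi> id_hom id_hom \<phi>) t"
        using vphi_comp[OF okf okp rI rI aI aI _ t, of "comp_bi \<psi> id_hom id_hom \<phi>" "ad (va A)"]
        by (simp add: bi_eq_def app_unitv_row)
    qed
    finally show "Wr (va A) (sdeg M) (vphi A A M (comp_bi \<psi> id_hom id_hom \<phi>)) q = app P1 (W q)" ..
  qed
  have x1: "app (Wr (va A) (sdeg N) (vphi A A N (comp_bi \<phi> g1 g0 \<psi>))) x = app P2 (app P1 x)"
    if x: "x \<in> chn ?fil (basis N) Q" for x
    unfolding app_app[OF b1 b2]
  proof (rule app_cong_supv[OF chn_supv[OF wsymD(1)[OF Q] x]])
    fix q assume q: "q \<in> hS (va A) (basis N)"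
    have "app P2 (P1 q) = Wr (va A) (sdeg N) (\<lambda>t. app ?fg (bhat 0 (ad (va A)) (vphi A A N \<psi>) t)) q"
      unfolding P1_def P2_def by (rule Wr_Wr[OF fp fg])
    also have "\<dots> = Wr (va A) (sdeg N) (vphi A A N (comp_bi \<phi> g1 g0 \<psi>)) q"
    proof (rule Wr_cong[OF _ q])
      fix t assume "t \<in> lists (aX (va A)) \<times> basis N \<times> lists (aX (va A))"
      then have t: "t \<in> bi_basis A A N" by (simp add: bi_basis_def)
      show "app ?fg (bhat 0 (ad (va A)) (vphi A A N \<psi>) t) = vphi A A N (comp_bi \<phi> g1 g0 \<psi>) t"
        using vphi_comp[OF okp okf rG aG _ t, of "comp_bi \<phi> g1 g0 \<psi>" "ad (va A)"]
        by (simp add: bi_eq_def app_app[OF bdd_Gh'[OF gG] famD(1)[OF ff]] del: Gh.simps)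
    qed
    finally show "Wr (va A) (sdeg N) (vphi A A N (comp_bi \<phi> g1 g0 \<psi>)) q = app P2 (P1 q)" ..
  qed
  note r = two_of_six[OF addh_app[OF bW] addh_app[OF b1] addh_app[OF bh(2)] addh_app[OF bh(1)]
      subgrp_chn[OF wsymD(1)[OF Q]] WS S1 S2 cW c1 c2 app_0 q2 x2 q1(1) x1]
  show "hinj (chn ?fil (basis M) Q) (app (hD (va A) (vb A A M)))
      (chn ?fil (basis N) Q) (app (hD (va A) (vb A A N))) (app W)"
    by (rule r(1))
  show "hsur (chn ?fil (basis M) Q) (app (hD (va A) (vb A A M)))
      (chn ?fil (basis N) Q) (app (hD (va A) (vb A A N))) (app W)"
    by (rule r(2))
  show "x \<in> chn ?fil (basis M) Q \<Longrightarrow> app W x \<in> chn ?fil (basis N) Q"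
    "x \<in> chn ?fil (basis M) Q \<Longrightarrow> app W (app (hD (va A) (vb A A M)) x) = app (hD (va A) (vb A A N)) (app W x)"
    by (rule WS, assumption) (rule cW, assumption)
qed

theorem proposition4p3:
  fixes A :: "'a ainf"
    and M :: "('a, 'm, 'a) bimod" and N :: "('a, 'n, 'a) bimod"
    and \<phi> :: "('a, 'm, 'a, 'n) bi_family"
    and \<kappa> :: setting
  assumes "gapped_ainf A"
    and "gapped_bimod A A M" and "gapped_bimod A A N"
    and "gapped_bimod_hom \<kappa> A A M A A N id_hom id_hom \<phi>"
    and "homotopy_equivalence_bi TYPE('c) TYPE('k) \<kappa> A A M A A N id_hom id_hom \<phi>"
  shows "induces_homology_iso \<kappa> (hochschild \<kappa> A M) (hochschild \<kappa> A N) (hoch_map A M \<phi>) \<and>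
         induces_homology_iso \<kappa> (chevalley_eilenberg \<kappa> A M) (chevalley_eilenberg \<kappa> A N) (ce_map A M \<phi>)"
proof -
  have A: "filtered_ainf A" and M: "filtered_bimod A A M" and N: "filtered_bimod A A N"
    and f: "bimod_hom \<kappa> A A M A A N id_hom id_hom \<phi>"
    using assms(1-4) unfolding gapped_ainf_def gapped_bimod_def gapped_bimod_hom_def by simp_all
  obtain c where ok: "okfam A A M N 0 (- c) \<phi>" by (rule bimod_hom_okfam[OF f])
  let ?W = "Wr (va A) (sdeg M) (vphi A A M \<phi>)"
  note bW = bdd_Wr[OF famD(1)[OF fam_vphi[OF ok]], of "va A" "sdeg M"]
  \<comment> \<open>A homomorphism has degree 0, so its chain map commutes with the projections to
    one degree.\<close>
  have dp: "app ?W (dproj (hcdeg (sdeg M) A) k x) = dproj (hcdeg (sdeg N) A) k (app ?W x)" for k x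
    using app_dproj[OF bW, of "hcdeg (sdeg N) A" "hcdeg (sdeg M) A" 0 k x] hdeg_Wr[OF hdeg_vphi[OF ok]] by simp
  have Q: "wsym A (Qh A)" "wsym A (Qs A)" by (simp_all add: wsym_def)
  note q = homotopy_equivalence_qis[OF A assms(2-5)]
  have cd: "cdeg (hochschild \<kappa> A K) = hcdeg (sdeg K) A" "cdeg (chevalley_eilenberg \<kappa> A K) = hcdeg (sdeg K) A"
    for K :: "('a, 'x, 'a) bimod"
    by (simp_all add: hochschild_def chevalley_eilenberg_def hcdeg_def)
  have "induces_homology_iso \<kappa> (hochschild \<kappa> A M) (hochschild \<kappa> A N) (hoch_map A M \<phi>)"
    by (rule vcplx_iso[OF vcplx_hochschild[OF A M] vcplx_hochschild[OF A N] hoch_map_Wr[OF ok] addh_app[OF bW]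
      q(3)[OF Q(1)] q(4)[OF Q(1)] app_scale[OF bW] _ q(1)[OF Q(1)] q(2)[OF Q(1)]]) (simp_all add: cd dp)
  moreover have "induces_homology_iso \<kappa> (chevalley_eilenberg \<kappa> A M) (chevalley_eilenberg \<kappa> A N) (ce_map A M \<phi>)"
    by (rule vcplx_iso[OF vcplx_ce[OF A M] vcplx_ce[OF A N] ce_map_Wr[OF ok] addh_app[OF bW]
      q(3)[OF Q(2)] q(4)[OF Q(2)] app_scale[OF bW] _ q(1)[OF Q(2)] q(2)[OF Q(2)]]) (simp_all add: cd dp)
  ultimately show ?thesis ..
qed

end
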